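(* Let $\tau\in\mathbb{H}$, $\gamma\in(0,2)$, $Q=\frac{2}{\gamma}+\frac{\gamma}{2}$, $\mu>0$, let $z_1,\dots,z_n\in\mathbb{T}$ be distinct points and $\alpha_1,\dots,\alpha_n\in\mathbb{R}$. Let $\varphi$ be a modular log-conformal factor and $g_\tau=e^{\varphi_\tau}\hat g_\tau$. Let $F:H^{-1}(\mathbb{T})\to\mathbb{R}$ be bounded and measurable. Write $\Pi_{\gamma,\mu}^{(z_i,\alpha_i)_i}(g_\tau,F)=\lim_{\epsilon\to0}\Pi_{\gamma,\mu}^{(z_i,\alpha_i)_i}(g_\tau,F,\epsilon)$ and $\Pi_{\gamma,\mu}^{(z_i,\alpha_i)_i}(\hat g_\tau,F)$ for the same limit with $\varphi_\tau$ replaced by $0$; such a limit is called non trivial if it belongs to $(0,+\infty)$. Then the following two statements are equivalent: 1) the limit $\Pi_{\gamma,\mu}^{(z_i,\alpha_i)_i}(g_\tau,F)$ exists and is non trivial; 2) the limit $\Pi_{\gamma,\mu}^{(z_i,\alpha_i)_i}(\hat g_\tau,F)$ exists and is non trivial. If both exist and are non trivial, then $$\ln\frac{\Pi_{\gamma,\mu}^{(z_i,\alpha_i)_i}(g_\tau,F)}{\Pi_{\gamma,\mu}^{(z_i,\alpha_i)_i}(\hat g_\tau,F)}=\frac{1+6Q^2}{96\pi}\int_{\mathbb{T}}|\partial^\tau\varphi_\tau|_\tau^2\,d\lambda_\tau ,$$ i.e. the central charge of the theory is $c_L=1+6Q^2$.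
   Context: $\mathbb{T}=\mathbb{R}^2/\mathbb{Z}^2$ with coordinates $x=(x_1,x_2)$ and Lebesgue measure $\lambda$; $\mathbb{H}=\{\tau\in\mathbb{C}:\mathrm{Im}\,\tau>0\}$. For $\tau\in\mathbb{H}$, $\hat g_\tau$ is the flat metric $|dx_1+\tau dx_2|^2$, with volume form $d\lambda_\tau=\mathrm{Im}(\tau)\,d\lambda$ and Laplacian $\triangle_\tau=\mathrm{Im}(\tau)^{-2}(|\tau|^2\partial_{11}-2\mathrm{Re}(\tau)\partial_{12}+\partial_{22})$; $\partial^\tau$ denotes the gradient in $\hat g_\tau$, so $\int_{\mathbb{T}}|\partial^\tau f|_\tau^2d\lambda_\tau=\frac{1}{\mathrm{Im}(\tau)}\int_{\mathbb{T}}|\tau\partial_1f-\partial_2f|^2d\lambda$. $H^1(\mathbb{T})$ and $H^{-1}(\mathbb{T})$ are the usual Sobolev space and its dual. The modular group $\mathcal{M}$ consists of the maps $\psi(z)=\frac{az+b}{cz+d}$ of $\mathbb{H}$ with $a,b,c,d\in\mathbb{Z}$, $ad-bc=1$; to $\psi$ is associated the map $\widetilde\psi(x)=(dx_1+bx_2,cx_1+ax_2)$ of $\mathbb{T}$. A modular log-conformal factor is a measurable map $\varphi:\tau\in\mathbb{H}\mapsto\varphi_\tau\in H^1(\mathbb{T})$ (real-valued functions) with $\varphi_{\psi(\tau)}=\varphi_\tau\circ\widetilde\psi$ for all $\psi\in\mathcal{M}$ and such that $\tau\mapsto\int_{\mathbb{T}}|\partial^\tau\varphi_\tau|^2_\tau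 d\lambda_\tau$ is $\mathcal{M}$-invariant. Green function: $G_\tau(x,w)=G_\tau(x-w)$ solves $-\triangle_\tau G_\tau(w,\cdot)=2\pi(\delta_w-\frac{1}{\mathrm{Im}\,\tau})$, $\int_{\mathbb{T}}G_\tau(w,\cdot)d\lambda_\tau=0$, where $\delta_w$ is the Dirac mass relative to $\lambda_\tau$. $X_\tau$ is the Gaussian Free Field with vanishing $\lambda_\tau$-mean: the centered Gaussian random element of $H^{-1}(\mathbb{T})$ with covariance kernel $G_\tau(x-y)$. $X_{g_\tau}$ is the GFF with vanishing mean for $\lambda_{g_\tau}=e^{\varphi_\tau}\lambda_\tau$, i.e. in law $X_{g_\tau}=X_\tau-\lambda_{g_\tau}(\mathbb{T})^{-1}\int X_\tau d\lambda_{g_\tau}$. For a field or function $Y$ on $\mathbb{T}$, its $\epsilon$-circle average (in $\hat g_\tau$) is $Y_\epsilon(x)=\frac1{2\pi}\int_0^{2\pi}Y(x+c_\tau(\epsilon e^{i\theta}))d\theta$ with $c_\tau(z)=\big(\mathrm{Re}\,z-\frac{\mathrm{Re}\,\tau}{\mathrm{Im}\,\tau}\mathrm{Im}\,z,\ \frac{\mathrm{Im}\,z}{\mathrm{Im}\,\tau}\big)$; $X_{g_\tau,\epsilon}$ and $\varphi_\tau^\epsilon$ are the circle averages of $X_{g_\tau}$ and $\varphi_\tau$. The Ricci scalar curvature satisfies $R_{g_\tau}d\lambda_{g_\tau}=-\triangle_\tau\varphi_\tau\,d\lambda_\tau$ (weakly). Free field partition function: $Z^{\mathrm{FF}}(\hat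 g_\tau)=\frac{1}{\sqrt{\mathrm{Im}\,\tau}\,|\eta(\tau)|^2}$, with $\eta(\tau)=q^{1/12}\prod_{n\ge1}(1-q^{2n})$, $q=e^{i\pi\tau}$, and $Z^{\mathrm{FF}}(g_\tau)=e^{\frac1{96\pi}\int_{\mathbb{T}}|\partial^\tau\varphi_\tau|^2_\tau d\lambda_\tau}Z^{\mathrm{FF}}(\hat g_\tau)$. Regularized partition function: $$\Pi_{\gamma,\mu}^{(z_i,\alpha_i)_i}(g_\tau,F,\epsilon)=Z^{\mathrm{FF}}(g_\tau)\int_{\mathbb{R}}\mathbb{E}\Big[F\big(c+X_{g_\tau}-\tfrac Q2\ln\mathrm{Im}\,\tau+\tfrac Q2\varphi_\tau\big)\prod_i\epsilon^{\frac{\alpha_i^2}{2}}e^{\alpha_i(c+X_{g_\tau,\epsilon}(z_i)-\frac Q2\ln\mathrm{Im}\,\tau+\frac Q2\varphi^\epsilon_\tau(z_i))}$$ $$\times\exp\Big(-\tfrac{Q}{4\pi}\int_{\mathbb{T}}R_{g_\tau}(c+X_{g_\tau})d\lambda_{g_\tau}-\mu\,\epsilon^{\frac{\gamma^2}{2}}\int_{\mathbb{T}}e^{\gamma(c+X_{g_\tau,\epsilon}-\frac Q2\ln\mathrm{Im}\,\tau+\frac Q2\varphi^\epsilon_\tau)}d\lambda_\tau\Big)\Big]dc.$$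
   Formalization: A limit counts as existing only if, for small ε, the integral over c and the expectation converge jointly absolutely; this is automatic for F ≥ 0, but for signed F convergence by mere cancellation breaks the equivalence and the formula. *)

theory Defs
  imports "HOL-Probability.Probability"
begin

section \<open>The torus\<close>

text \<open>Points of \<open>\<real>\<^sup>2/\<int>\<^sup>2\<close> are given by lifts in \<open>\<real> \<times> \<real>\<close>, functions on the torus are
  \<open>\<int>\<^sup>2\<close>-periodic functions, and integration is over a fundamental domain.\<close>

type_synonym pt = "real \<times> real"

definition torus_eq :: "pt \<Rightarrow> pt \<Rightarrow> bool" where
  "torus_eq x y \<longleftrightarrow> fst x - fst y \<in> \<int> \<and> snd x - snd y \<in> \<int>"

definition periodic :: "(pt \<Rightarrow> 'b) \<Rightarrow> bool" where
  "periodic f \<longleftrightarrow> (\<forall>x y. torus_eq x y \<longrightarrow> f x = f y)"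

definition torus :: "pt measure" where
  "torus = restrict_space lborel ({0..<1} \<times> {0..<1})"

definition torus_vol :: "complex \<Rightarrow> pt measure" where
  "torus_vol \<tau> = density torus (\<lambda>_. ennreal (Im \<tau>))"

definition pd1 :: "(pt \<Rightarrow> real) \<Rightarrow> pt \<Rightarrow> real" where
  "pd1 f x = deriv (\<lambda>s. f (s, snd x)) (fst x)"

definition pd2 :: "(pt \<Rightarrow> real) \<Rightarrow> pt \<Rightarrow> real" where
  "pd2 f x = deriv (\<lambda>s. f (fst x, s)) (snd x)"

primrec torus_Ck :: "nat \<Rightarrow> (pt \<Rightarrow> real) \<Rightarrow> bool" where
  "torus_Ck 0 f \<longleftrightarrow> periodic f \<and> continuous_on UNIV f"
| "torus_Ck (Suc k) f \<longleftrightarrow>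
     periodic f \<and> (\<forall>x. f differentiable (at x)) \<and> torus_Ck k (pd1 f) \<and> torus_Ck k (pd2 f)"

definition torus_smooth :: "(pt \<Rightarrow> real) \<Rightarrow> bool" where
  "torus_smooth f \<longleftrightarrow> (\<forall>k. torus_Ck k f)"

definition laplacian :: "complex \<Rightarrow> (pt \<Rightarrow> real) \<Rightarrow> pt \<Rightarrow> real" where
  "laplacian \<tau> f x =
     ((cmod \<tau>)\<^sup>2 * pd1 (pd1 f) x - 2 * Re \<tau> * pd1 (pd2 f) x + pd2 (pd2 f) x) / (Im \<tau>)\<^sup>2"

section \<open>Sobolev spaces\<close>

definition torus_L2 :: "(pt \<Rightarrow> real) \<Rightarrow> bool" where
  "torus_L2 f \<longleftrightarrow> periodic f \<and> f \<in> borel_measurable borel \<and> integrable torus (\<lambda>x. (f x)\<^sup>2)"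

text \<open>Here \<open>D\<close> is \<^const>\<open>pd1\<close> or \<^const>\<open>pd2\<close>.\<close>

definition is_weak_deriv ::
    "((pt \<Rightarrow> real) \<Rightarrow> pt \<Rightarrow> real) \<Rightarrow> (pt \<Rightarrow> real) \<Rightarrow> (pt \<Rightarrow> real) \<Rightarrow> bool" where
  "is_weak_deriv D f g \<longleftrightarrow> torus_L2 g \<and>
     (\<forall>\<psi>. torus_smooth \<psi> \<longrightarrow> (\<integral>x. f x * D \<psi> x \<partial>torus) = - (\<integral>x. g x * \<psi> x \<partial>torus))"

definition weak_deriv :: "((pt \<Rightarrow> real) \<Rightarrow> pt \<Rightarrow> real) \<Rightarrow> (pt \<Rightarrow> real) \<Rightarrow> pt \<Rightarrow> real" where
  "weak_deriv D f = (SOME g. is_weak_deriv D f g)"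

text \<open>Elements of \<open>H1\<close> are functions rather than classes modulo null sets; \<open>H1_norm\<close> is
  therefore only a seminorm, and everything below is insensitive to the representative.\<close>

definition H1 :: "(pt \<Rightarrow> real) set" where
  "H1 = {f. torus_L2 f \<and> (\<exists>g. is_weak_deriv pd1 f g) \<and> (\<exists>g. is_weak_deriv pd2 f g)}"

definition H1_norm :: "(pt \<Rightarrow> real) \<Rightarrow> real" where
  "H1_norm f = sqrt ((\<integral>x. (f x)\<^sup>2 \<partial>torus) + (\<integral>x. (weak_deriv pd1 f x)\<^sup>2 \<partial>torus)
                                          + (\<integral>x. (weak_deriv pd2 f x)\<^sup>2 \<partial>torus))"

text \<open>The integral \<open>\<integral>|\<partial>\<^sup>\<tau> f|\<^sub>\<tau>\<^sup>2 d\<lambda>\<^sub>\<tau>\<close>.\<close>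

definition dirichlet_energy :: "complex \<Rightarrow> (pt \<Rightarrow> real) \<Rightarrow> real" where
  "dirichlet_energy \<tau> f = 1 / Im \<tau> *
     (\<integral>x. (cmod (\<tau> * of_real (weak_deriv pd1 f x) - of_real (weak_deriv pd2 f x)))\<^sup>2 \<partial>torus)"

text \<open>Continuous linear functionals on \<open>H1\<close>, normalised to be \<open>0\<close> outside \<open>H1\<close> so that they
  are determined by their values on \<open>H1\<close>. Boundedness makes them respect a.e. equality.\<close>

type_synonym functional = "(pt \<Rightarrow> real) \<Rightarrow> real"

definition Hm1 :: "functional set" where
  "Hm1 = {T. (\<forall>f\<in>H1. \<forall>g\<in>H1. \<forall>a b. T (\<lambda>x. a * f x + b * g x) = a * T f + b * T g) \<and>
             (\<exists>C. \<forall>f\<in>H1. \<bar>T f\<bar> \<le> C * H1_norm f) \<and>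
             (\<forall>f. f \<notin> H1 \<longrightarrow> T f = 0)}"

definition Hm1_norm :: "functional \<Rightarrow> real" where
  "Hm1_norm T = (SUP f\<in>{f\<in>H1. H1_norm f \<le> 1}. \<bar>T f\<bar>)"

text \<open>The Borel sets of a space with a (pseudo-)distance.\<close>

definition borel_of_metric :: "'a set \<Rightarrow> ('a \<Rightarrow> 'a \<Rightarrow> real) \<Rightarrow> 'a measure" where
  "borel_of_metric S d =
     sigma S {U. U \<subseteq> S \<and> (\<forall>x\<in>U. \<exists>r>0. \<forall>y\<in>S. d x y < r \<longrightarrow> y \<in> U)}"

definition H1_borel :: "(pt \<Rightarrow> real) measure" where
  "H1_borel = borel_of_metric H1 (\<lambda>f g. H1_norm (\<lambda>x. f x - g x))"

definition Hm1_borel :: "functional measure" where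
  "Hm1_borel = borel_of_metric Hm1 (\<lambda>S T. Hm1_norm (\<lambda>f. S f - T f))"

text \<open>Functions are identified with distributions by means of the fixed measure \<open>\<lambda>\<close>
  (not \<open>\<lambda>\<^sub>\<tau>\<close>); the covariance of the free field below uses the same convention.\<close>

definition functional_of :: "(pt \<Rightarrow> real) \<Rightarrow> functional" where
  "functional_of f = (\<lambda>h. if h \<in> H1 then (\<integral>x. f x * h x \<partial>torus) else 0)"

section \<open>Modular log-conformal factors\<close>

definition upper_half :: "complex set" where
  "upper_half = {\<tau>. 0 < Im \<tau>}"

definition moebius :: "int \<Rightarrow> int \<Rightarrow> int \<Rightarrow> int \<Rightarrow> complex \<Rightarrow> complex" where
  "moebius a b c d \<tau> = (of_int a * \<tau> + of_int b) / (of_int c * \<tau> + of_int d)"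

definition torus_map :: "int \<Rightarrow> int \<Rightarrow> int \<Rightarrow> int \<Rightarrow> pt \<Rightarrow> pt" where
  "torus_map a b c d x = (of_int d * fst x + of_int b * snd x, of_int c * fst x + of_int a * snd x)"

definition modular_log_conformal_factor :: "(complex \<Rightarrow> pt \<Rightarrow> real) \<Rightarrow> bool" where
  "modular_log_conformal_factor \<phi> \<longleftrightarrow>
     \<phi> \<in> measurable (restrict_space borel upper_half) H1_borel \<and>
     (\<forall>a b c d. a * d - b * c = 1 \<longrightarrow> (\<forall>\<tau>\<in>upper_half.
        (AE x in torus. \<phi> (moebius a b c d \<tau>) x = \<phi> \<tau> (torus_map a b c d x)) \<and>
        dirichlet_energy (moebius a b c d \<tau>) (\<phi> (moebius a b c d \<tau>)) = dirichlet_energy \<tau> (\<phi> \<tau>)))"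

section \<open>Green function and Gaussian free field\<close>

text \<open>\<open>G\<close> is the one-argument function with \<open>G\<^sub>\<tau>(w, y) = G (w - y)\<close>; the equation
  \<open>-\<triangle>\<^sub>\<tau> G\<^sub>\<tau>(w, \<cdot>) = 2\<pi>(\<delta>\<^sub>w - 1/Im \<tau>)\<close> is in the sense of distributions, everything being
  relative to \<open>\<lambda>\<^sub>\<tau>\<close>. This determines \<open>G\<close> almost everywhere.\<close>

definition green_function :: "complex \<Rightarrow> (pt \<Rightarrow> real) \<Rightarrow> bool" where
  "green_function \<tau> G \<longleftrightarrow> periodic G \<and> G \<in> borel_measurable borel \<and> integrable torus G \<and>
     (\<forall>w. (\<integral>y. G (w - y) \<partial>torus_vol \<tau>) = 0 \<and>
       (\<forall>\<psi>. torus_smooth \<psi> \<longrightarrow>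
          (\<integral>y. G (w - y) * (- laplacian \<tau> \<psi> y) \<partial>torus_vol \<tau>)
            = 2 * pi * (\<psi> w - 1 / Im \<tau> * (\<integral>y. \<psi> y \<partial>torus_vol \<tau>))))"

definition centered_gaussian :: "'w measure \<Rightarrow> ('w \<Rightarrow> real) \<Rightarrow> bool" where
  "centered_gaussian M Y \<longleftrightarrow> Y \<in> borel_measurable M \<and>
     ((AE \<omega> in M. Y \<omega> = 0) \<or> (\<exists>\<sigma>>0. distributed M lborel Y (normal_density 0 \<sigma>)))"

text \<open>A random element of \<open>Hm1\<close> is Gaussian if all continuous linear functionals of it are, and
  by reflexivity these are the evaluations at elements of \<open>H1\<close>.\<close>

definition gaussian_free_field :: "'w measure \<Rightarrow> complex \<Rightarrow> ('w \<Rightarrow> functional) \<Rightarrow> bool" where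
  "gaussian_free_field M \<tau> X \<longleftrightarrow> prob_space M \<and> X \<in> measurable M Hm1_borel \<and>
     (\<forall>f\<in>H1. centered_gaussian M (\<lambda>\<omega>. X \<omega> f)) \<and>
     (\<exists>G. green_function \<tau> G \<and>
       (\<forall>f\<in>H1. \<forall>h\<in>H1. (\<integral>\<omega>. X \<omega> f * X \<omega> h \<partial>M)
          = (\<integral>x. f x * (\<integral>y. G (x - y) * h y \<partial>torus) \<partial>torus)))"

section \<open>Functionals of fields beyond the duality of \<open>H1\<close> and its dual\<close>

text \<open>The free field has to be averaged over circles, against \<open>e\<^sup>\<phi>\<close>, and against \<open>\<triangle>\<^sub>\<tau>\<phi>\<close>,
  none of which need lie in \<open>H1\<close>. These functionals are defined by applying the literal formula to
  the square Fourier partial sums and letting the cutoff tend to infinity. The limit exists for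
  circle averages of elements of \<open>H1\<close> (it is the average of the trace on the circle, and does not
  depend on the representative), and almost surely for each of the functionals of the free field.\<close>

definition fourier_trunc :: "nat \<Rightarrow> functional \<Rightarrow> pt \<Rightarrow> real" where
  "fourier_trunc N Y x = (\<Sum>k\<in>{- int N..int N}. \<Sum>l\<in>{- int N..int N}.
      Y (\<lambda>y. cos (2 * pi * (of_int k * fst y + of_int l * snd y))) * cos (2 * pi * (of_int k * fst x + of_int l * snd x)) +
      Y (\<lambda>y. sin (2 * pi * (of_int k * fst y + of_int l * snd y))) * sin (2 * pi * (of_int k * fst x + of_int l * snd x)))"

definition circle_map :: "complex \<Rightarrow> complex \<Rightarrow> pt" where
  "circle_map \<tau> z = (Re z - Re \<tau> / Im \<tau> * Im z, Im z / Im \<tau>)"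

definition circle_avg :: "complex \<Rightarrow> real \<Rightarrow> functional \<Rightarrow> pt \<Rightarrow> real" where
  "circle_avg \<tau> \<epsilon> Y x = lim (\<lambda>N. 1 / (2 * pi) *
     (LINT \<theta>:{0..2 * pi}|lborel. fourier_trunc N Y (x + circle_map \<tau> (of_real \<epsilon> * cis \<theta>))))"

text \<open>The volume measure \<open>\<lambda>\<^sub>g = e\<^sup>\<phi> \<lambda>\<^sub>\<tau>\<close> of the metric with log-conformal factor \<open>\<phi>\<close>.\<close>

definition vol_g :: "complex \<Rightarrow> (pt \<Rightarrow> real) \<Rightarrow> pt measure" where
  "vol_g \<tau> \<phi> = density (torus_vol \<tau>) (\<lambda>x. ennreal (exp (\<phi> x)))"

definition mean_g :: "complex \<Rightarrow> (pt \<Rightarrow> real) \<Rightarrow> functional \<Rightarrow> real" where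
  "mean_g \<tau> \<phi> Y = lim (\<lambda>N. \<integral>x. fourier_trunc N Y x \<partial>vol_g \<tau> \<phi>) / measure (vol_g \<tau> \<phi>) (space (vol_g \<tau> \<phi>))"

text \<open>\<open>\<integral> R\<^sub>g Y d\<lambda>\<^sub>g\<close>, where \<open>R\<^sub>g d\<lambda>\<^sub>g = -\<triangle>\<^sub>\<tau>\<phi> d\<lambda>\<^sub>\<tau>\<close> weakly, i.e.
  \<open>\<integral> R\<^sub>g \<psi> d\<lambda>\<^sub>g = -\<integral> \<phi> \<triangle>\<^sub>\<tau>\<psi> d\<lambda>\<^sub>\<tau>\<close> for smooth \<open>\<psi>\<close>.\<close>

definition curvature_pairing :: "complex \<Rightarrow> (pt \<Rightarrow> real) \<Rightarrow> functional \<Rightarrow> real" where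
  "curvature_pairing \<tau> \<phi> Y =
     lim (\<lambda>N. - (\<integral>x. \<phi> x * laplacian \<tau> (fourier_trunc N Y) x \<partial>torus_vol \<tau>))"

section \<open>Partition functions\<close>

text \<open>With \<open>q = exp (i \<pi> \<tau>)\<close>, the factor \<open>q powr (1/12)\<close> means \<open>exp (i \<pi> \<tau> / 12)\<close>.\<close>

definition dedekind_eta :: "complex \<Rightarrow> complex" where
  "dedekind_eta \<tau> = exp (\<i> * of_real pi * \<tau> / 12) *
     (\<Prod>n. 1 - exp (\<i> * of_real pi * \<tau>) ^ (2 * Suc n))"

definition Z_FF :: "complex \<Rightarrow> (pt \<Rightarrow> real) \<Rightarrow> real" where
  "Z_FF \<tau> \<phi> = exp (1 / (96 * pi) * dirichlet_energy \<tau> \<phi>) *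
     (1 / (sqrt (Im \<tau>) * (cmod (dedekind_eta \<tau>))\<^sup>2))"

text \<open>The field \<open>c + X\<^sub>g\<close>, where \<open>X\<^sub>g\<close> is \<open>X\<close> recentred to have vanishing \<open>\<lambda>\<^sub>g\<close>-mean.\<close>

definition field_g :: "complex \<Rightarrow> (pt \<Rightarrow> real) \<Rightarrow> real \<Rightarrow> functional \<Rightarrow> functional" where
  "field_g \<tau> \<phi> c X = (\<lambda>h. X h + functional_of (\<lambda>_. c - mean_g \<tau> \<phi> X) h)"

text \<open>In the following, \<open>\<phi>\<close> is the log-conformal factor at the given \<open>\<tau>\<close>; the background metric
  corresponds to \<open>\<phi> = 0\<close>.\<close>

definition liouville_integrand ::
    "complex \<Rightarrow> (pt \<Rightarrow> real) \<Rightarrow> real \<Rightarrow> real \<Rightarrow> real \<Rightarrow> nat \<Rightarrow> (nat \<Rightarrow> pt) \<Rightarrow> (nat \<Rightarrow> real) \<Rightarrow>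
     (functional \<Rightarrow> real) \<Rightarrow> real \<Rightarrow> real \<Rightarrow> functional \<Rightarrow> real" where
  "liouville_integrand \<tau> \<phi> \<gamma> Q \<mu> n z \<alpha> F \<epsilon> c X =
    (let Xg = field_g \<tau> \<phi> 0 X;
         V = (\<lambda>x. c + circle_avg \<tau> \<epsilon> Xg x - Q / 2 * ln (Im \<tau>)
                    + Q / 2 * circle_avg \<tau> \<epsilon> (functional_of \<phi>) x)
     in F (\<lambda>h. field_g \<tau> \<phi> c X h + functional_of (\<lambda>x. - (Q / 2) * ln (Im \<tau>) + Q / 2 * \<phi> x) h)
        * (\<Prod>i\<in>{1..n}. \<epsilon> powr ((\<alpha> i)\<^sup>2 / 2) * exp (\<alpha> i * V (z i)))
        * exp (- (Q / (4 * pi)) * curvature_pairing \<tau> \<phi> (field_g \<tau> \<phi> c X)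
               - \<mu> * \<epsilon> powr (\<gamma>\<^sup>2 / 2) * (\<integral>x. exp (\<gamma> * V x) \<partial>torus_vol \<tau>)))"

definition Pi_reg ::
    "'w measure \<Rightarrow> ('w \<Rightarrow> functional) \<Rightarrow> complex \<Rightarrow> (pt \<Rightarrow> real) \<Rightarrow> real \<Rightarrow> real \<Rightarrow> real \<Rightarrow> nat \<Rightarrow>
     (nat \<Rightarrow> pt) \<Rightarrow> (nat \<Rightarrow> real) \<Rightarrow> (functional \<Rightarrow> real) \<Rightarrow> real \<Rightarrow> real" where
  "Pi_reg M X \<tau> \<phi> \<gamma> Q \<mu> n z \<alpha> F \<epsilon> = Z_FF \<tau> \<phi> *
     (\<integral>c. (\<integral>\<omega>. liouville_integrand \<tau> \<phi> \<gamma> Q \<mu> n z \<alpha> F \<epsilon> c (X \<omega>) \<partial>M) \<partial>lborel)"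

definition Pi_lim ::
    "'w measure \<Rightarrow> ('w \<Rightarrow> functional) \<Rightarrow> complex \<Rightarrow> (pt \<Rightarrow> real) \<Rightarrow> real \<Rightarrow> real \<Rightarrow> real \<Rightarrow> nat \<Rightarrow>
     (nat \<Rightarrow> pt) \<Rightarrow> (nat \<Rightarrow> real) \<Rightarrow> (functional \<Rightarrow> real) \<Rightarrow> real" where
  "Pi_lim M X \<tau> \<phi> \<gamma> Q \<mu> n z \<alpha> F = Lim (at_right 0) (Pi_reg M X \<tau> \<phi> \<gamma> Q \<mu> n z \<alpha> F)"

text \<open>The limit exists and belongs to \<open>(0, \<infinity>)\<close>. Integrals of non-integrable functions are \<open>0\<close> by
  convention, so it is required that the regularised partition function be a genuine (absolutely
  convergent) integral over \<open>dc \<otimes> M\<close> for small \<open>\<epsilon>\<close>. If \<open>F \<ge> 0\<close> this is the same as the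
  regularised partition function being finite; for signed \<open>F\<close> it rules out that the iterated
  integral converges only thanks to cancellations in the inner expectation.\<close>

definition Pi_nontrivial ::
    "'w measure \<Rightarrow> ('w \<Rightarrow> functional) \<Rightarrow> complex \<Rightarrow> (pt \<Rightarrow> real) \<Rightarrow> real \<Rightarrow> real \<Rightarrow> real \<Rightarrow> nat \<Rightarrow>
     (nat \<Rightarrow> pt) \<Rightarrow> (nat \<Rightarrow> real) \<Rightarrow> (functional \<Rightarrow> real) \<Rightarrow> bool" where
  "Pi_nontrivial M X \<tau> \<phi> \<gamma> Q \<mu> n z \<alpha> F \<longleftrightarrow>
     (\<forall>\<^sub>F \<epsilon> in at_right 0. integrable (lborel \<Otimes>\<^sub>M M)
        (\<lambda>(c, \<omega>). liouville_integrand \<tau> \<phi> \<gamma> Q \<mu> n z \<alpha> F \<epsilon> c (X \<omega>))) \<and>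
     (\<exists>L>0. (Pi_reg M X \<tau> \<phi> \<gamma> Q \<mu> n z \<alpha> F \<longlongrightarrow> L) (at_right 0))"

end

theory Submission
  imports Defs
begin

text \<open>
  Both claims hold because, for every fixed \<open>\<epsilon> > 0\<close>, the regularized partition functions of \<open>g\<^sub>\<tau>\<close>
  and of the flat metric differ exactly by the factor \<open>exp((1 + 6Q\<^sup>2) D / (96\<pi>))\<close>, where \<open>D\<close> is the Dirichlet
  energy of \<open>\<phi>\<close>. The summand \<open>1\<close> is the explicit conformal anomaly of the free field partition function.
  For the rest, put \<open>Y = \<integral>R\<^sub>g X d\<lambda>\<^sub>g\<close> and \<open>a = -Q/(4\<pi>)\<close>. Constants do not contribute to the curvature term,
  because the total curvature of a torus is zero. Hence translating \<open>c\<close> by the \<open>\<lambda>\<^sub>g\<close>-mean of \<open>X\<close> turns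
  the integrand for \<open>g\<^sub>\<tau>\<close> into \<open>exp(aY)\<close> times the integrand for the flat metric at the field \<open>X + (Q/2) \<phi>\<close>.
  Now \<open>Y\<close> is a centred Gaussian variable of variance \<open>2\<pi>D\<close> whose covariance with the field \<open>X\<close> is
  \<open>2\<pi> (\<phi> - m)\<close>, where \<open>m\<close> is the mean of \<open>\<phi>\<close>. By the Cameron--Martin formula, the weight \<open>exp(aY)\<close> is
  worth a factor \<open>exp(a\<^sup>2 (2\<pi>D) / 2) = exp(6Q\<^sup>2 D / (96\<pi>))\<close> and a shift of \<open>X\<close> by
  \<open>2\<pi>a (\<phi> - m) = -(Q/2) (\<phi> - m)\<close>. This shift turns \<open>X + (Q/2) \<phi>\<close> into \<open>X\<close> plus a constant, and a further
  translation of \<open>c\<close> removes the constant (\<open>J_to_background\<close>). All these steps preserve integrability in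
  both directions, so the factor passes to the limit \<open>\<epsilon> \<longrightarrow> 0\<close>.

  What has to be justified is that the functionals involved exist and behave linearly. The pairing with the
  curvature and the circle averages are limits of Fourier partial sums. The contributions of the
  different shells of frequencies to these sums are independent Gaussian variables, so Kolmogorov's theorem
  (\<open>gaussian_series_convergent\<close>) gives almost sure convergence once the variances are summable. For the
  curvature pairing their sum is \<open>2\<pi>D\<close> by Parseval's identity (\<open>dirichlet_sums\<close>, resting on
  \<open>proj_converges\<close>). For circle averages summability follows from the decay of the circle means of Fourier
  modes (\<open>circ_mean_decay\<close>). That \<open>\<phi>\<close> itself has circle averages in this sense is then a consequence of the
  Cameron--Martin formula, since the laws of \<open>X\<close> and of its shift are mutually absolutely continuous
  (\<open>circle_average_shift_convergent\<close>).

  The Cameron--Martin formula is proved for the Fourier coefficients by comparing characteristic functions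
  (\<open>joint_char_determines_law\<close>, \<open>gaussian_shift\<close>, \<open>joint_char\<close>). It extends to all Borel functionals on the
  dual of \<open>H1\<close> because the Borel sets there are generated by the Fourier coefficients
  (\<open>Hm1_borel_coeffs\<close>).\<close>

section \<open>Joint laws and characteristic functions\<close>

lemma (in prob_space) integrable_bounded_iexp:
  assumes [measurable]: "u \<in> borel_measurable M" "f \<in> borel_measurable M"
    and b: "\<And>x. \<bar>u x :: real\<bar> \<le> B"
  shows "integrable M (\<lambda>x. complex_of_real (u x) * iexp (f x))"
  by (rule integrable_const_bound[where B=B]) (auto simp: norm_mult b)

text \<open>Dividing the weights \<open>u\<close> and \<open>w\<close> by their common total mass (read off at \<open>s = 0\<close>) turns them into
  probability densities, and the hypothesis into equality of two characteristic functions of real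
  random variables, so that the one-dimensional uniqueness theorem of Levy applies. This is how
  joint laws are handled below without any multivariate inversion formula.\<close>
lemma weighted_char_determines:
  fixes u :: "'a \<Rightarrow> real" and w :: "'b \<Rightarrow> real"
  assumes "prob_space M" "prob_space N"
    and [measurable]: "u \<in> borel_measurable M" "Z \<in> borel_measurable M"
      "w \<in> borel_measurable N" "Y \<in> borel_measurable N" "A \<in> sets borel"
    and u: "\<And>x. 0 \<le> u x" "\<And>x. u x \<le> B" and w: "\<And>x. 0 \<le> w x" "\<And>x. w x \<le> B"
    and eq: "\<And>s. (CLINT x|M. complex_of_real (u x) * iexp (s * Z x))
               = (CLINT x|N. complex_of_real (w x) * iexp (s * Y x))"
  shows "(LINT x|M. u x * indicator A (Z x)) = (LINT x|N. w x * indicator A (Y x))"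
proof -
  interpret M: prob_space M by fact
  interpret N: prob_space N by fact
  have iu: "integrable M u" by (rule M.integrable_const_bound[where B=B]) (auto simp: u)
  have iw: "integrable N w" by (rule N.integrable_const_bound[where B=B]) (auto simp: w)
  define m where "m = (LINT x|M. u x)"
  have mw: "m = (LINT x|N. w x)"
    using eq[of 0] by (simp add: m_def)
  show ?thesis
  proof (cases "m = 0")
    case True
    have "AE x in M. u x = 0"
      using True integral_nonneg_eq_0_iff_AE[OF iu] u by (simp add: m_def)
    moreover have "AE x in N. w x = 0"
      using True integral_nonneg_eq_0_iff_AE[OF iw] w by (simp add: mw)
    ultimately have "AE x in M. u x * indicator A (Z x) = 0" "AE x in N. w x * indicator A (Y x) = 0"
      by auto
    then show ?thesis by (simp add: integral_eq_zero_AE)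
  next
    case False
    then have m: "m > 0" using integral_nonneg_AE[of u M] u by (simp add: m_def less_le)
    have gen: "real_distribution (distr (density K (\<lambda>x. ennreal (f x / m))) borel g)
       \<and> char (distr (density K (\<lambda>x. ennreal (f x / m))) borel g) t
           = (CLINT x|K. complex_of_real (f x) * iexp (t * g x)) / m
       \<and> measure (distr (density K (\<lambda>x. ennreal (f x / m))) borel g) A
           = (LINT x|K. f x * indicator A (g x)) / m"
      if [measurable]: "f \<in> borel_measurable K" "g \<in> borel_measurable K" and "prob_space K"
        and f: "\<And>x. 0 \<le> f x" "\<And>x. f x \<le> B" and im: "integrable K f" "(LINT x|K. f x) = m"
      for K :: "'z measure" and f g t
    proof -
      interpret K: prob_space K by fact
      define D where "D = density K (\<lambda>x. ennreal (f x / m))"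
      have [measurable]: "g \<in> borel_measurable D" by (simp add: D_def)
      have "emeasure D (space D) = 1"
        using im m f by (simp add: D_def emeasure_density nn_integral_eq_integral integrable_divide cong: nn_integral_cong_simp)
      then have D: "prob_space D" by (rule prob_spaceI)
      have "char (distr D borel g) t = (CLINT x|D. iexp (t * g x))"
        by (simp add: char_def integral_distr)
      also have "\<dots> = (CLINT x|K. (f x / m) *\<^sub>R iexp (t * g x))"
        unfolding D_def using f m by (intro integral_density) (auto simp: AE_I2)
      also have "\<dots> = (CLINT x|K. complex_of_real (f x) * iexp (t * g x) / m)"
        by (simp add: scaleR_conv_of_real)
      finally have c: "char (distr D borel g) t = (CLINT x|K. complex_of_real (f x) * iexp (t * g x)) / m"
        by simp
      have "measure (distr D borel g) A = (LINT x|distr D borel g. indicator A x)"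
        using \<open>A \<in> sets borel\<close> by simp
      also have "\<dots> = (LINT x|D. indicator A (g x))"
        by (rule integral_distr) auto
      also have "\<dots> = (LINT x|K. (f x / m) *\<^sub>R indicator A (g x))"
        unfolding D_def using f m by (intro integral_density) (auto simp: AE_I2)
      finally have "measure (distr D borel g) A = (LINT x|K. f x * indicator A (g x)) / m"
        by simp
      then show ?thesis using c D prob_space.real_distribution_distr[OF D, of g]
        by (simp add: D_def)
    qed
    have "distr (density M (\<lambda>x. ennreal (u x / m))) borel Z = distr (density N (\<lambda>x. ennreal (w x / m))) borel Y"
      by (rule Levy_uniqueness)
         (use gen[of u M Z] gen[of w N Y] \<open>prob_space M\<close> \<open>prob_space N\<close> u w iu iw eq
          in \<open>auto simp: m_def[symmetric] mw[symmetric] fun_eq_iff\<close>)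
    then show ?thesis
      using gen[of u M Z] gen[of w N Y] \<open>prob_space M\<close> \<open>prob_space N\<close> u w iu iw m
      by (auto simp: m_def[symmetric] mw[symmetric])
  qed
qed

text \<open>Indicators are introduced one coordinate at a time. If the identity is known for the product
  \<open>p\<close> of the indicators so far and all pairs in \<open>S\<close>, then it also holds with the nonnegative weights
  \<open>p (1 + cos f)\<close> and \<open>p (1 + sin f)\<close>, because cosine and sine are combinations of exponentials and
  \<open>S\<close> is a linear space. Nonnegative weights are admissible in \<open>weighted_char_determines\<close>, which
  trades the exponential of the new coordinate for an indicator.\<close>
lemma joint_char_determines_rectangles:
  fixes S :: "(('a \<Rightarrow> real) \<times> ('b \<Rightarrow> real)) set"
  assumes M: "prob_space M" and N: "prob_space N"
    and meas: "\<And>f g. (f, g) \<in> S \<Longrightarrow> f \<in> borel_measurable M \<and> g \<in> borel_measurable N"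
    and lin: "\<And>f g f' g' a b. (f, g) \<in> S \<Longrightarrow> (f', g') \<in> S \<Longrightarrow>
                (\<lambda>x. a * f x + b * f' x, \<lambda>x. a * g x + b * g' x) \<in> S"
    and char: "\<And>f g. (f, g) \<in> S \<Longrightarrow> (CLINT x|M. iexp (f x)) = (CLINT x|N. iexp (g x))"
    and "finite K"
    and VW: "\<And>k. k \<in> K \<Longrightarrow> (V k, W k) \<in> S" and A: "\<And>k. k \<in> K \<Longrightarrow> A k \<in> sets borel"
    and "(f, g) \<in> S"
  shows "(CLINT x|M. complex_of_real (\<Prod>k\<in>K. indicator (A k) (V k x)) * iexp (f x))
       = (CLINT x|N. complex_of_real (\<Prod>k\<in>K. indicator (A k) (W k x)) * iexp (g x))"
  using \<open>finite K\<close> VW A \<open>(f, g) \<in> S\<close>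
proof (induction K arbitrary: f g)
  case empty
  then show ?case using char by simp
next
  case (insert k K)
  interpret M: prob_space M by fact
  interpret N: prob_space N by fact
  define p where "p = (\<lambda>x. \<Prod>k\<in>K. indicator (A k) (V k x) :: real)"
  define q where "q = (\<lambda>x. \<Prod>k\<in>K. indicator (A k) (W k x) :: real)"
  have [measurable]: "V j \<in> borel_measurable M" "W j \<in> borel_measurable N" "A j \<in> sets borel"
    if "j \<in> insert k K" for j using that insert.prems meas by blast+
  have [measurable]: "V k \<in> borel_measurable M" "W k \<in> borel_measurable N" "A k \<in> sets borel" by auto
  have [measurable]: "p \<in> borel_measurable M" "q \<in> borel_measurable N"
    unfolding p_def q_def by measurable
  have [measurable]: "f \<in> borel_measurable M" "g \<in> borel_measurable N"
    using insert.prems meas by blast+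
  have p: "0 \<le> p x" "p x \<le> 1" for x unfolding p_def by (auto intro!: prod_nonneg prod_le_1)
  have q: "0 \<le> q x" "q x \<le> 1" for x unfolding q_def by (auto intro!: prod_nonneg prod_le_1)
  have IH: "(CLINT x|M. complex_of_real (p x) * iexp (f' x)) = (CLINT x|N. complex_of_real (q x) * iexp (g' x))"
    if "(f', g') \<in> S" for f' g'
    unfolding p_def q_def by (rule insert.IH) (use insert.prems that in auto)
  have VWS: "(V k, W k) \<in> S" using insert.prems by auto
  have IH': "(CLINT x|M. complex_of_real (p x) * iexp (s * V k x + b * f x))
         = (CLINT x|N. complex_of_real (q x) * iexp (s * W k x + b * g x))" for s b
    by (rule IH) (use lin[OF VWS insert.prems(3), of s b] in auto)
  have ip: "integrable M (\<lambda>x. complex_of_real (p x) * iexp (h x))" if [measurable]: "h \<in> borel_measurable M" for h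
    by (rule M.integrable_bounded_iexp[where B=1]) (use p in \<open>auto simp: abs_le_iff intro: order_trans[of _ 0]\<close>)
  have iq: "integrable N (\<lambda>x. complex_of_real (q x) * iexp (h x))" if [measurable]: "h \<in> borel_measurable N" for h
    by (rule N.integrable_bounded_iexp[where B=1]) (use q in \<open>auto simp: abs_le_iff intro: order_trans[of _ 0]\<close>)
  have cexp: "complex_of_real (cos t) = (iexp t + iexp (- t)) / 2"
       "complex_of_real (sin t) = (iexp t - iexp (- t)) / (2 * \<i>)" for t
    by (simp_all add: cos_of_real[symmetric] sin_of_real[symmetric] cos_exp_eq sin_exp_eq)
  have trig: "complex_of_real (r * (1 + cos t)) * iexp v
       = complex_of_real r * iexp v + (complex_of_real r * iexp (v + 1 * t)) / 2 + (complex_of_real r * iexp (v + (-1) * t)) / 2"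
       "complex_of_real (r * (1 + sin t)) * iexp v
       = complex_of_real r * iexp v + (complex_of_real r * iexp (v + 1 * t)) / (2 * \<i>) - (complex_of_real r * iexp (v + (-1) * t)) / (2 * \<i>)"
     for r t v
    unfolding of_real_mult of_real_add cexp by (simp_all add: exp_add[symmetric] algebra_simps exp_diff divide_simps exp_minus)
  have C: "(CLINT x|M. complex_of_real (p x * (1 + cos (f x))) * iexp (s * V k x))
         = (CLINT x|N. complex_of_real (q x * (1 + cos (g x))) * iexp (s * W k x))" for s
    unfolding trig using IH'[of s 0] IH'[of s 1] IH'[of s "-1"] by (simp add: ip iq del: of_real_add of_real_mult of_real_diff)
  have Sn: "(CLINT x|M. complex_of_real (p x * (1 + sin (f x))) * iexp (s * V k x))
         = (CLINT x|N. complex_of_real (q x * (1 + sin (g x))) * iexp (s * W k x))" for s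
    unfolding trig using IH'[of s 0] IH'[of s 1] IH'[of s "-1"] by (simp add: ip iq del: of_real_add of_real_mult of_real_diff)
  have bd: "0 \<le> 1 + cos t" "1 + cos t \<le> 2" "0 \<le> 1 + sin t" "1 + sin t \<le> 2" for t :: real
    using cos_ge_minus_one[of t] cos_le_one[of t] sin_ge_minus_one[of t] sin_le_one[of t] by linarith+
  have bd2: "r * a \<le> 2" if "0 \<le> r" "r \<le> 1" "0 \<le> a" "a \<le> 2" for r a :: real
    using mult_mono[of r 1 a 2] that by simp
  have E0: "(LINT x|M. p x * indicator (A k) (V k x)) = (LINT x|N. q x * indicator (A k) (W k x))"
    by (rule weighted_char_determines[OF M N, where B=1]) (use IH'[of _ 0] p q in auto)
  have E1: "(LINT x|M. p x * (1 + cos (f x)) * indicator (A k) (V k x)) = (LINT x|N. q x * (1 + cos (g x)) * indicator (A k) (W k x))"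
    by (rule weighted_char_determines[OF M N, where B=2]) (use C p q bd bd2 in auto)
  have E2: "(LINT x|M. p x * (1 + sin (f x)) * indicator (A k) (V k x)) = (LINT x|N. q x * (1 + sin (g x)) * indicator (A k) (W k x))"
    by (rule weighted_char_determines[OF M N, where B=2]) (use Sn p q bd bd2 in auto)
  have abs1: "\<bar>r * a * indicator B y :: real\<bar> \<le> 1" if "0 \<le> r" "r \<le> 1" "\<bar>a\<bar> \<le> 1" for r a B y
    using that mult_mono[of r 1 "\<bar>a\<bar>" 1] by (auto simp: abs_mult split: split_indicator)
  have iM: "integrable M (\<lambda>x. p x * h x * indicator (A k) (V k x))"
    if [measurable]: "h \<in> borel_measurable M" and "\<And>x. \<bar>h x\<bar> \<le> 1" for h
    by (rule M.integrable_const_bound[where B=1]) (use p that in \<open>auto intro!: AE_I2 abs1\<close>)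
  have iN: "integrable N (\<lambda>x. q x * h x * indicator (A k) (W k x))"
    if [measurable]: "h \<in> borel_measurable N" and "\<And>x. \<bar>h x\<bar> \<le> 1" for h
    by (rule N.integrable_const_bound[where B=1]) (use q that in \<open>auto intro!: AE_I2 abs1\<close>)
  have i1: "integrable M (\<lambda>x. p x * indicator (A k) (V k x))" using iM[of "\<lambda>_. 1"] by simp
  have i2: "integrable N (\<lambda>x. q x * indicator (A k) (W k x))" using iN[of "\<lambda>_. 1"] by simp
  have Ec: "(LINT x|M. p x * cos (f x) * indicator (A k) (V k x)) = (LINT x|N. q x * cos (g x) * indicator (A k) (W k x))"
    using E1 E0 by (simp add: distrib_left distrib_right iM iN i1 i2)
  have Es: "(LINT x|M. p x * sin (f x) * indicator (A k) (V k x)) = (LINT x|N. q x * sin (g x) * indicator (A k) (W k x))"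
    using E2 E0 by (simp add: distrib_left distrib_right iM iN i1 i2)
  have split: "(CLINT x|K. complex_of_real (a x) * iexp (h x))
      = complex_of_real (LINT x|K. a x * cos (h x)) + \<i> * complex_of_real (LINT x|K. a x * sin (h x))"
    if "integrable K (\<lambda>x. a x * cos (h x))" "integrable K (\<lambda>x. a x * sin (h x))" for K :: "'z measure" and a h
  proof -
    have "(CLINT x|K. complex_of_real (a x) * iexp (h x))
      = (CLINT x|K. complex_of_real (a x * cos (h x)) + \<i> * complex_of_real (a x * sin (h x)))"
      by (intro Bochner_Integration.integral_cong) (auto simp: complex_eq_iff Re_exp Im_exp)
    also have "\<dots> = (CLINT x|K. complex_of_real (a x * cos (h x))) + (CLINT x|K. \<i> * complex_of_real (a x * sin (h x)))"
      using that by (intro Bochner_Integration.integral_add) (auto simp del: of_real_mult intro!: integrable_mult_right integrable_of_real)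
    also have "\<dots> = complex_of_real (LINT x|K. a x * cos (h x)) + \<i> * complex_of_real (LINT x|K. a x * sin (h x))"
      by (simp del: of_real_mult)
    finally show ?thesis .
  qed
  have e: "(\<Prod>k\<in>insert k K. indicator (A k) (V k x)) = p x * indicator (A k) (V k x)"
          "(\<Prod>k\<in>insert k K. indicator (A k) (W k y)) = q y * indicator (A k) (W k y)" for x y
    using insert.hyps by (simp_all add: p_def q_def)
  have [simp]: "p x * indicator (A k) (V k x) * c = p x * c * indicator (A k) (V k x)"
       "q y * indicator (A k) (W k y) * c = q y * c * indicator (A k) (W k y)" for x y c by simp_all
  show ?case
    unfolding e
    using split[of M "\<lambda>x. p x * indicator (A k) (V k x)" f] split[of N "\<lambda>x. q x * indicator (A k) (W k x)" g]
      iM[of "\<lambda>x. cos (f x)"] iM[of "\<lambda>x. sin (f x)"] iN[of "\<lambda>x. cos (g x)"] iN[of "\<lambda>x. sin (g x)"] Ec Es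
    by simp
qed

text \<open>A Cramer--Wold theorem for families of random variables of arbitrary size, on two possibly
  different probability spaces: \<open>S\<close> pairs each linear combination of the \<open>V i\<close> with the same linear
  combination of the \<open>W i\<close>. Equality on finite-dimensional rectangles suffices.\<close>
theorem joint_char_determines_law:
  fixes S :: "(('a \<Rightarrow> real) \<times> ('b \<Rightarrow> real)) set"
  assumes M: "prob_space M" and N: "prob_space N"
    and meas: "\<And>f g. (f, g) \<in> S \<Longrightarrow> f \<in> borel_measurable M \<and> g \<in> borel_measurable N"
    and lin: "\<And>f g f' g' a b. (f, g) \<in> S \<Longrightarrow> (f', g') \<in> S \<Longrightarrow>
                (\<lambda>x. a * f x + b * f' x, \<lambda>x. a * g x + b * g' x) \<in> S"
    and char: "\<And>f g. (f, g) \<in> S \<Longrightarrow> (CLINT x|M. iexp (f x)) = (CLINT x|N. iexp (g x))"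
    and VW: "\<And>i. i \<in> I \<Longrightarrow> (V i, W i) \<in> S" and "S \<noteq> {}"
  shows "distr M (\<Pi>\<^sub>M i\<in>I. borel) (\<lambda>x. \<lambda>i\<in>I. V i x) = distr N (\<Pi>\<^sub>M i\<in>I. borel) (\<lambda>x. \<lambda>i\<in>I. W i x)"
proof -
  interpret M: prob_space M by fact
  interpret N: prob_space N by fact
  have [measurable]: "V i \<in> borel_measurable M" "W i \<in> borel_measurable N" if "i \<in> I" for i
    using meas VW that by blast+
  have mV: "(\<lambda>x. \<lambda>i\<in>I. V i x) \<in> measurable M (\<Pi>\<^sub>M i\<in>I. borel)"
    by (rule measurable_restrict) auto
  have mW: "(\<lambda>x. \<lambda>i\<in>I. W i x) \<in> measurable N (\<Pi>\<^sub>M i\<in>I. borel)"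
    by (rule measurable_restrict) auto
  show ?thesis
  proof (rule measure_eqI_PiM_infinite)
    show "sets (distr M (\<Pi>\<^sub>M i\<in>I. borel) (\<lambda>x. \<lambda>i\<in>I. V i x)) = sets (\<Pi>\<^sub>M i\<in>I. borel)" by simp
    show "sets (distr N (\<Pi>\<^sub>M i\<in>I. borel) (\<lambda>x. \<lambda>i\<in>I. W i x)) = sets (\<Pi>\<^sub>M i\<in>I. borel)" by simp
    show "finite_measure (distr M (\<Pi>\<^sub>M i\<in>I. borel) (\<lambda>x. \<lambda>i\<in>I. V i x))"
      using M.prob_space_distr[OF mV] by (rule prob_space.finite_measure)
    fix A J assume J: "finite J" "J \<subseteq> I" and A: "\<And>i. i \<in> J \<Longrightarrow> A i \<in> sets (borel :: real measure)"
    have sp: "prod_emb I (\<lambda>_. borel) J (Pi\<^sub>E J A) \<in> sets (\<Pi>\<^sub>M i\<in>I. (borel :: real measure))"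
      by (rule sets_PiM_I) (use J A in auto)
    have key: "emeasure (distr K (\<Pi>\<^sub>M i\<in>I. borel) (\<lambda>x. \<lambda>i\<in>I. U i x)) (prod_emb I (\<lambda>_. borel) J (Pi\<^sub>E J A))
        = ennreal (LINT x|K. (\<Prod>j\<in>J. indicator (A j) (U j x)))"
      if "prob_space K" and [measurable]: "\<And>i. i \<in> I \<Longrightarrow> U i \<in> borel_measurable K" for K :: "'z measure" and U
    proof -
      interpret K: prob_space K by fact
      have mU: "(\<lambda>x. \<lambda>i\<in>I. U i x) \<in> measurable K (\<Pi>\<^sub>M i\<in>I. borel)"
        by (rule measurable_restrict) auto
      have "emeasure (distr K (\<Pi>\<^sub>M i\<in>I. borel) (\<lambda>x. \<lambda>i\<in>I. U i x)) (prod_emb I (\<lambda>_. borel) J (Pi\<^sub>E J A))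
        = emeasure K ((\<lambda>x. \<lambda>i\<in>I. U i x) -` prod_emb I (\<lambda>_. borel) J (Pi\<^sub>E J A) \<inter> space K)"
        by (rule emeasure_distr[OF mU sp])
      also have "(\<lambda>x. \<lambda>i\<in>I. U i x) -` prod_emb I (\<lambda>_. borel) J (Pi\<^sub>E J A) \<inter> space K
           = {x\<in>space K. \<forall>j\<in>J. U j x \<in> A j}" (is "_ = ?E")
        using J by (auto simp: prod_emb_def PiE_iff extensional_def subset_iff restrict_def)
      also have "emeasure K ?E = ennreal (LINT x|K. indicator ?E x)"
      proof -
        have "?E = (\<lambda>x. \<lambda>i\<in>I. U i x) -` prod_emb I (\<lambda>_. borel) J (Pi\<^sub>E J A) \<inter> space K"
          using J by (auto simp: prod_emb_def PiE_iff extensional_def subset_iff restrict_def)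
        also have "\<dots> \<in> sets K" by (rule measurable_sets[OF mU sp])
        finally show ?thesis by (simp add: K.emeasure_eq_measure)
      qed
      also have "(LINT x|K. indicator ?E x) = (LINT x|K. (\<Prod>j\<in>J. indicator (A j) (U j x) :: real))"
      proof (intro Bochner_Integration.integral_cong refl)
        fix x assume "x \<in> space K"
        then show "indicator ?E x = (\<Prod>j\<in>J. indicator (A j) (U j x) :: real)"
          using J by (auto simp: indicator_def prod_eq_1_iff if_distrib intro!: prod_zero[symmetric])
      qed
      finally show ?thesis .
    qed
    obtain f g where fg: "(f, g) \<in> S" using \<open>S \<noteq> {}\<close> by auto
    have z: "(\<lambda>_. 0, \<lambda>_. 0) \<in> S" using lin[OF fg fg, of 0 0] by simp
    have "(CLINT x|M. complex_of_real (\<Prod>k\<in>J. indicator (A k) (V k x)) * iexp 0)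
       = (CLINT x|N. complex_of_real (\<Prod>k\<in>J. indicator (A k) (W k x)) * iexp 0)"
      by (rule joint_char_determines_rectangles[OF M N meas lin char \<open>finite J\<close> VW A z]) (use J in auto)
    then have "(LINT x|M. (\<Prod>j\<in>J. indicator (A j) (V j x) :: real)) = (LINT x|N. (\<Prod>j\<in>J. indicator (A j) (W j x)))"
      by (simp del: of_real_prod of_real_indicator)
    then show "emeasure (distr M (\<Pi>\<^sub>M i\<in>I. borel) (\<lambda>x. \<lambda>i\<in>I. V i x)) (prod_emb I (\<lambda>_. borel) J (Pi\<^sub>E J A))
       = emeasure (distr N (\<Pi>\<^sub>M i\<in>I. borel) (\<lambda>x. \<lambda>i\<in>I. W i x)) (prod_emb I (\<lambda>_. borel) J (Pi\<^sub>E J A))"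
      using key[OF M, of V] key[OF N, of W] by simp
  qed
qed

section \<open>Square-integrable functions\<close>

lemma integrable_mult_L2:
  fixes f g :: "'a \<Rightarrow> real"
  assumes [measurable]: "f \<in> borel_measurable M" "g \<in> borel_measurable M"
    and f: "integrable M (\<lambda>x. (f x)\<^sup>2)" and g: "integrable M (\<lambda>x. (g x)\<^sup>2)"
  shows "integrable M (\<lambda>x. f x * g x)"
proof (rule Bochner_Integration.integrable_bound)
  show "integrable M (\<lambda>x. (f x)\<^sup>2 + (g x)\<^sup>2)" using f g by simp
  have "\<bar>a * b\<bar> \<le> a\<^sup>2 + b\<^sup>2" for a b :: real
    using sum_squares_bound[of "\<bar>a\<bar>" "\<bar>b\<bar>"] mult_nonneg_nonneg[of "\<bar>a\<bar>" "\<bar>b\<bar>"]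
    unfolding abs_mult power2_abs by linarith
  then show "AE x in M. norm (f x * g x) \<le> norm ((f x)\<^sup>2 + (g x)\<^sup>2)" by simp
qed measurable

lemma integrable_add_L2:
  fixes f g :: "'a \<Rightarrow> real"
  assumes "f \<in> borel_measurable M" "g \<in> borel_measurable M"
    and "integrable M (\<lambda>x. (f x)\<^sup>2)" "integrable M (\<lambda>x. (g x)\<^sup>2)"
  shows "integrable M (\<lambda>x. (f x + g x)\<^sup>2)"
  using assms integrable_mult_L2[OF assms] by (simp add: power2_sum mult.assoc)

lemma L2_Cauchy_Schwarz:
  fixes f g :: "'a \<Rightarrow> real"
  assumes m: "f \<in> borel_measurable M" "g \<in> borel_measurable M"
    and i: "integrable M (\<lambda>x. (f x)\<^sup>2)" "integrable M (\<lambda>x. (g x)\<^sup>2)"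
  shows "(LINT x|M. f x * g x)\<^sup>2 \<le> (LINT x|M. (f x)\<^sup>2) * (LINT x|M. (g x)\<^sup>2)"
proof -
  define a b c where "a = (LINT x|M. (f x)\<^sup>2)" and "b = (LINT x|M. f x * g x)" and "c = (LINT x|M. (g x)\<^sup>2)"
  have fg: "integrable M (\<lambda>x. f x * g x)" by (rule integrable_mult_L2[OF m i])
  have q: "0 \<le> a + 2 * t * b + t\<^sup>2 * c" for t
  proof -
    have "(f x + t * g x)\<^sup>2 = (f x)\<^sup>2 + 2 * t * (f x * g x) + t\<^sup>2 * (g x)\<^sup>2" for x
      by (simp add: power2_eq_square algebra_simps)
    then have "(LINT x|M. (f x + t * g x)\<^sup>2) = a + 2 * t * b + t\<^sup>2 * c"
      using i fg by (simp add: a_def b_def c_def)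
    moreover have "0 \<le> (LINT x|M. (f x + t * g x)\<^sup>2)" by simp
    ultimately show ?thesis by simp
  qed
  have "b\<^sup>2 \<le> a * c"
  proof (cases "c = 0")
    case True
    have "b = 0"
    proof (rule ccontr)
      assume "b \<noteq> 0"
      then show False using q[of "- (a + 1) / (2 * b)"] True by (simp add: field_simps)
    qed
    then show ?thesis using True by simp
  next
    case False
    then have "c > 0" by (auto simp: c_def less_le intro!: integral_nonneg_AE)
    then show ?thesis using q[of "- b / c"] by (simp add: power2_eq_square field_simps)
  qed
  then show ?thesis by (simp add: a_def b_def c_def)
qed

section \<open>Centred Gaussian variables\<close>

text \<open>Gaussianity is recorded through the characteristic function, so that variance zero is included;
  the second moment is kept because it does not follow from the characteristic function without an
  additional argument.\<close>
definition gaussian_var :: "'w measure \<Rightarrow> ('w \<Rightarrow> real) \<Rightarrow> real \<Rightarrow> bool" where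
  "gaussian_var M Y v \<longleftrightarrow> Y \<in> borel_measurable M \<and> integrable M (\<lambda>\<omega>. (Y \<omega>)\<^sup>2) \<and>
     (LINT \<omega>|M. (Y \<omega>)\<^sup>2) = v \<and>
     (\<forall>t. (CLINT \<omega>|M. iexp (t * Y \<omega>)) = complex_of_real (exp (- (t\<^sup>2 * v / 2))))"

lemma char_normal_density:
  assumes "\<sigma> > 0"
  shows "(CLINT x|density lborel (normal_density 0 \<sigma>). iexp (t * x)) = complex_of_real (exp (- (t\<^sup>2 * \<sigma>\<^sup>2 / 2)))"
proof -
  have "(CLINT x|density lborel (normal_density 0 \<sigma>). iexp (t * x))
      = (CLINT x|lborel. normal_density 0 \<sigma> x *\<^sub>R iexp (t * x))"
    by (rule integral_density) (auto simp: normal_density_nonneg)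
  also have "\<dots> = \<bar>\<sigma>\<bar> *\<^sub>R (CLINT x|lborel. normal_density 0 \<sigma> (0 + \<sigma> * x) *\<^sub>R iexp (t * (0 + \<sigma> * x)))"
    using assms by (intro lborel_integral_real_affine) auto
  also have "\<dots> = (CLINT x|lborel. \<bar>\<sigma>\<bar> *\<^sub>R normal_density 0 \<sigma> (0 + \<sigma> * x) *\<^sub>R iexp (t * (0 + \<sigma> * x)))"
    by (simp only: integral_scaleR_right)
  also have "\<dots> = (CLINT x|lborel. std_normal_density x *\<^sub>R iexp (t * \<sigma> * x))"
  proof (rule Bochner_Integration.integral_cong[OF refl])
    fix x
    have "\<bar>\<sigma>\<bar> * normal_density 0 \<sigma> (0 + \<sigma> * x) = std_normal_density x"
      using assms by (simp add: normal_density_def real_sqrt_mult power_mult_distrib field_simps)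
    then show "\<bar>\<sigma>\<bar> *\<^sub>R normal_density 0 \<sigma> (0 + \<sigma> * x) *\<^sub>R iexp (t * (0 + \<sigma> * x)) = std_normal_density x *\<^sub>R iexp (t * \<sigma> * x)"
      by (metis scaleR_scaleR add_0 mult.assoc)
  qed
  also have "\<dots> = char std_normal_distribution (t * \<sigma>)"
    unfolding char_def by (rule integral_density[symmetric]) (auto simp: normal_density_nonneg)
  finally show ?thesis
    by (simp add: char_std_normal_distribution power_mult_distrib)
qed

lemma centered_gaussian_var:
  assumes "prob_space M" "centered_gaussian M Y"
  shows "gaussian_var M Y (LINT \<omega>|M. (Y \<omega>)\<^sup>2)"
proof -
  interpret prob_space M by fact
  have m [measurable]: "Y \<in> borel_measurable M" using assms by (simp add: centered_gaussian_def)
  consider (zero) "AE \<omega> in M. Y \<omega> = 0"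
    | (normal) \<sigma> where "\<sigma> > 0" "distributed M lborel Y (normal_density 0 \<sigma>)"
    using assms by (auto simp: centered_gaussian_def)
  then show ?thesis
  proof cases
    case zero
    then have z: "AE \<omega> in M. (Y \<omega>)\<^sup>2 = 0" by auto
    have "integrable M (\<lambda>\<omega>. (Y \<omega>)\<^sup>2)"
      using z by (subst integrable_cong_AE[where g="\<lambda>_. 0"]) auto
    moreover have "(LINT \<omega>|M. (Y \<omega>)\<^sup>2) = 0" using z by (rule integral_eq_zero_AE)
    moreover have "(CLINT \<omega>|M. iexp (t * Y \<omega>)) = (CLINT \<omega>|M. 1)" for t
      by (rule integral_cong_AE) (use zero in auto)
    ultimately show ?thesis by (simp add: gaussian_var_def prob_space)
  next
    case normal
    note d = \<open>distributed M lborel Y (normal_density 0 \<sigma>)\<close>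
    have "integrable lborel (\<lambda>x. normal_density 0 \<sigma> x * x\<^sup>2)"
      using integrable_normal_moment[OF normal(1), of 0 2] by simp
    then have i: "integrable M (\<lambda>\<omega>. (Y \<omega>)\<^sup>2)"
      by (subst (asm) distributed_integrable[OF d]) (auto simp: normal_density_nonneg)
    have "(LINT x|lborel. normal_density 0 \<sigma> x * x\<^sup>2) = \<sigma>\<^sup>2"
      using integral_normal_moment_even[OF normal(1), of 0 1] by simp
    then have v: "(LINT \<omega>|M. (Y \<omega>)\<^sup>2) = \<sigma>\<^sup>2"
      by (subst (asm) distributed_integral[OF d]) (auto simp: normal_density_nonneg)
    have "(CLINT \<omega>|M. iexp (t * Y \<omega>)) = (CLINT x|distr M lborel Y. iexp (t * x))" for t
      by (subst integral_distr) auto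
    then show ?thesis
      using i v m char_normal_density[OF normal(1)] distributed_distr_eq_density[OF d]
      by (simp add: gaussian_var_def)
  qed
qed

text \<open>The converse direction, for positive variance, again by Levy's uniqueness theorem.\<close>
lemma gaussian_char_distr:
  assumes "prob_space M" and [measurable]: "Y \<in> borel_measurable M"
    and char: "\<And>t. (CLINT \<omega>|M. iexp (t * Y \<omega>)) = complex_of_real (exp (- (t\<^sup>2 * s / 2)))" and "s > 0"
  shows "distr M borel Y = density lborel (normal_density 0 (sqrt s))"
proof (rule Levy_uniqueness)
  interpret prob_space M by fact
  show "real_distribution (distr M borel Y)" by simp
  interpret N: prob_space "density lborel (normal_density 0 (sqrt s))"
    using assms by (intro prob_space_normal_density) simp
  show "real_distribution (density lborel (normal_density 0 (sqrt s)))"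
    by unfold_locales auto
  show "char (distr M borel Y) = char (density lborel (normal_density 0 (sqrt s)))"
    using \<open>s > 0\<close> char char_normal_density[of "sqrt s"]
    by (simp add: fun_eq_iff char_def integral_distr)
qed

section \<open>Series of independent Gaussian variables\<close>

text \<open>Independence of the \<open>D n\<close> is encoded by the fact that every finite linear combination is
  Gaussian with the variance of an orthogonal sum.\<close>
locale gaussian_sequence = prob_space M for M :: "'w measure" +
  fixes D :: "nat \<Rightarrow> 'w \<Rightarrow> real" and v :: "nat \<Rightarrow> real"
  assumes gauss: "\<And>n t. gaussian_var M (\<lambda>\<omega>. \<Sum>k<n. t k * D k \<omega>) (\<Sum>k<n. (t k)\<^sup>2 * v k)"
begin

lemma D_measurable [measurable]: "D k \<in> borel_measurable M"
  using gauss[where n="Suc k" and t="\<lambda>j. if j = k then 1 else 0"] by (simp add: gaussian_var_def if_distrib if_distribR cong: if_cong)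

lemma v_nonneg: "0 \<le> v k"
proof -
  have "(\<Sum>j<Suc k. (if j = k then 1 else 0)\<^sup>2 * v j) = v k"
    by (simp add: if_distrib if_distribR cong: if_cong)
  then have "v k = (LINT \<omega>|M. (\<Sum>j<Suc k. (if j = k then 1 else 0) * D j \<omega>)\<^sup>2)"
    using gauss[where n="Suc k" and t="\<lambda>j. if j = k then 1 else 0"] unfolding gaussian_var_def by metis
  then show ?thesis by simp
qed

text \<open>Changing the signs of the terms from index \<open>k\<close> on does not change the variance of any linear
  combination, hence not the joint law. This symmetry is the form in which independence
  enters the maximal inequality.\<close>
lemma reflection:
  assumes [measurable]: "g \<in> borel_measurable (\<Pi>\<^sub>M i\<in>{..<n}. borel)"
  shows "(LINT \<omega>|M. g (\<lambda>i\<in>{..<n}. D i \<omega>)) = (LINT \<omega>|M. g (\<lambda>i\<in>{..<n}. (if i < k then 1 else - 1) * D i \<omega>) :: real)"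
proof -
  define s :: "nat \<Rightarrow> real" where "s = (\<lambda>i. if i < k then 1 else - 1)"
  define S where "S = {(\<lambda>\<omega>. \<Sum>i<n. t i * D i \<omega>, \<lambda>\<omega>. \<Sum>i<n. (t i * s i) * D i \<omega>) | t :: nat \<Rightarrow> real. True}"
  have unit: "(\<Sum>i<n. (if i = j then 1 else 0) * D i \<omega>) = D j \<omega>"
    "(\<Sum>i<n. ((if i = j then 1 else 0) * s i) * D i \<omega>) = s j * D j \<omega>" if "j < n" for j \<omega>
    using that by (simp_all add: if_distrib if_distribR cong: if_cong)
  have "distr M (\<Pi>\<^sub>M i\<in>{..<n}. borel) (\<lambda>\<omega>. \<lambda>i\<in>{..<n}. D i \<omega>) = distr M (\<Pi>\<^sub>M i\<in>{..<n}. borel) (\<lambda>\<omega>. \<lambda>i\<in>{..<n}. s i * D i \<omega>)"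
  proof (rule joint_char_determines_law[where S=S])
    fix f g assume "(f, g) \<in> S"
    then obtain t where t: "f = (\<lambda>\<omega>. \<Sum>i<n. t i * D i \<omega>)" "g = (\<lambda>\<omega>. \<Sum>i<n. (t i * s i) * D i \<omega>)"
      by (auto simp: S_def)
    show "f \<in> borel_measurable M \<and> g \<in> borel_measurable M"
      using t by simp
    have [simp]: "(s i)\<^sup>2 = 1" for i by (simp add: s_def)
    have "gaussian_var M f (\<Sum>i<n. (t i)\<^sup>2 * v i)" "gaussian_var M g (\<Sum>i<n. (t i)\<^sup>2 * v i)"
      using gauss[where n=n and t=t] gauss[where n=n and t="\<lambda>i. t i * s i"] by (simp_all add: t power_mult_distrib)
    then have "(CLINT x|M. iexp (1 * f x)) = (CLINT x|M. iexp (1 * g x))"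
      unfolding gaussian_var_def by (elim conjE) (simp only:)
    then show "(CLINT x|M. iexp (f x)) = (CLINT x|M. iexp (g x))" by simp
  next
    fix f g f' g' and a b :: real assume "(f, g) \<in> S" "(f', g') \<in> S"
    then obtain t t' where "f = (\<lambda>\<omega>. \<Sum>i<n. t i * D i \<omega>)" "g = (\<lambda>\<omega>. \<Sum>i<n. (t i * s i) * D i \<omega>)"
      "f' = (\<lambda>\<omega>. \<Sum>i<n. t' i * D i \<omega>)" "g' = (\<lambda>\<omega>. \<Sum>i<n. (t' i * s i) * D i \<omega>)"
      by (auto simp: S_def)
    then show "(\<lambda>x. a * f x + b * f' x, \<lambda>x. a * g x + b * g' x) \<in> S"
      unfolding S_def
      by (intro CollectI exI[of _ "\<lambda>i. a * t i + b * t' i"])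
         (simp add: sum_distrib_left sum.distrib[symmetric] algebra_simps)
  next
    fix i assume "i \<in> {..<n}"
    then show "(D i, \<lambda>\<omega>. s i * D i \<omega>) \<in> S"
      unfolding S_def by (intro CollectI exI[of _ "\<lambda>j. if j = i then 1 else 0"]) (simp add: unit)
  qed (auto simp: S_def prob_space_axioms)
  then have "(LINT x|distr M (\<Pi>\<^sub>M i\<in>{..<n}. borel) (\<lambda>\<omega>. \<lambda>i\<in>{..<n}. D i \<omega>). g x)
       = (LINT x|distr M (\<Pi>\<^sub>M i\<in>{..<n}. borel) (\<lambda>\<omega>. \<lambda>i\<in>{..<n}. s i * D i \<omega>). g x)"
    by simp
  then show ?thesis
    by (simp add: integral_distr s_def)
qed

definition S :: "nat \<Rightarrow> 'w \<Rightarrow> real" where "S n \<omega> = (\<Sum>k<n. D k \<omega>)"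

lemma S_measurable [measurable]: "S n \<in> borel_measurable M"
  unfolding S_def[abs_def] by measurable

lemma S_L2: "integrable M (\<lambda>\<omega>. (S n \<omega>)\<^sup>2)" and S_var: "(LINT \<omega>|M. (S n \<omega>)\<^sup>2) = (\<Sum>k<n. v k)"
  using gauss[where n=n and t="\<lambda>_. 1"] by (simp_all add: gaussian_var_def S_def)

text \<open>The integrand is odd under the reflection at \<open>k\<close>: the event and \<open>S k\<close> are unchanged, while
  \<open>S n - S k\<close> changes sign.\<close>
lemma increment_orthogonal:
  assumes "k \<le> n"
  shows "(LINT \<omega>|M. indicator {\<omega>. \<rho> \<le> \<bar>S k \<omega>\<bar> \<and> (\<forall>j<k. \<bar>S j \<omega>\<bar> < \<rho>)} \<omega> * (S k \<omega> * (S n \<omega> - S k \<omega>))) = 0"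
    (is "(LINT \<omega>|M. ?h \<omega>) = 0")
proof -
  define g where "g = (\<lambda>d :: nat \<Rightarrow> real.
     indicator {d. \<rho> \<le> \<bar>\<Sum>i<k. d i\<bar> \<and> (\<forall>j<k. \<bar>\<Sum>i<j. d i\<bar> < \<rho>)} d * ((\<Sum>i<k. d i) * (\<Sum>i\<in>{k..<n}. d i)))"
  have sm: "(\<lambda>d. \<Sum>i<j. d i) \<in> borel_measurable (\<Pi>\<^sub>M i\<in>{..<n}. (borel :: real measure))" if "j \<le> n" for j
    by (rule borel_measurable_sum) (use that in auto)
  have st: "(\<lambda>d. \<Sum>i\<in>{k..<n}. d i) \<in> borel_measurable (\<Pi>\<^sub>M i\<in>{..<n}. (borel :: real measure))"
    by (rule borel_measurable_sum) auto
  have "{d \<in> space (\<Pi>\<^sub>M i\<in>{..<n}. (borel :: real measure)). \<rho> \<le> \<bar>\<Sum>i<k. d i\<bar> \<and> (\<forall>j\<in>{..<k}. \<bar>\<Sum>i<j. d i\<bar> < \<rho>)} \<in> sets (\<Pi>\<^sub>M i\<in>{..<n}. borel)"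
  proof (intro sets.sets_Collect_conj sets.sets_Collect_finite_All)
    show "{d \<in> space (\<Pi>\<^sub>M i\<in>{..<n}. (borel :: real measure)). \<rho> \<le> \<bar>\<Sum>i<k. d i\<bar>} \<in> sets (\<Pi>\<^sub>M i\<in>{..<n}. borel)"
      using assms by (intro borel_measurable_le borel_measurable_less borel_measurable_abs borel_measurable_const sm) auto
    fix j assume "j \<in> {..<k}"
    then show "{d \<in> space (\<Pi>\<^sub>M i\<in>{..<n}. (borel :: real measure)). \<bar>\<Sum>i<j. d i\<bar> < \<rho>} \<in> sets (\<Pi>\<^sub>M i\<in>{..<n}. borel)"
      using assms by (intro borel_measurable_le borel_measurable_less borel_measurable_abs borel_measurable_const sm) auto
  qed auto
  then have [measurable]: "(\<lambda>d. indicator {d. \<rho> \<le> \<bar>\<Sum>i<k. d i\<bar> \<and> (\<forall>j<k. \<bar>\<Sum>i<j. d i\<bar> < \<rho>)} d :: real) \<in> borel_measurable (\<Pi>\<^sub>M i\<in>{..<n}. borel)"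
    by (subst borel_measurable_indicator_iff) (simp add: Int_def conj_commute Ball_def)
  have g [measurable]: "g \<in> borel_measurable (\<Pi>\<^sub>M i\<in>{..<n}. borel)"
    unfolding g_def using assms by (intro borel_measurable_times sm st) auto
  have sums: "(\<Sum>i<j. (\<lambda>i\<in>{..<n}. D i \<omega>) i) = S j \<omega>" "(\<Sum>i<j. (\<lambda>i\<in>{..<n}. (if i < k then 1 else - 1) * D i \<omega>) i) = S j \<omega>"
    if "j \<le> k" for j \<omega>
    using that assms by (auto simp: S_def intro!: sum.cong)
  have "S n \<omega> = S k \<omega> + (\<Sum>i\<in>{k..<n}. D i \<omega>)" for \<omega>
    using assms sum.atLeastLessThan_concat[of 0 k n "\<lambda>i. D i \<omega>"] by (simp add: S_def atLeast0LessThan)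
  then have tails: "(\<Sum>i\<in>{k..<n}. (\<lambda>i\<in>{..<n}. D i \<omega>) i) = S n \<omega> - S k \<omega>"
    "(\<Sum>i\<in>{k..<n}. (\<lambda>i\<in>{..<n}. (if i < k then 1 else - 1) * D i \<omega>) i) = - (S n \<omega> - S k \<omega>)" for \<omega>
    by (simp_all add: sum_negf[symmetric])
  have gR: "g R = indicator {\<omega>. \<rho> \<le> \<bar>S k \<omega>\<bar> \<and> (\<forall>j<k. \<bar>S j \<omega>\<bar> < \<rho>)} \<omega> * (S k \<omega> * t)"
    if "\<And>j. j \<le> k \<Longrightarrow> (\<Sum>i<j. R i) = S j \<omega>" "(\<Sum>i\<in>{k..<n}. R i) = t" for R \<omega> t
    using that by (simp add: g_def indicator_def)
  have g1: "g (\<lambda>i\<in>{..<n}. D i \<omega>) = ?h \<omega>" for \<omega>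
    by (rule gR[OF sums(1) tails(1)])
  have g2: "g (\<lambda>i\<in>{..<n}. (if i < k then 1 else - 1) * D i \<omega>) = - ?h \<omega>" for \<omega>
    using gR[OF sums(2) tails(2)] by (simp only: mult_minus_right)
  have "(LINT \<omega>|M. ?h \<omega>) = (LINT \<omega>|M. - ?h \<omega>)"
    using reflection[OF g, of k] by (simp only: g1 g2)
  also have "\<dots> = - (LINT \<omega>|M. ?h \<omega>)" by (rule integral_minus)
  finally show ?thesis by linarith
qed

text \<open>Kolmogorov's inequality. On the event that the partial sums leave \<open>(-\<rho>, \<rho>)\<close> first at time \<open>k\<close>
  one has \<open>(S n)\<^sup>2 \<ge> (S k)\<^sup>2 + 2 S k (S n - S k)\<close>, where the cross term integrates to \<open>0\<close> by
  \<open>increment_orthogonal\<close> and the first term is at least \<open>\<rho>\<^sup>2\<close>.\<close>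
lemma maximal_inequality:
  assumes "\<rho> > 0"
  shows "prob {\<omega>\<in>space M. \<exists>k\<le>n. \<rho> \<le> \<bar>S k \<omega>\<bar>} \<le> (\<Sum>k<n. v k) / \<rho>\<^sup>2"
proof -
  define A where "A k = {\<omega>. \<rho> \<le> \<bar>S k \<omega>\<bar> \<and> (\<forall>j<k. \<bar>S j \<omega>\<bar> < \<rho>)}" for k
  have mA [measurable]: "A k \<inter> space M \<in> sets M" for k
  proof -
    have "{\<omega>\<in>space M. \<rho> \<le> \<bar>S k \<omega>\<bar> \<and> (\<forall>j\<in>{..<k}. \<bar>S j \<omega>\<bar> < \<rho>)} \<in> sets M" by measurable
    then show ?thesis by (simp add: A_def Int_def conj_commute Ball_def)
  qed
  have [measurable]: "(indicator (A k) :: _ \<Rightarrow> real) \<in> borel_measurable M" for k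
    using mA[of k] by (subst borel_measurable_indicator_iff) simp
  have uniq: "j = k" if "\<omega> \<in> A j" "\<omega> \<in> A k" for \<omega> j k
    using that unfolding A_def mem_Collect_eq by (metis linorder_cases not_le)
  have one: "(\<Sum>k\<le>n. indicator (A k) \<omega>) = (indicator {\<omega>. \<exists>k\<le>n. \<rho> \<le> \<bar>S k \<omega>\<bar>} \<omega> :: real)" for \<omega>
  proof (cases "\<exists>k\<le>n. \<rho> \<le> \<bar>S k \<omega>\<bar>")
    case True
    define k where "k = (LEAST k. \<rho> \<le> \<bar>S k \<omega>\<bar>)"
    obtain k0 where k0: "k0 \<le> n" "\<rho> \<le> \<bar>S k0 \<omega>\<bar>" using True by auto
    have "\<rho> \<le> \<bar>S k \<omega>\<bar>" "k \<le> k0" unfolding k_def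
      using k0 LeastI[of "\<lambda>k. \<rho> \<le> \<bar>S k \<omega>\<bar>" k0] Least_le[of "\<lambda>k. \<rho> \<le> \<bar>S k \<omega>\<bar>" k0] by auto
    moreover have "\<bar>S j \<omega>\<bar> < \<rho>" if "j < k" for j
      using not_less_Least[OF that[unfolded k_def]] by simp
    ultimately have kA: "\<omega> \<in> A k" "k \<le> n" using k0 by (auto simp: A_def)
    have "(\<Sum>j\<le>n. indicator (A j) \<omega> :: real) = (\<Sum>j\<le>n. if j = k then 1 else 0)"
    proof (rule sum.cong[OF refl])
      fix j show "indicator (A j) \<omega> = (if j = k then 1 else 0 :: real)"
      proof (cases "j = k")
        case True then show ?thesis using kA(1) by simp
      next
        case False
        then have "\<omega> \<notin> A j" using uniq kA(1) by blast
        then show ?thesis using False by simp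
      qed
    qed
    also have "\<dots> = 1" using kA(2) by simp
    finally have "(\<Sum>j\<le>n. indicator (A j) \<omega> :: real) = 1" .
    moreover have "\<omega> \<in> {\<omega>. \<exists>k\<le>n. \<rho> \<le> \<bar>S k \<omega>\<bar>}" using True by blast
    ultimately show ?thesis by (simp only: indicator_simps(1))
  next
    case False
    then have "(\<Sum>j\<le>n. indicator (A j) \<omega> :: real) = 0"
      by (intro sum.neutral ballI indicator_simps(2)) (auto simp only: A_def mem_Collect_eq atMost_iff)
    moreover have "\<omega> \<notin> {\<omega>. \<exists>k\<le>n. \<rho> \<le> \<bar>S k \<omega>\<bar>}" using False by blast
    ultimately show ?thesis by (metis indicator_simps(2))
  qed
  have L2d: "integrable M (\<lambda>\<omega>. (S n \<omega> - S k \<omega>)\<^sup>2)" for k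
    using integrable_add_L2[of "S n" M "\<lambda>\<omega>. - S k \<omega>"] S_L2 by simp
  have ind: "integrable M (\<lambda>\<omega>. indicator (A k) \<omega> * f \<omega>)" if "integrable M f" for f :: "_ \<Rightarrow> real" and k
    using that
  proof (rule Bochner_Integration.integrable_bound)
    have [measurable]: "f \<in> borel_measurable M" using that by simp
    show "(\<lambda>\<omega>. indicator (A k) \<omega> * f \<omega>) \<in> borel_measurable M" by measurable
  qed (auto simp: indicator_def)
  have i1: "integrable M (\<lambda>\<omega>. indicator (A k) \<omega> * (S k \<omega>)\<^sup>2)" for k by (rule ind[OF S_L2])
  have i2: "integrable M (\<lambda>\<omega>. indicator (A k) \<omega> * (S k \<omega> * (S n \<omega> - S k \<omega>)))" for k
    by (intro ind integrable_mult_L2 S_L2 L2d) measurable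
  have i0: "integrable M (\<lambda>\<omega>. indicator (A k) \<omega> :: real)" for k
    using ind[of "\<lambda>_. 1" k] by simp
  have "\<rho>\<^sup>2 * prob {\<omega>\<in>space M. \<exists>k\<le>n. \<rho> \<le> \<bar>S k \<omega>\<bar>}
      = \<rho>\<^sup>2 * (LINT \<omega>|M. indicator {\<omega>\<in>space M. \<exists>k\<le>n. \<rho> \<le> \<bar>S k \<omega>\<bar>} \<omega>)"
    by simp
  also have "(LINT \<omega>|M. indicator {\<omega>\<in>space M. \<exists>k\<le>n. \<rho> \<le> \<bar>S k \<omega>\<bar>} \<omega>) = (LINT \<omega>|M. (\<Sum>k\<le>n. indicator (A k) \<omega> :: real))"
    unfolding one by (intro Bochner_Integration.integral_cong) (simp_all add: indicator_def)
  also have "\<dots> = (\<Sum>k\<le>n. LINT \<omega>|M. indicator (A k) \<omega>)"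
    using i0 by simp
  also have "\<rho>\<^sup>2 * \<dots> = (\<Sum>k\<le>n. LINT \<omega>|M. indicator (A k) \<omega> * \<rho>\<^sup>2)"
    by (simp add: sum_distrib_left mult.commute)
  also have "\<dots> \<le> (\<Sum>k\<le>n. LINT \<omega>|M. indicator (A k) \<omega> * (S k \<omega>)\<^sup>2 + 2 * (indicator (A k) \<omega> * (S k \<omega> * (S n \<omega> - S k \<omega>))))"
  proof (rule sum_mono)
    fix k assume "k \<in> {..n}"
    then have z: "(LINT \<omega>|M. indicator (A k) \<omega> * (S k \<omega> * (S n \<omega> - S k \<omega>))) = 0"
      using increment_orthogonal[of k n \<rho>] by (simp add: A_def)
    have sq: "\<rho>\<^sup>2 \<le> (S k \<omega>)\<^sup>2" if "\<omega> \<in> A k" for \<omega>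
      using that assms power_mono[of \<rho> "\<bar>S k \<omega>\<bar>" 2] by (auto simp: A_def)
    have "(LINT \<omega>|M. indicator (A k) \<omega> * \<rho>\<^sup>2) \<le> (LINT \<omega>|M. indicator (A k) \<omega> * (S k \<omega>)\<^sup>2)"
      using i0 i1 by (intro integral_mono) (auto simp: indicator_def sq)
    then show "(LINT \<omega>|M. indicator (A k) \<omega> * \<rho>\<^sup>2) \<le> (LINT \<omega>|M. indicator (A k) \<omega> * (S k \<omega>)\<^sup>2 + 2 * (indicator (A k) \<omega> * (S k \<omega> * (S n \<omega> - S k \<omega>))))"
      using i1 i2 by (simp add: z)
  qed
  also have "\<dots> = (LINT \<omega>|M. (\<Sum>k\<le>n. indicator (A k) \<omega> * (S k \<omega>)\<^sup>2 + 2 * (indicator (A k) \<omega> * (S k \<omega> * (S n \<omega> - S k \<omega>)))))"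
    using i1 i2 by (intro Bochner_Integration.integral_sum[symmetric]) auto
  also have "\<dots> \<le> (LINT \<omega>|M. (S n \<omega>)\<^sup>2)"
  proof (rule integral_mono)
    fix \<omega>
    have "(\<Sum>k\<le>n. indicator (A k) \<omega> * (S k \<omega>)\<^sup>2 + 2 * (indicator (A k) \<omega> * (S k \<omega> * (S n \<omega> - S k \<omega>))))
       \<le> (\<Sum>k\<le>n. indicator (A k) \<omega> * (S n \<omega>)\<^sup>2)"
    proof (rule sum_mono)
      fix k
      have "indicator (A k) \<omega> * ((S k \<omega>)\<^sup>2 + 2 * (S k \<omega> * (S n \<omega> - S k \<omega>))) \<le> indicator (A k) \<omega> * (S n \<omega>)\<^sup>2"
        using zero_le_power2[of "S n \<omega> - S k \<omega>"]
        by (intro mult_left_mono) (auto simp: power2_eq_square algebra_simps)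
      then show "indicator (A k) \<omega> * (S k \<omega>)\<^sup>2 + 2 * (indicator (A k) \<omega> * (S k \<omega> * (S n \<omega> - S k \<omega>))) \<le> indicator (A k) \<omega> * (S n \<omega>)\<^sup>2"
        by (simp add: algebra_simps)
    qed
    also have "\<dots> = indicator {\<omega>. \<exists>k\<le>n. \<rho> \<le> \<bar>S k \<omega>\<bar>} \<omega> * (S n \<omega>)\<^sup>2"
      by (simp add: sum_distrib_right[symmetric] one)
    also have "\<dots> \<le> (S n \<omega>)\<^sup>2" by (simp add: indicator_def)
    finally show "(\<Sum>k\<le>n. indicator (A k) \<omega> * (S k \<omega>)\<^sup>2 + 2 * (indicator (A k) \<omega> * (S k \<omega> * (S n \<omega> - S k \<omega>)))) \<le> (S n \<omega>)\<^sup>2" .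
  qed (use i1 i2 S_L2 in auto)
  finally show ?thesis using assms by (simp add: S_var field_simps)
qed

end

lemma gaussian_sequence_shift:
  assumes "gaussian_sequence M D v"
  shows "gaussian_sequence M (\<lambda>k. D (m + k)) (\<lambda>k. v (m + k))"
proof -
  interpret gaussian_sequence M D v by fact
  show ?thesis
  proof
    fix n and t :: "nat \<Rightarrow> real"
    have e: "(\<Sum>k<m + n. (if k < m then 0 else t (k - m)) * f k) = (\<Sum>k<n. t k * f (m + k))" for f t :: "nat \<Rightarrow> real"
    proof -
      have "(\<Sum>k<m + n. (if k < m then 0 else t (k - m)) * f k)
         = (\<Sum>k\<in>{m..<m + n}. t (k - m) * f k)"
        by (rule sum.mono_neutral_cong_right) auto
      also have "\<dots> = (\<Sum>k<n. t k * f (m + k))"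
        by (rule sum.reindex_bij_witness[of _ "\<lambda>k. m + k" "\<lambda>k. k - m"]) auto
      finally show ?thesis .
    qed
    have e2: "(\<Sum>k<m + n. (if k < m then 0 else t (k - m))\<^sup>2 * f k) = (\<Sum>k<n. (t k)\<^sup>2 * f (m + k))" for f
      using e[of "\<lambda>k. (t k)\<^sup>2" f] by (simp add: if_distrib[of "\<lambda>x. x\<^sup>2"] cong: if_cong)
    show "gaussian_var M (\<lambda>\<omega>. \<Sum>k<n. t k * D (m + k) \<omega>) (\<Sum>k<n. (t k)\<^sup>2 * v (m + k))"
      using gauss[where n="m + n" and t="\<lambda>k. if k < m then 0 else t (k - m)"] unfolding e2 e[of t] .
  qed
qed

text \<open>Kolmogorov's one-series theorem. By the maximal inequality for the tails, the oscillation of the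
  partial sums beyond \<open>m\<close> exceeds \<open>\<rho>\<close> with probability at most \<open>(\<Sum>i\<ge>m. v i) / \<rho>\<^sup>2\<close>, which tends to
  \<open>0\<close>, so the partial sums are almost surely Cauchy.\<close>
theorem gaussian_series_convergent:
  assumes "gaussian_sequence M D v" and sv: "summable v"
  shows "AE \<omega> in M. convergent (\<lambda>n. \<Sum>k<n. D k \<omega>)"
proof -
  interpret gaussian_sequence M D v by fact
  have tail: "prob {\<omega>\<in>space M. \<exists>k. \<rho> \<le> \<bar>S (m + k) \<omega> - S m \<omega>\<bar>} \<le> (\<Sum>i. v (i + m)) / \<rho>\<^sup>2" if l: "\<rho> > 0" for \<rho> m
  proof -
    interpret T: gaussian_sequence M "\<lambda>k. D (m + k)" "\<lambda>k. v (m + k)"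
      by (rule gaussian_sequence_shift) fact
    have TS: "T.S k \<omega> = S (m + k) \<omega> - S m \<omega>" for k \<omega>
    proof -
      have "S (m + k) \<omega> = S m \<omega> + (\<Sum>i\<in>{m..<m+k}. D i \<omega>)"
        using sum.atLeastLessThan_concat[of 0 m "m + k" "\<lambda>i. D i \<omega>"] by (simp add: S_def atLeast0LessThan)
      moreover have "(\<Sum>i\<in>{m..<m+k}. D i \<omega>) = T.S k \<omega>"
        unfolding T.S_def by (rule sum.reindex_bij_witness[of _ "\<lambda>k. m + k" "\<lambda>k. k - m"]) auto
      ultimately show ?thesis by simp
    qed
    define B where "B n = {\<omega>\<in>space M. \<exists>k\<le>n. \<rho> \<le> \<bar>S (m + k) \<omega> - S m \<omega>\<bar>}" for n
    have "B n \<in> sets M" for n unfolding B_def by measurable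
    moreover have "incseq B" unfolding B_def by (auto simp: incseq_def intro: order_trans)
    ultimately have "(\<lambda>n. prob (B n)) \<longlonglongrightarrow> prob (\<Union>n. B n)"
      by (intro finite_Lim_measure_incseq) auto
    moreover have "prob (B n) \<le> (\<Sum>i. v (i + m)) / \<rho>\<^sup>2" for n
    proof -
      have "prob (B n) \<le> (\<Sum>k<n. v (m + k)) / \<rho>\<^sup>2"
        using T.maximal_inequality[OF l, of n] by (simp add: B_def TS)
      also have "(\<Sum>k<n. v (m + k)) \<le> (\<Sum>i. v (i + m))"
        using sum_le_suminf[of "\<lambda>i. v (i + m)" "{..<n}"] sv v_nonneg
        by (simp add: summable_iff_shift add.commute)
      finally show ?thesis using l by (simp add: divide_right_mono)
    qed
    ultimately have "prob (\<Union>n. B n) \<le> (\<Sum>i. v (i + m)) / \<rho>\<^sup>2"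
      by (intro LIMSEQ_le_const2) auto
    moreover have "(\<Union>n. B n) = {\<omega>\<in>space M. \<exists>k. \<rho> \<le> \<bar>S (m + k) \<omega> - S m \<omega>\<bar>}"
      by (auto simp: B_def)
    ultimately show ?thesis by simp
  qed
  have lim: "(\<lambda>m. (\<Sum>i. v (i + m)) / \<rho>\<^sup>2) \<longlonglongrightarrow> 0" for \<rho> :: real
    using tendsto_divide[OF suminf_exist_split2[OF sv] tendsto_const[of "\<rho>\<^sup>2"]] by (cases "\<rho> = 0") auto
  have osc: "AE \<omega> in M. \<exists>m. \<forall>k. \<bar>S (m + k) \<omega> - S m \<omega>\<bar> < \<rho>" if l: "\<rho> > 0" for \<rho>
  proof -
    define N where "N = {\<omega>\<in>space M. \<forall>m. \<exists>k. \<rho> \<le> \<bar>S (m + k) \<omega> - S m \<omega>\<bar>}"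
    have [measurable]: "N \<in> sets M" unfolding N_def by measurable
    have "prob N \<le> (\<Sum>i. v (i + m)) / \<rho>\<^sup>2" for m
    proof -
      have "prob N \<le> prob {\<omega>\<in>space M. \<exists>k. \<rho> \<le> \<bar>S (m + k) \<omega> - S m \<omega>\<bar>}"
        by (rule finite_measure_mono) (auto simp: N_def)
      then show ?thesis using tail[OF l, of m] by simp
    qed
    then have "prob N \<le> 0" using lim[of \<rho>] by (intro LIMSEQ_le_const) auto
    then have "emeasure M N = 0" by (simp add: emeasure_eq_measure measure_le_0_iff)
    then show ?thesis
      by (intro AE_I[of _ _ N]) (auto simp: N_def not_less)
  qed
  have "AE \<omega> in M. \<forall>j. \<exists>m. \<forall>k. \<bar>S (m + k) \<omega> - S m \<omega>\<bar> < inverse (real (Suc j))"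
    unfolding AE_all_countable using osc by auto
  then show ?thesis
  proof eventually_elim
    case (elim \<omega>)
    have "Cauchy (\<lambda>n. S n \<omega>)"
    proof (rule metric_CauchyI)
      fix e :: real assume "e > 0"
      then obtain j where j: "inverse (real (Suc j)) < e / 2"
        using reals_Archimedean[of "e / 2"] by auto
      obtain m where m: "\<And>k. \<bar>S (m + k) \<omega> - S m \<omega>\<bar> < inverse (real (Suc j))" using elim by blast
      have "dist (S a \<omega>) (S b \<omega>) < e" if "a \<ge> m" "b \<ge> m" for a b
        using m[of "a - m"] m[of "b - m"] that j by (simp add: dist_real_def)
      then show "\<exists>M. \<forall>m\<ge>M. \<forall>n\<ge>M. dist (S m \<omega>) (S n \<omega>) < e" by blast
    qed
    then show ?case by (simp add: S_def Cauchy_convergent_iff)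
  qed
qed

section \<open>The Cameron--Martin formula\<close>

text \<open>The pairs in \<open>T\<close> are random variables \<open>f\<close> jointly Gaussian with \<open>Y\<close>, together with their
  covariance \<open>c\<close> with \<open>Y\<close>. The variable \<open>f - (c/s) Y\<close> is independent of \<open>Y\<close>, so that on the product
  space \<open>M \<Otimes> M\<close> the variables \<open>f(x) - (c/s) Y(x) + (c/s) Y(y)\<close> and \<open>Y(y)\<close> have the same joint law as
  \<open>f\<close> and \<open>Y\<close>. In this representation the weight \<open>exp(aY)\<close> only concerns the one-dimensional Gaussian
  variable \<open>Y(y)\<close>, for which completing the square shows that the weight is the shift by \<open>a s\<close> up to
  the factor \<open>exp(a\<^sup>2 s / 2)\<close>. Shifting \<open>Y(y)\<close> by \<open>a s\<close> shifts \<open>f\<close> by \<open>a c\<close>.\<close>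
theorem gaussian_shift:
  fixes T :: "(('w \<Rightarrow> real) \<times> real) set" and I :: "'i set"
  assumes M: "prob_space M"
    and meas: "\<And>f c. (f, c) \<in> T \<Longrightarrow> f \<in> borel_measurable M"
    and lin: "\<And>f c f' c' a b. (f, c) \<in> T \<Longrightarrow> (f', c') \<in> T \<Longrightarrow> (\<lambda>\<omega>. a * f \<omega> + b * f' \<omega>, a * c + b * c') \<in> T"
    and char: "\<And>f c. (f, c) \<in> T \<Longrightarrow> \<exists>q. \<forall>r. (CLINT \<omega>|M. iexp (f \<omega> + r * Y \<omega>)) = complex_of_real (exp (- (q + 2 * r * c + r\<^sup>2 * s) / 2))"
    and Y [measurable]: "Y \<in> borel_measurable M"
    and Y_char: "\<And>t. (CLINT \<omega>|M. iexp (t * Y \<omega>)) = complex_of_real (exp (- (t\<^sup>2 * s / 2)))" and s: "s > 0"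
    and V: "\<And>i. i \<in> I \<Longrightarrow> (V i, c i) \<in> T"
    and g [measurable]: "g \<in> borel_measurable (\<Pi>\<^sub>M i\<in>I. borel)" and "T \<noteq> {}"
  shows "(\<integral>\<^sup>+\<omega>. ennreal (exp (a * Y \<omega>)) * g (\<lambda>i\<in>I. V i \<omega>) \<partial>M)
       = ennreal (exp (a\<^sup>2 * s / 2)) * (\<integral>\<^sup>+\<omega>. g (\<lambda>i\<in>I. V i \<omega> + a * c i) \<partial>M)"
proof -
  interpret M: prob_space M by fact
  interpret MM: pair_prob_space M M by unfold_locales
  have Vm [measurable]: "V i \<in> borel_measurable M" if "i \<in> I" for i using meas V that by blast
  \<comment> \<open>The index \<open>None\<close> stands for \<open>Y\<close> itself.\<close>
  define I' where "I' = insert None (Some ` I)"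
  define U where "U = (\<lambda>i \<omega>. case i of None \<Rightarrow> Y \<omega> | Some i \<Rightarrow> V i \<omega>)"
  define W where "W = (\<lambda>i (p :: 'w \<times> 'w). case i of None \<Rightarrow> Y (snd p) | Some i \<Rightarrow> V i (fst p) - c i / s * Y (fst p) + c i / s * Y (snd p))"
  \<comment> \<open>All linear combinations of \<open>Y\<close> and of elements of \<open>T\<close>, with their counterparts on the product.\<close>
  define S where "S = {(\<lambda>\<omega>. f \<omega> + r * Y \<omega>, \<lambda>p. f (fst p) - d / s * Y (fst p) + (d / s + r) * Y (snd p)) | f d r. (f, d) \<in> T}"
  have z: "(\<lambda>_. 0, 0) \<in> T" using \<open>T \<noteq> {}\<close> lin[where a=0 and b=0] by fastforce
  have law: "distr M (\<Pi>\<^sub>M i\<in>I'. borel) (\<lambda>\<omega>. \<lambda>i\<in>I'. U i \<omega>) = distr (M \<Otimes>\<^sub>M M) (\<Pi>\<^sub>M i\<in>I'. borel) (\<lambda>p. \<lambda>i\<in>I'. W i p)"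
  proof (rule joint_char_determines_law[where S=S])
    show "prob_space (M \<Otimes>\<^sub>M M)" by unfold_locales
    fix f g assume "(f, g) \<in> S"
    then obtain h d r where h: "(h, d) \<in> T" and f: "f = (\<lambda>\<omega>. h \<omega> + r * Y \<omega>)"
      and g: "g = (\<lambda>p. h (fst p) - d / s * Y (fst p) + (d / s + r) * Y (snd p))"
      by (auto simp: S_def)
    have [measurable]: "h \<in> borel_measurable M" using h meas by blast
    show "f \<in> borel_measurable M \<and> g \<in> borel_measurable (M \<Otimes>\<^sub>M M)" unfolding f g by simp
    obtain q where q: "\<And>r. (CLINT \<omega>|M. iexp (h \<omega> + r * Y \<omega>)) = complex_of_real (exp (- (q + 2 * r * d + r\<^sup>2 * s) / 2))"
      using char[OF h] by blast
    have "(CLINT p|M \<Otimes>\<^sub>M M. iexp (g p))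
       = (CLINT p|M \<Otimes>\<^sub>M M. iexp (h (fst p) + (- d / s) * Y (fst p)) * iexp ((d / s + r) * Y (snd p)))"
      by (simp add: g exp_add[symmetric] distrib_left[symmetric] algebra_simps)
    also have "\<dots> = (CLINT x|M. CLINT y|M. iexp (h x + (- d / s) * Y x) * iexp ((d / s + r) * Y y))"
      by (subst MM.integral_fst'[symmetric]) (auto intro!: MM.integrable_const_bound[where B=1] simp: norm_mult)
    also have "\<dots> = (CLINT x|M. iexp (h x + (- d / s) * Y x)) * (CLINT y|M. iexp ((d / s + r) * Y y))"
      by (simp del: of_real_add of_real_mult of_real_divide of_real_minus)
    also have "(CLINT x|M. iexp (h x + (- d / s) * Y x)) = complex_of_real (exp (- (q + 2 * (- d / s) * d + (- d / s)\<^sup>2 * s) / 2))"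
      by (rule q)
    also have "(CLINT y|M. iexp ((d / s + r) * Y y)) = complex_of_real (exp (- ((d / s + r)\<^sup>2 * s / 2)))"
      by (rule Y_char)
    also have "complex_of_real (exp (- (q + 2 * (- d / s) * d + (- d / s)\<^sup>2 * s) / 2)) * complex_of_real (exp (- ((d / s + r)\<^sup>2 * s / 2)))
       = complex_of_real (exp (- (q + 2 * r * d + r\<^sup>2 * s) / 2))"
      unfolding of_real_mult[symmetric] exp_add[symmetric] using s
      by (simp add: power2_eq_square field_simps)
    also have "\<dots> = (CLINT x|M. iexp (f x))" unfolding f q ..
    finally show "(CLINT x|M. iexp (f x)) = (CLINT p|M \<Otimes>\<^sub>M M. iexp (g p))" by simp
  next
    fix f g f' g' and a b :: real assume "(f, g) \<in> S" "(f', g') \<in> S"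
    then obtain h d r h' d' r' where h: "(h, d) \<in> T" "(h', d') \<in> T" and
      *: "f = (\<lambda>\<omega>. h \<omega> + r * Y \<omega>)" "g = (\<lambda>p. h (fst p) - d / s * Y (fst p) + (d / s + r) * Y (snd p))"
      "f' = (\<lambda>\<omega>. h' \<omega> + r' * Y \<omega>)" "g' = (\<lambda>p. h' (fst p) - d' / s * Y (fst p) + (d' / s + r') * Y (snd p))"
      by (auto simp: S_def)
    show "(\<lambda>x. a * f x + b * f' x, \<lambda>x. a * g x + b * g' x) \<in> S"
      unfolding S_def
    proof (rule CollectI, rule exI[of _ "\<lambda>\<omega>. a * h \<omega> + b * h' \<omega>"], rule exI[of _ "a * d + b * d'"],
        rule exI[of _ "a * r + b * r'"], intro conjI lin h)
      show "(\<lambda>x. a * f x + b * f' x, \<lambda>x. a * g x + b * g' x) =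
        (\<lambda>\<omega>. a * h \<omega> + b * h' \<omega> + (a * r + b * r') * Y \<omega>,
         \<lambda>p. a * h (fst p) + b * h' (fst p) - (a * d + b * d') / s * Y (fst p)
            + ((a * d + b * d') / s + (a * r + b * r')) * Y (snd p))"
        by (simp add: * fun_eq_iff add_divide_distrib algebra_simps)
    qed
  next
    fix i assume i: "i \<in> I'"
    show "(U i, W i) \<in> S"
    proof (cases i)
      case None
      show ?thesis unfolding S_def U_def W_def None option.case
        by (rule CollectI, rule exI[of _ "\<lambda>_. 0"], rule exI[of _ 0], rule exI[of _ 1]) (use z in simp)
    next
      case (Some j)
      have VT: "(V j, c j) \<in> T" using i V Some by (auto simp: I'_def)
      show ?thesis unfolding S_def U_def W_def Some option.case
        by (rule CollectI, rule exI[of _ "V j"], rule exI[of _ "c j"], rule exI[of _ 0]) (use VT in simp)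
    qed
  next
    show "S \<noteq> {}" using z unfolding S_def by blast
  qed (rule M)
  have [measurable]: "U i \<in> borel_measurable M" "W i \<in> borel_measurable (M \<Otimes>\<^sub>M M)" if "i \<in> I'" for i
    using that by (auto simp: I'_def U_def W_def)
  have mU [measurable]: "(\<lambda>\<omega>. \<lambda>i\<in>I'. U i \<omega>) \<in> measurable M (\<Pi>\<^sub>M i\<in>I'. borel)"
    by (rule measurable_restrict) auto
  have mW [measurable]: "(\<lambda>\<omega>. \<lambda>i\<in>I'. W i \<omega>) \<in> measurable (M \<Otimes>\<^sub>M M) (\<Pi>\<^sub>M i\<in>I'. borel)"
    by (rule measurable_restrict) auto
  have transfer: "(\<integral>\<^sup>+\<omega>. G (\<lambda>i\<in>I'. U i \<omega>) \<partial>M) = (\<integral>\<^sup>+x. \<integral>\<^sup>+y. G (\<lambda>i\<in>I'. W i (x, y)) \<partial>M \<partial>M)"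
    if [measurable]: "G \<in> borel_measurable (\<Pi>\<^sub>M i\<in>I'. borel)" for G :: "_ \<Rightarrow> ennreal"
  proof -
    have "(\<integral>\<^sup>+\<omega>. G (\<lambda>i\<in>I'. U i \<omega>) \<partial>M) = (\<integral>\<^sup>+x. G x \<partial>distr M (\<Pi>\<^sub>M i\<in>I'. borel) (\<lambda>\<omega>. \<lambda>i\<in>I'. U i \<omega>))"
      by (simp add: nn_integral_distr)
    also have "\<dots> = (\<integral>\<^sup>+p. G (\<lambda>i\<in>I'. W i p) \<partial>(M \<Otimes>\<^sub>M M))"
      unfolding law by (simp add: nn_integral_distr)
    also have "\<dots> = (\<integral>\<^sup>+x. \<integral>\<^sup>+y. G (\<lambda>i\<in>I'. W i (x, y)) \<partial>M \<partial>M)"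
      by (rule M.nn_integral_fst[symmetric]) measurable
    finally show ?thesis .
  qed
  have mz [measurable]: "(\<lambda>z. \<lambda>i\<in>I. z (Some i) + b i) \<in> measurable (\<Pi>\<^sub>M i\<in>I'. borel) (\<Pi>\<^sub>M i\<in>I. (borel :: real measure))" for b :: "'i \<Rightarrow> real"
    by (rule measurable_restrict) (auto simp: I'_def intro!: borel_measurable_add measurable_component_singleton)
  have mN: "(\<lambda>z. z None) \<in> measurable (\<Pi>\<^sub>M i\<in>I'. borel) (borel :: real measure)"
    by (rule measurable_component_singleton) (auto simp: I'_def)
  have mg: "(\<lambda>z. g (\<lambda>i\<in>I. z (Some i) + b i)) \<in> borel_measurable (\<Pi>\<^sub>M i\<in>I'. borel)" for b
    by (rule measurable_compose[OF mz g])
  have [simp]: "None \<in> I'" "i \<in> I \<Longrightarrow> Some i \<in> I'" for i by (auto simp: I'_def)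
  define G1 where "G1 = (\<lambda>z. ennreal (exp (a * z None)) * g (\<lambda>i\<in>I. z (Some i) + 0))"
  define G2 where "G2 = (\<lambda>z. g (\<lambda>i\<in>I. z (Some i) + a * c i))"
  have "(\<lambda>z. ennreal (exp (a * z None))) \<in> borel_measurable (\<Pi>\<^sub>M i\<in>I'. borel)"
    by (rule measurable_compose[OF mN]) measurable
  then have [measurable]: "G1 \<in> borel_measurable (\<Pi>\<^sub>M i\<in>I'. borel)" "G2 \<in> borel_measurable (\<Pi>\<^sub>M i\<in>I'. borel)"
    unfolding G1_def G2_def using mg[of "\<lambda>_. 0"] mg[of "\<lambda>i. a * c i"] by (auto intro!: borel_measurable_times_ennreal)
  have inner: "(\<integral>\<^sup>+y. G1 (\<lambda>i\<in>I'. W i (x, y)) \<partial>M) = ennreal (exp (a\<^sup>2 * s / 2)) * (\<integral>\<^sup>+y. G2 (\<lambda>i\<in>I'. W i (x, y)) \<partial>M)" for x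
  proof -
    define H where "H = (\<lambda>t. g (\<lambda>i\<in>I. V i x - c i / s * Y x + c i / s * t))"
    have "(\<lambda>t. \<lambda>i\<in>I. V i x - c i / s * Y x + c i / s * t) \<in> measurable borel (\<Pi>\<^sub>M i\<in>I. borel)"
      by (rule measurable_restrict) auto
    then have [measurable]: "H \<in> borel_measurable borel" unfolding H_def by (rule measurable_compose[OF _ g])
    have YN: "distr M borel Y = density lborel (normal_density 0 (sqrt s))"
      by (rule gaussian_char_distr[OF M Y Y_char s])
    have nY: "(\<integral>\<^sup>+y. K (Y y) \<partial>M) = (\<integral>\<^sup>+t. ennreal (normal_density 0 (sqrt s) t) * K t \<partial>lborel)"
      if [measurable]: "K \<in> borel_measurable borel" for K :: "real \<Rightarrow> ennreal"
      using nn_integral_distr[of Y M borel K] by (simp add: YN nn_integral_density)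
    have "G1 (\<lambda>i\<in>I'. W i (x, y)) = ennreal (exp (a * Y y)) * H (Y y)" for y
      by (simp add: G1_def H_def W_def cong: restrict_cong)
    then have "(\<integral>\<^sup>+y. G1 (\<lambda>i\<in>I'. W i (x, y)) \<partial>M) = (\<integral>\<^sup>+y. ennreal (exp (a * Y y)) * H (Y y) \<partial>M)" by simp
    also have "\<dots> = (\<integral>\<^sup>+t. ennreal (normal_density 0 (sqrt s) t) * (ennreal (exp (a * t)) * H t) \<partial>lborel)"
      by (rule nY[of "\<lambda>t. ennreal (exp (a * t)) * H t"]) measurable
    also have "\<dots> = (\<integral>\<^sup>+t. ennreal (normal_density 0 (sqrt s) (a * s + t)) * (ennreal (exp (a * (a * s + t))) * H (a * s + t)) \<partial>lborel)"
      by (subst nn_integral_real_affine[where c=1 and t="a * s"]) auto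
    also have "\<dots> = (\<integral>\<^sup>+t. ennreal (exp (a\<^sup>2 * s / 2)) * (ennreal (normal_density 0 (sqrt s) t) * H (a * s + t)) \<partial>lborel)"
    proof (rule nn_integral_cong)
      fix t
      have "normal_density 0 (sqrt s) (a * s + t) * exp (a * (a * s + t)) = exp (a\<^sup>2 * s / 2) * normal_density 0 (sqrt s) t"
      proof -
        have "- (a * s + t)\<^sup>2 / (2 * s) + a * (a * s + t) = a\<^sup>2 * s / 2 + (- t\<^sup>2 / (2 * s))"
          using s by (simp add: power2_eq_square field_simps)
        then have "exp (- (a * s + t)\<^sup>2 / (2 * s)) * exp (a * (a * s + t)) = exp (a\<^sup>2 * s / 2) * exp (- t\<^sup>2 / (2 * s))"
          by (metis exp_add)
        then show ?thesis using s by (simp add: normal_density_def)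
      qed
      then show "ennreal (normal_density 0 (sqrt s) (a * s + t)) * (ennreal (exp (a * (a * s + t))) * H (a * s + t))
        = ennreal (exp (a\<^sup>2 * s / 2)) * (ennreal (normal_density 0 (sqrt s) t) * H (a * s + t))"
        by (simp add: mult.assoc[symmetric] ennreal_mult[symmetric] normal_density_nonneg)
    qed
    also have "\<dots> = ennreal (exp (a\<^sup>2 * s / 2)) * (\<integral>\<^sup>+t. ennreal (normal_density 0 (sqrt s) t) * H (a * s + t) \<partial>lborel)"
      by (rule nn_integral_cmult) measurable
    also have "(\<integral>\<^sup>+t. ennreal (normal_density 0 (sqrt s) t) * H (a * s + t) \<partial>lborel) = (\<integral>\<^sup>+y. H (a * s + Y y) \<partial>M)"
      by (rule nY[of "\<lambda>t. H (a * s + t)", symmetric]) measurable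
    also have "\<dots> = (\<integral>\<^sup>+y. G2 (\<lambda>i\<in>I'. W i (x, y)) \<partial>M)"
      using s by (simp add: G2_def H_def W_def field_simps cong: restrict_cong)
    finally show ?thesis .
  qed
  have "(\<integral>\<^sup>+\<omega>. ennreal (exp (a * Y \<omega>)) * g (\<lambda>i\<in>I. V i \<omega>) \<partial>M) = (\<integral>\<^sup>+\<omega>. G1 (\<lambda>i\<in>I'. U i \<omega>) \<partial>M)"
    by (simp add: G1_def U_def cong: restrict_cong)
  also have "\<dots> = (\<integral>\<^sup>+x. ennreal (exp (a\<^sup>2 * s / 2)) * (\<integral>\<^sup>+y. G2 (\<lambda>i\<in>I'. W i (x, y)) \<partial>M) \<partial>M)"
    by (subst transfer) (simp_all add: inner)
  also have "\<dots> = ennreal (exp (a\<^sup>2 * s / 2)) * (\<integral>\<^sup>+x. (\<integral>\<^sup>+y. G2 (\<lambda>i\<in>I'. W i (x, y)) \<partial>M) \<partial>M)"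
    by (rule nn_integral_cmult) measurable
  also have "(\<integral>\<^sup>+x. (\<integral>\<^sup>+y. G2 (\<lambda>i\<in>I'. W i (x, y)) \<partial>M) \<partial>M) = (\<integral>\<^sup>+\<omega>. G2 (\<lambda>i\<in>I'. U i \<omega>) \<partial>M)"
    by (rule transfer[symmetric]) measurable
  also have "\<dots> = (\<integral>\<^sup>+\<omega>. g (\<lambda>i\<in>I. V i \<omega> + a * c i) \<partial>M)"
    by (simp add: G2_def U_def cong: restrict_cong)
  finally show ?thesis .
qed

section \<open>Fourier modes on the torus\<close>

lemma space_torus: "space torus = {0..<1} \<times> {0..<1}"
  by (simp add: torus_def space_restrict_space)

lemma borel_measurable_torus [measurable (raw)]:
  "f \<in> measurable borel N \<Longrightarrow> f \<in> measurable torus N"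
  unfolding torus_def by (rule measurable_restrict_space1) simp

lemma unit_square_borel [measurable]: "{0..<1::real} \<times> {0..<1::real} \<in> sets borel"
  by (metis borel_prod pair_measureI atLeastLessThan_borel)

interpretation torus: prob_space torus
proof
  have "emeasure torus (space torus) = emeasure (lborel \<Otimes>\<^sub>M lborel) ({0..<1::real} \<times> {0..<1::real})"
    unfolding space_torus by (simp add: torus_def emeasure_restrict_space lborel_prod)
  also have "\<dots> = 1" by (subst lborel.emeasure_pair_measure_Times) auto
  finally show "emeasure torus (space torus) = 1" .
qed

text \<open>The torus measure is the product of two copies of this measure, which gives access to Fubini
  and to the fundamental theorem of calculus in each variable.\<close>
definition unit_interval :: "real measure" where "unit_interval = restrict_space lborel {0..<1}"

lemma integral_unit_interval:
  fixes f :: "real \<Rightarrow> real"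
  shows "(LINT t|unit_interval. f t) = (LINT t|lborel. indicator {0..<1} t * f t)"
  unfolding unit_interval_def by (subst integral_restrict_space) auto

lemma torus_Fubini:
  fixes f :: "pt \<Rightarrow> real"
  assumes "integrable torus f"
  shows "(LINT x|torus. f x) = (LINT s|unit_interval. LINT t|unit_interval. f (s, t))" (is ?A)
    and "(LINT x|torus. f x) = (LINT t|unit_interval. LINT s|unit_interval. f (s, t))" (is ?B)
proof -
  let ?g = "\<lambda>x. indicator ({0..<1} \<times> {0..<1}) x * f x"
  have g: "integrable (lborel \<Otimes>\<^sub>M lborel) ?g"
    using assms unfolding torus_def by (subst (asm) integrable_restrict_space) (auto simp: lborel_prod)
  have e: "(LINT x|torus. f x) = (LINT x|(lborel \<Otimes>\<^sub>M lborel). ?g x)"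
    unfolding torus_def by (subst integral_restrict_space) (auto simp: lborel_prod)
  have g_eq: "?g (s, t) = indicator {0..<1} s * (indicator {0..<1} t * f (s, t))"
    "?g (s, t) = indicator {0..<1} t * (indicator {0..<1} s * f (s, t))" for s t
    by (auto simp: indicator_def)
  show ?A unfolding e lborel_pair.integral_fst'[OF g, symmetric] g_eq(1)
    by (simp add: integral_unit_interval)
  have "(LINT x|(lborel \<Otimes>\<^sub>M lborel). ?g x) = (LINT t|lborel. LINT s|lborel. ?g (s, t))"
    using lborel_pair.integral_snd[of "\<lambda>s t. ?g (s, t)"] g by (simp add: case_prod_beta')
  then show ?B unfolding e g_eq(2) by (simp add: integral_unit_interval)
qed

lemma unit_interval_FTC:
  fixes F f :: "real \<Rightarrow> real"
  assumes "\<And>t. (F has_real_derivative f t) (at t)" and "continuous_on UNIV f"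
  shows "(LINT t|unit_interval. f t) = F 1 - F 0"
proof -
  have "(LINT t|unit_interval. f t) = (LINT t|lborel. f t * indicator {0..1} t)"
    unfolding integral_unit_interval
  proof (rule integral_cong_AE)
    have [measurable]: "f \<in> borel_measurable borel" by (rule borel_measurable_continuous_onI) fact
    show "(\<lambda>t. indicator {0..<1} t * f t) \<in> borel_measurable lborel"
      "(\<lambda>t. f t * indicator {0..1} t) \<in> borel_measurable lborel" by measurable
    show "AE t in lborel. indicator {0..<1} t * f t = f t * indicator {0..1} t"
      using AE_lborel_singleton[of "1::real"] by eventually_elim (auto simp: indicator_def)
  qed
  also have "\<dots> = F 1 - F 0"
    by (rule integral_FTC_Icc_real) (use assms in \<open>auto simp: continuous_on_eq_continuous_at\<close>)
  finally show ?thesis .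
qed

lemma torus_integrable_bounded:
  fixes f :: "pt \<Rightarrow> real"
  assumes "f \<in> borel_measurable borel" "\<And>x. \<bar>f x\<bar> \<le> B"
  shows "integrable torus f"
  by (rule torus.integrable_const_bound[where B=B]) (use assms in \<open>auto intro: borel_measurable_torus\<close>)

lemma continuous_borel_pt: "continuous_on UNIV (f :: pt \<Rightarrow> real) \<Longrightarrow> f \<in> borel_measurable borel"
  by (rule borel_measurable_continuous_onI)

lemma unit_interval_cos:
  fixes k :: int
  shows "(LINT t|unit_interval. cos (2 * pi * of_int k * t + c)) = (if k = 0 then cos c else 0)"
proof (cases "k = 0")
  case True
  have "(LINT t|unit_interval. cos c) = cos c * 1 - cos c * 0"
    by (rule unit_interval_FTC[where F="\<lambda>t. cos c * t"]) (auto intro!: derivative_eq_intros)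
  then show ?thesis using True by simp
next
  case False
  let ?F = "\<lambda>t. sin (2 * pi * of_int k * t + c) / (2 * pi * of_int k)"
  have "(LINT t|unit_interval. cos (2 * pi * of_int k * t + c)) = ?F 1 - ?F 0"
    using False by (intro unit_interval_FTC) (auto intro!: derivative_eq_intros continuous_intros)
  also have "sin (2 * pi * of_int k * 1 + c) = sin c"
    using sin_cos_eq_iff[of "2 * pi * of_int k * 1 + c" c]
    by (simp add: sin_add sin_int_2pin cos_int_2pin mult.commute mult.left_commute)
  finally show ?thesis using False by simp
qed

lemma torus_integral_cos:
  fixes k l :: int
  shows "(LINT x|torus. cos (2 * pi * (of_int k * fst x + of_int l * snd x) + c)) = (if k = 0 \<and> l = 0 then cos c else 0)"
proof -
  have i: "integrable torus (\<lambda>x. cos (2 * pi * (of_int k * fst x + of_int l * snd x) + c))"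
    by (rule torus_integrable_bounded[where B=1])
       (auto intro!: continuous_borel_pt continuous_intros)
  show ?thesis
  proof (cases "k = 0")
    case False
    have "cos (2 * pi * (of_int k * s + of_int l * t) + c) = cos (2 * pi * of_int k * s + (2 * pi * of_int l * t + c))" for s t
      by (simp add: algebra_simps)
    then show ?thesis using False torus_Fubini(2)[OF i] by (simp add: unit_interval_cos)
  next
    case True
    have "(LINT x|torus. cos (2 * pi * (of_int k * fst x + of_int l * snd x) + c))
      = (LINT s|unit_interval. LINT t|unit_interval. cos (2 * pi * of_int l * t + c))"
      using True by (subst torus_Fubini(1)[OF i]) (simp add: algebra_simps)
    also have "\<dots> = (if l = 0 then cos c else 0)"
      using unit_interval_cos[of 0 0] unit_interval_cos[of 0 c] by (simp add: unit_interval_cos)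
    finally show ?thesis using True by simp
  qed
qed

text \<open>The index \<open>(k, l, b)\<close> stands for the cosine (\<open>b = True\<close>) or sine of \<open>2\<pi>(k x\<^sub>1 + l x\<^sub>2)\<close>. As in the
  square partial sums, \<open>(k, l)\<close> runs over all of \<open>\<int>\<^sup>2\<close>, so that each nonconstant function occurs twice
  up to sign and the modes form a tight frame rather than an orthonormal basis: the squared norms \<open>1/2\<close>
  compensate for the repetition.\<close>
type_synonym idx = "int \<times> int \<times> bool"

definition mode :: "idx \<Rightarrow> pt \<Rightarrow> real" where
  "mode i x = (case i of (k, l, b) \<Rightarrow> (if b then cos else sin) (2 * pi * (of_int k * fst x + of_int l * snd x)))"

lemma mode_cos: "mode (k, l, True) = (\<lambda>x. cos (2 * pi * (of_int k * fst x + of_int l * snd x)))"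
  and mode_sin: "mode (k, l, False) = (\<lambda>x. sin (2 * pi * (of_int k * fst x + of_int l * snd x)))"
  by (auto simp: mode_def)

definition level :: "idx \<Rightarrow> nat" where
  "level i = (case i of (k, l, b) \<Rightarrow> nat (max \<bar>k\<bar> \<bar>l\<bar>))"

definition cutoff :: "nat \<Rightarrow> idx set" where
  "cutoff N = {- int N..int N} \<times> {- int N..int N} \<times> UNIV"

lemma finite_cutoff [simp, intro]: "finite (cutoff N)"
  by (simp add: cutoff_def)

lemma in_cutoff_iff: "i \<in> cutoff N \<longleftrightarrow> level i \<le> N"
  by (cases i) (auto simp: cutoff_def level_def)

lemma cutoff_mono: "N \<le> N' \<Longrightarrow> cutoff N \<subseteq> cutoff N'"
  by (auto simp: in_cutoff_iff)

lemma fourier_trunc_mode: "fourier_trunc N Y x = (\<Sum>i\<in>cutoff N. Y (mode i) * mode i x)"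
proof -
  have "(\<Sum>i\<in>cutoff N. Y (mode i) * mode i x)
     = (\<Sum>k\<in>{- int N..int N}. \<Sum>l\<in>{- int N..int N}. \<Sum>b\<in>UNIV. Y (mode (k, l, b)) * mode (k, l, b) x)"
    unfolding cutoff_def by (simp add: sum.cartesian_product case_prod_beta')
  then show ?thesis
    by (simp add: fourier_trunc_def UNIV_bool mode_cos mode_sin add.commute)
qed

lemma mode_continuous [continuous_intros]: "continuous_on A (mode i)"
  by (cases i; cases "snd (snd i)") (auto simp: mode_cos mode_sin intro!: continuous_intros)

lemma mode_measurable [measurable]: "mode i \<in> borel_measurable borel"
  by (intro continuous_borel_pt mode_continuous)

lemma mode_bound: "\<bar>mode i x\<bar> \<le> 1"
  by (cases i) (auto simp: mode_def)

lemma periodic_mode: "periodic (mode i)"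
proof -
  have per: "cos (2 * pi * (of_int k * a + of_int l * b)) = cos (2 * pi * (of_int k * a' + of_int l * b'))
      \<and> sin (2 * pi * (of_int k * a + of_int l * b)) = sin (2 * pi * (of_int k * a' + of_int l * b'))"
    if m: "a - a' = of_int m" and n: "b - b' = of_int n" for k l m n :: int and a a' b b' :: real
  proof -
    have "a = a' + of_int m" "b = b' + of_int n" using m n by linarith+
    then have e: "2 * pi * (of_int k * a + of_int l * b) = 2 * pi * (of_int k * a' + of_int l * b') + 2 * pi * of_int (k * m + l * n)"
      by (simp add: algebra_simps)
    show ?thesis unfolding e by (simp only: sin_add cos_add sin_int_2pin cos_int_2pin) simp
  qed
  show ?thesis
    unfolding periodic_def
  proof (intro allI impI)
    fix x y assume "torus_eq x y"
    then obtain m n where mn: "fst x - fst y = of_int m" "snd x - snd y = of_int n"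
      unfolding torus_eq_def Ints_def by blast
    obtain k l b where i: "i = (k, l, b)" by (cases i)
    show "mode i x = mode i y"
      using per[OF mn, of k l] by (cases b) (simp_all only: i mode_def prod.case if_True if_False)
  qed
qed

text \<open>Square integrability on the fundamental domain, without periodicity: limits and truncations
  then need not be made periodic.\<close>
definition L2t :: "(pt \<Rightarrow> real) \<Rightarrow> bool" where
  "L2t f \<longleftrightarrow> f \<in> borel_measurable borel \<and> integrable torus (\<lambda>x. (f x)\<^sup>2)"

definition ip :: "(pt \<Rightarrow> real) \<Rightarrow> (pt \<Rightarrow> real) \<Rightarrow> real" where
  "ip f g = (LINT x|torus. f x * g x)"

lemma L2t_measurable: "L2t f \<Longrightarrow> f \<in> borel_measurable borel" "L2t f \<Longrightarrow> f \<in> borel_measurable torus"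
  by (auto simp: L2t_def)

lemma L2t_bounded:
  assumes [measurable]: "f \<in> borel_measurable borel" and B: "\<And>x. \<bar>f x\<bar> \<le> B"
  shows "L2t f"
  unfolding L2t_def
proof
  show "integrable torus (\<lambda>x. (f x)\<^sup>2)"
  proof (rule torus_integrable_bounded)
    show "\<bar>(f x)\<^sup>2\<bar> \<le> B\<^sup>2" for x
      using power_mono[OF B[of x], of 2] by simp
  qed measurable
qed fact

lemma L2t_mode [simp]: "L2t (mode i)"
  by (rule L2t_bounded[where B=1]) (auto simp: mode_bound)

lemma L2t_const [simp]: "L2t (\<lambda>_. c)"
  by (rule L2t_bounded[where B="\<bar>c\<bar>"]) auto

lemma L2t_integrable_mult: "L2t f \<Longrightarrow> L2t g \<Longrightarrow> integrable torus (\<lambda>x. f x * g x)"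
  by (rule integrable_mult_L2) (auto simp: L2t_def)

lemma L2t_integrable: "L2t f \<Longrightarrow> integrable torus f"
  using L2t_integrable_mult[of f "\<lambda>_. 1"] by simp

lemma L2t_add [intro]: "L2t f \<Longrightarrow> L2t g \<Longrightarrow> L2t (\<lambda>x. f x + g x)"
  unfolding L2t_def by (auto intro!: integrable_add_L2)

lemma L2t_scale [intro]: "L2t f \<Longrightarrow> L2t (\<lambda>x. c * f x)"
  unfolding L2t_def by (auto simp: power_mult_distrib)

lemma L2t_diff [intro]: "L2t f \<Longrightarrow> L2t g \<Longrightarrow> L2t (\<lambda>x. f x - g x)"
  using L2t_add[of f "\<lambda>x. -1 * g x"] L2t_scale[of g "-1"] by simp

lemma L2t_sum [intro]: "(\<And>i. i \<in> A \<Longrightarrow> L2t (f i)) \<Longrightarrow> L2t (\<lambda>x. \<Sum>i\<in>A. f i x)"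
  by (induction A rule: infinite_finite_induct) auto

lemma ip_commute: "ip f g = ip g f"
  by (simp add: ip_def mult.commute)

lemma ip_add_left: "L2t f \<Longrightarrow> L2t f' \<Longrightarrow> L2t g \<Longrightarrow> ip (\<lambda>x. f x + f' x) g = ip f g + ip f' g"
  unfolding ip_def by (simp add: distrib_right L2t_integrable_mult)

lemma ip_scale_left: "ip (\<lambda>x. c * f x) g = c * ip f g"
  unfolding ip_def by (simp add: mult.assoc)

lemma ip_diff_left: "L2t f \<Longrightarrow> L2t f' \<Longrightarrow> L2t g \<Longrightarrow> ip (\<lambda>x. f x - f' x) g = ip f g - ip f' g"
  unfolding ip_def by (simp add: left_diff_distrib L2t_integrable_mult)

lemma ip_sum_left:
  assumes "\<And>i. i \<in> A \<Longrightarrow> L2t (f i)" "L2t g"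
  shows "ip (\<lambda>x. \<Sum>i\<in>A. c i * f i x) g = (\<Sum>i\<in>A. c i * ip (f i) g)"
  unfolding ip_def sum_distrib_right using assms
  by (subst Bochner_Integration.integral_sum) (auto simp: mult.assoc L2t_integrable_mult)

lemma ip_sum_right:
  assumes "\<And>i. i \<in> A \<Longrightarrow> L2t (f i)" "L2t g"
  shows "ip g (\<lambda>x. \<Sum>i\<in>A. c i * f i x) = (\<Sum>i\<in>A. c i * ip g (f i))"
  using ip_sum_left[OF assms] by (simp add: ip_commute)

lemma ip_diff_right: "L2t f \<Longrightarrow> L2t f' \<Longrightarrow> L2t g \<Longrightarrow> ip g (\<lambda>x. f x - f' x) = ip g f - ip g f'"
  using ip_diff_left by (simp add: ip_commute)

lemma ip_self_nonneg: "0 \<le> ip f f"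
  unfolding ip_def by simp

lemma L2t_square_integrable: "L2t f \<Longrightarrow> integrable torus (\<lambda>x. (f x)\<^sup>2)"
  by (simp add: L2t_def)

lemma ip_Cauchy_Schwarz:
  assumes f: "L2t f" and g: "L2t g"
  shows "(ip f g)\<^sup>2 \<le> ip f f * ip g g"
  using L2_Cauchy_Schwarz[OF f[THEN L2t_measurable(2)] g[THEN L2t_measurable(2)]
      f[THEN L2t_square_integrable] g[THEN L2t_square_integrable]]
  unfolding ip_def power2_eq_square .

lemma ip_abs_le:
  assumes "L2t f" "L2t g"
  shows "\<bar>ip f g\<bar> \<le> sqrt (ip f f) * sqrt (ip g g)"
  using real_sqrt_le_mono[OF ip_Cauchy_Schwarz[OF assms]] by (simp add: real_sqrt_mult)

text \<open>\<open>neg\<close> exchanges the two copies of a mode, and \<open>parity\<close> is the sign relating them.\<close>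
definition neg :: "idx \<Rightarrow> idx" where "neg i = (case i of (k, l, b) \<Rightarrow> (- k, - l, b))"

definition parity :: "idx \<Rightarrow> real" where "parity i = (if snd (snd i) then 1 else - 1)"

lemma mode_neg: "mode (neg i) x = parity i * mode i x"
proof -
  obtain k l b where i: "i = (k, l, b)" by (cases i)
  have e: "2 * pi * (of_int (- k) * fst x + of_int (- l) * snd x) = - (2 * pi * (of_int k * fst x + of_int l * snd x))"
    by (simp add: algebra_simps)
  show ?thesis
    by (cases b) (simp_all only: i mode_def neg_def parity_def prod.case e cos_minus sin_minus if_True if_False snd_conv mult_1 mult_minus1)
qed

lemma level_neg [simp]: "level (neg i) = level i"
  by (cases i) (simp add: level_def neg_def)

lemma parity_square [simp]: "parity i * parity i = 1" "(parity i)\<^sup>2 = 1"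
  by (auto simp: parity_def)

lemma ip_mode: "ip (mode i) (mode j) = (of_bool (i = j) + parity j * of_bool (i = neg j)) / 2"
proof -
  obtain k l b where i: "i = (k, l, b)" by (cases i)
  obtain k' l' b' where j: "j = (k', l', b')" by (cases j)
  let ?a = "\<lambda>x :: pt. 2 * pi * (of_int k * fst x + of_int l * snd x)"
  let ?b = "\<lambda>x :: pt. 2 * pi * (of_int k' * fst x + of_int l' * snd x)"
  have P: "?a x + ?b x = 2 * pi * (of_int (k + k') * fst x + of_int (l + l') * snd x)"
    and D: "?a x - ?b x = 2 * pi * (of_int (k - k') * fst x + of_int (l - l') * snd x)" for x
    by (simp_all add: algebra_simps)
  have ic: "integrable torus (\<lambda>x. cos (2 * pi * (of_int m * fst x + of_int n * snd x) + c))" for m n :: int and c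
    by (rule torus_integrable_bounded[where B=1]) (auto intro!: continuous_borel_pt continuous_intros)
  have isn: "integrable torus (\<lambda>x. sin (2 * pi * (of_int m * fst x + of_int n * snd x)))" for m n :: int
    by (rule torus_integrable_bounded[where B=1]) (auto intro!: continuous_borel_pt continuous_intros)
  have Is: "(LINT x|torus. sin (2 * pi * (of_int m * fst x + of_int n * snd x))) = 0" for m n :: int
    using torus_integral_cos[of m n "- pi / 2"] by (simp add: cos_diff)
  note Ic = torus_integral_cos[where c=0, simplified]
  note ic0 = ic[where c=0, simplified]
  define C where "C m n = (\<lambda>x :: pt. cos (2 * pi * (of_int m * fst x + of_int n * snd x)))" for m n :: int
  define Z where "Z m n = (\<lambda>x :: pt. sin (2 * pi * (of_int m * fst x + of_int n * snd x)))" for m n :: int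
  have int: "integrable torus (C m n)" "integrable torus (Z m n)"
    and val: "(LINT x|torus. C m n x) = of_bool (m = 0 \<and> n = 0)" "(LINT x|torus. Z m n x) = 0" for m n
    unfolding C_def Z_def using ic0 isn by (simp_all add: Ic Is)
  show ?thesis
  proof (cases b; cases b')
    assume b: b b'
    have e: "mode i x * mode j x = (C (k - k') (l - l') x + C (k + k') (l + l') x) / 2" for x
      by (simp only: i j b mode_def prod.case if_True cos_times_cos P D C_def)
    have ip: "ip (mode i) (mode j) = (of_bool (k - k' = 0 \<and> l - l' = 0) + of_bool (k + k' = 0 \<and> l + l' = 0)) / 2"
      unfolding ip_def e by (simp add: int val)
    show ?thesis unfolding ip by (auto simp: i j b parity_def neg_def)
  next
    assume b: "\<not> b" "\<not> b'"
    have e: "mode i x * mode j x = (C (k - k') (l - l') x - C (k + k') (l + l') x) / 2" for x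
      by (simp only: i j b mode_def prod.case if_False sin_times_sin P D C_def)
    have ip: "ip (mode i) (mode j) = (of_bool (k - k' = 0 \<and> l - l' = 0) - of_bool (k + k' = 0 \<and> l + l' = 0)) / 2"
      unfolding ip_def e by (simp add: int val)
    show ?thesis unfolding ip by (auto simp: i j b parity_def neg_def)
  next
    assume b: "b" "\<not> b'"
    have e: "mode i x * mode j x = (Z (k + k') (l + l') x - Z (k - k') (l - l') x) / 2" for x
      by (simp only: i j b mode_def prod.case if_False if_True cos_times_sin P D Z_def)
    have ip: "ip (mode i) (mode j) = 0"
      unfolding ip_def e by (simp add: int val)
    show ?thesis unfolding ip using b by (simp add: i j neg_def)
  next
    assume b: "\<not> b" "b'"
    have e: "mode i x * mode j x = (Z (k + k') (l + l') x + Z (k - k') (l - l') x) / 2" for x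
      by (simp only: i j b mode_def prod.case if_False if_True sin_times_cos P D Z_def)
    have ip: "ip (mode i) (mode j) = 0"
      unfolding ip_def e by (simp add: int val)
    show ?thesis unfolding ip using b by (simp add: i j neg_def)
  qed
qed

lemma ip_mode_level: "level i \<noteq> level j \<Longrightarrow> ip (mode i) (mode j) = 0"
  by (auto simp: ip_mode)

text \<open>The tight frame property. It makes \<open>proj\<close> the orthogonal projection onto the span of the modes up to
  level \<open>N\<close>, with coefficients computed as if the modes were orthonormal.\<close>
lemma reproducing:
  assumes "level j \<le> N"
  shows "(\<Sum>i\<in>cutoff N. ip (mode j) (mode i) * mode i x) = mode j x"
proof -
  have j: "j \<in> cutoff N" "neg j \<in> cutoff N" using assms by (auto simp: in_cutoff_iff)
  have "ip (mode j) (mode i) * mode i x = (if i = j then mode j x / 2 else 0) + (if i = neg j then parity j * mode i x / 2 else 0)" for i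
    by (subst ip_commute) (auto simp: ip_mode add_divide_distrib distrib_right)
  then show ?thesis using j by (simp add: sum.distrib mode_neg flip: mult.assoc)
qed

definition proj :: "nat \<Rightarrow> (pt \<Rightarrow> real) \<Rightarrow> pt \<Rightarrow> real" where
  "proj N f x = (\<Sum>i\<in>cutoff N. ip f (mode i) * mode i x)"

lemma L2t_proj [simp]: "L2t (proj N f)"
  unfolding proj_def[abs_def] by (intro L2t_sum L2t_scale L2t_mode)

lemma ip_proj: "L2t g \<Longrightarrow> ip (proj N f) g = (\<Sum>i\<in>cutoff N. ip f (mode i) * ip (mode i) g)"
  unfolding proj_def[abs_def] by (rule ip_sum_left) auto

lemma ip_proj_mode:
  assumes "L2t f" "level j \<le> N"
  shows "ip (proj N f) (mode j) = ip f (mode j)"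
proof -
  have "ip (proj N f) (mode j) = (\<Sum>i\<in>cutoff N. ip (mode j) (mode i) * ip f (mode i))"
    by (simp add: ip_proj mult.commute ip_commute[of "mode j" "mode i" for i])
  also have "\<dots> = ip f (\<lambda>x. \<Sum>i\<in>cutoff N. ip (mode j) (mode i) * mode i x)"
    using assms by (subst ip_sum_right) auto
  finally show ?thesis using assms by (simp add: reproducing)
qed

lemma ip_proj_proj: "L2t f \<Longrightarrow> ip (proj N f) (proj N f) = (\<Sum>i\<in>cutoff N. (ip f (mode i))\<^sup>2)"
  by (simp add: ip_proj[of "proj N f"] ip_commute[of "mode i" "proj N f" for i] ip_proj_mode in_cutoff_iff power2_eq_square)

lemma proj_residual:
  assumes "L2t f"
  shows "ip (\<lambda>x. f x - proj N f x) (\<lambda>x. f x - proj N f x) = ip f f - (\<Sum>i\<in>cutoff N. (ip f (mode i))\<^sup>2)"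
proof -
  have "ip (proj N f) f = (\<Sum>i\<in>cutoff N. (ip f (mode i))\<^sup>2)"
    using assms by (simp add: ip_proj ip_commute[of "mode i" f for i] power2_eq_square)
  then show ?thesis using assms ip_proj_proj[OF assms, of N]
    by (simp add: ip_diff_left ip_diff_right L2t_diff ip_commute[of f "proj N f"])
qed

lemma Bessel: "L2t f \<Longrightarrow> (\<Sum>i\<in>cutoff N. (ip f (mode i))\<^sup>2) \<le> ip f f"
  using proj_residual[of f N] ip_self_nonneg[of "\<lambda>x. f x - proj N f x"] by simp

lemma proj_trig:
  assumes "p = (\<lambda>x. \<Sum>i\<in>cutoff N. c i * mode i x)"
  shows "proj N p = p"
proof
  fix x
  have "proj N p x = (\<Sum>i\<in>cutoff N. \<Sum>j\<in>cutoff N. c j * (ip (mode j) (mode i) * mode i x))"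
    unfolding proj_def assms by (simp add: ip_sum_left sum_distrib_right mult.assoc)
  also have "\<dots> = (\<Sum>j\<in>cutoff N. c j * (\<Sum>i\<in>cutoff N. ip (mode j) (mode i) * mode i x))"
    by (subst sum.swap) (simp add: sum_distrib_left)
  also have "\<dots> = p x" by (simp add: reproducing in_cutoff_iff assms)
  finally show "proj N p x = p x" .
qed

text \<open>The synthesis map of a Parseval frame is the adjoint of the analysis map and hence a
  contraction; equality fails because of the redundancy.\<close>
lemma synthesis_bound:
  assumes "finite A"
  shows "ip (\<lambda>x. \<Sum>i\<in>A. c i * mode i x) (\<lambda>x. \<Sum>i\<in>A. c i * mode i x) \<le> (\<Sum>i\<in>A. (c i)\<^sup>2)"
proof -
  define p where "p = (\<lambda>x. \<Sum>i\<in>A. c i * mode i x)"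
  have p: "L2t p" unfolding p_def by (intro L2t_sum L2t_scale L2t_mode)
  obtain N where N: "A \<subseteq> cutoff N"
  proof
    show "A \<subseteq> cutoff (Max (insert 0 (level ` A)))" using assms by (auto simp: in_cutoff_iff)
  qed
  define s where "s = (\<Sum>i\<in>A. c i * ip (mode i) p)"
  have s: "ip p p = s" unfolding s_def using ip_sum_left[of A mode p c] p by (simp add: p_def)
  have "s\<^sup>2 \<le> (\<Sum>i\<in>A. (c i)\<^sup>2) * (\<Sum>i\<in>A. (ip (mode i) p)\<^sup>2)"
    unfolding s_def by (rule Cauchy_Schwarz_ineq_sum)
  also have "(\<Sum>i\<in>A. (ip (mode i) p)\<^sup>2) \<le> (\<Sum>i\<in>cutoff N. (ip p (mode i))\<^sup>2)"
    unfolding ip_commute[of "mode i" p for i] using N by (intro sum_mono2) auto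
  also have "\<dots> \<le> ip p p" by (rule Bessel[OF p])
  finally have "s\<^sup>2 \<le> (\<Sum>i\<in>A. (c i)\<^sup>2) * s" by (simp add: s sum_nonneg mult_left_mono)
  moreover have "s \<ge> 0" using ip_self_nonneg[of p] s by simp
  ultimately have "s \<le> (\<Sum>i\<in>A. (c i)\<^sup>2)"
    by (cases "s = 0") (auto simp: power2_eq_square sum_nonneg)
  then show ?thesis using s by (simp add: p_def)
qed

section \<open>Completeness of the Fourier modes\<close>

inductive_set trig :: "(pt \<Rightarrow> real) set" where
  mode: "mode i \<in> trig"
| add: "p \<in> trig \<Longrightarrow> q \<in> trig \<Longrightarrow> (\<lambda>x. p x + q x) \<in> trig"
| scale: "p \<in> trig \<Longrightarrow> (\<lambda>x. c * p x) \<in> trig"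

lemma trig_const: "(\<lambda>_. c) \<in> trig"
  using trig.scale[OF trig.mode[of "(0, 0, True)"], of c] by (simp add: mode_cos)

lemma trig_mode_mult: "(\<lambda>x. mode i x * mode j x) \<in> trig"
proof -
  obtain k l b where i: "i = (k, l, b)" by (cases i)
  obtain k' l' b' where j: "j = (k', l', b')" by (cases j)
  let ?a = "\<lambda>x :: pt. 2 * pi * (of_int k * fst x + of_int l * snd x)"
  let ?b = "\<lambda>x :: pt. 2 * pi * (of_int k' * fst x + of_int l' * snd x)"
  have P: "?a x + ?b x = 2 * pi * (of_int (k + k') * fst x + of_int (l + l') * snd x)"
    and D: "?a x - ?b x = 2 * pi * (of_int (k - k') * fst x + of_int (l - l') * snd x)" for x
    by (simp_all add: algebra_simps)
  let ?m = "\<lambda>b. mode (k - k', l - l', b)" and ?p = "\<lambda>b. mode (k + k', l + l', b)"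
  have comb: "(\<lambda>x. c * ?p b x + d * ?m b x) \<in> trig" for b c d
    by (intro trig.intros)
  show ?thesis
  proof (cases b; cases b')
    assume b: b b'
    have "mode i x * mode j x = (1/2) * ?p True x + (1/2) * ?m True x" for x
      by (simp only: i j b mode_def prod.case if_True cos_times_cos P D) (simp add: field_simps)
    then show ?thesis using comb by presburger
  next
    assume b: "\<not> b" "\<not> b'"
    have "mode i x * mode j x = (-1/2) * ?p True x + (1/2) * ?m True x" for x
      by (simp only: i j b mode_def prod.case if_True if_False sin_times_sin P D) (simp add: field_simps)
    then show ?thesis using comb by presburger
  next
    assume b: "b" "\<not> b'"
    have "mode i x * mode j x = (1/2) * ?p False x + (-1/2) * ?m False x" for x
      by (simp only: i j b mode_def prod.case if_True if_False cos_times_sin P D) (simp add: field_simps)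
    then show ?thesis using comb by presburger
  next
    assume b: "\<not> b" "b'"
    have "mode i x * mode j x = (1/2) * ?p False x + (1/2) * ?m False x" for x
      by (simp only: i j b mode_def prod.case if_True if_False sin_times_cos P D) (simp add: field_simps)
    then show ?thesis using comb by presburger
  qed
qed

lemma trig_mult:
  assumes "p \<in> trig" "q \<in> trig"
  shows "(\<lambda>x. p x * q x) \<in> trig"
  using assms(1)
proof induction
  case (mode i)
  show ?case using assms(2)
  proof induction
    case (mode j)
    show ?case by (rule trig_mode_mult)
  next
    case (add p q)
    then show ?case using trig.add by (simp add: distrib_left)
  next
    case (scale p c)
    then show ?case using trig.scale[of "\<lambda>x. mode i x * p x" c] by (simp add: mult.left_commute)
  qed
next
  case (add p q)
  then show ?case using trig.add by (simp add: distrib_right)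
next
  case (scale p c)
  then show ?case using trig.scale[of "\<lambda>x. p x * q x" c] by (simp add: mult.assoc)
qed

lemma trig_cutoff:
  assumes "p \<in> trig"
  shows "\<exists>N c. p = (\<lambda>x. \<Sum>i\<in>cutoff N. c i * mode i x)"
proof -
  have "\<exists>N. \<forall>N'\<ge>N. proj N' p = p" using assms
  proof induction
    case (mode i)
    have "proj N' (mode i) = mode i" if "level i \<le> N'" for N'
      using that by (intro ext) (simp add: proj_def reproducing)
    then show ?case by blast
  next
    case (add p q)
    have L: "L2t p" "L2t q" using add.IH by (metis L2t_proj order_refl)+
    have "proj N (\<lambda>x. p x + q x) x = proj N p x + proj N q x" for N x
      using L by (simp add: proj_def ip_add_left distrib_right sum.distrib)
    moreover obtain N M where "\<forall>N'\<ge>N. proj N' p = p" "\<forall>N'\<ge>M. proj N' q = q" using add.IH by blast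
    ultimately have "\<forall>N'\<ge>max N M. proj N' (\<lambda>x. p x + q x) = (\<lambda>x. p x + q x)" by auto
    then show ?case by blast
  next
    case (scale p c)
    have "proj N (\<lambda>x. c * p x) x = c * proj N p x" for N x
      by (simp add: proj_def ip_scale_left sum_distrib_left mult.assoc)
    then show ?case using scale.IH by (metis (no_types, lifting) ext)
  qed
  then obtain N where "proj N p = p" by blast
  then have "p = (\<lambda>x. \<Sum>i\<in>cutoff N. ip p (mode i) * mode i x)" by (metis (no_types) ext proj_def)
  then show ?thesis by (intro exI[of _ N] exI[of _ "\<lambda>i. ip p (mode i)"])
qed

lemma L2t_trig: "p \<in> trig \<Longrightarrow> L2t p"
  by (induction rule: trig.induct) auto

text \<open>The ambient space \<open>\<real>\<^sup>2 \<times> \<real>\<^sup>2\<close> of a product of two circles.\<close>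
type_synonym amb = "(real \<times> real) \<times> (real \<times> real)"

definition torus_embed :: "pt \<Rightarrow> amb" where
  "torus_embed x = ((cos (2 * pi * fst x), sin (2 * pi * fst x)), (cos (2 * pi * snd x), sin (2 * pi * snd x)))"

lemma torus_embed_continuous: "continuous_on A torus_embed"
  unfolding torus_embed_def[abs_def] by (intro continuous_intros)

lemma torus_embed_measurable [measurable]: "torus_embed \<in> borel_measurable borel"
  by (intro borel_measurable_continuous_onI torus_embed_continuous)

text \<open>Trigonometric polynomials are closed under multiplication, hence they contain all polynomials in
  the coordinates of the embedded torus; this is what makes Stone--Weierstrass available.\<close>
lemma polynomial_torus_embed:
  assumes "real_polynomial_function g"
  shows "(\<lambda>x. g (torus_embed x)) \<in> trig"
  using assms
proof induction
  case (linear f)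
  then interpret bounded_linear f .
  have "f (torus_embed x) = f ((1, 0), (0, 0)) * mode (1, 0, True) x + f ((0, 1), (0, 0)) * mode (1, 0, False) x
      + (f ((0, 0), (1, 0)) * mode (0, 1, True) x + f ((0, 0), (0, 1)) * mode (0, 1, False) x)" for x
  proof -
    have "torus_embed x = mode (1, 0, True) x *\<^sub>R ((1, 0), (0, 0)) + mode (1, 0, False) x *\<^sub>R ((0, 1), (0, 0))
      + (mode (0, 1, True) x *\<^sub>R ((0, 0), (1, 0)) + mode (0, 1, False) x *\<^sub>R ((0, 0), (0, 1)))"
      by (simp add: torus_embed_def mode_cos mode_sin)
    then show ?thesis by (simp only: add scaleR) (simp add: mult.commute)
  qed
  then show ?case by (simp only:) (intro trig.intros)
next
  case (const c)
  show ?case by (rule trig_const)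
next
  case (add f g)
  then show ?case by (intro trig.add)
next
  case (mult f g)
  then show ?case by (intro trig_mult)
qed

definition approx :: "(pt \<Rightarrow> real) \<Rightarrow> bool" where
  "approx f \<longleftrightarrow> L2t f \<and> (\<forall>e>0. \<exists>p\<in>trig. ip (\<lambda>x. f x - p x) (\<lambda>x. f x - p x) < e)"

lemma ip_add_right: "L2t f \<Longrightarrow> L2t f' \<Longrightarrow> L2t g \<Longrightarrow> ip g (\<lambda>x. f x + f' x) = ip g f + ip g f'"
  using ip_add_left by (simp add: ip_commute)

lemma ip_add_self_le:
  assumes "L2t f" "L2t g"
  shows "ip (\<lambda>x. f x + g x) (\<lambda>x. f x + g x) \<le> 2 * ip f f + 2 * ip g g"
proof -
  have "0 \<le> ip (\<lambda>x. f x - g x) (\<lambda>x. f x - g x)" by (rule ip_self_nonneg)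
  also have "\<dots> = ip f f + ip g g - 2 * ip f g"
    using assms by (simp add: ip_diff_left ip_diff_right L2t_diff ip_commute[of g f])
  finally have "2 * ip f g \<le> ip f f + ip g g" by simp
  moreover have "ip (\<lambda>x. f x + g x) (\<lambda>x. f x + g x) = ip f f + ip g g + 2 * ip f g"
    using assms by (simp add: ip_add_left ip_add_right L2t_add ip_commute[of g f])
  ultimately show ?thesis by simp
qed

lemma approx_closed:
  assumes f: "L2t f" and "\<And>e. e > 0 \<Longrightarrow> \<exists>g. approx g \<and> ip (\<lambda>x. f x - g x) (\<lambda>x. f x - g x) < e"
  shows "approx f"
  unfolding approx_def
proof (intro conjI allI impI f)
  fix e :: real assume "e > 0"
  then obtain g where g: "approx g" "ip (\<lambda>x. f x - g x) (\<lambda>x. f x - g x) < e / 4"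
    using assms(2)[of "e / 4"] by auto
  have "e / 4 > 0" using \<open>e > 0\<close> by simp
  then obtain p where p: "p \<in> trig" "ip (\<lambda>x. g x - p x) (\<lambda>x. g x - p x) < e / 4"
    using g(1) unfolding approx_def by blast
  have "L2t g" using g by (simp add: approx_def)
  then have "ip (\<lambda>x. (f x - g x) + (g x - p x)) (\<lambda>x. (f x - g x) + (g x - p x)) \<le>
     2 * ip (\<lambda>x. f x - g x) (\<lambda>x. f x - g x) + 2 * ip (\<lambda>x. g x - p x) (\<lambda>x. g x - p x)"
    using f L2t_trig[OF p(1)] by (intro ip_add_self_le L2t_diff)
  then have "ip (\<lambda>x. f x - p x) (\<lambda>x. f x - p x) < e" using g p by simp
  then show "\<exists>p\<in>trig. ip (\<lambda>x. f x - p x) (\<lambda>x. f x - p x) < e" using p by blast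
qed

lemma approx_limit:
  assumes f: "L2t f" and g: "\<And>n. approx (g n)" and w: "L2t w"
    and lim: "\<And>x. x \<in> {0..<1} \<times> {0..<1} \<Longrightarrow> (\<lambda>n. g n x) \<longlonglongrightarrow> f x"
    and dom: "\<And>n x. x \<in> {0..<1} \<times> {0..<1} \<Longrightarrow> \<bar>f x - g n x\<bar> \<le> \<bar>w x\<bar>"
  shows "approx f"
proof (rule approx_closed[OF f])
  fix e :: real assume "e > 0"
  have gm: "g n \<in> borel_measurable borel" for n using g by (simp add: approx_def L2t_def)
  have fm: "f \<in> borel_measurable borel" using f by (simp add: L2t_def)
  have "(\<lambda>n. LINT x|torus. (f x - g n x)\<^sup>2) \<longlonglongrightarrow> (LINT x|torus. 0)"
  proof (rule integral_dominated_convergence[where w="\<lambda>x. (w x)\<^sup>2"])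
    show "integrable torus (\<lambda>x. (w x)\<^sup>2)" using w by (rule L2t_square_integrable)
    show "AE x in torus. (\<lambda>n. (f x - g n x)\<^sup>2) \<longlonglongrightarrow> 0"
    proof (rule AE_I2)
      fix x assume "x \<in> space torus"
      then have "(\<lambda>n. (f x - g n x)\<^sup>2) \<longlonglongrightarrow> (f x - f x)\<^sup>2"
        unfolding space_torus by (intro tendsto_intros lim)
      then show "(\<lambda>n. (f x - g n x)\<^sup>2) \<longlonglongrightarrow> 0" by simp
    qed
    show "AE x in torus. norm ((f x - g n x)\<^sup>2) \<le> (w x)\<^sup>2" for n
    proof (rule AE_I2)
      fix x assume "x \<in> space torus"
      then have "\<bar>f x - g n x\<bar>\<^sup>2 \<le> \<bar>w x\<bar>\<^sup>2"
        unfolding space_torus by (intro power_mono dom) auto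
      then show "norm ((f x - g n x)\<^sup>2) \<le> (w x)\<^sup>2" by simp
    qed
  qed (use gm fm in \<open>auto intro!: borel_measurable_torus\<close>)
  then have "eventually (\<lambda>n. (LINT x|torus. (f x - g n x)\<^sup>2) < e) sequentially"
    using \<open>e > 0\<close> by (intro order_tendstoD) auto
  then obtain n where "(LINT x|torus. (f x - g n x)\<^sup>2) < e" by (auto simp: eventually_sequentially)
  then show "\<exists>g. approx g \<and> ip (\<lambda>x. f x - g x) (\<lambda>x. f x - g x) < e"
    using g[of n] by (auto simp: ip_def power2_eq_square)
qed

text \<open>By Stone--Weierstrass on the compact image of the embedding.\<close>
lemma approx_continuous:
  fixes u :: "amb \<Rightarrow> real"
  assumes "continuous_on UNIV u"
  shows "approx (\<lambda>x. u (torus_embed x))"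
  unfolding approx_def
proof (intro conjI allI impI)
  let ?S = "torus_embed ` ({0..1} \<times> {0..1})"
  have S: "compact ?S"
    by (intro compact_continuous_image torus_embed_continuous compact_Times) auto
  have per: "torus_embed x \<in> cball 0 1 \<times> cball 0 1" for x
    by (simp add: torus_embed_def norm_Pair)
  have "bounded (u ` (cball 0 1 \<times> cball 0 1))"
    by (intro compact_imp_bounded compact_continuous_image compact_Times compact_cball continuous_on_subset[OF assms]) auto
  then obtain B where B: "\<And>w. w \<in> cball 0 1 \<times> cball 0 1 \<Longrightarrow> \<bar>u w\<bar> \<le> B"
    unfolding bounded_iff by auto
  have [measurable]: "u \<in> borel_measurable borel" by (rule borel_measurable_continuous_onI) fact
  show Lu: "L2t (\<lambda>x. u (torus_embed x))"
    by (rule L2t_bounded[where B=B]) (use B per in auto)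
  fix e :: real assume e: "e > 0"
  define d where "d = sqrt (e / 2)"
  have d: "d > 0" "d\<^sup>2 < e" using e by (simp_all add: d_def)
  obtain g where g: "real_polynomial_function g" "\<And>w. w \<in> ?S \<Longrightarrow> \<bar>u w - g w\<bar> < d"
    using Stone_Weierstrass_real_polynomial_function[OF S continuous_on_subset[OF assms] d(1)] by auto
  let ?p = "\<lambda>x. g (torus_embed x)"
  have p: "?p \<in> trig" by (rule polynomial_torus_embed) fact
  have "ip (\<lambda>x. u (torus_embed x) - ?p x) (\<lambda>x. u (torus_embed x) - ?p x) \<le> (LINT x|torus. d\<^sup>2)"
    unfolding ip_def
  proof (rule integral_mono)
    show "integrable torus (\<lambda>x. (u (torus_embed x) - ?p x) * (u (torus_embed x) - ?p x))"
      by (intro L2t_integrable_mult L2t_diff Lu L2t_trig p)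
    fix x assume "x \<in> space torus"
    then have "torus_embed x \<in> ?S" by (intro imageI) (auto simp: space_torus)
    then have "\<bar>u (torus_embed x) - ?p x\<bar> \<le> d" using g(2) by (simp add: less_imp_le)
    then have "\<bar>u (torus_embed x) - ?p x\<bar>\<^sup>2 \<le> d\<^sup>2" by (intro power_mono) auto
    then show "(u (torus_embed x) - ?p x) * (u (torus_embed x) - ?p x) \<le> d\<^sup>2"
      by (simp add: power2_eq_square)
  qed simp
  also have "\<dots> < e" using d by (simp add: torus.prob_space)
  finally show "\<exists>p\<in>trig. ip (\<lambda>x. u (torus_embed x) - p x) (\<lambda>x. u (torus_embed x) - p x) < e"
    using p by (intro bexI[of _ ?p])
qed

lemma approx_add: "approx f \<Longrightarrow> approx g \<Longrightarrow> approx (\<lambda>x. f x + g x)"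
proof -
  assume f: "approx f" and g: "approx g"
  then have L: "L2t f" "L2t g" by (auto simp: approx_def)
  show "approx (\<lambda>x. f x + g x)"
    unfolding approx_def
  proof (intro conjI allI impI L2t_add L)
    fix e :: real assume "e > 0"
    then have "e / 4 > 0" by simp
    obtain p where p: "p \<in> trig" "ip (\<lambda>x. f x - p x) (\<lambda>x. f x - p x) < e / 4"
      using f \<open>e / 4 > 0\<close> unfolding approx_def by blast
    obtain q where q: "q \<in> trig" "ip (\<lambda>x. g x - q x) (\<lambda>x. g x - q x) < e / 4"
      using g \<open>e / 4 > 0\<close> unfolding approx_def by blast
    have "ip (\<lambda>x. (f x - p x) + (g x - q x)) (\<lambda>x. (f x - p x) + (g x - q x)) \<le>
       2 * ip (\<lambda>x. f x - p x) (\<lambda>x. f x - p x) + 2 * ip (\<lambda>x. g x - q x) (\<lambda>x. g x - q x)"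
      using L L2t_trig[OF p(1)] L2t_trig[OF q(1)] by (intro ip_add_self_le L2t_diff)
    also have "\<dots> < e" using p q by simp
    also have "(\<lambda>x. (f x - p x) + (g x - q x)) = (\<lambda>x. (f x + g x) - (p x + q x))" by auto
    finally show "\<exists>p\<in>trig. ip (\<lambda>x. f x + g x - p x) (\<lambda>x. f x + g x - p x) < e"
      using trig.add[OF p(1) q(1)] by (intro bexI[of _ "\<lambda>x. p x + q x"])
  qed
qed

lemma approx_trig: "p \<in> trig \<Longrightarrow> approx p"
  unfolding approx_def by (auto simp: L2t_trig ip_def intro!: bexI[of _ p])

lemma approx_scale: "approx f \<Longrightarrow> approx (\<lambda>x. c * f x)"
proof (cases "c = 0")
  case True
  then show ?thesis using approx_trig[OF trig_const[of 0]] by simp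
next
  case False
  assume f: "approx f"
  show ?thesis unfolding approx_def
  proof (intro conjI allI impI L2t_scale)
    show "L2t f" using f by (simp add: approx_def)
    fix e :: real assume "e > 0"
    then have "e / c\<^sup>2 > 0" using False by simp
    then obtain p where p: "p \<in> trig" "ip (\<lambda>x. f x - p x) (\<lambda>x. f x - p x) < e / c\<^sup>2"
      using f unfolding approx_def by blast
    have "ip (\<lambda>x. c * f x - c * p x) (\<lambda>x. c * f x - c * p x) = c\<^sup>2 * ip (\<lambda>x. f x - p x) (\<lambda>x. f x - p x)"
      unfolding right_diff_distrib[symmetric] ip_scale_left
      by (subst ip_commute) (simp add: ip_scale_left power2_eq_square)
    also have "\<dots> < e" using p(2) False by (simp add: field_simps)
    finally show "\<exists>p\<in>trig. ip (\<lambda>x. c * f x - p x) (\<lambda>x. c * f x - p x) < e"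
      using trig.scale[OF p(1)] by (intro bexI[of _ "\<lambda>x. c * p x"])
  qed
qed

lemma L2t_indicator:
  assumes [measurable]: "A \<in> sets borel"
  shows "L2t (indicator A)"
  by (rule L2t_bounded[where B=1]) (auto simp: indicator_def)

text \<open>Open sets are treated by the continuous functions \<open>min 1 (n dist(w, -A))\<close>, which increase to the
  indicator; the remaining Borel sets follow because the sets with this property form a
  \<open>\<lambda>\<close>-system.\<close>
lemma approx_embedded_set:
  fixes B :: "amb set"
  assumes "B \<in> sets borel"
  shows "approx (\<lambda>x. indicator B (torus_embed x))"
proof -
  have L: "L2t (\<lambda>x. indicator B (torus_embed x))" if [measurable]: "B \<in> sets borel" for B
    by (rule L2t_bounded[where B=1]) (auto simp: indicator_def)
  have "Int_stable {S :: amb set. open S}" "{S :: amb set. open S} \<subseteq> Pow UNIV"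
    "B \<in> sigma_sets UNIV {S. open S}" using assms by (auto simp: borel_def Int_stable_def)
  then show ?thesis
  proof (induction rule: sigma_sets_induct_disjoint)
    case (basic A)
    then have A: "open A" by simp
    show ?case
    proof (cases "A = UNIV")
      case True
      then show ?thesis using approx_trig[OF trig_const[of 1]] by simp
    next
      case False
      then have ne: "- A \<noteq> {}" by blast
      define u where "u n w = min 1 (real n * infdist w (- A))" for n w
      have u1: "approx (\<lambda>x. u n (torus_embed x))" for n
        unfolding u_def by (intro approx_continuous continuous_intros)
      have u2: "(\<lambda>n. u n w) \<longlonglongrightarrow> indicator A w" for w
      proof (cases "w \<in> A")
        case True
        then have "infdist w (- A) \<noteq> 0"
          using ne A by (subst in_closed_iff_infdist_zero[symmetric]) auto
        then have pos: "infdist w (- A) > 0" using infdist_nonneg[of w "- A"] by linarith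
        then obtain N where N: "1 < real N * infdist w (- A)"
          using reals_Archimedean3 by blast
        have "u n w = 1" if "n \<ge> N" for n
        proof -
          have "real N * infdist w (- A) \<le> real n * infdist w (- A)"
            using that pos by (intro mult_right_mono) auto
          then have "1 \<le> real n * infdist w (- A)" using N by linarith
          then show ?thesis unfolding u_def by (rule min_absorb1)
        qed
        then have "eventually (\<lambda>n. u n w = 1) sequentially" by (auto simp: eventually_sequentially)
        then show ?thesis using True by (simp add: tendsto_eventually)
      next
        case False
        then show ?thesis by (simp add: u_def)
      qed
      have u3: "\<bar>indicator A w - u n w\<bar> \<le> \<bar>1\<bar>" for w n
      proof -
        have "0 \<le> u n w" "u n w \<le> 1" using infdist_nonneg[of w "- A"] by (simp_all add: u_def)
        then show ?thesis by (simp add: indicator_def)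
      qed
      show ?thesis
        by (rule approx_limit[OF L u1 L2t_const u2 u3]) (use A in simp)
    qed
  next
    case empty
    then show ?case using approx_trig[OF trig_const[of 0]] by simp
  next
    case (compl A)
    have "(\<lambda>x. 1 + (- 1) * indicator A (torus_embed x)) = (\<lambda>x. indicator (UNIV - A) (torus_embed x) :: real)"
      by (auto simp: indicator_def)
    then show ?case
      using approx_add[OF approx_trig[OF trig_const[of 1]] approx_scale[OF compl.IH, of "- 1"]] by simp
  next
    case (union A)
    have m: "A i \<in> sets borel" for i using union by (auto simp: borel_def)
    have s1: "approx (\<lambda>x. \<Sum>i<n. indicator (A i) (torus_embed x))" for n
    proof (induction n)
      case 0
      then show ?case using approx_trig[OF trig_const[of 0]] by simp
    next
      case (Suc n)
      then show ?case using approx_add union.IH by simp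
    qed
    have sum: "(\<Sum>i<n. indicator (A i) w) = (indicator (\<Union>i<n. A i) w :: real)" for w n
      by (rule indicator_UN_disjoint[symmetric]) (use union(1) in \<open>auto simp: disjoint_family_on_def\<close>)
    have s2: "(\<lambda>n. \<Sum>i<n. indicator (A i) w) \<longlonglongrightarrow> (indicator (\<Union>i. A i) w :: real)" for w
      unfolding sum by (rule LIMSEQ_indicator_UN)
    have s3: "\<bar>indicator (\<Union>i. A i) w - (\<Sum>i<n. indicator (A i) w)\<bar> \<le> (\<bar>1\<bar> :: real)" for w n
      unfolding sum by (simp add: indicator_def)
    show ?case
      by (rule approx_limit[OF L s1 L2t_const s2 s3]) (use m in blast)
  qed
qed

text \<open>The inverse of \<open>t \<mapsto> (cos(2\<pi>t), sin(2\<pi>t))\<close> on \<open>[0, 1)\<close>, extended to a Borel function on the plane. It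
  turns Borel sets of the fundamental domain into Borel sets of the ambient space.\<close>
definition turn :: "real \<times> real \<Rightarrow> real" where
  "turn w = (if fst w \<in> {-1..1} then (if snd w \<ge> 0 then arccos (fst w) / (2 * pi) else 1 - arccos (fst w) / (2 * pi)) else 0)"

lemma turn_measurable [measurable]: "turn \<in> borel_measurable borel"
proof -
  define h where "h c = (if c \<in> {-1..1} then arccos c else 0)" for c
  have [measurable]: "h \<in> borel_measurable borel"
    unfolding h_def[abs_def]
    by (intro borel_measurable_continuous_on_if continuous_on_arccos' continuous_on_const) auto
  have [measurable]: "fst \<in> borel_measurable (borel :: (real \<times> real) measure)"
      "snd \<in> borel_measurable (borel :: (real \<times> real) measure)"
    by (intro borel_measurable_continuous_onI continuous_intros)+
  have e: "turn = (\<lambda>w. if fst w \<in> {-1..1} then (if snd w \<ge> 0 then h (fst w) / (2 * pi) else 1 - h (fst w) / (2 * pi)) else 0)"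
    by (auto simp: turn_def h_def fun_eq_iff)
  show ?thesis unfolding e by measurable
qed

lemma turn_inverse:
  assumes "t \<in> {0..<1}"
  shows "turn (cos (2 * pi * t), sin (2 * pi * t)) = t"
proof (cases "t \<le> 1 / 2")
  case True
  then have "2 * pi * t \<le> pi" by (simp add: field_simps)
  moreover have "0 \<le> 2 * pi * t" using assms by simp
  ultimately show ?thesis by (simp add: turn_def arccos_cos sin_ge_zero)
next
  case False
  have a: "0 < 2 * pi * (1 - t)" "2 * pi * (1 - t) < pi" using False assms by (auto simp: field_simps)
  have c: "cos (2 * pi * t) = cos (2 * pi * (1 - t))" "sin (2 * pi * t) = - sin (2 * pi * (1 - t))"
    by (simp_all add: right_diff_distrib cos_diff sin_diff)
  have "sin (2 * pi * (1 - t)) > 0" using a by (rule sin_gt_zero)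
  then show ?thesis using a by (simp add: turn_def c arccos_cos)
qed

lemma approx_indicator:
  assumes [measurable]: "A \<in> sets borel"
  shows "approx (indicator A)"
proof -
  define B where "B = {w :: amb. (turn (fst w), turn (snd w)) \<in> A}"
  have B: "B \<in> sets borel" unfolding B_def
  proof -
    have "(\<lambda>w :: amb. (turn (fst w), turn (snd w))) \<in> borel_measurable borel"
      by (intro borel_measurable_Pair measurable_compose[OF _ turn_measurable] borel_measurable_continuous_onI continuous_intros)
    from measurable_sets[OF this assms] show "{w. (turn (fst w), turn (snd w)) \<in> A} \<in> sets borel"
      by (simp add: vimage_def)
  qed
  have "indicator B (torus_embed x) = (indicator A x :: real)" if "x \<in> {0..<1} \<times> {0..<1}" for x
    using that turn_inverse[of "fst x"] turn_inverse[of "snd x"]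
    by (auto simp: B_def torus_embed_def indicator_def)
  then have e: "(\<lambda>n. indicator B (torus_embed x)) \<longlonglongrightarrow> (indicator A x :: real)"
    "\<bar>indicator A x - indicator B (torus_embed x)\<bar> \<le> \<bar>0 :: real\<bar>" if "x \<in> {0..<1} \<times> {0..<1}" for x
    using that by simp_all
  show ?thesis
    by (rule approx_limit[OF L2t_indicator approx_embedded_set[OF B] L2t_const e]) (auto simp: assms)
qed

lemma approx_L2:
  assumes f: "L2t f"
  shows "approx f"
proof -
  have [measurable]: "f \<in> borel_measurable borel" using f by (simp add: L2t_def)
  obtain F where F: "\<And>i. simple_function borel (F i)" "\<And>x. (\<lambda>i. F i x) \<longlonglongrightarrow> f x"
      "\<And>i x. dist (F i x) 0 \<le> 2 * dist (f x) 0"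
    using borel_measurable_implies_sequence_metric[of f borel 0] by auto
  have "approx (F n)" for n
  proof -
    have fin: "finite (range (F n))" using F(1)[of n] by (simp add: simple_function_def)
    have "F n x = (\<Sum>y\<in>range (F n). y * indicator (F n -` {y}) x)" for x
      using fin by (simp add: indicator_def if_distrib cong: if_cong)
    moreover have "approx (\<lambda>x. \<Sum>y\<in>Y. y * indicator (F n -` {y}) x)" if "finite Y" for Y
      using that
    proof induction
      case empty
      then show ?case using approx_trig[OF trig_const[of 0]] by simp
    next
      case (insert y Y)
      have "F n -` {y} \<inter> space borel \<in> sets borel"
        using simple_functionD(2)[OF F(1)] .
      then have "F n -` {y} \<in> sets borel" by simp
      from approx_add[OF approx_scale[OF approx_indicator[OF this], of y] insert.IH]
      show ?case by (simp only: sum.insert[OF insert.hyps(1,2)])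
    qed
    ultimately show ?thesis using fin by (metis (no_types, lifting) ext)
  qed
  moreover have "\<bar>f x - F n x\<bar> \<le> \<bar>3 * f x\<bar>" for n x
    using F(3)[of n x] abs_triangle_ineq4[of "f x" "F n x"] by (simp add: dist_real_def abs_mult)
  ultimately show ?thesis
    using F(2) by (intro approx_limit[OF f _ L2t_scale[OF f, of 3], of F])
qed

text \<open>A trigonometric polynomial \<open>p\<close> is fixed by \<open>proj N\<close> for large \<open>N\<close>, and the residual of \<open>f\<close> equals the
  residual of \<open>f - p\<close>, whose norm is at most that of \<open>f - p\<close>.\<close>
theorem proj_converges:
  assumes f: "L2t f"
  shows "(\<lambda>N. ip (\<lambda>x. f x - proj N f x) (\<lambda>x. f x - proj N f x)) \<longlonglongrightarrow> 0"
proof (rule LIMSEQ_I)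
  fix e :: real assume "e > 0"
  then obtain p where p: "p \<in> trig" "ip (\<lambda>x. f x - p x) (\<lambda>x. f x - p x) < e"
    using approx_L2[OF f] unfolding approx_def by blast
  obtain M c where M: "p = (\<lambda>x. \<Sum>i\<in>cutoff M. c i * mode i x)" using trig_cutoff[OF p(1)] by blast
  have "ip (\<lambda>x. f x - proj N f x) (\<lambda>x. f x - proj N f x) < e" if "N \<ge> M" for N
  proof -
    have "p = (\<lambda>x. \<Sum>i\<in>cutoff N. (if i \<in> cutoff M then c i else 0) * mode i x)"
      unfolding M using cutoff_mono[OF that]
      by (intro ext sum.mono_neutral_cong_left) auto
    then have pp: "proj N p = p" by (rule proj_trig)
    let ?r = "\<lambda>x. f x - p x"
    have Lp: "L2t p" using p by (intro L2t_trig)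
    have "proj N ?r x = proj N f x - p x" for x
    proof -
      have "proj N ?r x = proj N f x - proj N p x"
        using f Lp by (simp add: proj_def ip_diff_left left_diff_distrib sum_subtractf)
      then show ?thesis by (simp add: pp)
    qed
    then have "(\<lambda>x. f x - proj N f x) = (\<lambda>x. ?r x - proj N ?r x)" by auto
    then have "ip (\<lambda>x. f x - proj N f x) (\<lambda>x. f x - proj N f x) = ip ?r ?r - (\<Sum>i\<in>cutoff N. (ip ?r (mode i))\<^sup>2)"
      using proj_residual[of ?r N] f Lp by (simp add: L2t_diff)
    then show ?thesis using p(2) sum_nonneg[of "cutoff N" "\<lambda>i. (ip ?r (mode i))\<^sup>2"] by simp
  qed
  then show "\<exists>no. \<forall>N\<ge>no. norm (ip (\<lambda>x. f x - proj N f x) (\<lambda>x. f x - proj N f x) - 0) < e"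
    using ip_self_nonneg by (auto intro!: exI[of _ M])
qed

corollary Parseval:
  assumes "L2t f"
  shows "(\<lambda>N. \<Sum>i\<in>cutoff N. (ip f (mode i))\<^sup>2) \<longlonglongrightarrow> ip f f"
  using tendsto_diff[OF tendsto_const[of "ip f f"] proj_converges[OF assms]]
  by (simp add: proj_residual[OF assms])

section \<open>Derivatives of trigonometric polynomials\<close>

text \<open>Differentiation maps the mode \<open>i\<close> to a multiple of the mode \<open>flip i\<close>; the multiples for the two
  coordinate directions are \<open>d1 i\<close> and \<open>d2 i\<close>.\<close>
definition flip :: "idx \<Rightarrow> idx" where "flip i = (case i of (k, l, b) \<Rightarrow> (k, l, \<not> b))"

definition d1 :: "idx \<Rightarrow> real" where "d1 i = (case i of (k, l, b) \<Rightarrow> (if b then - 1 else 1) * (2 * pi * of_int k))"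
definition d2 :: "idx \<Rightarrow> real" where "d2 i = (case i of (k, l, b) \<Rightarrow> (if b then - 1 else 1) * (2 * pi * of_int l))"

lemma flip_flip [simp]: "flip (flip i) = i" by (cases i) (simp add: flip_def)
lemma level_flip [simp]: "level (flip i) = level i" by (cases i) (simp add: flip_def level_def)
lemma d1_flip [simp]: "d1 (flip i) = - d1 i"
proof -
  obtain k l b where "i = (k, l, b)" by (cases i)
  then show ?thesis by (cases b) (simp_all add: flip_def d1_def)
qed
lemma d2_flip [simp]: "d2 (flip i) = - d2 i"
proof -
  obtain k l b where "i = (k, l, b)" by (cases i)
  then show ?thesis by (cases b) (simp_all add: flip_def d2_def)
qed

lemma flip_bij: "bij_betw flip (cutoff N) (cutoff N)"
  by (rule bij_betwI[where g=flip]) (auto simp: in_cutoff_iff)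

lemma sum_flip: "(\<Sum>i\<in>cutoff N. f (flip i)) = (\<Sum>i\<in>cutoff N. f i)"
  by (rule sum.reindex_bij_betw[OF flip_bij])

lemma mode_has_derivative:
  "(mode i has_derivative (\<lambda>h. (d1 i * mode (flip i) x) * fst h + (d2 i * mode (flip i) x) * snd h)) (at x)"
proof -
  obtain k l b where i: "i = (k, l, b)" by (cases i)
  show ?thesis
  proof (cases b)
    case True
    show ?thesis unfolding i
      by (simp add: True mode_cos mode_sin flip_def d1_def d2_def)
         (auto intro!: derivative_eq_intros simp: algebra_simps fun_eq_iff)
  next
    case False
    show ?thesis unfolding i
      by (simp add: False mode_cos mode_sin flip_def d1_def d2_def)
         (auto intro!: derivative_eq_intros simp: algebra_simps fun_eq_iff)
  qed
qed

lemma partials_of_has_derivative: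
  assumes "(f has_derivative (\<lambda>h. a * fst h + b * snd h)) (at x)"
  shows "((\<lambda>s. f (s, snd x)) has_real_derivative a) (at (fst x))"
    and "((\<lambda>s. f (fst x, s)) has_real_derivative b) (at (snd x))"
    and "pd1 f x = a" and "pd2 f x = b"
proof -
  have "((\<lambda>s. (s, snd x)) has_derivative (\<lambda>h. (h, 0))) (at (fst x))"
    by (auto intro!: derivative_eq_intros)
  from has_derivative_compose[OF this, of f "\<lambda>h. a * fst h + b * snd h"] assms
  show 1: "((\<lambda>s. f (s, snd x)) has_real_derivative a) (at (fst x))"
    by (simp add: has_field_derivative_def)
  have "((\<lambda>s. (fst x, s)) has_derivative (\<lambda>h. (0, h))) (at (snd x))"
    by (auto intro!: derivative_eq_intros)
  from has_derivative_compose[OF this, of f "\<lambda>h. a * fst h + b * snd h"] assms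
  show 2: "((\<lambda>s. f (fst x, s)) has_real_derivative b) (at (snd x))"
    by (simp add: has_field_derivative_def)
  show "pd1 f x = a" "pd2 f x = b"
    using DERIV_imp_deriv[OF 1] DERIV_imp_deriv[OF 2] by (simp_all add: pd1_def pd2_def)
qed

lemma differentiable_partials:
  fixes f :: "pt \<Rightarrow> real"
  assumes "f differentiable (at x)"
  shows "(f has_derivative (\<lambda>h. pd1 f x * fst h + pd2 f x * snd h)) (at x)"
proof -
  obtain f' where f': "(f has_derivative f') (at x)" using assms by (auto simp: differentiable_def)
  interpret bounded_linear f' by (rule has_derivative_bounded_linear[OF f'])
  have "f' h = f' (1, 0) * fst h + f' (0, 1) * snd h" for h
  proof -
    have "h = fst h *\<^sub>R (1, 0) + snd h *\<^sub>R (0, 1)" by (cases h) simp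
    then have "f' h = f' (fst h *\<^sub>R (1, 0) + snd h *\<^sub>R (0, 1))" by simp
    also have "\<dots> = f' (1, 0) * fst h + f' (0, 1) * snd h" by (simp only: add scaleR) (simp add: mult.commute)
    finally show ?thesis .
  qed
  then have "f' = (\<lambda>h. f' (1, 0) * fst h + f' (0, 1) * snd h)" by blast
  then have d: "(f has_derivative (\<lambda>h. f' (1, 0) * fst h + f' (0, 1) * snd h)) (at x)" using f' by metis
  show ?thesis unfolding partials_of_has_derivative(3,4)[OF d] by (rule d)
qed

lemma sum_mode_has_derivative:
  "((\<lambda>x. \<Sum>i\<in>A. c i * mode (g i) x) has_derivative
     (\<lambda>h. (\<Sum>i\<in>A. c i * d1 (g i) * mode (flip (g i)) x) * fst h + (\<Sum>i\<in>A. c i * d2 (g i) * mode (flip (g i)) x) * snd h)) (at x)"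
proof -
  have "((\<lambda>x. \<Sum>i\<in>A. c i * mode (g i) x) has_derivative
     (\<lambda>h. \<Sum>i\<in>A. c i * ((d1 (g i) * mode (flip (g i)) x) * fst h + (d2 (g i) * mode (flip (g i)) x) * snd h))) (at x)"
    by (intro has_derivative_sum has_derivative_mult_right mode_has_derivative)
  then show ?thesis
    by (simp add: distrib_left sum.distrib sum_distrib_right mult.assoc)
qed

lemma pd_sum_mode:
  "pd1 (\<lambda>x. \<Sum>i\<in>A. c i * mode (g i) x) = (\<lambda>x. \<Sum>i\<in>A. c i * d1 (g i) * mode (flip (g i)) x)"
  "pd2 (\<lambda>x. \<Sum>i\<in>A. c i * mode (g i) x) = (\<lambda>x. \<Sum>i\<in>A. c i * d2 (g i) * mode (flip (g i)) x)"
  using partials_of_has_derivative(3,4)[OF sum_mode_has_derivative] by blast+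

lemma trig_sum: "(\<And>i. i \<in> A \<Longrightarrow> f i \<in> trig) \<Longrightarrow> (\<lambda>x. \<Sum>i\<in>A. f i x) \<in> trig"
  by (induction A rule: infinite_finite_induct) (auto intro: trig.add trig_const)

lemma trig_sum_mode: "(\<lambda>x. \<Sum>i\<in>A. c i * mode (g i) x) \<in> trig"
  by (intro trig_sum trig.intros)

lemma trig_cases:
  assumes "p \<in> trig"
  obtains N c where "p = (\<lambda>x. \<Sum>i\<in>cutoff N. c i * mode i x)"
  using trig_cutoff[OF assms] by blast

lemma trig_pd: assumes "p \<in> trig" shows "pd1 p \<in> trig" "pd2 p \<in> trig"
proof -
  obtain N c where p: "p = (\<lambda>x. \<Sum>i\<in>cutoff N. c i * mode i x)" using assms by (rule trig_cases)
  show "pd1 p \<in> trig" unfolding p pd_sum_mode(1)[where g="\<lambda>i. i"] by (rule trig_sum_mode)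
  show "pd2 p \<in> trig" unfolding p pd_sum_mode(2)[where g="\<lambda>i. i"] by (rule trig_sum_mode)
qed

lemma trig_differentiable: assumes "p \<in> trig" shows "p differentiable (at x)"
proof -
  obtain N c where p: "p = (\<lambda>x. \<Sum>i\<in>cutoff N. c i * mode i x)" using assms by (rule trig_cases)
  show ?thesis unfolding p differentiable_def using sum_mode_has_derivative[where g="\<lambda>i. i"] by blast
qed

lemma trig_continuous: "p \<in> trig \<Longrightarrow> continuous_on UNIV p"
  by (simp add: continuous_at_imp_continuous_on differentiable_imp_continuous_within trig_differentiable)

lemma periodic_sum:
  fixes f :: "'i \<Rightarrow> pt \<Rightarrow> real"
  assumes "\<And>i. i \<in> A \<Longrightarrow> periodic (f i)"
  shows "periodic (\<lambda>x. \<Sum>i\<in>A. f i x)"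
  unfolding periodic_def
proof (intro allI impI sum.cong refl)
  fix x y i assume "torus_eq x y" "i \<in> A"
  then show "f i x = f i y" using assms unfolding periodic_def by blast
qed

lemma periodic_scale: "periodic f \<Longrightarrow> periodic (\<lambda>x. c * f x :: real)"
  unfolding periodic_def by metis

lemma trig_periodic: assumes "p \<in> trig" shows "periodic p"
proof -
  obtain N c where p: "p = (\<lambda>x. \<Sum>i\<in>cutoff N. c i * mode i x)" using assms by (rule trig_cases)
  show ?thesis unfolding p by (intro periodic_sum periodic_scale periodic_mode)
qed

lemma trig_smooth: "p \<in> trig \<Longrightarrow> torus_smooth p"
proof -
  have "torus_Ck k p" if "p \<in> trig" for k p
    using that
  proof (induction k arbitrary: p)
    case 0
    then show ?case by (simp add: trig_continuous trig_periodic)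
  next
    case (Suc k)
    then show ?case by (simp add: trig_pd trig_differentiable trig_periodic)
  qed
  then show "p \<in> trig \<Longrightarrow> torus_smooth p" by (simp add: torus_smooth_def)
qed

definition eigenvalue :: "complex \<Rightarrow> idx \<Rightarrow> real" where
  "eigenvalue \<tau> i = ((cmod \<tau>)\<^sup>2 * (d1 i)\<^sup>2 - 2 * Re \<tau> * (d1 i * d2 i) + (d2 i)\<^sup>2) / (Im \<tau>)\<^sup>2"

lemma laplacian_sum_mode:
  "laplacian \<tau> (\<lambda>x. \<Sum>i\<in>A. c i * mode i x) x = - (\<Sum>i\<in>A. c i * eigenvalue \<tau> i * mode i x)"
proof -
  let ?p = "\<lambda>x. \<Sum>i\<in>A. c i * mode i x"
  have e: "pd1 (pd1 ?p) x = (\<Sum>i\<in>A. - (c i * (d1 i)\<^sup>2 * mode i x))"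
    "pd1 (pd2 ?p) x = (\<Sum>i\<in>A. - (c i * (d1 i * d2 i) * mode i x))"
    "pd2 (pd2 ?p) x = (\<Sum>i\<in>A. - (c i * (d2 i)\<^sup>2 * mode i x))"
    unfolding pd_sum_mode[where g="\<lambda>i. i"] pd_sum_mode[where g=flip] flip_flip
    by (simp_all add: power2_eq_square mult.assoc mult.left_commute mult.commute)
  show ?thesis
    unfolding laplacian_def e
    by (simp add: eigenvalue_def sum_distrib_left sum_negf[symmetric] sum_divide_distrib sum.distrib[symmetric] sum_subtractf[symmetric]
         add_divide_distrib diff_divide_distrib algebra_simps)
qed

section \<open>Weak derivatives\<close>

lemma L2t_continuous:
  assumes "continuous_on UNIV f"
  shows "L2t f"
proof -
  have [measurable]: "f \<in> borel_measurable borel" by (rule continuous_borel_pt) fact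
  have "compact ({0..1::real} \<times> {0..1::real})" by (intro compact_Times) auto
  then have "bounded (f ` ({0..1} \<times> {0..1}))"
    by (intro compact_imp_bounded compact_continuous_image continuous_on_subset[OF assms]) auto
  then obtain B where B: "\<And>x. x \<in> {0..1} \<times> {0..1} \<Longrightarrow> \<bar>f x\<bar> \<le> B"
    unfolding bounded_iff by auto
  have "integrable torus (\<lambda>x. (f x)\<^sup>2)"
  proof (rule torus.integrable_const_bound[where B="B\<^sup>2"])
    show "AE x in torus. norm ((f x)\<^sup>2) \<le> B\<^sup>2"
    proof (rule AE_I2)
      fix x assume "x \<in> space torus"
      then have "\<bar>f x\<bar> \<le> B" by (intro B) (auto simp: space_torus)
      from power_mono[OF this, of 2] show "norm ((f x)\<^sup>2) \<le> B\<^sup>2" by simp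
    qed
    show "(\<lambda>x. (f x)\<^sup>2) \<in> borel_measurable torus" by (rule borel_measurable_torus) measurable
  qed
  then show ?thesis by (simp add: L2t_def)
qed

lemma torus_L2_iff: "torus_L2 f \<longleftrightarrow> periodic f \<and> L2t f"
  by (auto simp: torus_L2_def L2t_def)

lemma smooth_C1:
  assumes "torus_smooth \<psi>"
  shows "\<psi> differentiable (at x)" "continuous_on UNIV \<psi>" "continuous_on UNIV (pd1 \<psi>)" "continuous_on UNIV (pd2 \<psi>)" "periodic \<psi>"
proof -
  have "torus_Ck (Suc 0) \<psi>" using assms by (simp add: torus_smooth_def)
  then show d: "\<psi> differentiable (at x)" and "continuous_on UNIV (pd1 \<psi>)" "continuous_on UNIV (pd2 \<psi>)" "periodic \<psi>" for x
    by (simp_all del: split_paired_All)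
  have "torus_Ck 0 \<psi>" using assms unfolding torus_smooth_def by blast
  then show "continuous_on UNIV \<psi>" by simp
qed

lemma smooth_L2t: "torus_smooth \<psi> \<Longrightarrow> D = pd1 \<or> D = pd2 \<Longrightarrow> L2t (D \<psi>)" "torus_smooth \<psi> \<Longrightarrow> L2t \<psi>"
  using smooth_C1 by (auto intro: L2t_continuous)

lemma is_weak_deriv_iff: "is_weak_deriv D f g \<longleftrightarrow> torus_L2 g \<and> (\<forall>\<psi>. torus_smooth \<psi> \<longrightarrow> ip f (D \<psi>) = - ip g \<psi>)"
  by (simp add: is_weak_deriv_def ip_def)

lemma torus_L2_lin: "torus_L2 f \<Longrightarrow> torus_L2 g \<Longrightarrow> torus_L2 (\<lambda>x. a * f x + b * g x)"
  unfolding torus_L2_iff periodic_def by (intro conjI L2t_add L2t_scale) (metis+)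

lemma is_weak_deriv_lin:
  assumes D: "D = pd1 \<or> D = pd2" and "is_weak_deriv D f g" "is_weak_deriv D f' g'" and f: "torus_L2 f" "torus_L2 f'"
  shows "is_weak_deriv D (\<lambda>x. a * f x + b * f' x) (\<lambda>x. a * g x + b * g' x)"
  unfolding is_weak_deriv_iff
proof (intro conjI allI impI)
  have g: "torus_L2 g" "torus_L2 g'" using assms by (auto simp: is_weak_deriv_iff)
  then show "torus_L2 (\<lambda>x. a * g x + b * g' x)" by (rule torus_L2_lin)
  fix \<psi> assume \<psi>: "torus_smooth \<psi>"
  have L: "L2t f" "L2t f'" "L2t g" "L2t g'" using f g by (auto simp: torus_L2_iff)
  have "ip f (D \<psi>) = - ip g \<psi>" "ip f' (D \<psi>) = - ip g' \<psi>" using assms \<psi> by (auto simp: is_weak_deriv_iff)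
  then show "ip (\<lambda>x. a * f x + b * f' x) (D \<psi>) = - ip (\<lambda>x. a * g x + b * g' x) \<psi>"
    using L smooth_L2t(1)[OF \<psi> D] smooth_L2t(2)[OF \<psi>] by (simp add: ip_add_left ip_scale_left L2t_scale)
qed

text \<open>Integration by parts in each variable: the boundary terms cancel by periodicity.\<close>
lemma mode_weak_deriv:
  "is_weak_deriv pd1 (mode i) (\<lambda>x. d1 i * mode (flip i) x)"
  "is_weak_deriv pd2 (mode i) (\<lambda>x. d2 i * mode (flip i) x)"
proof -
  have L: "torus_L2 (\<lambda>x. c * mode (flip i) x)" for c
    unfolding torus_L2_iff by (intro conjI L2t_scale L2t_mode periodic_scale periodic_mode)
  have dm: "((\<lambda>s. mode i (s, t)) has_real_derivative d1 i * mode (flip i) (s, t)) (at s)"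
    "((\<lambda>t. mode i (s, t)) has_real_derivative d2 i * mode (flip i) (s, t)) (at t)" for s t
    using partials_of_has_derivative(1,2)[OF mode_has_derivative, of i "(s, t)"] by simp_all
  have per: "mode i (1, t) = mode i (0, t)" "mode i (s, 1) = mode i (s, 0)" for s t
    using periodic_mode[of i] by (auto simp: periodic_def torus_eq_def)
  have key: "ip (mode i) (pd1 \<psi>) = - ip (\<lambda>x. d1 i * mode (flip i) x) \<psi>
     \<and> ip (mode i) (pd2 \<psi>) = - ip (\<lambda>x. d2 i * mode (flip i) x) \<psi>" if \<psi>: "torus_smooth \<psi>" for \<psi>
  proof -
    note c = smooth_C1[OF \<psi>]
    have c2: "continuous_on A (\<lambda>y. f (g y))" if "continuous_on UNIV f" "continuous_on A g" for f :: "pt \<Rightarrow> real" and g :: "real \<Rightarrow> pt" and A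
      using that by (intro continuous_on_compose2[of UNIV f A g]) auto
    have d\<psi>: "((\<lambda>s. \<psi> (s, t)) has_real_derivative pd1 \<psi> (s, t)) (at s)"
      "((\<lambda>t. \<psi> (s, t)) has_real_derivative pd2 \<psi> (s, t)) (at t)" for s t
      using partials_of_has_derivative(1,2)[OF differentiable_partials[OF c(1)], of "(s, t)"] by simp_all
    have per\<psi>: "\<psi> (1, t) = \<psi> (0, t)" "\<psi> (s, 1) = \<psi> (s, 0)" for s t
      using c(5) by (auto simp: periodic_def torus_eq_def)
    let ?f = "\<lambda>x. d1 i * mode (flip i) x * \<psi> x + mode i x * pd1 \<psi> x"
    let ?g = "\<lambda>x. d2 i * mode (flip i) x * \<psi> x + mode i x * pd2 \<psi> x"
    have Lf: "L2t ?f" "L2t ?g" by (intro L2t_continuous continuous_intros mode_continuous c)+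
    have "(LINT s|unit_interval. ?f (s, t)) = mode i (1, t) * \<psi> (1, t) - mode i (0, t) * \<psi> (0, t)" for t
      by (rule unit_interval_FTC)
         (auto intro!: DERIV_mult'[THEN DERIV_cong] dm d\<psi> continuous_intros c2 mode_continuous c simp: algebra_simps)
    then have "(LINT x|torus. ?f x) = 0"
      using per per\<psi> by (subst torus_Fubini(2)[OF L2t_integrable[OF Lf(1)]]) (simp add: integral_unit_interval)
    moreover have "(LINT s|unit_interval. ?g (t, s)) = mode i (t, 1) * \<psi> (t, 1) - mode i (t, 0) * \<psi> (t, 0)" for t
      by (rule unit_interval_FTC)
         (auto intro!: DERIV_mult'[THEN DERIV_cong] dm d\<psi> continuous_intros c2 mode_continuous c simp: algebra_simps)
    then have "(LINT x|torus. ?g x) = 0"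
      using per per\<psi> by (subst torus_Fubini(1)[OF L2t_integrable[OF Lf(2)]]) (simp add: integral_unit_interval)
    moreover have "(LINT x|torus. ?f x) = ip (\<lambda>x. d1 i * mode (flip i) x) \<psi> + ip (mode i) (pd1 \<psi>)"
      "(LINT x|torus. ?g x) = ip (\<lambda>x. d2 i * mode (flip i) x) \<psi> + ip (mode i) (pd2 \<psi>)"
      unfolding ip_def using smooth_L2t[OF \<psi>]
      by (subst Bochner_Integration.integral_add; auto intro!: L2t_integrable_mult L2t_scale)+
    ultimately show ?thesis by simp
  qed
  then show "is_weak_deriv pd1 (mode i) (\<lambda>x. d1 i * mode (flip i) x)"
    "is_weak_deriv pd2 (mode i) (\<lambda>x. d2 i * mode (flip i) x)"
    using L by (auto simp: is_weak_deriv_iff)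
qed

text \<open>Testing the definition of the weak derivative against modes determines all its Fourier
  coefficients.\<close>
lemma weak_deriv_coeff:
  assumes "is_weak_deriv pd1 f g" shows "ip g (mode i) = - d1 i * ip f (mode (flip i))"
proof -
  have e: "pd1 (mode i) = (\<lambda>x. d1 i * mode (flip i) x)"
    using partials_of_has_derivative(3)[OF mode_has_derivative] by blast
  have "ip f (pd1 (mode i)) = - ip g (mode i)"
    using assms trig_smooth[OF trig.mode] by (auto simp: is_weak_deriv_iff)
  then show ?thesis unfolding e using ip_scale_left[of "d1 i" "mode (flip i)" f] by (simp add: ip_commute[of f])
qed

lemma weak_deriv_coeff2:
  assumes "is_weak_deriv pd2 f g" shows "ip g (mode i) = - d2 i * ip f (mode (flip i))"
proof -
  have e: "pd2 (mode i) = (\<lambda>x. d2 i * mode (flip i) x)"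
    using partials_of_has_derivative(4)[OF mode_has_derivative] by blast
  have "ip f (pd2 (mode i)) = - ip g (mode i)"
    using assms trig_smooth[OF trig.mode] by (auto simp: is_weak_deriv_iff)
  then show ?thesis unfolding e using ip_scale_left[of "d2 i" "mode (flip i)" f] by (simp add: ip_commute[of f])
qed

section \<open>The Sobolev space in Fourier coordinates\<close>

text \<open>In Fourier coordinates the Sobolev norm becomes a weighted \<open>\<ell>\<^sup>2\<close>-norm with these weights.\<close>
definition weight :: "idx \<Rightarrow> real" where "weight i = 1 + (d1 i)\<^sup>2 + (d2 i)\<^sup>2"

lemma weight_pos: "0 < weight i"
  using zero_le_power2[of "d1 i"] zero_le_power2[of "d2 i"] unfolding weight_def by linarith

lemma H1_D:
  assumes "f \<in> H1"
  shows "torus_L2 f" "L2t f" "is_weak_deriv pd1 f (weak_deriv pd1 f)" "is_weak_deriv pd2 f (weak_deriv pd2 f)"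
proof -
  show "torus_L2 f" using assms by (simp add: H1_def)
  then show "L2t f" by (simp add: torus_L2_iff)
  show "is_weak_deriv pd1 f (weak_deriv pd1 f)" "is_weak_deriv pd2 f (weak_deriv pd2 f)"
    using assms unfolding H1_def weak_deriv_def by (auto intro: someI_ex[of "is_weak_deriv pd1 f"] someI_ex[of "is_weak_deriv pd2 f"])
qed

lemma H1_I: "torus_L2 f \<Longrightarrow> is_weak_deriv pd1 f a \<Longrightarrow> is_weak_deriv pd2 f b \<Longrightarrow> f \<in> H1"
  by (auto simp: H1_def)

lemma H1_lin: "f \<in> H1 \<Longrightarrow> g \<in> H1 \<Longrightarrow> (\<lambda>x. a * f x + b * g x) \<in> H1"
  by (intro H1_I[OF torus_L2_lin is_weak_deriv_lin is_weak_deriv_lin]) (auto dest: H1_D)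

lemma H1_mode [simp]: "mode i \<in> H1"
  by (rule H1_I[OF _ mode_weak_deriv]) (simp add: torus_L2_iff periodic_mode)

lemma H1_scale: "f \<in> H1 \<Longrightarrow> (\<lambda>x. c * f x) \<in> H1"
  using H1_lin[of f f c 0] by simp

lemma H1_trig: "p \<in> trig \<Longrightarrow> p \<in> H1"
proof (induction rule: trig.induct)
  case (add p q)
  then show ?case using H1_lin[of p q 1 1] by simp
qed (auto intro: H1_scale)

lemma H1_norm_sq: "f \<in> H1 \<Longrightarrow> (H1_norm f)\<^sup>2 = ip f f + ip (weak_deriv pd1 f) (weak_deriv pd1 f) + ip (weak_deriv pd2 f) (weak_deriv pd2 f)"
  unfolding H1_norm_def ip_def by (simp add: power2_eq_square)

lemma H1_norm_nonneg: "0 \<le> H1_norm f"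
  unfolding H1_norm_def by simp

text \<open>Parseval for the function and for its two weak derivatives.\<close>
lemma H1_norm_sq_sums:
  assumes f: "f \<in> H1"
  shows "(\<lambda>N. \<Sum>i\<in>cutoff N. weight i * (ip f (mode i))\<^sup>2) \<longlonglongrightarrow> (H1_norm f)\<^sup>2"
proof -
  note D = H1_D[OF f]
  have L: "L2t (weak_deriv pd1 f)" "L2t (weak_deriv pd2 f)"
    using D by (auto simp: is_weak_deriv_iff torus_L2_iff)
  have e: "(\<Sum>i\<in>cutoff N. weight i * (ip f (mode i))\<^sup>2) = (\<Sum>i\<in>cutoff N. (ip f (mode i))\<^sup>2)
     + (\<Sum>i\<in>cutoff N. (ip (weak_deriv pd1 f) (mode i))\<^sup>2) + (\<Sum>i\<in>cutoff N. (ip (weak_deriv pd2 f) (mode i))\<^sup>2)" for N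
  proof -
    have "(\<Sum>i\<in>cutoff N. (ip (weak_deriv pd1 f) (mode i))\<^sup>2) = (\<Sum>i\<in>cutoff N. (d1 (flip i))\<^sup>2 * (ip f (mode (flip i)))\<^sup>2)"
      "(\<Sum>i\<in>cutoff N. (ip (weak_deriv pd2 f) (mode i))\<^sup>2) = (\<Sum>i\<in>cutoff N. (d2 (flip i))\<^sup>2 * (ip f (mode (flip i)))\<^sup>2)"
      by (simp_all add: weak_deriv_coeff[OF D(3)] weak_deriv_coeff2[OF D(4)] power_mult_distrib)
    then show ?thesis
      unfolding sum_flip[of "\<lambda>i. (d1 i)\<^sup>2 * (ip f (mode i))\<^sup>2"] sum_flip[of "\<lambda>i. (d2 i)\<^sup>2 * (ip f (mode i))\<^sup>2"]
      by (simp add: weight_def distrib_right sum.distrib)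
  qed
  show ?thesis unfolding e H1_norm_sq[OF f]
    by (intro tendsto_add Parseval D L)
qed

lemma cutoff_incseq: "(\<And>i. 0 \<le> f i) \<Longrightarrow> incseq (\<lambda>N. \<Sum>i\<in>cutoff N. f i :: real)"
  by (intro incseq_SucI sum_mono2 cutoff_mono) auto

lemma H1_norm_sum_le: "f \<in> H1 \<Longrightarrow> (\<Sum>i\<in>cutoff N. weight i * (ip f (mode i))\<^sup>2) \<le> (H1_norm f)\<^sup>2"
  using incseq_le[OF cutoff_incseq H1_norm_sq_sums] by (simp add: weight_pos less_imp_le)

lemma proj_H1: "proj N f \<in> H1"
  unfolding proj_def[abs_def] by (intro H1_trig trig_sum_mode)

lemma ip_proj_high:
  assumes "level i > N" shows "ip (proj N f) (mode i) = 0"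
  using assms by (subst ip_proj) (auto simp: in_cutoff_iff ip_mode_level)

lemma H1_norm_residual:
  assumes f: "f \<in> H1"
  shows "(H1_norm (\<lambda>x. f x - proj N f x))\<^sup>2 = (H1_norm f)\<^sup>2 - (\<Sum>i\<in>cutoff N. weight i * (ip f (mode i))\<^sup>2)"
proof -
  note L = H1_D(2)[OF f]
  let ?r = "\<lambda>x. f x - proj N f x"
  have r: "?r \<in> H1" using H1_lin[OF f proj_H1, of 1 "-1" N f] by simp
  have c: "ip ?r (mode i) = (if level i \<le> N then 0 else ip f (mode i))" for i
    using L by (simp add: ip_diff_left ip_proj_mode ip_proj_high)
  have "(\<Sum>i\<in>cutoff M. weight i * (ip ?r (mode i))\<^sup>2) =
     (\<Sum>i\<in>cutoff M. weight i * (ip f (mode i))\<^sup>2) - (\<Sum>i\<in>cutoff N. weight i * (ip f (mode i))\<^sup>2)" if "M \<ge> N" for M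
  proof -
    have "(\<Sum>i\<in>cutoff M. weight i * (ip ?r (mode i))\<^sup>2) = (\<Sum>i\<in>cutoff M - cutoff N. weight i * (ip f (mode i))\<^sup>2)"
      by (rule sum.mono_neutral_cong_right) (auto simp: c in_cutoff_iff)
    then show ?thesis using cutoff_mono[OF that] by (simp add: sum_diff)
  qed
  note step = this
  have "eventually (\<lambda>M. (\<Sum>i\<in>cutoff M. weight i * (ip f (mode i))\<^sup>2) - (\<Sum>i\<in>cutoff N. weight i * (ip f (mode i))\<^sup>2)
      = (\<Sum>i\<in>cutoff M. weight i * (ip ?r (mode i))\<^sup>2)) sequentially"
    using eventually_ge_at_top[of N] by (rule eventually_mono) (rule step[symmetric])
  then have "(\<lambda>M. \<Sum>i\<in>cutoff M. weight i * (ip ?r (mode i))\<^sup>2) \<longlonglongrightarrow> (H1_norm f)\<^sup>2 - (\<Sum>i\<in>cutoff N. weight i * (ip f (mode i))\<^sup>2)"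
    by (rule Lim_transform_eventually[rotated]) (intro tendsto_diff H1_norm_sq_sums f tendsto_const)
  from LIMSEQ_unique[OF H1_norm_sq_sums[OF r] this] show ?thesis .
qed

lemma H1_norm_residual_tendsto:
  assumes f: "f \<in> H1"
  shows "(\<lambda>N. H1_norm (\<lambda>x. f x - proj N f x)) \<longlonglongrightarrow> 0"
proof -
  have "(\<lambda>N. (H1_norm (\<lambda>x. f x - proj N f x))\<^sup>2) \<longlonglongrightarrow> (H1_norm f)\<^sup>2 - (H1_norm f)\<^sup>2"
    unfolding H1_norm_residual[OF f] by (intro tendsto_diff tendsto_const H1_norm_sq_sums f)
  then have "(\<lambda>N. sqrt ((H1_norm (\<lambda>x. f x - proj N f x))\<^sup>2)) \<longlonglongrightarrow> sqrt 0"
    by (intro tendsto_real_sqrt) simp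
  then show ?thesis by (simp add: H1_norm_nonneg)
qed

lemma L2_le_H1: "f \<in> H1 \<Longrightarrow> ip f f \<le> (H1_norm f)\<^sup>2"
  by (simp add: H1_norm_sq ip_self_nonneg)

lemma weak_deriv_sum_mode:
  assumes "finite A"
  shows "is_weak_deriv pd1 (\<lambda>x. \<Sum>i\<in>A. c i * mode i x) (\<lambda>x. \<Sum>i\<in>A. (c i * d1 i) * mode (flip i) x)
    \<and> is_weak_deriv pd2 (\<lambda>x. \<Sum>i\<in>A. c i * mode i x) (\<lambda>x. \<Sum>i\<in>A. (c i * d2 i) * mode (flip i) x)"
  using assms
proof induction
  case empty
  have z: "torus_L2 (\<lambda>_. 0)" by (simp add: torus_L2_iff periodic_def)
  have "is_weak_deriv D (\<lambda>_. 0) (\<lambda>_. 0)" for D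
    using z by (simp add: is_weak_deriv_iff ip_def)
  then show ?case by simp
next
  case (insert j A)
  have L: "torus_L2 (mode j)" "torus_L2 (\<lambda>x. \<Sum>i\<in>A. c i * mode i x)"
    by (intro H1_D(1) H1_mode H1_trig[OF trig_sum_mode[where g="\<lambda>i. i"]])+
  show ?case
    using is_weak_deriv_lin[OF _ mode_weak_deriv(1) insert.IH[THEN conjunct1] L, of "c j" 1]
      is_weak_deriv_lin[OF _ mode_weak_deriv(2) insert.IH[THEN conjunct2] L, of "c j" 1]
    unfolding sum.insert[OF insert.hyps] by (simp add: mult.assoc)
qed

text \<open>As in \<open>synthesis_bound\<close>, only an inequality because the \<open>c i\<close> need not be the Fourier coefficients
  of the sum.\<close>
lemma H1_norm_synthesis:
  "(H1_norm (\<lambda>x. \<Sum>i\<in>cutoff N. c i * mode i x))\<^sup>2 \<le> (\<Sum>i\<in>cutoff N. weight i * (c i)\<^sup>2)"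
proof -
  let ?p = "\<lambda>x. \<Sum>i\<in>cutoff N. c i * mode i x"
  have p: "?p \<in> H1" by (intro H1_trig trig_sum_mode)
  note D = H1_D[OF p]
  have W: "ip g g \<le> (\<Sum>i\<in>cutoff N. (c i * d i)\<^sup>2)"
    if g: "L2t g" and co: "\<And>i. ip g (mode i) = ip (\<lambda>x. \<Sum>i\<in>cutoff N. (c i * d i) * mode (flip i) x) (mode i)" for g d
  proof -
    let ?q = "\<lambda>x. \<Sum>i\<in>cutoff N. (c i * d i) * mode (flip i) x"
    have Lq: "L2t ?q" by (intro L2t_sum L2t_scale L2t_mode)
    have "ip g g = ip ?q ?q"
      using LIMSEQ_unique[OF Parseval[OF g, unfolded co] Parseval[OF Lq]] .
    also have "?q = (\<lambda>x. \<Sum>i\<in>cutoff N. (c (flip i) * d (flip i)) * mode i x)"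
    proof
      fix x show "?q x = (\<Sum>i\<in>cutoff N. (c (flip i) * d (flip i)) * mode i x)"
        using sum_flip[of "\<lambda>i. (c (flip i) * d (flip i)) * mode i x" N] by simp
    qed
    also have "ip \<dots> \<dots> \<le> (\<Sum>i\<in>cutoff N. (c (flip i) * d (flip i))\<^sup>2)"
      by (rule synthesis_bound) simp
    finally show ?thesis unfolding sum_flip[of "\<lambda>i. (c i * d i)\<^sup>2"] .
  qed
  have L: "L2t (weak_deriv pd1 ?p)" "L2t (weak_deriv pd2 ?p)"
    using D by (auto simp: is_weak_deriv_iff torus_L2_iff)
  have co: "ip (weak_deriv pd1 ?p) (mode i) = ip (\<lambda>x. \<Sum>i\<in>cutoff N. (c i * d1 i) * mode (flip i) x) (mode i)"
    "ip (weak_deriv pd2 ?p) (mode i) = ip (\<lambda>x. \<Sum>i\<in>cutoff N. (c i * d2 i) * mode (flip i) x) (mode i)" for i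
    using weak_deriv_coeff[OF D(3)] weak_deriv_coeff2[OF D(4)]
      weak_deriv_coeff[OF weak_deriv_sum_mode[OF finite_cutoff, of c N, THEN conjunct1]]
      weak_deriv_coeff2[OF weak_deriv_sum_mode[OF finite_cutoff, of c N, THEN conjunct2]]
    by (simp_all only:)
  have "(H1_norm ?p)\<^sup>2 \<le> (\<Sum>i\<in>cutoff N. (c i)\<^sup>2) + (\<Sum>i\<in>cutoff N. (c i * d1 i)\<^sup>2) + (\<Sum>i\<in>cutoff N. (c i * d2 i)\<^sup>2)"
    unfolding H1_norm_sq[OF p]
    by (intro add_mono synthesis_bound finite_cutoff W[OF L(1) co(1)] W[OF L(2) co(2)])
  also have "\<dots> = (\<Sum>i\<in>cutoff N. weight i * (c i)\<^sup>2)"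
    by (simp add: weight_def sum.distrib[symmetric] power_mult_distrib algebra_simps)
  finally show ?thesis .
qed

section \<open>The dual space and its Borel sets\<close>

lemma Hm1_lin: "T \<in> Hm1 \<Longrightarrow> f \<in> H1 \<Longrightarrow> g \<in> H1 \<Longrightarrow> T (\<lambda>x. a * f x + b * g x) = a * T f + b * T g"
  by (simp add: Hm1_def)

lemma Hm1_outside: "T \<in> Hm1 \<Longrightarrow> f \<notin> H1 \<Longrightarrow> T f = 0"
  by (simp add: Hm1_def)

lemma Hm1_scale: "T \<in> Hm1 \<Longrightarrow> f \<in> H1 \<Longrightarrow> T (\<lambda>x. a * f x) = a * T f"
  using Hm1_lin[of T f f a 0] by simp

lemma Hm1_zero: "T \<in> Hm1 \<Longrightarrow> T (\<lambda>_. 0) = 0"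
  using Hm1_scale[of T "mode (0,0,True)" 0] by simp

lemma Hm1_diff: "T \<in> Hm1 \<Longrightarrow> f \<in> H1 \<Longrightarrow> g \<in> H1 \<Longrightarrow> T (\<lambda>x. f x - g x) = T f - T g"
  using Hm1_lin[of T f g 1 "-1"] by simp

lemma Hm1_sum:
  assumes "T \<in> Hm1" "finite A"
  shows "T (\<lambda>x. \<Sum>i\<in>A. c i * mode i x) = (\<Sum>i\<in>A. c i * T (mode i))"
  using assms(2)
proof induction
  case empty
  show ?case using Hm1_zero[OF assms(1)] by simp
next
  case (insert j A)
  have "T (\<lambda>x. c j * mode j x + 1 * (\<Sum>i\<in>A. c i * mode i x)) = c j * T (mode j) + 1 * T (\<lambda>x. \<Sum>i\<in>A. c i * mode i x)"
    by (intro Hm1_lin assms(1) H1_mode H1_trig[OF trig_sum_mode[where g="\<lambda>i. i"]])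
  then show ?case unfolding sum.insert[OF insert.hyps] insert.IH by simp
qed

lemma Hm1_bounded:
  assumes "T \<in> Hm1"
  obtains C where "0 \<le> C" "\<And>f. f \<in> H1 \<Longrightarrow> \<bar>T f\<bar> \<le> C * H1_norm f"
proof -
  obtain C where C: "\<forall>f\<in>H1. \<bar>T f\<bar> \<le> C * H1_norm f" using assms by (auto simp: Hm1_def)
  have "\<bar>T f\<bar> \<le> \<bar>C\<bar> * H1_norm f" if "f \<in> H1" for f
  proof -
    have "C * H1_norm f \<le> \<bar>C\<bar> * H1_norm f" by (intro mult_right_mono H1_norm_nonneg) simp
    then show ?thesis using C that by fastforce
  qed
  then show ?thesis using that[of "\<bar>C\<bar>"] by simp
qed

lemma zero_H1: "(\<lambda>_. 0) \<in> H1"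
  by (intro H1_trig trig_const)

lemma H1_norm_zero: "H1_norm (\<lambda>_. 0) = 0"
  using H1_norm_synthesis[of "\<lambda>_. 0" 0] by (simp add: H1_norm_nonneg)

lemma H1_norm_scale:
  assumes "f \<in> H1" shows "H1_norm (\<lambda>x. c * f x) = \<bar>c\<bar> * H1_norm f"
proof -
  have "(\<Sum>i\<in>cutoff N. weight i * (ip (\<lambda>x. c * f x) (mode i))\<^sup>2) = c\<^sup>2 * (\<Sum>i\<in>cutoff N. weight i * (ip f (mode i))\<^sup>2)" for N
    unfolding ip_scale_left sum_distrib_left power_mult_distrib by (intro sum.cong refl) (simp only: mult.left_commute)
  then have "(\<lambda>N. \<Sum>i\<in>cutoff N. weight i * (ip (\<lambda>x. c * f x) (mode i))\<^sup>2) \<longlonglongrightarrow> c\<^sup>2 * (H1_norm f)\<^sup>2"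
    using tendsto_mult[OF tendsto_const[of "c\<^sup>2"] H1_norm_sq_sums[OF assms]] by simp
  from LIMSEQ_unique[OF this H1_norm_sq_sums[OF H1_scale[OF assms]]]
  have "(H1_norm (\<lambda>x. c * f x))\<^sup>2 = (\<bar>c\<bar> * H1_norm f)\<^sup>2" by (simp add: power_mult_distrib)
  then show ?thesis
    by (rule power2_eq_imp_eq) (simp_all add: H1_norm_nonneg)
qed

lemma Hm1_norm_bdd: 
  assumes "T \<in> Hm1" shows "bdd_above ((\<lambda>f. \<bar>T f\<bar>) ` {f\<in>H1. H1_norm f \<le> 1})"
proof -
  obtain C where C: "0 \<le> C" "\<And>f. f \<in> H1 \<Longrightarrow> \<bar>T f\<bar> \<le> C * H1_norm f" using Hm1_bounded[OF assms] by blast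
  have "\<bar>T f\<bar> \<le> C" if "f \<in> H1" "H1_norm f \<le> 1" for f
    using C(2)[OF that(1)] mult_left_mono[OF that(2) C(1)] by simp
  then show ?thesis by (intro bdd_aboveI[where M=C]) auto
qed

lemma Hm1_norm_le:
  assumes "\<And>f. f \<in> H1 \<Longrightarrow> H1_norm f \<le> 1 \<Longrightarrow> \<bar>T f\<bar> \<le> K"
  shows "Hm1_norm T \<le> K"
  unfolding Hm1_norm_def
proof (rule cSUP_least)
  have "(\<lambda>_. 0) \<in> {f\<in>H1. H1_norm f \<le> 1}" using zero_H1 H1_norm_zero by simp
  then show "{f\<in>H1. H1_norm f \<le> 1} \<noteq> {}" by blast
qed (use assms in blast)

lemma Hm1_norm_upper: "T \<in> Hm1 \<Longrightarrow> f \<in> H1 \<Longrightarrow> H1_norm f \<le> 1 \<Longrightarrow> \<bar>T f\<bar> \<le> Hm1_norm T"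
  unfolding Hm1_norm_def by (rule cSUP_upper) (auto intro: Hm1_norm_bdd)

lemma Hm1_norm_nonneg: "T \<in> Hm1 \<Longrightarrow> 0 \<le> Hm1_norm T"
  using order_trans[OF abs_ge_zero Hm1_norm_upper[OF _ zero_H1]] by (simp add: H1_norm_zero)

lemma Hm1_norm_bound:
  assumes T: "T \<in> Hm1" and f: "f \<in> H1"
  shows "\<bar>T f\<bar> \<le> Hm1_norm T * H1_norm f"
proof (cases "H1_norm f = 0")
  case True
  obtain C where "\<And>f. f \<in> H1 \<Longrightarrow> \<bar>T f\<bar> \<le> C * H1_norm f" using Hm1_bounded[OF T] by blast
  from this[OF f] show ?thesis using True by simp
next
  case False
  then have p: "H1_norm f > 0" using H1_norm_nonneg[of f] by linarith
  have "\<bar>T (\<lambda>x. inverse (H1_norm f) * f x)\<bar> \<le> Hm1_norm T"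
    using p by (intro Hm1_norm_upper T H1_scale f) (simp add: H1_norm_scale[OF f])
  then show ?thesis unfolding Hm1_scale[OF T f] using p by (simp add: abs_mult field_simps)
qed

lemma Hm1_lincomb:
  assumes S: "S \<in> Hm1" and T: "T \<in> Hm1" shows "(\<lambda>f. a * S f + b * T f) \<in> Hm1"
proof -
  obtain C where C: "\<And>f. f \<in> H1 \<Longrightarrow> \<bar>S f\<bar> \<le> C * H1_norm f" using Hm1_bounded[OF S] by blast
  obtain D where D: "\<And>f. f \<in> H1 \<Longrightarrow> \<bar>T f\<bar> \<le> D * H1_norm f" using Hm1_bounded[OF T] by blast
  have "\<bar>a * S f + b * T f\<bar> \<le> (\<bar>a\<bar> * C + \<bar>b\<bar> * D) * H1_norm f" if f: "f \<in> H1" for f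
  proof -
    have "\<bar>a * S f + b * T f\<bar> \<le> \<bar>a\<bar> * \<bar>S f\<bar> + \<bar>b\<bar> * \<bar>T f\<bar>" using abs_triangle_ineq[of "a * S f" "b * T f"] by (simp add: abs_mult)
    also have "\<dots> \<le> \<bar>a\<bar> * (C * H1_norm f) + \<bar>b\<bar> * (D * H1_norm f)"
      by (intro add_mono mult_left_mono C D f) simp_all
    finally show ?thesis by (simp add: algebra_simps)
  qed
  then have bd: "\<exists>C. \<forall>f\<in>H1. \<bar>a * S f + b * T f\<bar> \<le> C * H1_norm f" by blast
  have "a * S (\<lambda>x. u * f x + v * g x) + b * T (\<lambda>x. u * f x + v * g x) = u * (a * S f + b * T f) + v * (a * S g + b * T g)"
    if "f \<in> H1" "g \<in> H1" for f g u v
    unfolding Hm1_lin[OF S that] Hm1_lin[OF T that] by (simp add: algebra_simps)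
  then show ?thesis unfolding Hm1_def using bd S T by (simp add: Hm1_outside)
qed

lemma Hm1_add: "S \<in> Hm1 \<Longrightarrow> T \<in> Hm1 \<Longrightarrow> (\<lambda>f. S f + T f) \<in> Hm1"
  using Hm1_lincomb[of S T 1 1] by simp

lemma Hm1_minus: "S \<in> Hm1 \<Longrightarrow> T \<in> Hm1 \<Longrightarrow> (\<lambda>f. S f - T f) \<in> Hm1"
  using Hm1_lincomb[of S T 1 "-1"] by simp

lemma Hm1_norm_triangle:
  assumes "S \<in> Hm1" "T \<in> Hm1" "U \<in> Hm1"
  shows "Hm1_norm (\<lambda>f. S f - U f) \<le> Hm1_norm (\<lambda>f. S f - T f) + Hm1_norm (\<lambda>f. T f - U f)"
proof (rule Hm1_norm_le)
  fix f assume f: "f \<in> H1" "H1_norm f \<le> 1"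
  have "\<bar>S f - T f\<bar> \<le> Hm1_norm (\<lambda>f. S f - T f)" "\<bar>T f - U f\<bar> \<le> Hm1_norm (\<lambda>f. T f - U f)"
    using Hm1_norm_upper[OF Hm1_minus[OF assms(1,2)] f] Hm1_norm_upper[OF Hm1_minus[OF assms(2,3)] f] by simp_all
  then show "\<bar>S f - U f\<bar> \<le> Hm1_norm (\<lambda>f. S f - T f) + Hm1_norm (\<lambda>f. T f - U f)" by linarith
qed

lemma Hm1_norm_commute: "Hm1_norm (\<lambda>f. S f - T f) = Hm1_norm (\<lambda>f. T f - S f)"
  unfolding Hm1_norm_def by (simp add: abs_minus_commute)

lemma functional_of_H1: "f \<in> H1 \<Longrightarrow> functional_of g f = ip g f"
  by (simp add: functional_of_def ip_def)

lemma functional_of_mode: "functional_of g (mode i) = ip g (mode i)"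
  by (simp add: functional_of_H1)

lemma functional_of_Hm1:
  assumes g: "L2t g" shows "functional_of g \<in> Hm1"
proof -
  have "\<bar>functional_of g f\<bar> \<le> sqrt (ip g g) * H1_norm f" if f: "f \<in> H1" for f
  proof -
    have "\<bar>ip g f\<bar> \<le> sqrt (ip g g) * sqrt (ip f f)" by (rule ip_abs_le[OF g H1_D(2)[OF f]])
    also have "sqrt (ip f f) \<le> H1_norm f"
      using real_sqrt_le_mono[OF L2_le_H1[OF f]] by (simp add: H1_norm_nonneg)
    finally show ?thesis using functional_of_H1[OF f] by (simp add: mult_left_mono ip_self_nonneg)
  qed
  then have bd: "\<exists>C. \<forall>f\<in>H1. \<bar>functional_of g f\<bar> \<le> C * H1_norm f" by blast
  have "functional_of g (\<lambda>x. a * f x + b * h x) = a * functional_of g f + b * functional_of g h"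
    if fh: "f \<in> H1" "h \<in> H1" for f h a b
  proof -
    have "ip (\<lambda>x. a * f x + b * h x) g = a * ip f g + b * ip h g"
      using H1_D(2)[OF fh(1)] H1_D(2)[OF fh(2)] g by (simp add: ip_add_left ip_scale_left L2t_scale)
    then show ?thesis using fh H1_lin[OF fh, of a b] by (simp add: functional_of_H1 ip_commute[of g])
  qed
  then show ?thesis unfolding Hm1_def using bd by (simp add: functional_of_def)
qed

section \<open>Fourier truncation of distributions\<close>

text \<open>The distribution whose density is the trigonometric polynomial with coefficients \<open>u\<close>, normalized to
  vanish outside \<open>H1\<close>.\<close>
definition trunc :: "nat \<Rightarrow> (idx \<Rightarrow> real) \<Rightarrow> functional" where
  "trunc N u = functional_of (\<lambda>x. \<Sum>i\<in>cutoff N. u i * mode i x)"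

lemma trunc_Hm1: "trunc N u \<in> Hm1"
  unfolding trunc_def by (intro functional_of_Hm1 L2t_sum L2t_scale L2t_mode)

lemma trunc_apply: "f \<in> H1 \<Longrightarrow> trunc N u f = (\<Sum>i\<in>cutoff N. u i * ip f (mode i))"
  unfolding trunc_def by (simp add: functional_of_H1 ip_sum_left H1_D(2) ip_commute[of f])

lemma trunc_dist: "Hm1_norm (\<lambda>f. trunc N u f - trunc N v f) \<le> (\<Sum>i\<in>cutoff N. \<bar>u i - v i\<bar>)"
proof (rule Hm1_norm_le)
  fix f assume f: "f \<in> H1" "H1_norm f \<le> 1"
  have b: "\<bar>ip f (mode i)\<bar> \<le> 1" if "i \<in> cutoff N" for i
  proof -
    have "(ip f (mode i))\<^sup>2 \<le> (\<Sum>i\<in>cutoff N. (ip f (mode i))\<^sup>2)"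
      using that by (intro member_le_sum) auto
    also have "\<dots> \<le> (H1_norm f)\<^sup>2" using Bessel[OF H1_D(2)[OF f(1)]] L2_le_H1[OF f(1)] by (rule order_trans)
    also have "\<dots> \<le> 1" using f(2) H1_norm_nonneg by (simp add: power_le_one)
    finally show ?thesis by (simp add: abs_square_le_1)
  qed
  have "\<bar>trunc N u f - trunc N v f\<bar> = \<bar>\<Sum>i\<in>cutoff N. (u i - v i) * ip f (mode i)\<bar>"
    using f by (simp add: trunc_apply left_diff_distrib sum_subtractf)
  also have "\<dots> \<le> (\<Sum>i\<in>cutoff N. \<bar>(u i - v i) * ip f (mode i)\<bar>)" by (rule sum_abs)
  also have "\<dots> \<le> (\<Sum>i\<in>cutoff N. \<bar>u i - v i\<bar>)"
    using b by (intro sum_mono) (simp add: abs_mult mult_left_le)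
  finally show "\<bar>trunc N u f - trunc N v f\<bar> \<le> (\<Sum>i\<in>cutoff N. \<bar>u i - v i\<bar>)" .
qed

text \<open>The dual of the weighted \<open>\<ell>\<^sup>2\<close>-description of \<open>H1\<close>, obtained by testing \<open>T\<close> against the polynomial with
  coefficients \<open>T (mode i) / weight i\<close>.\<close>
lemma Hm1_coeff_bound:
  assumes "T \<in> Hm1"
  obtains K where "\<And>N. (\<Sum>i\<in>cutoff N. (T (mode i))\<^sup>2 / weight i) \<le> K"
proof -
  obtain C where C: "0 \<le> C" "\<And>f. f \<in> H1 \<Longrightarrow> \<bar>T f\<bar> \<le> C * H1_norm f" using Hm1_bounded[OF assms] by blast
  have "(\<Sum>i\<in>cutoff N. (T (mode i))\<^sup>2 / weight i) \<le> C\<^sup>2" for N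
  proof -
    define B where "B = (\<Sum>i\<in>cutoff N. (T (mode i))\<^sup>2 / weight i)"
    let ?c = "\<lambda>i. T (mode i) / weight i"
    let ?p = "\<lambda>x. \<Sum>i\<in>cutoff N. ?c i * mode i x"
    have p: "?p \<in> H1" by (intro H1_trig trig_sum_mode)
    have Tp: "T ?p = B" unfolding Hm1_sum[OF assms finite_cutoff] B_def by (simp add: power2_eq_square)
    have "(H1_norm ?p)\<^sup>2 \<le> (\<Sum>i\<in>cutoff N. weight i * (?c i)\<^sup>2)" by (rule H1_norm_synthesis)
    also have "\<dots> = B" unfolding B_def using weight_pos less_imp_neq[OF weight_pos]
      by (intro sum.cong) (auto simp: power2_eq_square field_simps)
    finally have n: "(H1_norm ?p)\<^sup>2 \<le> B" .
    have B0: "0 \<le> B" unfolding B_def using weight_pos by (intro sum_nonneg) (simp add: less_imp_le)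
    have "B \<le> C * H1_norm ?p" using C(2)[OF p] Tp by simp
    then have "B\<^sup>2 \<le> (C * H1_norm ?p)\<^sup>2" using B0 by (intro power_mono) auto
    also have "\<dots> = C\<^sup>2 * (H1_norm ?p)\<^sup>2" by (simp add: power_mult_distrib)
    also have "\<dots> \<le> C\<^sup>2 * B" by (intro mult_left_mono n) simp
    finally have "B\<^sup>2 \<le> C\<^sup>2 * B" .
    then have "B \<le> C\<^sup>2" using B0 by (cases "B = 0") (auto simp: power2_eq_square)
    then show ?thesis by (simp add: B_def)
  qed
  then show ?thesis using that by blast
qed

lemma Hm1_fourier_series:
  assumes T: "T \<in> Hm1" and f: "f \<in> H1"
  shows "(\<lambda>N. trunc N (\<lambda>i. T (mode i)) f) \<longlonglongrightarrow> T f"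
proof -
  obtain C where C: "0 \<le> C" "\<And>f. f \<in> H1 \<Longrightarrow> \<bar>T f\<bar> \<le> C * H1_norm f" using Hm1_bounded[OF T] by blast
  have "T f - trunc N (\<lambda>i. T (mode i)) f = T (\<lambda>x. f x - proj N f x)" for N
  proof -
    have "T (proj N f) = (\<Sum>i\<in>cutoff N. ip f (mode i) * T (mode i))"
      unfolding proj_def[abs_def] by (rule Hm1_sum[OF T finite_cutoff])
    then show ?thesis unfolding Hm1_diff[OF T f proj_H1] trunc_apply[OF f] by (simp add: mult.commute)
  qed
  moreover have "(\<lambda>x. f x - proj N f x) \<in> H1" for N
    using H1_lin[OF f proj_H1, of 1 "-1" N f] by simp
  ultimately have b: "norm (T f - trunc N (\<lambda>i. T (mode i)) f) \<le> C * H1_norm (\<lambda>x. f x - proj N f x)" for N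
    unfolding real_norm_def by (metis C(2))
  have "(\<lambda>N. C * H1_norm (\<lambda>x. f x - proj N f x)) \<longlonglongrightarrow> C * 0"
    by (intro tendsto_mult tendsto_const H1_norm_residual_tendsto f)
  then have z: "(\<lambda>N. C * H1_norm (\<lambda>x. f x - proj N f x)) \<longlonglongrightarrow> 0" by simp
  have "(\<lambda>N. T f - trunc N (\<lambda>i. T (mode i)) f) \<longlonglongrightarrow> 0"
    by (rule Lim_null_comparison[OF always_eventually[OF allI[OF b]] z])
  from tendsto_diff[OF tendsto_const[of "T f"] this] show ?thesis by simp
qed

text \<open>By Cauchy--Schwarz, the difference of two truncations is bounded on the unit ball of \<open>H1\<close> by a tail
  of the convergent series \<open>\<Sum> (T (mode i))\<^sup>2 / weight i\<close>.\<close>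
lemma trunc_tendsto:
  assumes T: "T \<in> Hm1"
  shows "(\<lambda>N. Hm1_norm (\<lambda>f. trunc N (\<lambda>i. T (mode i)) f - T f)) \<longlonglongrightarrow> 0"
proof -
  let ?s = "\<lambda>N. \<Sum>i\<in>cutoff N. (T (mode i))\<^sup>2 / weight i"
  obtain K where K: "\<And>N. ?s N \<le> K" using Hm1_coeff_bound[OF T] by blast
  have inc: "incseq ?s" by (intro cutoff_incseq) (simp add: weight_pos less_imp_le)
  obtain S where S: "?s \<longlonglongrightarrow> S" "\<And>N. ?s N \<le> S" using incseq_convergent[OF inc, of K] K by blast
  have "Hm1_norm (\<lambda>f. trunc N (\<lambda>i. T (mode i)) f - T f) \<le> sqrt (S - ?s N)" for N
  proof (rule Hm1_norm_le)
    fix f assume f: "f \<in> H1" "H1_norm f \<le> 1"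
    let ?t = "\<lambda>N. trunc N (\<lambda>i. T (mode i)) f"
    have "\<bar>?t N - ?t M\<bar> \<le> sqrt (S - ?s N)" if "M \<ge> N" for M
    proof -
      let ?D = "cutoff M - cutoff N"
      have D: "(\<Sum>i\<in>cutoff M. h i) - (\<Sum>i\<in>cutoff N. h i) = (\<Sum>i\<in>?D. h i)" for h :: "idx \<Rightarrow> real"
        using cutoff_mono[OF that] by (simp add: sum_diff)
      have "?t M - ?t N = (\<Sum>i\<in>?D. T (mode i) * ip f (mode i))" unfolding trunc_apply[OF f(1)] D ..
      also have "\<dots> = (\<Sum>i\<in>?D. (T (mode i) / sqrt (weight i)) * (sqrt (weight i) * ip f (mode i)))"
        using weight_pos less_imp_neq[OF weight_pos] by (intro sum.cong) (auto simp: less_imp_neq[symmetric])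
      finally have e: "?t M - ?t N = (\<Sum>i\<in>?D. (T (mode i) / sqrt (weight i)) * (sqrt (weight i) * ip f (mode i)))" .
      have "(?t M - ?t N)\<^sup>2 \<le> (\<Sum>i\<in>?D. (T (mode i) / sqrt (weight i))\<^sup>2) * (\<Sum>i\<in>?D. (sqrt (weight i) * ip f (mode i))\<^sup>2)"
        unfolding e by (rule Cauchy_Schwarz_ineq_sum)
      also have "(\<Sum>i\<in>?D. (T (mode i) / sqrt (weight i))\<^sup>2) = (\<Sum>i\<in>?D. (T (mode i))\<^sup>2 / weight i)"
        by (simp add: power_divide weight_pos less_imp_le)
      also have "\<dots> = ?s M - ?s N" unfolding D ..
      also have "(\<Sum>i\<in>?D. (sqrt (weight i) * ip f (mode i))\<^sup>2) = (\<Sum>i\<in>?D. weight i * (ip f (mode i))\<^sup>2)"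
        by (simp add: power_mult_distrib weight_pos less_imp_le)
      also have "(?s M - ?s N) * \<dots> \<le> (S - ?s N) * 1"
      proof (rule mult_mono)
        have "(\<Sum>i\<in>?D. weight i * (ip f (mode i))\<^sup>2) \<le> (\<Sum>i\<in>cutoff M. weight i * (ip f (mode i))\<^sup>2)"
          by (intro sum_mono2) (auto simp: weight_pos less_imp_le)
        also have "\<dots> \<le> (H1_norm f)\<^sup>2" by (rule H1_norm_sum_le[OF f(1)])
        also have "\<dots> \<le> 1" using f(2) H1_norm_nonneg by (simp add: power_le_one)
        finally show "(\<Sum>i\<in>?D. weight i * (ip f (mode i))\<^sup>2) \<le> 1" .
        show "0 \<le> (\<Sum>i\<in>?D. weight i * (ip f (mode i))\<^sup>2)" by (intro sum_nonneg) (simp add: weight_pos less_imp_le)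
      qed (use S(2) in auto)
      finally have "sqrt ((?t M - ?t N)\<^sup>2) \<le> sqrt (S - ?s N)" by (intro real_sqrt_le_mono) simp
      then show ?thesis by (simp add: abs_minus_commute)
    qed
    moreover have "(\<lambda>M. \<bar>?t N - ?t M\<bar>) \<longlonglongrightarrow> \<bar>?t N - T f\<bar>"
      by (intro tendsto_intros Hm1_fourier_series T f)
    ultimately show "\<bar>?t N - T f\<bar> \<le> sqrt (S - ?s N)"
      by (intro LIMSEQ_le_const2) auto
  qed
  moreover have "0 \<le> Hm1_norm (\<lambda>f. trunc N (\<lambda>i. T (mode i)) f - T f)" for N
    by (intro Hm1_norm_nonneg Hm1_minus trunc_Hm1 T)
  ultimately have b: "norm (Hm1_norm (\<lambda>f. trunc N (\<lambda>i. T (mode i)) f - T f)) \<le> sqrt (S - ?s N)" for N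
    by simp
  have "(\<lambda>N. sqrt (S - ?s N)) \<longlonglongrightarrow> sqrt (S - S)"
    by (intro tendsto_intros S)
  then have z: "(\<lambda>N. sqrt (S - ?s N)) \<longlonglongrightarrow> 0" by simp
  show ?thesis by (rule Lim_null_comparison[OF always_eventually[OF allI[OF b]] z])
qed

section \<open>The Borel sets are generated by the Fourier coefficients\<close>

abbreviation Hm1_dist :: "functional \<Rightarrow> functional \<Rightarrow> real" where
  "Hm1_dist S T \<equiv> Hm1_norm (\<lambda>f. S f - T f)"

definition Hm1_open :: "functional set \<Rightarrow> bool" where
  "Hm1_open U \<longleftrightarrow> U \<subseteq> Hm1 \<and> (\<forall>S\<in>U. \<exists>r>0. \<forall>T\<in>Hm1. Hm1_dist S T < r \<longrightarrow> T \<in> U)"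

lemma space_Hm1_borel: "space Hm1_borel = Hm1"
  and sets_Hm1_borel: "sets Hm1_borel = sigma_sets Hm1 {U. Hm1_open U}"
  unfolding Hm1_borel_def borel_of_metric_def Hm1_open_def by (simp_all add: space_measure_of_conv sets_measure_of_conv subset_eq)

lemma Hm1_evaluation_measurable:
  assumes f: "f \<in> H1"
  shows "(\<lambda>T. T f) \<in> borel_measurable Hm1_borel"
proof (rule borel_measurableI)
  fix V :: "real set" assume V: "open V"
  have "Hm1_open {T\<in>Hm1. T f \<in> V}"
    unfolding Hm1_open_def
  proof (intro conjI ballI)
    fix S assume "S \<in> {T\<in>Hm1. T f \<in> V}"
    then have S: "S \<in> Hm1" "S f \<in> V" by auto
    obtain e where e: "e > 0" "\<And>y. dist y (S f) < e \<Longrightarrow> y \<in> V" using V S(2) unfolding open_dist by blast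
    define r where "r = e / (H1_norm f + 1)"
    have r: "r > 0" using e H1_norm_nonneg[of f] by (simp add: r_def)
    have "T f \<in> V" if T: "T \<in> Hm1" "Hm1_dist S T < r" for T
    proof (rule e(2))
      have "\<bar>S f - T f\<bar> \<le> Hm1_dist S T * H1_norm f" by (rule Hm1_norm_bound[OF Hm1_minus[OF S(1) T(1)] f])
      also have "\<dots> \<le> r * H1_norm f" using T(2) by (intro mult_right_mono H1_norm_nonneg) simp
      also have "\<dots> < r * (H1_norm f + 1)" using r by simp
      also have "\<dots> = e" using H1_norm_nonneg[of f] by (simp add: r_def)
      finally show "dist (T f) (S f) < e" by (simp add: dist_real_def abs_minus_commute)
    qed
    then show "\<exists>r>0. \<forall>T\<in>Hm1. Hm1_dist S T < r \<longrightarrow> T \<in> {T \<in> Hm1. T f \<in> V}" using r by blast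
  qed blast
  moreover have "(\<lambda>T. T f) -` V \<inter> space Hm1_borel = {T\<in>Hm1. T f \<in> V}" by (auto simp: space_Hm1_borel)
  ultimately show "(\<lambda>T. T f) -` V \<inter> space Hm1_borel \<in> sets Hm1_borel"
    by (simp add: sets_Hm1_borel sigma_sets.Basic)
qed

text \<open>The points of \<open>U\<close> around which \<open>U\<close> contains a ball of radius larger than \<open>1/(m+1)\<close>. These sets are
  again open and exhaust an open \<open>U\<close>; the uniform radius lets membership in \<open>U\<close> be read off from
  the late terms of an approximating sequence.\<close>
definition interior_part :: "functional set \<Rightarrow> nat \<Rightarrow> functional set" where
  "interior_part U m = {T\<in>Hm1. \<exists>r>inverse (real (Suc m)). \<forall>S\<in>Hm1. Hm1_dist T S < r \<longrightarrow> S \<in> U}"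

lemma interior_part_stable:
  assumes "T \<in> interior_part U m"
  obtains r where "r > 0" "\<And>S. S \<in> Hm1 \<Longrightarrow> Hm1_dist T S < r \<Longrightarrow> S \<in> interior_part U m"
proof -
  let ?m = "inverse (real (Suc m))"
  obtain r where T: "T \<in> Hm1" and r: "r > ?m" "\<And>S. S \<in> Hm1 \<Longrightarrow> Hm1_dist T S < r \<Longrightarrow> S \<in> U"
    using assms unfolding interior_part_def by blast
  define s where "s = (r - ?m) / 2"
  have "0 < (r - a) / 2 \<and> a < r - (r - a) / 2" if "a < r" for a
    using that by (simp add: field_simps)
  from this[OF r(1)] have s1: "s > 0" and s2: "r - s > ?m" by (simp_all only: s_def)
  have "S \<in> interior_part U m" if S: "S \<in> Hm1" "Hm1_dist T S < s" for S
  proof -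
    have "R \<in> U" if "R \<in> Hm1" "Hm1_dist S R < r - s" for R
      using Hm1_norm_triangle[OF T S(1) that(1)] S(2) that by (intro r(2)) auto
    then show ?thesis unfolding interior_part_def using S(1) s2 by blast
  qed
  then show ?thesis using that s1 by blast
qed

lemma Hm1_open_iff_trunc:
  assumes U: "Hm1_open U" and T: "T \<in> Hm1"
  shows "T \<in> U \<longleftrightarrow> (\<exists>m. \<exists>N0. \<forall>N\<ge>N0. trunc N (\<lambda>i. T (mode i)) \<in> interior_part U m)"
proof
  assume "T \<in> U"
  then obtain r where r: "r > 0" "\<And>S. S \<in> Hm1 \<Longrightarrow> Hm1_dist T S < r \<Longrightarrow> S \<in> U"
    using U unfolding Hm1_open_def by blast
  obtain m where m: "inverse (real (Suc m)) < r / 2" using reals_Archimedean[of "r / 2"] r(1) by auto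
  have "eventually (\<lambda>N. Hm1_dist (trunc N (\<lambda>i. T (mode i))) T < r / 2) sequentially"
    using order_tendstoD(2)[OF trunc_tendsto[OF T], of "r / 2"] r(1) by simp
  then obtain N0 where N0: "\<And>N. N \<ge> N0 \<Longrightarrow> Hm1_dist (trunc N (\<lambda>i. T (mode i))) T < r / 2"
    unfolding eventually_sequentially by blast
  have "trunc N (\<lambda>i. T (mode i)) \<in> interior_part U m" if "N \<ge> N0" for N
  proof -
    have "S \<in> U" if "S \<in> Hm1" "Hm1_dist (trunc N (\<lambda>i. T (mode i))) S < r / 2" for S
      using Hm1_norm_triangle[OF T trunc_Hm1 that(1), of N "\<lambda>i. T (mode i)"] N0[OF \<open>N \<ge> N0\<close>] that
        Hm1_norm_commute[of T "trunc N (\<lambda>i. T (mode i))"] by (intro r(2)) auto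
    then show ?thesis unfolding interior_part_def using m trunc_Hm1 by blast
  qed
  then show "\<exists>m. \<exists>N0. \<forall>N\<ge>N0. trunc N (\<lambda>i. T (mode i)) \<in> interior_part U m" by blast
next
  assume "\<exists>m. \<exists>N0. \<forall>N\<ge>N0. trunc N (\<lambda>i. T (mode i)) \<in> interior_part U m"
  then obtain m N0 where N0: "\<And>N. N \<ge> N0 \<Longrightarrow> trunc N (\<lambda>i. T (mode i)) \<in> interior_part U m" by blast
  have "eventually (\<lambda>N. Hm1_dist (trunc N (\<lambda>i. T (mode i))) T < inverse (real (Suc m))) sequentially"
    by (rule order_tendstoD(2)[OF trunc_tendsto[OF T]]) simp
  then obtain N1 where N1: "\<And>N. N \<ge> N1 \<Longrightarrow> Hm1_dist (trunc N (\<lambda>i. T (mode i))) T < inverse (real (Suc m))"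
    unfolding eventually_sequentially by blast
  let ?N = "max N0 N1"
  obtain r where "r > inverse (real (Suc m))" "\<And>S. S \<in> Hm1 \<Longrightarrow> Hm1_dist (trunc ?N (\<lambda>i. T (mode i))) S < r \<Longrightarrow> S \<in> U"
    using N0[of ?N] unfolding interior_part_def by auto
  then show "T \<in> U" using N1[of ?N] T by simp
qed

lemma open_trunc_vimage: "open {u :: idx \<Rightarrow> real. trunc N u \<in> interior_part U m}"
  unfolding open_subopen[of "{u :: idx \<Rightarrow> real. trunc N u \<in> interior_part U m}"]
proof (rule ballI)
  fix u :: "idx \<Rightarrow> real" assume "u \<in> {u. trunc N u \<in> interior_part U m}"
  then have "trunc N u \<in> interior_part U m" by simp
  then obtain r where r: "r > 0" "\<And>S. S \<in> Hm1 \<Longrightarrow> Hm1_dist (trunc N u) S < r \<Longrightarrow> S \<in> interior_part U m"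
    using interior_part_stable by blast
  let ?T = "{v :: idx \<Rightarrow> real. (\<Sum>i\<in>cutoff N. \<bar>u i - v i\<bar>) < r}"
  have "open ?T"
    by (intro open_Collect_less continuous_intros continuous_on_product_coordinates)
  moreover have "u \<in> ?T" using r by simp
  moreover have "?T \<subseteq> {u. trunc N u \<in> interior_part U m}"
    using r(2)[OF trunc_Hm1] trunc_dist[of N u] by (auto intro: le_less_trans)
  ultimately show "\<exists>T. open T \<and> u \<in> T \<and> T \<subseteq> {u. trunc N u \<in> interior_part U m}" by blast
qed

definition coeffs :: "functional \<Rightarrow> idx \<Rightarrow> real" where "coeffs T = (\<lambda>i. T (mode i))"

text \<open>Since \<open>T\<close> is the limit of its Fourier truncations, membership of \<open>T\<close> in an open set is a countable
  combination of conditions on truncations, and these are open conditions on the coefficients.\<close>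
theorem Hm1_borel_measurableI:
  assumes X: "\<And>\<omega>. \<omega> \<in> space M \<Longrightarrow> X \<omega> \<in> Hm1"
    and m: "\<And>i. (\<lambda>\<omega>. X \<omega> (mode i)) \<in> borel_measurable M"
  shows "X \<in> measurable M Hm1_borel"
proof -
  have c: "(\<lambda>\<omega>. coeffs (X \<omega>)) \<in> borel_measurable M"
    unfolding coeffs_def by (rule measurable_coordinatewise_then_product) (rule m)
  have "X -` U \<inter> space M \<in> sets M" if U: "Hm1_open U" for U
  proof -
    have "{\<omega>\<in>space M. trunc N (coeffs (X \<omega>)) \<in> interior_part U m} \<in> sets M" for N m
    proof -
      have "(\<lambda>\<omega>. coeffs (X \<omega>)) -` {u. trunc N u \<in> interior_part U m} \<inter> space M \<in> sets M"
        by (rule measurable_sets[OF c borel_open[OF open_trunc_vimage]])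
      also have "(\<lambda>\<omega>. coeffs (X \<omega>)) -` {u. trunc N u \<in> interior_part U m} \<inter> space M = {\<omega>\<in>space M. trunc N (coeffs (X \<omega>)) \<in> interior_part U m}"
        by auto
      finally show ?thesis .
    qed
    then have "(\<Union>m. \<Union>N0. \<Inter>N\<in>{N0..}. {\<omega>\<in>space M. trunc N (coeffs (X \<omega>)) \<in> interior_part U m}) \<in> sets M"
      by (intro sets.countable_UN sets.countable_INT'') auto
    also have "(\<Union>m. \<Union>N0. \<Inter>N\<in>{N0..}. {\<omega>\<in>space M. trunc N (coeffs (X \<omega>)) \<in> interior_part U m}) = X -` U \<inter> space M"
      using Hm1_open_iff_trunc[OF U X] unfolding coeffs_def by fastforce
    finally show ?thesis .
  qed
  then show ?thesis
    unfolding Hm1_borel_def borel_of_metric_def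
    by (intro measurable_measure_of) (auto simp: X Hm1_open_def)
qed

text \<open>Two laws on the dual space are therefore equal as soon as the laws of the coefficient sequences are.\<close>
corollary Hm1_borel_coeffs:
  assumes "A \<in> sets Hm1_borel"
  obtains B where "B \<in> sets borel" "A = {T\<in>Hm1. coeffs T \<in> B}"
proof -
  let ?M = "vimage_algebra Hm1 coeffs borel"
  have c: "coeffs \<in> measurable ?M borel" by (rule measurable_vimage_algebra1) simp
  have "(\<lambda>T. T (mode i)) \<in> borel_measurable ?M" for i
    using measurable_compose[OF c borel_measurable_continuous_onI[OF continuous_on_product_coordinates[of i]]]
    by (simp add: coeffs_def)
  then have "(\<lambda>T. T) \<in> measurable ?M Hm1_borel"
    by (intro Hm1_borel_measurableI) auto
  from measurable_sets[OF this assms] have "A \<inter> Hm1 \<in> sets ?M"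
    by (simp add: Int_commute vimage_def)
  moreover have "A \<subseteq> Hm1" using sets.sets_into_space[OF assms] by (simp add: space_Hm1_borel)
  ultimately have "A \<in> sets ?M" by (simp add: Int_absorb2)
  then show ?thesis using that by (auto simp: sets_vimage_algebra2 vimage_def)
qed

section \<open>Circle averages of the Fourier modes\<close>

text \<open>A van der Corput type bound for the Bessel function \<open>J\<^sub>0\<close>, with exponent \<open>1/3\<close> in place of the optimal \<open>1/2\<close>. With
  \<open>g\<close> the oscillating part of the phase, write \<open>cos(\<psi> + g)\<close> as the derivative of
  \<open>sin(\<psi> + g) g' / (g'\<^sup>2 + E)\<close> plus errors; the regularization \<open>E > 0\<close> avoids a separate treatment of the
  stationary points. The integral of the derivative vanishes by periodicity, and the choice
  \<open>E = \<rho>\<^sup>4\<close> balances the errors. The only nontrivial error is the integral of \<open>g\<^sup>2 / (g'\<^sup>2 + E)\<close>, which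
  is evaluated through the periodic function \<open>g arctan(g' / \<rho>\<^sup>2)\<close>.\<close>
lemma oscillatory_integral:
  fixes A B \<psi> \<rho> :: real
  assumes r: "A\<^sup>2 + B\<^sup>2 = (\<rho> ^ 3)\<^sup>2" and \<rho>: "\<rho> \<ge> 1"
  shows "\<bar>integral {0..2 * pi} (\<lambda>t. cos (\<psi> + (A * cos t + B * sin t)))\<bar> \<le> (4 * pi + pi\<^sup>2) / \<rho>"
proof -
  define g where "g t = A * cos t + B * sin t" for t
  define g' where "g' t = B * cos t - A * sin t" for t
  define E where "E = \<rho> ^ 4"
  have E: "E > 0" "sqrt E = \<rho>\<^sup>2" using \<rho> by (auto simp: E_def real_sqrt_unique power_mult[symmetric])
  have dg: "(g has_real_derivative g' t) (at t)" "(g' has_real_derivative - g t) (at t)" for t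
    unfolding g_def[abs_def] g'_def[abs_def] by (auto intro!: derivative_eq_intros simp: algebra_simps)
  have cg [continuous_intros]: "continuous_on S g" "continuous_on S g'" for S
    unfolding g_def[abs_def] g'_def[abs_def] by (intro continuous_intros)+
  have pyth: "(g t)\<^sup>2 + (g' t)\<^sup>2 = (\<rho> ^ 3)\<^sup>2" for t
  proof -
    have "(g t)\<^sup>2 + (g' t)\<^sup>2 = (A\<^sup>2 + B\<^sup>2) * ((sin t)\<^sup>2 + (cos t)\<^sup>2)"
      unfolding g_def g'_def by (simp only: power2_eq_square) algebra
    then show ?thesis using r by simp
  qed
  have gb: "\<bar>g t\<bar> \<le> \<rho> ^ 3" "\<bar>g' t\<bar> \<le> \<rho> ^ 3" for t
    using pyth[of t] \<rho> by (auto intro!: power2_le_imp_le[of "\<bar>_\<bar>"] simp: sum_power2_ge_zero) (metis add.commute le_add_same_cancel2 zero_le_power2)+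
  have den: "(g' t)\<^sup>2 + E > 0" for t using E by (simp add: add_nonneg_pos)
  have per: "g (2 * pi) = g 0" "g' (2 * pi) = g' 0" by (simp_all add: g_def g'_def)
  \<comment> \<open>\<open>P\<close> and \<open>Q\<close> are the two periodic antiderivatives, \<open>P'\<close> and \<open>Q'\<close> their derivatives.\<close>
  define P where "P t = sin (\<psi> + g t) * (g' t / ((g' t)\<^sup>2 + E))" for t
  define P' where "P' t = cos (\<psi> + g t) * (g' t)\<^sup>2 / ((g' t)\<^sup>2 + E)
      + sin (\<psi> + g t) * (- g t * (E - (g' t)\<^sup>2) / ((g' t)\<^sup>2 + E)\<^sup>2)" for t
  define Q where "Q t = g t * arctan (g' t / \<rho>\<^sup>2)" for t
  define Q' where "Q' t = g' t * arctan (g' t / \<rho>\<^sup>2) - (g t)\<^sup>2 * \<rho>\<^sup>2 / ((g' t)\<^sup>2 + E)" for t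
  have dH: "((\<lambda>t. g' t / ((g' t)\<^sup>2 + E)) has_real_derivative (- g t * (E - (g' t)\<^sup>2) / ((g' t)\<^sup>2 + E)\<^sup>2)) (at t)" for t
    using den[of t]
    by (auto intro!: derivative_eq_intros dg simp: power2_eq_square field_simps)
  have dS: "((\<lambda>t. sin (\<psi> + g t)) has_real_derivative cos (\<psi> + g t) * g' t) (at t)" for t
    by (auto intro!: derivative_eq_intros dg)
  have dP: "(P has_real_derivative P' t) (at t)" for t
    unfolding P_def[abs_def] P'_def
    by (rule DERIV_cong[OF DERIV_mult[OF dS dH]]) (simp add: power2_eq_square ac_simps)
  have dQ: "(Q has_real_derivative Q' t) (at t)" for t
    unfolding Q_def[abs_def] Q'_def using den[of t] \<rho>
    by (auto intro!: derivative_eq_intros dg simp: E_def power2_eq_square eval_nat_numeral divide_simps add_nonneg_eq_0_iff algebra_simps)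
  have FTC: "(f' has_integral (f (2 * pi) - f 0)) {0..2 * pi}"
    if "\<And>t. (f has_real_derivative f' t) (at t)" for f f' :: "real \<Rightarrow> real"
    using that by (intro fundamental_theorem_of_calculus)
      (auto simp: has_real_derivative_iff_has_vector_derivative[symmetric] intro: has_field_derivative_at_within)
  have IP: "(P' has_integral 0) {0..2 * pi}" and IQ: "(Q' has_integral 0) {0..2 * pi}"
    using FTC[OF dP] FTC[OF dQ] by (simp_all add: P_def Q_def per)
  have ne: "(g' t)\<^sup>2 + E \<noteq> 0" for t using den[of t] by simp
  have int: "f integrable_on {0..2 * pi}" if "continuous_on {0..2 * pi} f" for f :: "real \<Rightarrow> real"
    using that by (rule integrable_continuous_real)
  let ?u = "\<lambda>t. (g t)\<^sup>2 / ((g' t)\<^sup>2 + E)"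
  have iu: "?u integrable_on {0..2 * pi}"
    by (intro int continuous_intros) (use ne in auto)
  have iat: "(\<lambda>t. g' t * arctan (g' t / \<rho>\<^sup>2)) integrable_on {0..2 * pi}"
    using \<rho> by (intro int continuous_intros) auto
  have "integral {0..2 * pi} Q' = integral {0..2 * pi} (\<lambda>t. g' t * arctan (g' t / \<rho>\<^sup>2)) - \<rho>\<^sup>2 * integral {0..2 * pi} ?u"
  proof -
    have "Q' = (\<lambda>t. g' t * arctan (g' t / \<rho>\<^sup>2) - \<rho>\<^sup>2 * ?u t)"
      by (auto simp: Q'_def fun_eq_iff)
    then show ?thesis
      using iu iat by (simp only: integral_diff[OF iat integrable_on_mult_right[OF iu]] integral_mult_right)
  qed
  then have "\<rho>\<^sup>2 * integral {0..2 * pi} ?u = integral {0..2 * pi} (\<lambda>t. g' t * arctan (g' t / \<rho>\<^sup>2))"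
    using IQ by (simp add: integral_unique)
  also have "\<dots> \<le> integral {0..2 * pi} (\<lambda>t. \<rho> ^ 3 * (pi / 2))"
  proof (rule integral_le[OF iat])
    fix t
    have "\<bar>arctan (g' t / \<rho>\<^sup>2)\<bar> \<le> pi / 2" using arctan_lbound[of "g' t / \<rho>\<^sup>2"] arctan_ubound[of "g' t / \<rho>\<^sup>2"] by linarith
    then have "\<bar>g' t\<bar> * \<bar>arctan (g' t / \<rho>\<^sup>2)\<bar> \<le> \<rho> ^ 3 * (pi / 2)"
      using gb(2)[of t] \<rho> by (intro mult_mono) auto
    then show "g' t * arctan (g' t / \<rho>\<^sup>2) \<le> \<rho> ^ 3 * (pi / 2)" unfolding abs_mult[symmetric] by linarith
  qed (rule integrable_const_ivl)
  also have "\<dots> = \<rho>\<^sup>2 * (pi\<^sup>2 * \<rho>)" by (simp add: power2_eq_square power3_eq_cube)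
  finally have Iu: "integral {0..2 * pi} ?u \<le> pi\<^sup>2 * \<rho>" using \<rho> by simp
  let ?c = "\<lambda>t. cos (\<psi> + g t)"
  define R where "R t = P' t - ?c t" for t
  have ic: "?c integrable_on {0..2 * pi}" by (intro int continuous_intros)
  have iR: "R integrable_on {0..2 * pi}" unfolding R_def[abs_def]
    by (rule integrable_diff[OF has_integral_integrable[OF IP] ic])
  have "integral {0..2 * pi} R = - integral {0..2 * pi} ?c"
    unfolding R_def[abs_def] using integral_diff[OF has_integral_integrable[OF IP] ic] IP by (simp add: integral_unique)
  then have "\<bar>integral {0..2 * pi} ?c\<bar> = norm (integral {0..2 * pi} R)" by simp
  also have "\<dots> \<le> integral {0..2 * pi} (\<lambda>t. (1 / \<rho> + 1 / \<rho>\<^sup>2) + (1 / \<rho>\<^sup>2) * ?u t)"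
  proof (rule integral_norm_bound_integral[OF iR])
    show "(\<lambda>t. (1 / \<rho> + 1 / \<rho>\<^sup>2) + (1 / \<rho>\<^sup>2) * ?u t) integrable_on {0..2 * pi}"
      by (intro integrable_add integrable_on_mult_right iu) auto
    fix t
    let ?d = "(g' t)\<^sup>2 + E"
    have Rt: "R t = sin (\<psi> + g t) * (- g t * (E - (g' t)\<^sup>2) / ?d\<^sup>2) - cos (\<psi> + g t) * (E / ?d)"
    proof -
      have "cos (\<psi> + g t) = cos (\<psi> + g t) * (((g' t)\<^sup>2 + E) / ?d)" using ne[of t] by simp
      also have "\<dots> = cos (\<psi> + g t) * (g' t)\<^sup>2 / ?d + cos (\<psi> + g t) * (E / ?d)"
        by (simp only: add_divide_distrib distrib_left times_divide_eq_right)
      finally show ?thesis unfolding R_def P'_def by linarith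
    qed
    have "\<bar>sin (\<psi> + g t) * (- g t * (E - (g' t)\<^sup>2) / ?d\<^sup>2)\<bar> \<le> 1 * (\<rho> ^ 3 * ?d / ?d\<^sup>2)"
    proof -
      have "\<bar>E - (g' t)\<^sup>2\<bar> \<le> ?d" using E zero_le_power2[of "g' t"] by linarith
      then have "\<bar>- g t * (E - (g' t)\<^sup>2)\<bar> \<le> \<rho> ^ 3 * ?d"
        unfolding abs_mult using gb(1)[of t] \<rho> by (intro mult_mono) auto
      then have "\<bar>- g t * (E - (g' t)\<^sup>2) / ?d\<^sup>2\<bar> \<le> \<rho> ^ 3 * ?d / ?d\<^sup>2"
        unfolding abs_divide abs_power2 by (rule divide_right_mono) simp
      then show ?thesis unfolding abs_mult[of "sin _"] by (intro mult_mono) auto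
    qed
    also have "1 * (\<rho> ^ 3 * ?d / ?d\<^sup>2) = \<rho> ^ 3 / ?d" using ne[of t] by (simp add: power2_eq_square)
    also have "\<dots> \<le> \<rho> ^ 3 / E" using \<rho> E den[of t] by (intro divide_left_mono) auto
    also have "\<dots> = 1 / \<rho>" using \<rho> by (simp add: E_def power3_eq_cube power4_eq_xxxx)
    finally have 1: "\<bar>sin (\<psi> + g t) * (- g t * (E - (g' t)\<^sup>2) / ?d\<^sup>2)\<bar> \<le> 1 / \<rho>" .
    have "\<bar>cos (\<psi> + g t) * (E / ?d)\<bar> \<le> 1 * (E / ?d)"
      unfolding abs_mult using E den[of t] by (intro mult_mono) auto
    also have "1 * (E / ?d) = (1 / \<rho>\<^sup>2) * (((g t)\<^sup>2 + (g' t)\<^sup>2) / ?d)"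
    proof -
      have "(\<rho> ^ 3)\<^sup>2 = \<rho>\<^sup>2 * E" by (simp add: E_def power_mult[symmetric] power_add[symmetric])
      then show ?thesis unfolding pyth using \<rho> by simp
    qed
    also have "\<dots> \<le> (1 / \<rho>\<^sup>2) * (?u t + 1)"
    proof (rule mult_left_mono)
      have "(g' t)\<^sup>2 / ?d \<le> 1" using den[of t] E by simp
      then show "((g t)\<^sup>2 + (g' t)\<^sup>2) / ?d \<le> ?u t + 1" unfolding add_divide_distrib by simp
    qed simp
    finally have 2: "\<bar>cos (\<psi> + g t) * (E / ?d)\<bar> \<le> (1 / \<rho>\<^sup>2) * (?u t + 1)" .
    have "\<bar>R t\<bar> \<le> 1 / \<rho> + (1 / \<rho>\<^sup>2) * (?u t + 1)"
      unfolding Rt by (rule order_trans[OF abs_triangle_ineq4 add_mono[OF 1 2]])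
    then show "norm (R t) \<le> (1 / \<rho> + 1 / \<rho>\<^sup>2) + (1 / \<rho>\<^sup>2) * ?u t"
      by (simp only: real_norm_def distrib_left mult_1_right)
  qed
  also have "\<dots> = 2 * pi * (1 / \<rho> + 1 / \<rho>\<^sup>2) + (1 / \<rho>\<^sup>2) * integral {0..2 * pi} ?u"
    using integral_add[of "\<lambda>t. 1 / \<rho> + 1 / \<rho>\<^sup>2" "{0..2*pi}" "\<lambda>t. (1 / \<rho>\<^sup>2) * ?u t"] integrable_on_mult_right[OF iu, of "1 / \<rho>\<^sup>2"]
    by (simp only: integral_mult_right integral_const_real integrable_const_ivl) simp
  also have "\<dots> \<le> 2 * pi * (1 / \<rho> + 1 / \<rho>) + (1 / \<rho>\<^sup>2) * (pi\<^sup>2 * \<rho>)"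
  proof (intro add_mono mult_left_mono Iu order_refl)
    show "1 / \<rho>\<^sup>2 \<le> 1 / \<rho>" using \<rho> by (simp add: field_simps power2_eq_square)
  qed auto
  also have "\<dots> = (4 * pi + pi\<^sup>2) / \<rho>" using \<rho> by (simp add: field_simps power2_eq_square)
  finally show ?thesis by (simp add: g_def)
qed

text \<open>The eigenvalue is \<open>4\<pi>\<^sup>2\<close> times the squared length of \<open>(k, l)\<close> in the dual metric.\<close>
lemma eigenvalue_eq:
  assumes "Im \<tau> > 0"
  shows "eigenvalue \<tau> (k, l, b) = (2 * pi)\<^sup>2 * ((of_int k)\<^sup>2 + ((of_int l - of_int k * Re \<tau>) / Im \<tau>)\<^sup>2)"
proof -
  have "(d1 (k, l, b))\<^sup>2 = (2 * pi * of_int k)\<^sup>2" "(d2 (k, l, b))\<^sup>2 = (2 * pi * of_int l)\<^sup>2"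
    "d1 (k, l, b) * d2 (k, l, b) = (2 * pi * of_int k) * (2 * pi * of_int l)"
    by (cases b; simp add: d1_def d2_def power2_eq_square)+
  then show ?thesis
    using assms unfolding eigenvalue_def by (simp add: cmod_power2) (simp add: power2_eq_square field_simps)
qed

lemma eigenvalue_nonneg: "Im \<tau> > 0 \<Longrightarrow> 0 \<le> eigenvalue \<tau> i"
  by (cases i) (simp add: eigenvalue_eq)

lemma eigenvalue_level:
  assumes "Im \<tau> > 0"
  shows "(real (level i) / (1 + \<bar>Re \<tau>\<bar> + Im \<tau>))\<^sup>2 \<le> eigenvalue \<tau> i"
proof -
  obtain k l b where i: "i = (k, l, b)" by (cases i)
  define w where "w = (of_int l - of_int k * Re \<tau>) / Im \<tau>"
  define K where "K = 1 + \<bar>Re \<tau>\<bar> + Im \<tau>"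
  have K: "K > 0" using assms by (simp add: K_def)
  have l: "of_int l = w * Im \<tau> + of_int k * Re \<tau>" using assms by (simp add: w_def)
  have "real (level i) = max \<bar>of_int k\<bar> \<bar>of_int l\<bar>" by (simp add: i level_def of_int_max flip: of_int_abs)
  also have "\<dots> \<le> \<bar>of_int k\<bar> + \<bar>of_int l\<bar>" by simp
  also have "\<dots> \<le> \<bar>of_int k\<bar> + (\<bar>w\<bar> * Im \<tau> + \<bar>of_int k\<bar> * \<bar>Re \<tau>\<bar>)"
    unfolding l using assms abs_triangle_ineq[of "w * Im \<tau>" "of_int k * Re \<tau>"] by (simp add: abs_mult)
  also have "\<dots> \<le> K * (\<bar>of_int k\<bar> + \<bar>w\<bar>)"
    using assms by (simp add: K_def algebra_simps)
  finally have "real (level i) / K \<le> \<bar>of_int k\<bar> + \<bar>w\<bar>" using K by (simp add: field_simps)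
  then have "(real (level i) / K)\<^sup>2 \<le> (\<bar>of_int k\<bar> + \<bar>w\<bar>)\<^sup>2" using K by (intro power_mono) auto
  also have "\<dots> \<le> 2 * ((of_int k)\<^sup>2 + w\<^sup>2)"
    using sum_squares_bound[of "\<bar>of_int k :: real\<bar>" "\<bar>w\<bar>"] by (simp add: power2_sum)
  also have "\<dots> \<le> (2 * pi)\<^sup>2 * ((of_int k)\<^sup>2 + w\<^sup>2)"
  proof (rule mult_right_mono)
    have "2 * 1 \<le> 2 * pi" using pi_gt3 by simp
    from power_mono[OF this, of 2] show "2 \<le> (2 * pi)\<^sup>2" by simp
  qed simp
  finally show ?thesis by (simp add: i eigenvalue_eq[OF assms] w_def K_def)
qed

definition circ_mean :: "complex \<Rightarrow> real \<Rightarrow> idx \<Rightarrow> pt \<Rightarrow> real" where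
  "circ_mean \<tau> \<epsilon> i x = 1 / (2 * pi) * (LINT \<theta>:{0..2 * pi}|lborel. mode i (x + circle_map \<tau> (of_real \<epsilon> * cis \<theta>)))"

lemma circle_map_cis: "circle_map \<tau> (of_real \<epsilon> * cis \<theta>) = (\<epsilon> * cos \<theta> - Re \<tau> / Im \<tau> * (\<epsilon> * sin \<theta>), \<epsilon> * sin \<theta> / Im \<tau>)"
  by (simp add: circle_map_def)

lemma mode_circle_continuous_pair:
  "continuous_on S (\<lambda>p :: pt \<times> real. mode i (fst p + circle_map \<tau> (of_real \<epsilon> * cis (snd p))))"
proof -
  obtain c d where cd: "Re \<tau> / Im \<tau> = c" "inverse (Im \<tau>) = d" by blast
  have "(\<lambda>p :: pt \<times> real. fst p + circle_map \<tau> (of_real \<epsilon> * cis (snd p)))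
     = (\<lambda>p. fst p + (\<epsilon> * cos (snd p) - c * (\<epsilon> * sin (snd p)), \<epsilon> * sin (snd p) * d))"
    unfolding circle_map_cis divide_inverse[of "_ * _"] cd ..
  moreover have "continuous_on S (\<lambda>p :: pt \<times> real. fst p + (\<epsilon> * cos (snd p) - c * (\<epsilon> * sin (snd p)), \<epsilon> * sin (snd p) * d))"
    by (intro continuous_intros)
  ultimately have "continuous_on S (\<lambda>p :: pt \<times> real. fst p + circle_map \<tau> (of_real \<epsilon> * cis (snd p)))"
    by (simp only:)
  then show ?thesis
    by (rule continuous_on_compose2[OF mode_continuous[of UNIV i]]) simp
qed

lemma mode_circle_continuous:
  "continuous_on S (\<lambda>\<theta>. mode i (x + circle_map \<tau> (of_real \<epsilon> * cis \<theta>)))"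
  using continuous_on_compose2[OF mode_circle_continuous_pair[of UNIV], of S "\<lambda>\<theta>. (x, \<theta>)"]
  by (simp add: continuous_on_Pair)

lemma circle_avg_series:
  "circle_avg \<tau> \<epsilon> Y x = lim (\<lambda>N. \<Sum>i\<in>cutoff N. Y (mode i) * circ_mean \<tau> \<epsilon> i x)"
proof -
  have "1 / (2 * pi) * (LINT \<theta>:{0..2 * pi}|lborel. fourier_trunc N Y (x + circle_map \<tau> (of_real \<epsilon> * cis \<theta>)))
      = (\<Sum>i\<in>cutoff N. Y (mode i) * circ_mean \<tau> \<epsilon> i x)" for N
  proof -
    have i: "set_integrable lborel {0..2 * pi} (\<lambda>\<theta>. mode i (x + circle_map \<tau> (of_real \<epsilon> * cis \<theta>)))" for i
      by (rule borel_integrable_atLeastAtMost'[OF mode_circle_continuous])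
    have "(LINT \<theta>:{0..2 * pi}|lborel. fourier_trunc N Y (x + circle_map \<tau> (of_real \<epsilon> * cis \<theta>)))
      = (\<Sum>i\<in>cutoff N. LINT \<theta>:{0..2 * pi}|lborel. Y (mode i) * mode i (x + circle_map \<tau> (of_real \<epsilon> * cis \<theta>)))"
      unfolding fourier_trunc_mode set_lebesgue_integral_def scaleR_sum_right
      by (intro Bochner_Integration.integral_sum set_integrable_mult_right[unfolded set_integrable_def, OF i[unfolded set_integrable_def]])
    also have "\<dots> = (\<Sum>i\<in>cutoff N. Y (mode i) * (LINT \<theta>:{0..2 * pi}|lborel. mode i (x + circle_map \<tau> (of_real \<epsilon> * cis \<theta>))))"
      by simp
    finally show ?thesis by (simp add: circ_mean_def sum_divide_distrib)
  qed
  then show ?thesis unfolding circle_avg_def by simp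
qed

lemma circ_mean_const: "circ_mean \<tau> \<epsilon> (0, 0, True) x = 1"
  by (simp add: circ_mean_def mode_cos set_lebesgue_integral_def)

lemma circ_mean_measurable [measurable]: "circ_mean \<tau> \<epsilon> i \<in> borel_measurable borel"
proof -
  have sb: "sets ((borel :: pt measure) \<Otimes>\<^sub>M (lborel :: real measure)) = sets borel"
    unfolding borel_prod[symmetric] by (rule sets_pair_measure_cong[OF refl sets_lborel])
  note borel_measurable_continuous_onI[OF mode_circle_continuous_pair]
  then have [measurable]: "(\<lambda>p. mode i (fst p + circle_map \<tau> (of_real \<epsilon> * cis (snd p)))) \<in> borel_measurable (borel \<Otimes>\<^sub>M lborel)"
    by (subst measurable_cong_sets[OF sb refl])
  have "(\<lambda>p. indicator {0..2 * pi} (snd p) *\<^sub>R mode i (fst p + circle_map \<tau> (of_real \<epsilon> * cis (snd p)))) \<in> borel_measurable (borel \<Otimes>\<^sub>M lborel)"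
    by measurable
  then have "(\<lambda>x. LINT \<theta>|lborel. indicator {0..2 * pi} \<theta> *\<^sub>R mode i (x + circle_map \<tau> (of_real \<epsilon> * cis \<theta>))) \<in> borel_measurable borel"
    by (intro lborel.borel_measurable_lebesgue_integral) (simp add: case_prod_beta')
  then show ?thesis unfolding circ_mean_def[abs_def] set_lebesgue_integral_def by simp
qed

text \<open>On the circle the phase of a mode is \<open>\<psi> + A cos \<theta> + B sin \<theta>\<close> with \<open>A\<^sup>2 + B\<^sup>2 = \<epsilon>\<^sup>2\<close> times the
  eigenvalue, which grows at least like the square of the level.\<close>
lemma circ_mean_decay:
  assumes \<tau>: "Im \<tau> > 0" and \<epsilon>: "\<epsilon> > 0"
  obtains K where "0 \<le> K" "\<And>i x. 1 \<le> level i \<Longrightarrow> \<bar>circ_mean \<tau> \<epsilon> i x\<bar> \<le> K / root 3 (real (level i))"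
proof -
  define C where "C = 1 + \<bar>Re \<tau>\<bar> + Im \<tau>"
  have C: "C > 0" using \<tau> by (simp add: C_def)
  define K where "K = 4 * root 3 (C / \<epsilon>)"
  have "\<bar>circ_mean \<tau> \<epsilon> i x\<bar> \<le> K / root 3 (real (level i))" if lev: "1 \<le> level i" for i x
  proof -
    obtain k l b where i: "i = (k, l, b)" by (cases i)
    define A B where "A = 2 * pi * \<epsilon> * of_int k" and "B = 2 * pi * \<epsilon> * ((of_int l - of_int k * Re \<tau>) / Im \<tau>)"
    define r where "r = \<epsilon> * sqrt (eigenvalue \<tau> i)"
    define \<psi> where "\<psi> = 2 * pi * (of_int k * fst x + of_int l * snd x) + (if b then 0 else - pi / 2)"
    have AB: "A\<^sup>2 + B\<^sup>2 = r\<^sup>2"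
      unfolding r_def power_mult_distrib real_sqrt_pow2[OF eigenvalue_nonneg[OF \<tau>, of i]]
      unfolding i eigenvalue_eq[OF \<tau>] A_def B_def power_mult_distrib by (simp only: distrib_left) (simp only: ac_simps)
    have m: "mode i (x + circle_map \<tau> (of_real \<epsilon> * cis t)) = cos (\<psi> + (A * cos t + B * sin t))" for t
    proof -
      have ph: "2 * pi * (of_int k * fst (x + circle_map \<tau> (of_real \<epsilon> * cis t)) + of_int l * snd (x + circle_map \<tau> (of_real \<epsilon> * cis t)))
         = 2 * pi * (of_int k * fst x + of_int l * snd x) + (A * cos t + B * sin t)"
        unfolding circle_map_cis fst_add snd_add fst_conv snd_conv A_def B_def using \<tau> by (simp add: field_simps)
      show ?thesis
      proof (cases b)
        case True
        then show ?thesis unfolding i mode_def prod.case ph by (simp add: \<psi>_def)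
      next
        case False
        have "sin u = cos (u - pi / 2)" for u by (simp add: cos_diff)
        then show ?thesis using False unfolding i mode_def prod.case ph by (simp add: \<psi>_def algebra_simps)
      qed
    qed
    have cm: "circ_mean \<tau> \<epsilon> i x = integral {0..2 * pi} (\<lambda>t. cos (\<psi> + (A * cos t + B * sin t))) / (2 * pi)"
      unfolding circ_mean_def m
      by (subst set_borel_integral_eq_integral) (auto intro!: borel_integrable_atLeastAtMost' continuous_intros)
    have lo: "\<epsilon> * real (level i) / C \<le> r"
    proof -
      have "sqrt ((real (level i) / C)\<^sup>2) \<le> sqrt (eigenvalue \<tau> i)"
        unfolding C_def by (intro real_sqrt_le_mono eigenvalue_level \<tau>)
      then have "real (level i) / C \<le> sqrt (eigenvalue \<tau> i)" using C by simp
      from mult_left_mono[OF this, of \<epsilon>] show ?thesis using \<epsilon> by (simp add: r_def)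
    qed
    have q: "K / root 3 (real (level i)) = 4 / root 3 (\<epsilon> * real (level i) / C)"
      using C \<epsilon> lev by (simp add: K_def real_root_divide real_root_mult)
    have pos: "0 < root 3 (\<epsilon> * real (level i) / C)" using C \<epsilon> lev by simp
    show ?thesis
    proof (cases "r \<ge> 1")
      case True
      then have "root 3 r \<ge> 1" by (simp add: real_root_ge_1_iff)
      moreover have "root 3 r ^ 3 = r" using True by (simp add: odd_real_root_pow)
      ultimately have "\<bar>integral {0..2 * pi} (\<lambda>t. cos (\<psi> + (A * cos t + B * sin t)))\<bar> \<le> (4 * pi + pi\<^sup>2) / root 3 r"
        by (intro oscillatory_integral) (simp_all add: AB)
      from divide_right_mono[OF this, of "2 * pi"]
      have "\<bar>circ_mean \<tau> \<epsilon> i x\<bar> \<le> (4 * pi + pi\<^sup>2) / root 3 r / (2 * pi)"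
        unfolding cm abs_divide by (simp only: abs_of_pos[OF mult_pos_pos[OF zero_less_numeral pi_gt_zero]]) simp
      also have "4 * pi + pi\<^sup>2 = (2 + pi / 2) * (2 * pi)" by (simp add: power2_eq_square algebra_simps)
      also have "\<dots> / root 3 r / (2 * pi) = (2 + pi / 2) / root 3 r" by simp
      also have "\<dots> \<le> 4 / root 3 (\<epsilon> * real (level i) / C)"
        using pi_less_4 lo pos by (intro frac_le) auto
      finally show ?thesis by (simp add: q)
    next
      case False
      have "\<bar>integral {0..2 * pi} (\<lambda>t. cos (\<psi> + (A * cos t + B * sin t)))\<bar> \<le> 1 * (2 * pi - 0)"
      proof -
        have c: "continuous_on {0..2 * pi} (\<lambda>t. cos (\<psi> + (A * cos t + B * sin t)))" by (intro continuous_intros)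
        show ?thesis using integral_bound[OF _ c, of 1] by simp
      qed
      then have "\<bar>circ_mean \<tau> \<epsilon> i x\<bar> \<le> 1" unfolding cm by (simp add: abs_divide)
      also have "1 \<le> 4 / root 3 (\<epsilon> * real (level i) / C)"
      proof -
        have "1 \<le> 4 / y" if "0 < y" "y \<le> 1" for y :: real using that by (simp add: field_simps)
        moreover have "root 3 (\<epsilon> * real (level i) / C) \<le> 1"
          using real_root_le_mono[of 3 "\<epsilon> * real (level i) / C" 1] False lo by simp
        ultimately show ?thesis using pos by blast
      qed
      finally show ?thesis by (simp add: q)
    qed
  qed
  moreover have "0 \<le> K" using C \<epsilon> by (simp add: K_def)
  ultimately show ?thesis using that by blast
qed

section \<open>Energy and covariance in Fourier coordinates\<close>

text \<open>The square partial sums are partial sums over shells; modes in different shells are orthogonal,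
  whereas inside a shell each mode has a copy.\<close>
definition shell :: "nat \<Rightarrow> idx set" where "shell n = {i. level i = n}"
definition below :: "nat \<Rightarrow> idx set" where "below n = {i. level i < n}"

lemma below_Suc: "below (Suc N) = cutoff N"
  by (auto simp: below_def in_cutoff_iff)

lemma finite_below [simp]: "finite (below n)"
proof (rule finite_subset)
  show "below n \<subseteq> cutoff n" by (auto simp: below_def in_cutoff_iff)
qed (rule finite_cutoff)

lemma shell_in_below: "k < n \<Longrightarrow> shell k = {i \<in> below n. level i = k}"
  by (auto simp: shell_def below_def)

lemma finite_shell [simp]: "finite (shell n)"
proof (rule finite_subset)
  show "shell n \<subseteq> cutoff n" by (auto simp: shell_def in_cutoff_iff)
qed (rule finite_cutoff)

lemma sum_below: "(\<Sum>k<n. \<Sum>i\<in>shell k. f i) = (\<Sum>i\<in>below n. f i :: real)"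
proof -
  have "(\<Sum>i\<in>below n. f i) = (\<Sum>k\<in>{..<n}. \<Sum>i\<in>{i \<in> below n. level i = k}. f i)"
    by (rule sum.group[symmetric, OF finite_below finite_lessThan]) (auto simp: below_def)
  then show ?thesis by (simp add: shell_in_below[of _ n])
qed

lemma card_shell: "n \<ge> 1 \<Longrightarrow> card (shell n) \<le> 16 * n"
proof -
  assume n: "n \<ge> 1"
  have c: "card (cutoff N) = 2 * (2 * N + 1)\<^sup>2" for N
  proof -
    have "nat (2 * int N) = 2 * N" by (simp add: nat_mult_distrib)
    then show ?thesis by (simp add: cutoff_def card_cartesian_product power2_eq_square nat_add_distrib)
  qed
  have s: "shell n = cutoff n - cutoff (n - 1)" using n by (auto simp: shell_def in_cutoff_iff)
  have "card (shell n) = card (cutoff n) - card (cutoff (n - 1))"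
    unfolding s by (intro card_Diff_subset cutoff_mono finite_cutoff) simp
  also have "\<dots> = 16 * n"
  proof -
    obtain m where "n = Suc m" using n by (cases n) auto
    then show ?thesis unfolding c by (simp add: power2_eq_square algebra_simps)
  qed
  finally show ?thesis by simp
qed

definition synth :: "idx set \<Rightarrow> (idx \<Rightarrow> real) \<Rightarrow> pt \<Rightarrow> real" where
  "synth A c x = (\<Sum>i\<in>A. c i * mode i x)"

lemma synth_H1: "synth A c \<in> H1"
  unfolding synth_def[abs_def] by (intro H1_trig trig_sum_mode)

lemma synth_L2t: "L2t (synth A c)"
  unfolding synth_def[abs_def] by (intro L2t_sum L2t_scale L2t_mode)

lemma ip_synth: "L2t f \<Longrightarrow> ip f (synth A c) = (\<Sum>i\<in>A. c i * ip f (mode i))"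
  unfolding synth_def[abs_def] by (rule ip_sum_right) auto

lemma eigenvalue_zero: "level i = 0 \<Longrightarrow> eigenvalue \<tau> i = 0"
  by (cases i) (auto simp: level_def eigenvalue_def d1_def d2_def)

lemma eigenvalue_pos: "Im \<tau> > 0 \<Longrightarrow> level i \<noteq> 0 \<Longrightarrow> eigenvalue \<tau> i > 0"
  by (rule less_le_trans[OF _ eigenvalue_level]) (auto simp: add_pos_nonneg add_nonneg_pos intro!: zero_less_power divide_pos_pos)

text \<open>Parseval for the real and imaginary parts of \<open>\<tau> \<partial>\<^sub>1 f - \<partial>\<^sub>2 f\<close>.\<close>
lemma dirichlet_sums:
  assumes \<tau>: "Im \<tau> > 0" and f: "f \<in> H1"
  shows "(\<lambda>N. Im \<tau> * (\<Sum>i\<in>cutoff N. eigenvalue \<tau> i * (ip f (mode i))\<^sup>2)) \<longlonglongrightarrow> dirichlet_energy \<tau> f"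
proof -
  note D = H1_D[OF f]
  let ?u = "weak_deriv pd1 f" and ?v = "weak_deriv pd2 f"
  have L: "L2t ?u" "L2t ?v" using D by (auto simp: is_weak_deriv_iff torus_L2_iff)
  let ?w1 = "\<lambda>x. Re \<tau> * ?u x - ?v x" and ?w2 = "\<lambda>x. Im \<tau> * ?u x"
  have Lw: "L2t ?w1" "L2t ?w2" by (intro L2t_diff L2t_scale L)+
  have e: "dirichlet_energy \<tau> f = 1 / Im \<tau> * (ip ?w1 ?w1 + ip ?w2 ?w2)"
  proof -
    have "(cmod (\<tau> * of_real (?u x) - of_real (?v x)))\<^sup>2 = ?w1 x * ?w1 x + ?w2 x * ?w2 x" for x
      unfolding cmod_power2 by (simp add: power2_eq_square)
    then show ?thesis unfolding dirichlet_energy_def ip_def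
      by (simp add: L2t_integrable_mult[OF Lw(1) Lw(1)] L2t_integrable_mult[OF Lw(2) Lw(2)])
  qed
  let ?F = "\<lambda>i. (ip f (mode i))\<^sup>2"
  have c: "(ip ?w1 (mode i))\<^sup>2 + (ip ?w2 (mode i))\<^sup>2 = (Im \<tau>)\<^sup>2 * (eigenvalue \<tau> (flip i) * ?F (flip i))" for i
  proof -
    have "ip ?w1 (mode i) = (d2 i - Re \<tau> * d1 i) * ip f (mode (flip i))"
      "ip ?w2 (mode i) = - (Im \<tau> * d1 i) * ip f (mode (flip i))"
      using L by (simp_all add: ip_diff_left L2t_scale ip_scale_left weak_deriv_coeff[OF D(3)] weak_deriv_coeff2[OF D(4)] algebra_simps)
    then have "(ip ?w1 (mode i))\<^sup>2 + (ip ?w2 (mode i))\<^sup>2 = ((d2 i - Re \<tau> * d1 i)\<^sup>2 + (Im \<tau> * d1 i)\<^sup>2) * ?F (flip i)"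
      by (simp add: power_mult_distrib distrib_right)
    also have "(d2 i - Re \<tau> * d1 i)\<^sup>2 + (Im \<tau> * d1 i)\<^sup>2 = (Im \<tau>)\<^sup>2 * eigenvalue \<tau> (flip i)"
    proof -
      have "(Im \<tau>)\<^sup>2 * eigenvalue \<tau> (flip i) = (cmod \<tau>)\<^sup>2 * (d1 i)\<^sup>2 - 2 * Re \<tau> * (d1 i * d2 i) + (d2 i)\<^sup>2"
        using \<tau> by (simp add: eigenvalue_def)
      then show ?thesis unfolding cmod_power2 by (simp add: power2_eq_square algebra_simps)
    qed
    finally show ?thesis by simp
  qed
  have "(\<lambda>N. 1 / Im \<tau> * ((\<Sum>i\<in>cutoff N. (ip ?w1 (mode i))\<^sup>2) + (\<Sum>i\<in>cutoff N. (ip ?w2 (mode i))\<^sup>2))) \<longlonglongrightarrow> dirichlet_energy \<tau> f"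
    unfolding e by (intro tendsto_mult tendsto_add tendsto_const Parseval Lw)
  moreover have "1 / Im \<tau> * ((\<Sum>i\<in>cutoff N. (ip ?w1 (mode i))\<^sup>2) + (\<Sum>i\<in>cutoff N. (ip ?w2 (mode i))\<^sup>2))
      = Im \<tau> * (\<Sum>i\<in>cutoff N. eigenvalue \<tau> i * ?F i)" for N
    unfolding sum.distrib[symmetric] c sum_distrib_left[symmetric] sum_flip[of "\<lambda>i. eigenvalue \<tau> i * ?F i"]
    using \<tau> by (simp add: power2_eq_square)
  ultimately show ?thesis by simp
qed

lemma torus_vol_integral:
  fixes f :: "pt \<Rightarrow> real"
  assumes "Im \<tau> > 0" "f \<in> borel_measurable borel"
  shows "(LINT x|torus_vol \<tau>. f x) = Im \<tau> * (LINT x|torus. f x)"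
  unfolding torus_vol_def using assms by (subst integral_density) (auto intro: borel_measurable_torus)

lemma laplacian_mode: "laplacian \<tau> (mode i) x = - (eigenvalue \<tau> i * mode i x)"
  using laplacian_sum_mode[of \<tau> "\<lambda>_. 1" "{i}" x] by simp

text \<open>The eigenvalue of convolution with the Green function. At level \<open>0\<close> the quotient is \<open>0\<close> by the
  convention for division by zero, as it should be for a kernel of vanishing mean.\<close>
definition green_coeff :: "complex \<Rightarrow> idx \<Rightarrow> real" where
  "green_coeff \<tau> i = 2 * pi / (Im \<tau> * eigenvalue \<tau> i)"

text \<open>The modes are eigenfunctions of the Laplacian, so the equation of the Green function tested against
  a mode determines the convolution.\<close>
lemma green_convolution:
  assumes \<tau>: "Im \<tau> > 0" and G: "green_function \<tau> G"
  shows "(LINT y|torus. G (w - y) * mode j y) = green_coeff \<tau> j * mode j w"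
proof -
  have [measurable]: "G \<in> borel_measurable borel" using G by (simp add: green_function_def)
  have Gm [measurable]: "(\<lambda>y. G (w - y)) \<in> borel_measurable borel"
    by (rule measurable_compose[OF _ \<open>G \<in> borel_measurable borel\<close>])
       (intro borel_measurable_continuous_onI continuous_intros)
  show ?thesis
  proof (cases "level j = 0")
    case True
    then obtain b where j: "j = (0, 0, b)" by (cases j) (auto simp: level_def)
    have "(LINT y|torus_vol \<tau>. G (w - y)) = 0" using G unfolding green_function_def by blast
    then have "(LINT y|torus. G (w - y)) = 0" using \<tau> by (simp add: torus_vol_integral)
    then have "(LINT y|torus. G (w - y) * mode j y) = 0"
      by (cases b) (simp_all add: j mode_cos mode_sin)
    then show ?thesis using True by (simp add: green_coeff_def eigenvalue_zero)
  next
    case False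
    have "(LINT y|torus_vol \<tau>. G (w - y) * (- laplacian \<tau> (mode j) y))
       = 2 * pi * (mode j w - 1 / Im \<tau> * (LINT y|torus_vol \<tau>. mode j y))"
      using G trig_smooth[OF trig.mode] unfolding green_function_def by blast
    moreover have "(LINT y|torus_vol \<tau>. mode j y) = Im \<tau> * ip (mode j) (mode (0, 0, True))"
      using \<tau> by (simp add: torus_vol_integral ip_def mode_cos)
    moreover have "ip (mode j) (mode (0, 0, True)) = 0"
      using False by (intro ip_mode_level) (simp add: level_def)
    moreover have "(LINT y|torus_vol \<tau>. G (w - y) * (- laplacian \<tau> (mode j) y))
       = Im \<tau> * eigenvalue \<tau> j * (LINT y|torus. G (w - y) * mode j y)"
      unfolding laplacian_mode using \<tau> by (subst torus_vol_integral) (auto simp: mult.left_commute)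
    ultimately have "Im \<tau> * eigenvalue \<tau> j * (LINT y|torus. G (w - y) * mode j y) = 2 * pi * mode j w"
      by simp
    then show ?thesis using \<tau> eigenvalue_pos[OF \<tau> False] by (simp add: green_coeff_def field_simps)
  qed
qed

section \<open>The Gaussian free field\<close>

lemma gaussian_var_cong:
  assumes "\<And>\<omega>. \<omega> \<in> space M \<Longrightarrow> Y \<omega> = Z \<omega>"
  shows "gaussian_var M Y v \<longleftrightarrow> gaussian_var M Z v"
proof -
  have "Y \<in> borel_measurable M \<longleftrightarrow> Z \<in> borel_measurable M" by (rule measurable_cong) fact
  moreover have "integrable M (\<lambda>\<omega>. (Y \<omega>)\<^sup>2) \<longleftrightarrow> integrable M (\<lambda>\<omega>. (Z \<omega>)\<^sup>2)"
    "(LINT \<omega>|M. (Y \<omega>)\<^sup>2) = (LINT \<omega>|M. (Z \<omega>)\<^sup>2)"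
    "(CLINT \<omega>|M. iexp (t * Y \<omega>)) = (CLINT \<omega>|M. iexp (t * Z \<omega>))" for t
    using assms by (auto intro!: Bochner_Integration.integrable_cong Bochner_Integration.integral_cong)
  ultimately show ?thesis by (simp add: gaussian_var_def)
qed

locale gff =
  fixes M :: "'w measure" and \<tau> :: complex and X :: "'w \<Rightarrow> functional"
  assumes tau: "Im \<tau> > 0" and gff: "gaussian_free_field M \<tau> X"
begin

sublocale prob_space M using gff by (simp add: gaussian_free_field_def)

lemma X_measurable [measurable]: "X \<in> measurable M Hm1_borel"
  using gff by (simp add: gaussian_free_field_def)

lemma X_Hm1: "\<omega> \<in> space M \<Longrightarrow> X \<omega> \<in> Hm1"
  using measurable_space[OF X_measurable] by (simp add: space_Hm1_borel)

lemma X_eval [measurable]: "f \<in> H1 \<Longrightarrow> (\<lambda>\<omega>. X \<omega> f) \<in> borel_measurable M"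
  by (rule measurable_compose[OF X_measurable Hm1_evaluation_measurable])

lemma X_gaussian: "f \<in> H1 \<Longrightarrow> gaussian_var M (\<lambda>\<omega>. X \<omega> f) (LINT \<omega>|M. (X \<omega> f)\<^sup>2)"
  using gff by (intro centered_gaussian_var prob_space_axioms) (simp add: gaussian_free_field_def)

lemma X_L2: "f \<in> H1 \<Longrightarrow> integrable M (\<lambda>\<omega>. (X \<omega> f)\<^sup>2)"
  using X_gaussian by (simp add: gaussian_var_def)

lemma X_integrable_mult: "f \<in> H1 \<Longrightarrow> h \<in> H1 \<Longrightarrow> integrable M (\<lambda>\<omega>. X \<omega> f * X \<omega> h)"
  by (intro integrable_mult_L2 X_L2 X_eval)

lemma X_synth: "\<omega> \<in> space M \<Longrightarrow> finite A \<Longrightarrow> X \<omega> (synth A c) = (\<Sum>i\<in>A. c i * X \<omega> (mode i))"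
  unfolding synth_def[abs_def] by (rule Hm1_sum[OF X_Hm1])

text \<open>Independent of the choice of the Green function among those allowed in the definition of the field.\<close>
lemma cov_mode:
  assumes f: "f \<in> H1"
  shows "(LINT \<omega>|M. X \<omega> f * X \<omega> (mode j)) = green_coeff \<tau> j * ip f (mode j)"
proof -
  obtain G where G: "green_function \<tau> G"
    "(LINT \<omega>|M. X \<omega> f * X \<omega> (mode j)) = (LINT x|torus. f x * (LINT y|torus. G (x - y) * mode j y))"
    using gff f H1_mode unfolding gaussian_free_field_def by blast
  have "f x * (green_coeff \<tau> j * mode j x) = green_coeff \<tau> j * (f x * mode j x)" for x
    by (rule mult.left_commute)
  then show ?thesis unfolding G(2) green_convolution[OF tau G(1)] ip_def
    by (simp only: integral_mult_right_zero)
qed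

lemma cov_synth:
  assumes f: "f \<in> H1" and A: "finite A"
  shows "(LINT \<omega>|M. X \<omega> f * X \<omega> (synth A c)) = ip f (synth A (\<lambda>i. c i * green_coeff \<tau> i))"
proof -
  have "(LINT \<omega>|M. X \<omega> f * X \<omega> (synth A c)) = (LINT \<omega>|M. (\<Sum>i\<in>A. c i * (X \<omega> f * X \<omega> (mode i))))"
    by (intro Bochner_Integration.integral_cong) (simp_all add: X_synth A sum_distrib_left mult.left_commute)
  also have "\<dots> = (\<Sum>i\<in>A. c i * (LINT \<omega>|M. X \<omega> f * X \<omega> (mode i)))"
    by (subst Bochner_Integration.integral_sum) (auto intro!: X_integrable_mult f)
  also have "\<dots> = ip f (synth A (\<lambda>i. c i * green_coeff \<tau> i))"
    by (simp add: cov_mode f ip_synth H1_D(2)[OF f] mult.assoc)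
  finally show ?thesis .
qed

lemma synth_gaussian:
  assumes A: "finite A"
  shows "gaussian_var M (\<lambda>\<omega>. \<Sum>i\<in>A. c i * X \<omega> (mode i)) (ip (synth A c) (synth A (\<lambda>i. c i * green_coeff \<tau> i)))"
proof -
  have "(LINT \<omega>|M. (X \<omega> (synth A c))\<^sup>2) = ip (synth A c) (synth A (\<lambda>i. c i * green_coeff \<tau> i))"
    using cov_synth[OF synth_H1 A, of A c c] by (simp add: power2_eq_square)
  then have "gaussian_var M (\<lambda>\<omega>. X \<omega> (synth A c)) (ip (synth A c) (synth A (\<lambda>i. c i * green_coeff \<tau> i)))"
    using X_gaussian[OF synth_H1[of A c]] by simp
  then show ?thesis
    by (subst (asm) gaussian_var_cong[where Z="\<lambda>\<omega>. \<Sum>i\<in>A. c i * X \<omega> (mode i)"]) (simp_all add: X_synth A)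
qed

definition shell_var :: "(idx \<Rightarrow> real) \<Rightarrow> nat \<Rightarrow> real" where
  "shell_var c n = ip (synth (shell n) c) (synth (shell n) (\<lambda>i. c i * green_coeff \<tau> i))"

lemma ip_synth_below:
  "ip (synth (below n) (\<lambda>i. t (level i) * c i)) (synth (below n) (\<lambda>i. t (level i) * c i * green_coeff \<tau> i))
     = (\<Sum>k<n. (t k)\<^sup>2 * shell_var c k)"
proof -
  let ?f = "\<lambda>i j. c j * green_coeff \<tau> j * (c i * ip (mode i) (mode j))"
  have exp: "ip (synth A a) (synth A b) = (\<Sum>j\<in>A. \<Sum>i\<in>A. b j * (a i * ip (mode i) (mode j)))" for A a b
  proof -
    have "ip (synth A a) (mode j) = (\<Sum>i\<in>A. a i * ip (mode i) (mode j))" for j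
      unfolding synth_def[abs_def] by (rule ip_sum_left) auto
    then show ?thesis by (simp add: ip_synth synth_L2t sum_distrib_left)
  qed
  have inner: "(\<Sum>i\<in>below n. t k * c j * green_coeff \<tau> j * (t (level i) * c i * ip (mode i) (mode j)))
      = (\<Sum>i\<in>shell k. (t k)\<^sup>2 * ?f i j)" if "k < n" "j \<in> shell k" for j k
  proof (rule sum.mono_neutral_cong_right)
    show "shell k \<subseteq> below n" using that by (auto simp: shell_in_below[of k n])
    show "\<forall>i\<in>below n - shell k. t k * c j * green_coeff \<tau> j * (t (level i) * c i * ip (mode i) (mode j)) = 0"
      using that by (auto simp: shell_def ip_mode_level)
  qed (auto simp: shell_def power2_eq_square)
  have "ip (synth (below n) (\<lambda>i. t (level i) * c i)) (synth (below n) (\<lambda>i. t (level i) * c i * green_coeff \<tau> i))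
     = (\<Sum>k<n. \<Sum>j\<in>shell k. \<Sum>i\<in>below n. t (level j) * c j * green_coeff \<tau> j * (t (level i) * c i * ip (mode i) (mode j)))"
    unfolding exp sum_below ..
  also have "\<dots> = (\<Sum>k<n. \<Sum>j\<in>shell k. \<Sum>i\<in>below n. t k * c j * green_coeff \<tau> j * (t (level i) * c i * ip (mode i) (mode j)))"
    by (intro sum.cong refl) (simp add: shell_def)
  also have "\<dots> = (\<Sum>k<n. \<Sum>j\<in>shell k. \<Sum>i\<in>shell k. (t k)\<^sup>2 * ?f i j)"
  proof (rule sum.cong[OF refl], rule sum.cong[OF refl])
    fix k j assume "k \<in> {..<n}" "j \<in> shell k"
    then show "(\<Sum>i\<in>below n. t k * c j * green_coeff \<tau> j * (t (level i) * c i * ip (mode i) (mode j))) = (\<Sum>i\<in>shell k. (t k)\<^sup>2 * ?f i j)"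
      by (intro inner) auto
  qed
  also have "\<dots> = (\<Sum>k<n. (t k)\<^sup>2 * shell_var c k)"
    unfolding shell_var_def exp by (simp add: sum_distrib_left)
  finally show ?thesis .
qed

text \<open>Modes of different levels are orthogonal, hence the contributions of the shells are independent.\<close>
lemma shell_sequence: "gaussian_sequence M (\<lambda>n \<omega>. \<Sum>i\<in>shell n. c i * X \<omega> (mode i)) (shell_var c)"
proof (intro gaussian_sequence.intro gaussian_sequence_axioms.intro prob_space_axioms)
  fix n and t :: "nat \<Rightarrow> real"
  have "(\<Sum>k<n. t k * (\<Sum>i\<in>shell k. c i * X \<omega> (mode i))) = (\<Sum>i\<in>below n. t (level i) * c i * X \<omega> (mode i))" for \<omega>
    unfolding sum_below[symmetric] sum_distrib_left by (intro sum.cong refl) (simp add: shell_def mult.assoc)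
  then show "gaussian_var M (\<lambda>\<omega>. \<Sum>k<n. t k * (\<Sum>i\<in>shell k. c i * X \<omega> (mode i))) (\<Sum>k<n. (t k)\<^sup>2 * shell_var c k)"
    using synth_gaussian[where A="below n" and c="\<lambda>i. t (level i) * c i", OF finite_below] by (simp add: ip_synth_below)
qed

theorem mode_series_convergent:
  assumes "summable (shell_var c)"
  shows "AE \<omega> in M. convergent (\<lambda>N. \<Sum>i\<in>cutoff N. c i * X \<omega> (mode i))"
  using gaussian_series_convergent[OF shell_sequence assms]
proof eventually_elim
  case (elim \<omega>)
  then have "convergent (\<lambda>n. \<Sum>i\<in>below n. c i * X \<omega> (mode i))" by (simp add: sum_below)
  then show ?case unfolding convergent_def below_Suc[symmetric] using LIMSEQ_Suc by blast
qed

text \<open>The shell of level \<open>n\<close> contains \<open>O(n)\<close> modes, on each of which the field has variance \<open>O(n\<^bsup>-2\<^esup>)\<close>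
  while the squared circle mean is \<open>O(n\<^bsup>-2/3\<^esup>)\<close>. The shell variances are therefore \<open>O(n\<^bsup>-5/3\<^esup>)\<close> and
  summable.\<close>
theorem circle_average_convergent:
  assumes "\<epsilon> > 0"
  shows "AE \<omega> in M. convergent (\<lambda>N. \<Sum>i\<in>cutoff N. X \<omega> (mode i) * circ_mean \<tau> \<epsilon> i x)"
proof -
  obtain K where K: "0 \<le> K" "\<And>i x. 1 \<le> level i \<Longrightarrow> \<bar>circ_mean \<tau> \<epsilon> i x\<bar> \<le> K / root 3 (real (level i))"
    using circ_mean_decay[OF tau assms] by blast
  define c where "c i = circ_mean \<tau> \<epsilon> i x" for i
  define C where "C = 1 + \<bar>Re \<tau>\<bar> + Im \<tau>"
  have C: "C > 0" using tau by (simp add: C_def)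
  define B where "B = 16 * K\<^sup>2 * (2 * pi * C\<^sup>2 / Im \<tau>)"
  have bound: "norm (shell_var c n) \<le> B * real n powr (- 5 / 3)" if n: "n \<ge> 1" for n
  proof -
    define a where "a = K / root 3 (real n)"
    define b where "b = 2 * pi * C\<^sup>2 / (Im \<tau> * (real n)\<^sup>2)"
    have a0: "0 \<le> a" using K by (simp add: a_def)
    have b0: "0 \<le> b" using tau by (simp add: b_def)
    have ca: "\<bar>c i\<bar> \<le> a" if "i \<in> shell n" for i using K(2)[of i x] that n by (simp add: c_def a_def shell_def)
    have vb: "0 \<le> green_coeff \<tau> i \<and> green_coeff \<tau> i \<le> b" if i: "i \<in> shell n" for i
    proof -
      have l: "level i = n" using i by (simp add: shell_def)
      have e: "(real n / C)\<^sup>2 \<le> eigenvalue \<tau> i" using eigenvalue_level[OF tau, of i] by (simp add: l C_def)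
      have p: "0 < (real n / C)\<^sup>2" using n C by simp
      then have ep: "0 < eigenvalue \<tau> i" using e by linarith
      have "green_coeff \<tau> i \<le> 2 * pi / (Im \<tau> * (real n / C)\<^sup>2)"
        unfolding green_coeff_def using e p ep tau by (intro divide_left_mono mult_left_mono mult_pos_pos) auto
      also have "\<dots> = b" using C n tau by (simp add: b_def field_simps)
      finally show ?thesis using tau ep by (simp add: green_coeff_def)
    qed
    have sq: "(\<Sum>i\<in>shell n. (f i)\<^sup>2) \<le> 16 * real n * s\<^sup>2" if "\<And>i. i \<in> shell n \<Longrightarrow> \<bar>f i\<bar> \<le> s" for f s
    proof -
      have "(\<Sum>i\<in>shell n. (f i)\<^sup>2) \<le> real (card (shell n)) * s\<^sup>2"
        using that by (intro sum_bounded_above) (metis abs_ge_zero power2_abs power_mono)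
      also have "\<dots> \<le> real (16 * n) * s\<^sup>2" using card_shell[OF n] by (intro mult_right_mono of_nat_mono) auto
      finally show ?thesis by simp
    qed
    let ?q = "\<lambda>i. c i * green_coeff \<tau> i"
    have qb: "\<bar>?q i\<bar> \<le> a * b" if "i \<in> shell n" for i
      unfolding abs_mult using ca[OF that] vb[OF that] a0 by (intro mult_mono) auto
    have "\<bar>shell_var c n\<bar> \<le> sqrt (ip (synth (shell n) c) (synth (shell n) c)) * sqrt (ip (synth (shell n) ?q) (synth (shell n) ?q))"
      unfolding shell_var_def by (rule ip_abs_le[OF synth_L2t synth_L2t])
    also have "\<dots> \<le> sqrt (16 * real n * a\<^sup>2) * sqrt (16 * real n * (a * b)\<^sup>2)"
      using order_trans[OF synthesis_bound[OF finite_shell] sq[OF ca]] order_trans[OF synthesis_bound[OF finite_shell] sq[OF qb]]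
      by (intro mult_mono real_sqrt_le_mono) (auto simp: synth_def[abs_def] ip_self_nonneg)
    also have "\<dots> = sqrt ((16 * real n * a\<^sup>2 * b)\<^sup>2)"
      unfolding real_sqrt_mult[symmetric] by (simp add: power2_eq_square algebra_simps)
    also have "\<dots> = 16 * real n * a\<^sup>2 * b" using b0 by simp
    also have "\<dots> = B * (real n / ((root 3 (real n))\<^sup>2 * (real n)\<^sup>2))"
      by (simp add: a_def b_def B_def power_divide ac_simps)
    also have "real n / ((root 3 (real n))\<^sup>2 * (real n)\<^sup>2) = real n powr (- 5 / 3)"
    proof -
      have "root 3 (real n) = real n powr (1 / 3)" using n by (simp add: root_powr_inverse)
      then have "(root 3 (real n))\<^sup>2 = real n powr (2 / 3)" using n by (simp add: powr_power)
      moreover have "(real n)\<^sup>2 = real n powr 2" using n by (simp add: powr_numeral)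
      ultimately have "real n / ((root 3 (real n))\<^sup>2 * (real n)\<^sup>2) = real n powr 1 / (real n powr (2/3) * real n powr 2)" using n by simp
      also have "\<dots> = real n powr (1 - (2/3 + 2))" by (simp only: powr_add[symmetric] powr_diff[symmetric])
      finally show ?thesis by simp
    qed
    finally show ?thesis by simp
  qed
  have "summable (\<lambda>n. B * real n powr (- 5 / 3))"
    by (intro summable_mult) (simp add: summable_real_powr_iff)
  then have "summable (shell_var c)"
    by (rule summable_comparison_test'[where N=1]) (rule bound)
  from mode_series_convergent[OF this] show ?thesis by (simp add: c_def mult.commute)
qed

end

section \<open>Pairing the free field with the curvature\<close>

text \<open>The Fourier coefficients of \<open>-\<triangle>\<^sub>\<tau> \<phi>\<close> with respect to \<open>\<lambda>\<^sub>\<tau>\<close>.\<close>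
definition pairing_coeff :: "complex \<Rightarrow> (pt \<Rightarrow> real) \<Rightarrow> idx \<Rightarrow> real" where
  "pairing_coeff \<tau> \<phi> i = Im \<tau> * eigenvalue \<tau> i * ip \<phi> (mode i)"

lemma curvature_pairing_series:
  assumes \<tau>: "Im \<tau> > 0" and \<phi>: "L2t \<phi>"
  shows "curvature_pairing \<tau> \<phi> Y = lim (\<lambda>N. \<Sum>i\<in>cutoff N. pairing_coeff \<tau> \<phi> i * Y (mode i))"
proof -
  have "- (LINT x|torus_vol \<tau>. \<phi> x * laplacian \<tau> (fourier_trunc N Y) x) = (\<Sum>i\<in>cutoff N. pairing_coeff \<tau> \<phi> i * Y (mode i))" for N
  proof -
    let ?q = "synth (cutoff N) (\<lambda>i. - (Y (mode i) * eigenvalue \<tau> i))"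
    have lap: "laplacian \<tau> (fourier_trunc N Y) = ?q"
    proof
      fix x
      have "fourier_trunc N Y = (\<lambda>x. \<Sum>i\<in>cutoff N. Y (mode i) * mode i x)" by (rule ext) (rule fourier_trunc_mode)
      then show "laplacian \<tau> (fourier_trunc N Y) x = ?q x"
        by (simp add: laplacian_sum_mode synth_def sum_negf)
    qed
    have "(LINT x|torus_vol \<tau>. \<phi> x * ?q x) = Im \<tau> * ip \<phi> ?q"
      unfolding ip_def using L2t_measurable(1)[OF \<phi>] L2t_measurable(1)[OF synth_L2t]
      by (intro torus_vol_integral \<tau>) measurable
    then show ?thesis
      unfolding lap ip_synth[OF \<phi>] by (simp add: pairing_coeff_def sum_distrib_left sum_negf ac_simps)
  qed
  then show ?thesis unfolding curvature_pairing_def by simp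
qed

text \<open>Applying the Green function to \<open>-\<triangle>\<^sub>\<tau> \<phi>\<close> gives back \<open>2\<pi> \<phi>\<close> up to its mean. This is the origin of
  the covariance \<open>2\<pi> (\<phi> - mean)\<close> between the free field and its pairing with the curvature.\<close>
lemma pairing_green:
  assumes \<tau>: "Im \<tau> > 0"
  shows "pairing_coeff \<tau> \<phi> i * green_coeff \<tau> i = (if level i = 0 then 0 else 2 * pi * ip \<phi> (mode i))"
  using \<tau> eigenvalue_pos[OF \<tau>, of i] by (auto simp: pairing_coeff_def green_coeff_def eigenvalue_zero)

definition centre :: "(pt \<Rightarrow> real) \<Rightarrow> pt \<Rightarrow> real" where
  "centre \<phi> x = \<phi> x - ip \<phi> (\<lambda>_. 1)"

lemma centre_L2t: "L2t \<phi> \<Longrightarrow> L2t (centre \<phi>)"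
  unfolding centre_def[abs_def] by (intro L2t_diff) auto

lemma level_zero_iff: "level i = 0 \<longleftrightarrow> i = (0, 0, True) \<or> i = (0, 0, False)"
  by (cases i) (auto simp: level_def)

lemma mode_level_zero: "mode (0, 0, True) = (\<lambda>_. 1)" "mode (0, 0, False) = (\<lambda>_. 0)"
  by (simp_all add: mode_cos mode_sin)

lemma synth_pairing_green:
  assumes \<tau>: "Im \<tau> > 0"
  shows "synth (cutoff N) (\<lambda>i. pairing_coeff \<tau> \<phi> i * green_coeff \<tau> i) x = 2 * pi * (proj N \<phi> x - ip \<phi> (\<lambda>_. 1))"
proof -
  have "2 * pi * proj N \<phi> x - synth (cutoff N) (\<lambda>i. pairing_coeff \<tau> \<phi> i * green_coeff \<tau> i) x
     = (\<Sum>i\<in>cutoff N. (if level i = 0 then 2 * pi * ip \<phi> (mode i) * mode i x else 0))"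
    unfolding synth_def proj_def sum_distrib_left sum_subtractf[symmetric] pairing_green[OF \<tau>]
    by (intro sum.cong) auto
  also have "\<dots> = (\<Sum>i\<in>{(0, 0, True), (0, 0, False)}. 2 * pi * ip \<phi> (mode i) * mode i x)"
    by (rule sum.mono_neutral_cong_right) (auto simp: level_zero_iff in_cutoff_iff level_def)
  also have "\<dots> = 2 * pi * ip \<phi> (\<lambda>_. 1)" by (simp add: mode_level_zero)
  finally show ?thesis by (simp add: right_diff_distrib)
qed

context gff
begin

context
  fixes \<phi> :: "pt \<Rightarrow> real"
  assumes \<phi>: "\<phi> \<in> H1"
begin

abbreviation "\<kappa> \<equiv> pairing_coeff \<tau> \<phi>"
abbreviation "\<phi>0 \<equiv> centre \<phi>"
abbreviation "s \<equiv> 2 * pi * dirichlet_energy \<tau> \<phi>"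

lemma \<phi>_L2t: "L2t \<phi>" by (rule H1_D(2)[OF \<phi>])

lemma ip_below_pairing:
  "ip (synth (cutoff N) \<kappa>) (synth (cutoff N) (\<lambda>i. \<kappa> i * green_coeff \<tau> i))
     = 2 * pi * (Im \<tau> * (\<Sum>i\<in>cutoff N. eigenvalue \<tau> i * (ip \<phi> (mode i))\<^sup>2))"
proof -
  have m: "ip (mode i) (synth (cutoff N) (\<lambda>i. \<kappa> i * green_coeff \<tau> i)) = 2 * pi * ip \<phi> (mode i)"
    if i: "i \<in> cutoff N" "level i \<noteq> 0" for i
  proof -
    have "synth (cutoff N) (\<lambda>i. \<kappa> i * green_coeff \<tau> i) = (\<lambda>x. 2 * pi * (proj N \<phi> x - ip \<phi> (\<lambda>_. 1)))"
      by (rule ext) (rule synth_pairing_green[OF tau])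
    then have "ip (mode i) (synth (cutoff N) (\<lambda>i. \<kappa> i * green_coeff \<tau> i)) = 2 * pi * (ip (proj N \<phi>) (mode i) - ip (\<lambda>_. ip \<phi> (\<lambda>_. 1)) (mode i))"
      by (simp add: ip_commute[of "mode i"] ip_scale_left ip_diff_left)
    moreover have "ip (\<lambda>_. ip \<phi> (\<lambda>_. 1) * 1) (mode i) = ip \<phi> (\<lambda>_. 1) * ip (mode (0, 0, True)) (mode i)"
      unfolding mode_level_zero by (rule ip_scale_left)
    moreover have "ip (mode (0, 0, True)) (mode i) = 0" using i by (intro ip_mode_level) (simp add: level_def)
    moreover have "ip (proj N \<phi>) (mode i) = ip \<phi> (mode i)" using i by (intro ip_proj_mode \<phi>_L2t) (simp add: in_cutoff_iff)
    ultimately show ?thesis by simp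
  qed
  have "ip (synth (cutoff N) \<kappa>) (synth (cutoff N) (\<lambda>i. \<kappa> i * green_coeff \<tau> i))
     = (\<Sum>i\<in>cutoff N. \<kappa> i * ip (mode i) (synth (cutoff N) (\<lambda>i. \<kappa> i * green_coeff \<tau> i)))"
    by (subst ip_commute) (simp add: ip_synth synth_L2t ip_commute[of "synth (cutoff N) (\<lambda>i. \<kappa> i * green_coeff \<tau> i)" "mode i" for i])
  also have "\<dots> = (\<Sum>i\<in>cutoff N. 2 * pi * (Im \<tau> * (eigenvalue \<tau> i * (ip \<phi> (mode i))\<^sup>2)))"
  proof (rule sum.cong[OF refl])
    fix i assume i: "i \<in> cutoff N"
    show "\<kappa> i * ip (mode i) (synth (cutoff N) (\<lambda>i. \<kappa> i * green_coeff \<tau> i)) = 2 * pi * (Im \<tau> * (eigenvalue \<tau> i * (ip \<phi> (mode i))\<^sup>2))"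
    proof (cases "level i = 0")
      case True
      then show ?thesis by (simp add: pairing_coeff_def eigenvalue_zero)
    next
      case False
      show ?thesis unfolding m[OF i False] by (simp add: pairing_coeff_def power2_eq_square)
    qed
  qed
  finally show ?thesis by (simp add: sum_distrib_left)
qed

text \<open>So the pairing of the free field with the curvature is Gaussian with variance \<open>2\<pi>\<close> times the Dirichlet
  energy.\<close>
lemma variance_tendsto:
  "(\<lambda>N. ip (synth (cutoff N) \<kappa>) (synth (cutoff N) (\<lambda>i. \<kappa> i * green_coeff \<tau> i))) \<longlonglongrightarrow> s"
  unfolding ip_below_pairing by (intro tendsto_mult tendsto_const dirichlet_sums tau \<phi>)

lemma pairing_convergent: "AE \<omega> in M. convergent (\<lambda>N. \<Sum>i\<in>cutoff N. \<kappa> i * X \<omega> (mode i))"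
proof (rule mode_series_convergent)
  have "(\<lambda>N. \<Sum>k<Suc N. shell_var \<kappa> k) \<longlonglongrightarrow> s"
    using variance_tendsto ip_synth_below[of "Suc N" "\<lambda>_. 1" \<kappa> for N] by (simp add: below_Suc)
  then have "(\<lambda>N. \<Sum>k<N. shell_var \<kappa> k) \<longlonglongrightarrow> s" by (rule LIMSEQ_imp_Suc)
  then show "summable (shell_var \<kappa>)" by (auto simp: summable_def sums_def)
qed

definition Y :: "'w \<Rightarrow> real" where "Y \<omega> = curvature_pairing \<tau> \<phi> (X \<omega>)"

lemma Y_lim: "Y \<omega> = lim (\<lambda>N. \<Sum>i\<in>cutoff N. \<kappa> i * X \<omega> (mode i))"
  unfolding Y_def by (rule curvature_pairing_series[OF tau \<phi>_L2t])

lemma Y_measurable [measurable]: "Y \<in> borel_measurable M"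
proof -
  have "(\<lambda>\<omega>. \<Sum>i\<in>cutoff N. \<kappa> i * X \<omega> (mode i)) \<in> borel_measurable M" for N
    by (intro borel_measurable_sum borel_measurable_times borel_measurable_const X_eval H1_mode)
  then show ?thesis unfolding Y_lim[abs_def] by (rule borel_measurable_lim_metric)
qed

text \<open>The values of the field off \<open>space M\<close> are arbitrary; setting them to \<open>0\<close> makes the linearity of \<open>X0\<close>
  an identity of functions, as required of the set \<open>T\<close> in \<open>gaussian_shift\<close>.\<close>
definition X0 :: "'w \<Rightarrow> functional" where "X0 \<omega> = (if \<omega> \<in> space M then X \<omega> else (\<lambda>_. 0))"

lemma X0_lin: "f \<in> H1 \<Longrightarrow> g \<in> H1 \<Longrightarrow> a * X0 \<omega> f + b * X0 \<omega> g = X0 \<omega> (\<lambda>x. a * f x + b * g x)"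
  by (simp add: X0_def Hm1_lin[OF X_Hm1])

text \<open>For the truncated pairing this is the characteristic function of the field evaluated at a single
  element of \<open>H1\<close>, with the variance computed from the covariances above; then the cutoff is removed by
  dominated convergence.\<close>
lemma joint_char:
  assumes f: "f \<in> H1"
  shows "(CLINT \<omega>|M. iexp (X0 \<omega> f + r * Y \<omega>))
    = complex_of_real (exp (- ((LINT \<omega>|M. (X \<omega> f)\<^sup>2) + 2 * r * (2 * pi * ip f \<phi>0) + r\<^sup>2 * s) / 2))"
proof (rule LIMSEQ_unique)
  let ?q = "\<lambda>N. synth (cutoff N) \<kappa>"
  let ?v = "LINT \<omega>|M. (X \<omega> f)\<^sup>2"
  have fr: "(\<lambda>x. 1 * f x + r * ?q N x) \<in> H1" for N by (intro H1_lin f synth_H1)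
  have Xfr: "X \<omega> (\<lambda>x. 1 * f x + r * ?q N x) = X \<omega> f + r * X \<omega> (?q N)" if "\<omega> \<in> space M" for \<omega> N
    using Hm1_lin[OF X_Hm1[OF that] f synth_H1, of 1 r] by simp
  have mean: "ip f (synth (cutoff N) (\<lambda>i. \<kappa> i * green_coeff \<tau> i)) = 2 * pi * (ip f (proj N \<phi>) - ip f (\<lambda>_. ip \<phi> (\<lambda>_. 1)))" for N
  proof -
    have "synth (cutoff N) (\<lambda>i. \<kappa> i * green_coeff \<tau> i) = (\<lambda>x. 2 * pi * (proj N \<phi> x - ip \<phi> (\<lambda>_. 1)))"
      by (rule ext) (rule synth_pairing_green[OF tau])
    then show ?thesis
      using ip_scale_left[of "2 * pi" "\<lambda>x. proj N \<phi> x - ip \<phi> (\<lambda>_. 1)" f] H1_D(2)[OF f]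
      by (simp add: ip_commute[of f] ip_diff_left)
  qed
  have var: "(LINT \<omega>|M. (X \<omega> (\<lambda>x. 1 * f x + r * ?q N x))\<^sup>2) = ?v + 2 * r * (2 * pi * (ip f (proj N \<phi>) - ip f (\<lambda>_. ip \<phi> (\<lambda>_. 1))))
      + r\<^sup>2 * ip (?q N) (synth (cutoff N) (\<lambda>i. \<kappa> i * green_coeff \<tau> i))" for N
  proof -
    have "(LINT \<omega>|M. (X \<omega> (\<lambda>x. 1 * f x + r * ?q N x))\<^sup>2)
      = (LINT \<omega>|M. (X \<omega> f)\<^sup>2 + (2 * r) * (X \<omega> f * X \<omega> (?q N)) + r\<^sup>2 * (X \<omega> (?q N) * X \<omega> (?q N)))"
      by (intro Bochner_Integration.integral_cong refl) (simp add: Xfr[simplified] power2_eq_square algebra_simps)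
    also have "\<dots> = ?v + (2 * r) * (LINT \<omega>|M. X \<omega> f * X \<omega> (?q N)) + r\<^sup>2 * (LINT \<omega>|M. X \<omega> (?q N) * X \<omega> (?q N))"
      by (simp add: X_L2 f X_integrable_mult synth_H1)
    finally show ?thesis by (simp add: cov_synth f synth_H1 mean)
  qed
  have eq: "(CLINT \<omega>|M. iexp (X0 \<omega> f + r * (\<Sum>i\<in>cutoff N. \<kappa> i * X \<omega> (mode i))))
      = complex_of_real (exp (- (LINT \<omega>|M. (X \<omega> (\<lambda>x. 1 * f x + r * ?q N x))\<^sup>2) / 2))" for N
  proof -
    have "(CLINT \<omega>|M. iexp (X0 \<omega> f + r * (\<Sum>i\<in>cutoff N. \<kappa> i * X \<omega> (mode i)))) = (CLINT \<omega>|M. iexp (1 * X \<omega> (\<lambda>x. 1 * f x + r * ?q N x)))"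
      unfolding mult_1_left[of "X _ _"]
      by (intro Bochner_Integration.integral_cong refl) (simp add: Xfr[simplified] X_synth X0_def)
    also have "\<dots> = complex_of_real (exp (- (1\<^sup>2 * (LINT \<omega>|M. (X \<omega> (\<lambda>x. 1 * f x + r * ?q N x))\<^sup>2) / 2)))"
      using X_gaussian[OF fr] unfolding gaussian_var_def by blast
    finally show ?thesis by simp
  qed
  have Xm: "(\<lambda>\<omega>. X0 \<omega> f) \<in> borel_measurable M"
    using X_eval[OF f] by (subst measurable_cong[where g="\<lambda>\<omega>. X \<omega> f"]) (simp_all add: X0_def)
  have Sm: "(\<lambda>\<omega>. \<Sum>i\<in>cutoff N. \<kappa> i * X \<omega> (mode i)) \<in> borel_measurable M" for N
    by (intro borel_measurable_sum borel_measurable_times borel_measurable_const X_eval H1_mode)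
  show "(\<lambda>N. CLINT \<omega>|M. iexp (X0 \<omega> f + r * (\<Sum>i\<in>cutoff N. \<kappa> i * X \<omega> (mode i)))) \<longlonglongrightarrow> (CLINT \<omega>|M. iexp (X0 \<omega> f + r * Y \<omega>))"
  proof (rule integral_dominated_convergence[where w="\<lambda>_. 1"])
    show "AE \<omega> in M. (\<lambda>N. iexp (X0 \<omega> f + r * (\<Sum>i\<in>cutoff N. \<kappa> i * X \<omega> (mode i)))) \<longlonglongrightarrow> iexp (X0 \<omega> f + r * Y \<omega>)"
      using pairing_convergent
    proof eventually_elim
      case (elim \<omega>)
      then have "(\<lambda>N. \<Sum>i\<in>cutoff N. \<kappa> i * X \<omega> (mode i)) \<longlonglongrightarrow> Y \<omega>"
        unfolding Y_lim by (simp add: convergent_LIMSEQ_iff)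
      then show ?case by (intro tendsto_intros)
    qed
  qed (use Xm Sm Y_measurable in \<open>auto simp: norm_exp_i_times intro!: borel_measurable_add borel_measurable_times\<close>)
  have pl: "(\<lambda>N. ip f (proj N \<phi>)) \<longlonglongrightarrow> ip f \<phi>"
  proof -
    have b: "norm (ip f (\<lambda>x. \<phi> x - proj N \<phi> x)) \<le> sqrt (ip f f) * sqrt (ip (\<lambda>x. \<phi> x - proj N \<phi> x) (\<lambda>x. \<phi> x - proj N \<phi> x))" for N
      using ip_abs_le[OF H1_D(2)[OF f] L2t_diff[OF \<phi>_L2t L2t_proj]] by simp
    have "(\<lambda>N. sqrt (ip f f) * sqrt (ip (\<lambda>x. \<phi> x - proj N \<phi> x) (\<lambda>x. \<phi> x - proj N \<phi> x))) \<longlonglongrightarrow> sqrt (ip f f) * sqrt 0"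
      by (intro tendsto_mult tendsto_const tendsto_real_sqrt proj_converges \<phi>_L2t)
    then have z: "(\<lambda>N. sqrt (ip f f) * sqrt (ip (\<lambda>x. \<phi> x - proj N \<phi> x) (\<lambda>x. \<phi> x - proj N \<phi> x))) \<longlonglongrightarrow> 0" by simp
    have "(\<lambda>N. ip f (\<lambda>x. \<phi> x - proj N \<phi> x)) \<longlonglongrightarrow> 0"
      by (rule Lim_null_comparison[OF always_eventually[OF allI[OF b]] z])
    from tendsto_diff[OF tendsto_const[of "ip f \<phi>"] this] show ?thesis
      by (simp add: ip_diff_right \<phi>_L2t H1_D(2)[OF f])
  qed
  have c: "ip f \<phi>0 = ip f \<phi> - ip f (\<lambda>_. ip \<phi> (\<lambda>_. 1))"
    unfolding centre_def[abs_def] by (simp add: ip_diff_right \<phi>_L2t H1_D(2)[OF f])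
  show "(\<lambda>N. CLINT \<omega>|M. iexp (X0 \<omega> f + r * (\<Sum>i\<in>cutoff N. \<kappa> i * X \<omega> (mode i)))) \<longlonglongrightarrow>
     complex_of_real (exp (- (?v + 2 * r * (2 * pi * ip f \<phi>0) + r\<^sup>2 * s) / 2))"
    unfolding eq var c by (intro tendsto_of_real tendsto_exp tendsto_divide tendsto_minus tendsto_add tendsto_mult tendsto_diff
        tendsto_const pl variance_tendsto) simp
qed

text \<open>If the Dirichlet energy vanishes, then all nonconstant Fourier coefficients of \<open>\<phi>\<close> do, and both the
  weight and the shift are trivial. Otherwise \<open>gaussian_shift\<close> applies.\<close>
lemma cameron_martin_coeffs:
  assumes g: "g \<in> borel_measurable (borel :: (idx \<Rightarrow> real) measure)"
  shows "(\<integral>\<^sup>+\<omega>. ennreal (exp (a * Y \<omega>)) * g (coeffs (X \<omega>)) \<partial>M)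
       = ennreal (exp (a\<^sup>2 * s / 2)) * (\<integral>\<^sup>+\<omega>. g (\<lambda>i. X \<omega> (mode i) + a * (2 * pi * ip (mode i) \<phi>0)) \<partial>M)"
proof (cases "s > 0")
  case True
  define T where "T = {(\<lambda>\<omega>. X0 \<omega> f, 2 * pi * ip f \<phi>0) | f. f \<in> H1}"
  have PiM: "sets (\<Pi>\<^sub>M i\<in>(UNIV :: idx set). (borel :: real measure)) = sets borel"
    by (rule sets_PiM_equal_borel)
  have g': "g \<in> borel_measurable (\<Pi>\<^sub>M i\<in>(UNIV :: idx set). (borel :: real measure))"
    using g by (subst measurable_cong_sets[OF PiM refl])
  have X0m: "(\<lambda>\<omega>. X0 \<omega> f) \<in> borel_measurable M" if "f \<in> H1" for f
    using X_eval[OF that] by (subst measurable_cong[where g="\<lambda>\<omega>. X \<omega> f"]) (simp_all add: X0_def)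
  have X00: "X0 \<omega> (\<lambda>_. 0) = 0" for \<omega>
    by (simp add: X0_def Hm1_zero[OF X_Hm1])
  have "(\<integral>\<^sup>+\<omega>. ennreal (exp (a * Y \<omega>)) * g (\<lambda>i\<in>UNIV. X0 \<omega> (mode i)) \<partial>M)
       = ennreal (exp (a\<^sup>2 * s / 2)) * (\<integral>\<^sup>+\<omega>. g (\<lambda>i\<in>UNIV. X0 \<omega> (mode i) + a * (2 * pi * ip (mode i) \<phi>0)) \<partial>M)"
  proof (rule gaussian_shift[where T=T])
    show "prob_space M" by (rule prob_space_axioms)
    show "f \<in> borel_measurable M" if "(f, c) \<in> T" for f c
      using that X0m by (auto simp: T_def)
    show "(\<lambda>\<omega>. a * f \<omega> + b * f' \<omega>, a * c + b * c') \<in> T" if "(f, c) \<in> T" "(f', c') \<in> T" for f c f' c' a b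
    proof -
      have T_D: "\<exists>h\<in>H1. f = (\<lambda>\<omega>. X0 \<omega> h) \<and> c = 2 * pi * ip h \<phi>0" if "(f, c) \<in> T" for f c
        using that unfolding T_def mem_Collect_eq prod.inject by (elim exE conjE) (rule bexI, rule conjI)
      from T_D[OF that(1)] obtain h where h: "h \<in> H1" "f = (\<lambda>\<omega>. X0 \<omega> h)" "c = 2 * pi * ip h \<phi>0"
        by (elim bexE conjE)
      from T_D[OF that(2)] obtain h' where h': "h' \<in> H1" "f' = (\<lambda>\<omega>. X0 \<omega> h')" "c' = 2 * pi * ip h' \<phi>0"
        by (elim bexE conjE)
      note h = h(1) h'(1) h(2,3) h'(2,3)
      have "ip (\<lambda>x. a * h x + b * h' x) \<phi>0 = a * ip h \<phi>0 + b * ip h' \<phi>0"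
        using h by (simp add: ip_add_left ip_scale_left L2t_scale H1_D(2) centre_L2t \<phi>_L2t)
      then show ?thesis
        unfolding T_def using h H1_lin[OF h(1,2), of a b]
        by (intro CollectI exI[of _ "\<lambda>x. a * h x + b * h' x"]) (simp add: X0_lin algebra_simps)
    qed
    show "\<exists>q. \<forall>r. (CLINT \<omega>|M. iexp (f \<omega> + r * Y \<omega>)) = complex_of_real (exp (- (q + 2 * r * c + r\<^sup>2 * s) / 2))"
      if "(f, c) \<in> T" for f c
      using that joint_char unfolding T_def by blast
    show "Y \<in> borel_measurable M" by (rule Y_measurable)
    show "(CLINT \<omega>|M. iexp (t * Y \<omega>)) = complex_of_real (exp (- (t\<^sup>2 * s / 2)))" for t
    proof -
      have "ip (\<lambda>_. 0) \<phi>0 = 0" by (simp add: ip_def)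
      moreover have "(LINT \<omega>|M. (X \<omega> (\<lambda>_. 0))\<^sup>2) = (LINT \<omega>|M. 0)"
        by (intro Bochner_Integration.integral_cong refl) (simp add: Hm1_zero[OF X_Hm1])
      ultimately show ?thesis using joint_char[OF zero_H1, of t] by (simp add: X00)
    qed
    show "s > 0" by fact
    show "((\<lambda>\<omega>. X0 \<omega> (mode i)), 2 * pi * ip (mode i) \<phi>0) \<in> T" for i
      unfolding T_def using H1_mode by blast
    show "T \<noteq> {}" unfolding T_def using H1_mode by blast
    show "g \<in> borel_measurable (\<Pi>\<^sub>M i\<in>(UNIV :: idx set). (borel :: real measure))" by (rule g')
  qed
  moreover have "(\<integral>\<^sup>+\<omega>. ennreal (exp (a * Y \<omega>)) * g (\<lambda>i\<in>UNIV. X0 \<omega> (mode i)) \<partial>M) = (\<integral>\<^sup>+\<omega>. ennreal (exp (a * Y \<omega>)) * g (coeffs (X \<omega>)) \<partial>M)"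
    by (intro nn_integral_cong) (simp add: coeffs_def X0_def restrict_UNIV)
  moreover have "(\<integral>\<^sup>+\<omega>. g (\<lambda>i\<in>UNIV. X0 \<omega> (mode i) + a * (2 * pi * ip (mode i) \<phi>0)) \<partial>M) = (\<integral>\<^sup>+\<omega>. g (\<lambda>i. X \<omega> (mode i) + a * (2 * pi * ip (mode i) \<phi>0)) \<partial>M)"
    by (intro nn_integral_cong) (simp add: X0_def restrict_UNIV)
  ultimately show ?thesis by simp
next
  case False
  let ?f = "\<lambda>i. eigenvalue \<tau> i * (ip \<phi> (mode i))\<^sup>2"
  have nn: "0 \<le> ?f i" for i using eigenvalue_nonneg[OF tau] by simp
  have inc: "incseq (\<lambda>N. Im \<tau> * (\<Sum>i\<in>cutoff N. ?f i))"
    using cutoff_incseq[of ?f] nn tau by (auto simp: incseq_def)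
  have le: "Im \<tau> * (\<Sum>i\<in>cutoff N. ?f i) \<le> dirichlet_energy \<tau> \<phi>" for N
    by (rule incseq_le[OF inc dirichlet_sums[OF tau \<phi>]])
  have "dirichlet_energy \<tau> \<phi> \<le> 0" using False by (simp add: not_less zero_less_mult_iff)
  then have D: "Im \<tau> * (\<Sum>i\<in>cutoff N. ?f i) \<le> 0" for N using le[of N] by linarith
  have sums_zero: "(\<Sum>i\<in>cutoff N. ?f i) = 0" for N
  proof -
    have "0 \<le> (\<Sum>i\<in>cutoff N. ?f i)" by (rule sum_nonneg) (rule nn)
    with D[of N] tau show ?thesis by (simp only: mult_le_0_iff) linarith
  qed
  have z: "?f i = 0" for i
    using sums_zero[of "level i"] sum_nonneg_eq_0_iff[OF finite_cutoff, of "level i" ?f] nn by (auto simp: in_cutoff_iff)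
  have "\<kappa> i = 0" for i using z[of i] by (auto simp: pairing_coeff_def)
  then have Y0: "Y \<omega> = 0" for \<omega> unfolding Y_lim by simp
  have "ip (mode i) \<phi>0 = 0" for i
  proof -
    have e: "ip (mode i) \<phi>0 = ip \<phi> (mode i) - ip \<phi> (mode (0, 0, True)) * ip (mode (0, 0, True)) (mode i)"
      using ip_scale_left[of "ip \<phi> (\<lambda>_. 1)" "\<lambda>_. 1" "mode i"]
      unfolding centre_def[abs_def] ip_commute[of "mode i"]
      by (subst ip_diff_left) (simp_all add: \<phi>_L2t mode_level_zero)
    show ?thesis
    proof (cases "level i = 0")
      case True
      have one: "ip (\<lambda>_. 1) (\<lambda>_. 1) = 1" by (simp add: ip_def torus.prob_space)
      have zero: "ip f (\<lambda>_. 0) = 0" for f by (simp add: ip_def)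
      show ?thesis using True unfolding level_zero_iff e by (auto simp: mode_level_zero one zero)
    next
      case False
      then have "ip \<phi> (mode i) = 0" using z[of i] eigenvalue_pos[OF tau False] by simp
      moreover have "ip (mode (0, 0, True)) (mode i) = 0" using False by (intro ip_mode_level) (simp add: level_def)
      ultimately show ?thesis by (simp add: e)
    qed
  qed
  moreover have "dirichlet_energy \<tau> \<phi> = 0"
    using \<open>dirichlet_energy \<tau> \<phi> \<le> 0\<close> le[of 0] sums_zero[of 0] by simp
  ultimately show ?thesis by (simp add: Y0 coeffs_def)
qed

lemma shift_Hm1: "T \<in> Hm1 \<Longrightarrow> (\<lambda>f. T f + c * functional_of \<phi>0 f) \<in> Hm1"
  using Hm1_lincomb[of T "functional_of \<phi>0" 1 c] functional_of_Hm1[OF centre_L2t[OF \<phi>_L2t]] by simp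

text \<open>The law of the field is determined by the law of its Fourier coefficients
  (\<open>Hm1_borel_coeffs\<close>).\<close>
theorem cameron_martin:
  assumes G: "G \<in> borel_measurable Hm1_borel"
  shows "(\<integral>\<^sup>+\<omega>. ennreal (exp (a * Y \<omega>)) * G (X \<omega>) \<partial>M)
       = ennreal (exp (a\<^sup>2 * s / 2)) * (\<integral>\<^sup>+\<omega>. G (\<lambda>f. X \<omega> f + 2 * pi * a * functional_of \<phi>0 f) \<partial>M)"
proof -
  define X' where "X' \<omega> = (\<lambda>f. X \<omega> f + 2 * pi * a * functional_of \<phi>0 f)" for \<omega>
  have X'_mode: "X' \<omega> (mode i) = X \<omega> (mode i) + a * (2 * pi * ip (mode i) \<phi>0)" for \<omega> i
    by (simp add: X'_def functional_of_mode ip_commute)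
  have X' [measurable]: "X' \<in> measurable M Hm1_borel"
  proof (rule Hm1_borel_measurableI)
    show "X' \<omega> \<in> Hm1" if "\<omega> \<in> space M" for \<omega> unfolding X'_def by (rule shift_Hm1[OF X_Hm1[OF that]])
    show "(\<lambda>\<omega>. X' \<omega> (mode i)) \<in> borel_measurable M" for i
      unfolding X'_mode by (intro borel_measurable_add X_eval H1_mode borel_measurable_const)
  qed
  have Y: "(\<lambda>\<omega>. ennreal (exp (a * Y \<omega>))) \<in> borel_measurable M" using Y_measurable by measurable
  let ?K = "ennreal (exp (a\<^sup>2 * s / 2))"
  let ?D1 = "density M (\<lambda>\<omega>. ennreal (exp (a * Y \<omega>)))" and ?D2 = "density M (\<lambda>_. ?K)"
  have X1: "X \<in> measurable ?D1 Hm1_borel" and X2: "X' \<in> measurable ?D2 Hm1_borel" by simp_all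
  have "distr ?D1 Hm1_borel X = distr ?D2 Hm1_borel X'"
  proof (rule measure_eqI)
    fix A assume "A \<in> sets (distr ?D1 Hm1_borel X)"
    then have A: "A \<in> sets Hm1_borel" by simp
    obtain B where B: "B \<in> sets borel" "A = {T\<in>Hm1. coeffs T \<in> B}" using Hm1_borel_coeffs[OF A] by blast
    have s1: "X -` A \<inter> space M \<in> sets M" "X' -` A \<inter> space M \<in> sets M" by (intro measurable_sets[OF _ A] X_measurable X')+
    have "emeasure (distr ?D1 Hm1_borel X) A = emeasure ?D1 (X -` A \<inter> space M)"
      using emeasure_distr[OF X1 A] by simp
    also have "\<dots> = (\<integral>\<^sup>+\<omega>. ennreal (exp (a * Y \<omega>)) * indicator (X -` A \<inter> space M) \<omega> \<partial>M)"
      by (rule emeasure_density[OF Y s1(1)])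
    also have "\<dots> = (\<integral>\<^sup>+\<omega>. ennreal (exp (a * Y \<omega>)) * indicator B (coeffs (X \<omega>)) \<partial>M)"
      by (intro nn_integral_cong) (auto simp: B(2) indicator_def X_Hm1)
    also have "\<dots> = ?K * (\<integral>\<^sup>+\<omega>. indicator B (\<lambda>i. X \<omega> (mode i) + a * (2 * pi * ip (mode i) \<phi>0)) \<partial>M)"
      by (rule cameron_martin_coeffs) (use B(1) in simp)
    also have "(\<integral>\<^sup>+\<omega>. indicator B (\<lambda>i. X \<omega> (mode i) + a * (2 * pi * ip (mode i) \<phi>0)) \<partial>M) = (\<integral>\<^sup>+\<omega>. indicator (X' -` A \<inter> space M) \<omega> \<partial>M)"
      using shift_Hm1[OF X_Hm1, of _ "2 * pi * a"]
      by (intro nn_integral_cong) (auto simp: B(2) indicator_def coeffs_def X'_mode X'_def[symmetric])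
    also have "?K * \<dots> = (\<integral>\<^sup>+\<omega>. ?K * indicator (X' -` A \<inter> space M) \<omega> \<partial>M)"
      by (rule nn_integral_cmult[symmetric]) (use s1 in simp)
    also have "\<dots> = emeasure ?D2 (X' -` A \<inter> space M)"
      by (rule emeasure_density[symmetric]) (use s1 in simp_all)
    also have "\<dots> = emeasure (distr ?D2 Hm1_borel X') A"
      using emeasure_distr[OF X2 A] by simp
    finally show "emeasure (distr ?D1 Hm1_borel X) A = emeasure (distr ?D2 Hm1_borel X') A" .
  qed simp
  have G1: "G \<in> borel_measurable (distr ?D1 Hm1_borel X)" and G2: "G \<in> borel_measurable (distr ?D2 Hm1_borel X')"
    using G by simp_all
  from \<open>distr ?D1 Hm1_borel X = distr ?D2 Hm1_borel X'\<close>
  have "(\<integral>\<^sup>+T. G T \<partial>distr ?D1 Hm1_borel X) = (\<integral>\<^sup>+T. G T \<partial>distr ?D2 Hm1_borel X')" by simp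
  moreover have "(\<integral>\<^sup>+T. G T \<partial>distr ?D1 Hm1_borel X) = (\<integral>\<^sup>+\<omega>. ennreal (exp (a * Y \<omega>)) * G (X \<omega>) \<partial>M)"
    using Y measurable_compose[OF X_measurable G] by (simp add: nn_integral_distr[OF X1 G1] nn_integral_density)
  moreover have "(\<integral>\<^sup>+T. G T \<partial>distr ?D2 Hm1_borel X') = ?K * (\<integral>\<^sup>+\<omega>. G (X' \<omega>) \<partial>M)"
    unfolding nn_integral_distr[OF X2 G2]
    using measurable_compose[OF X' G] by (simp add: nn_integral_density nn_integral_cmult)
  ultimately show ?thesis by (simp add: X'_def)
qed

text \<open>By the Cameron--Martin formula, the law of the field shifted by \<open>\<phi>\<close> is absolutely continuous with
  respect to the law of the field. Therefore the circle averages of both the field and the shifted field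
  converge almost surely, and their difference is the deterministic series in question. This replaces
  a trace theorem for \<open>H1\<close>.\<close>
lemma circle_average_shift_convergent:
  assumes "\<epsilon> > 0"
  shows "convergent (\<lambda>N. \<Sum>i\<in>cutoff N. functional_of \<phi>0 (mode i) * circ_mean \<tau> \<epsilon> i x)"
proof -
  let ?S = "\<lambda>T N. \<Sum>i\<in>cutoff N. T (mode i) * circ_mean \<tau> \<epsilon> i x"
  \<comment> \<open>With this weight the shift \<open>2\<pi>a\<close> is exactly \<open>1\<close>.\<close>
  define a where "a = 1 / (2 * pi)"
  define Bad where "Bad = {T\<in>Hm1. \<not> Cauchy (?S T)}"
  have ev: "(\<lambda>T. ?S T N) \<in> borel_measurable Hm1_borel" for N
    by (intro borel_measurable_sum borel_measurable_times borel_measurable_const Hm1_evaluation_measurable H1_mode)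
  have "{T\<in>space Hm1_borel. Cauchy (?S T)} \<in> sets Hm1_borel" by (rule sets_Collect_Cauchy[OF ev])
  then have Bad: "Bad \<in> sets Hm1_borel"
    unfolding Bad_def space_Hm1_borel[symmetric] by (rule sets.sets_Collect_neg)
  then have G: "indicator Bad \<in> borel_measurable Hm1_borel" by simp
  have X: "AE \<omega> in M. Cauchy (?S (X \<omega>))"
    using circle_average_convergent[OF assms, of x] by (simp add: Cauchy_convergent_iff)
  then have "(\<integral>\<^sup>+\<omega>. ennreal (exp (a * Y \<omega>)) * indicator Bad (X \<omega>) \<partial>M) = (\<integral>\<^sup>+\<omega>. 0 \<partial>M)"
    by (intro nn_integral_cong_AE) (auto simp: Bad_def indicator_def)
  then have "(\<integral>\<^sup>+\<omega>. indicator Bad (\<lambda>f. X \<omega> f + 2 * pi * a * functional_of \<phi>0 f) \<partial>M) = 0"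
    unfolding cameron_martin[OF G] by simp
  moreover have m: "(\<lambda>\<omega>. (\<lambda>f. X \<omega> f + 2 * pi * a * functional_of \<phi>0 f)) \<in> measurable M Hm1_borel"
    by (intro Hm1_borel_measurableI shift_Hm1 X_Hm1 borel_measurable_add X_eval H1_mode borel_measurable_const)
  ultimately have "AE \<omega> in M. indicator Bad (\<lambda>f. X \<omega> f + 2 * pi * a * functional_of \<phi>0 f) = (0 :: ennreal)"
    using nn_integral_0_iff_AE[OF measurable_compose[OF m G]] by simp
  then have "AE \<omega> in M. Cauchy (?S (\<lambda>f. X \<omega> f + 1 * functional_of \<phi>0 f))"
    using AE_space
  proof eventually_elim
    case (elim \<omega>)
    have "2 * pi * a = 1" by (simp add: a_def)
    then show ?case using elim shift_Hm1[OF X_Hm1[OF elim(2)], of 1] by (simp add: Bad_def indicator_def split: if_splits)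
  qed
  then obtain \<omega> where "Cauchy (?S (X \<omega>))" "Cauchy (?S (\<lambda>f. X \<omega> f + 1 * functional_of \<phi>0 f))"
    using AE_conjI[OF X] AE_False not_AE_zero_E by (smt (verit) eventually_mono)
  then have "convergent (\<lambda>N. ?S (\<lambda>f. X \<omega> f + 1 * functional_of \<phi>0 f) N - ?S (X \<omega>) N)"
    unfolding Cauchy_convergent_iff by (rule convergent_diff[rotated])
  then show ?thesis by (simp add: distrib_right sum.distrib)
qed

end

end

section \<open>Measurability of the Liouville integrand\<close>

lemma ip_const_mode: "ip (\<lambda>_. k) (mode i) = k * of_bool (i = (0, 0, True))"
proof -
  have "ip (\<lambda>_. k * 1) (mode i) = k * ip (mode (0, 0, True)) (mode i)"
    unfolding mode_level_zero by (rule ip_scale_left)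
  moreover have "ip (mode (0, 0, True)) (mode i) = of_bool (i = (0, 0, True))"
    by (cases i) (auto simp: ip_mode neg_def parity_def)
  ultimately show ?thesis by simp
qed

lemma circle_series_const: "(\<Sum>i\<in>cutoff N. functional_of (\<lambda>_. k) (mode i) * circ_mean \<tau> \<epsilon> i x) = k"
proof -
  have "(0, 0, True) \<in> cutoff N" by (simp add: in_cutoff_iff level_def)
  then have "(\<Sum>i\<in>cutoff N. k * of_bool (i = (0, 0, True)) * circ_mean \<tau> \<epsilon> i x) = (\<Sum>i\<in>{(0, 0, True)}. k * circ_mean \<tau> \<epsilon> i x)"
    by (intro sum.mono_neutral_cong_right) auto
  then show ?thesis by (simp add: functional_of_mode ip_const_mode circ_mean_const)
qed

text \<open>Circle averages are limits of partial sums and hence additive only where these converge.\<close>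
definition circle_conv :: "complex \<Rightarrow> real \<Rightarrow> functional \<Rightarrow> pt \<Rightarrow> bool" where
  "circle_conv \<tau> \<epsilon> T x \<longleftrightarrow> convergent (\<lambda>N. \<Sum>i\<in>cutoff N. T (mode i) * circ_mean \<tau> \<epsilon> i x)"

lemma circle_conv_LIMSEQ: "circle_conv \<tau> \<epsilon> T x \<Longrightarrow> (\<lambda>N. \<Sum>i\<in>cutoff N. T (mode i) * circ_mean \<tau> \<epsilon> i x) \<longlonglongrightarrow> circle_avg \<tau> \<epsilon> T x"
  unfolding circle_conv_def circle_avg_series by (simp add: convergent_LIMSEQ_iff)

lemma circle_lin:
  assumes "circle_conv \<tau> \<epsilon> S x" "circle_conv \<tau> \<epsilon> T x"
  shows "circle_conv \<tau> \<epsilon> (\<lambda>f. S f + b * T f) x"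
    and "circle_avg \<tau> \<epsilon> (\<lambda>f. S f + b * T f) x = circle_avg \<tau> \<epsilon> S x + b * circle_avg \<tau> \<epsilon> T x"
proof -
  have "(\<lambda>N. (\<Sum>i\<in>cutoff N. S (mode i) * circ_mean \<tau> \<epsilon> i x) + b * (\<Sum>i\<in>cutoff N. T (mode i) * circ_mean \<tau> \<epsilon> i x))
      \<longlonglongrightarrow> circle_avg \<tau> \<epsilon> S x + b * circle_avg \<tau> \<epsilon> T x"
    by (intro tendsto_add tendsto_mult tendsto_const circle_conv_LIMSEQ assms)
  then have *: "(\<lambda>N. \<Sum>i\<in>cutoff N. (S (mode i) + b * T (mode i)) * circ_mean \<tau> \<epsilon> i x)
      \<longlonglongrightarrow> circle_avg \<tau> \<epsilon> S x + b * circle_avg \<tau> \<epsilon> T x"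
    by (simp add: distrib_right sum.distrib sum_distrib_left mult.assoc)
  then show "circle_conv \<tau> \<epsilon> (\<lambda>f. S f + b * T f) x" unfolding circle_conv_def by (rule convergentI)
  show "circle_avg \<tau> \<epsilon> (\<lambda>f. S f + b * T f) x = circle_avg \<tau> \<epsilon> S x + b * circle_avg \<tau> \<epsilon> T x"
    using limI[OF *] by (subst circle_avg_series)
qed

lemma circle_const: "circle_conv \<tau> \<epsilon> (functional_of (\<lambda>_. k)) x" "circle_avg \<tau> \<epsilon> (functional_of (\<lambda>_. k)) x = k"
  unfolding circle_conv_def circle_avg_series circle_series_const by (simp_all add: convergent_const)

lemma functional_of_const: "functional_of (\<lambda>_. k) = (\<lambda>f. k * functional_of (\<lambda>_. 1) f)"
  by (rule ext) (simp add: functional_of_def)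

lemma circle_avg_measurable:
  assumes [measurable]: "T \<in> measurable N Hm1_borel" "u \<in> measurable N borel"
  shows "(\<lambda>p. circle_avg \<tau> \<epsilon> (T p) (u p)) \<in> borel_measurable N"
proof -
  have "(\<lambda>p. T p (mode i)) \<in> borel_measurable N" for i
    by (rule measurable_compose[OF assms(1) Hm1_evaluation_measurable[OF H1_mode]])
  moreover have "(\<lambda>p. circ_mean \<tau> \<epsilon> i (u p)) \<in> borel_measurable N" for i
    by (rule measurable_compose[OF assms(2) circ_mean_measurable])
  ultimately show ?thesis unfolding circle_avg_series
    by (intro borel_measurable_lim_metric borel_measurable_sum borel_measurable_times)
qed

lemma finite_torus_vol: "finite_measure (torus_vol \<tau>)"
proof (rule finite_measureI)
  have "emeasure (torus_vol \<tau>) (space (torus_vol \<tau>)) = ennreal (Im \<tau>) * emeasure torus (space torus)"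
    unfolding torus_vol_def by (simp add: emeasure_density_const)
  then show "emeasure (torus_vol \<tau>) (space (torus_vol \<tau>)) \<noteq> \<infinity>"
    by (simp add: torus.emeasure_space_1)
qed

lemma borel_measurable_torus_vol: "f \<in> measurable borel N \<Longrightarrow> f \<in> measurable (torus_vol \<tau>) N"
  unfolding torus_vol_def using borel_measurable_torus by simp

text \<open>The regularized partition functions at a fixed \<open>\<epsilon> > 0\<close>.\<close>
locale liouville = gff M \<tau> X for M :: "'w measure" and \<tau> X +
  fixes \<gamma> Q \<mu> :: real and n :: nat and z :: "nat \<Rightarrow> pt" and \<alpha> :: "nat \<Rightarrow> real"
    and F :: "functional \<Rightarrow> real" and \<epsilon> :: real
  assumes eps: "\<epsilon> > 0" and F_measurable: "F \<in> borel_measurable Hm1_borel"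
begin

text \<open>The integrand without the curvature term, as a function of the field \<open>W\<close> on which \<open>F\<close> is evaluated
  and of its circle averages \<open>V\<close>.\<close>
definition L :: "functional \<Rightarrow> (pt \<Rightarrow> real) \<Rightarrow> real" where
  "L W V = F W * (\<Prod>i\<in>{1..n}. \<epsilon> powr ((\<alpha> i)\<^sup>2 / 2) * exp (\<alpha> i * V (z i)))
     * exp (- (\<mu> * \<epsilon> powr (\<gamma>\<^sup>2 / 2) * (LINT x|torus_vol \<tau>. exp (\<gamma> * V x))))"

lemma L_measurable:
  assumes W: "W \<in> measurable N Hm1_borel" and V: "(\<lambda>p. V (fst p) (snd p)) \<in> borel_measurable (N \<Otimes>\<^sub>M (borel :: pt measure))"
  shows "(\<lambda>p. L (W p) (V p)) \<in> borel_measurable N"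
proof -
  interpret finite_measure "torus_vol \<tau>" by (rule finite_torus_vol)
  have 1: "(\<lambda>p. F (W p)) \<in> borel_measurable N" by (rule measurable_compose[OF W F_measurable])
  have 2: "(\<lambda>p. V p x) \<in> borel_measurable N" for x
    using measurable_compose[OF measurable_Pair2'[of x borel N] V] by simp
  have id: "(\<lambda>x. x) \<in> measurable (torus_vol \<tau>) (borel :: pt measure)"
    by (rule borel_measurable_torus_vol) simp
  have "(\<lambda>p. (fst p, snd p)) \<in> measurable (N \<Otimes>\<^sub>M torus_vol \<tau>) (N \<Otimes>\<^sub>M (borel :: pt measure))"
    by (intro measurable_Pair measurable_fst measurable_compose[OF measurable_snd id])
  from measurable_compose[OF this V] have "(\<lambda>p. V (fst p) (snd p)) \<in> borel_measurable (N \<Otimes>\<^sub>M torus_vol \<tau>)" by simp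
  then have "(\<lambda>p. exp (\<gamma> * V (fst p) (snd p))) \<in> borel_measurable (N \<Otimes>\<^sub>M torus_vol \<tau>)" by measurable
  then have 3: "(\<lambda>p. LINT x|torus_vol \<tau>. exp (\<gamma> * V p x)) \<in> borel_measurable N"
    by (intro borel_measurable_lebesgue_integral) (simp add: case_prod_beta')
  show ?thesis unfolding L_def
    using 1 2 3 by (intro borel_measurable_times borel_measurable_prod measurable_compose[OF _ borel_measurable_exp]
        borel_measurable_uminus borel_measurable_const)
qed

lemma L_cong:
  assumes "\<And>i. i \<in> {1..n} \<Longrightarrow> V (z i) = V' (z i)" and AE: "AE x in torus. V x = V' x"
    and m: "V \<in> borel_measurable borel" "V' \<in> borel_measurable borel"
  shows "L W V = L W V'"
proof -
  have "(LINT x|torus_vol \<tau>. exp (\<gamma> * V x)) = (LINT x|torus_vol \<tau>. exp (\<gamma> * V' x))"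
  proof (rule integral_cong_AE)
    show "AE x in torus_vol \<tau>. exp (\<gamma> * V x) = exp (\<gamma> * V' x)"
      unfolding torus_vol_def using AE by (subst AE_density) (auto elim: eventually_mono)
  qed (intro borel_measurable_torus_vol; use m in measurable)+
  moreover have "(\<Prod>i\<in>{1..n}. \<epsilon> powr ((\<alpha> i)\<^sup>2 / 2) * exp (\<alpha> i * V (z i))) = (\<Prod>i\<in>{1..n}. \<epsilon> powr ((\<alpha> i)\<^sup>2 / 2) * exp (\<alpha> i * V' (z i)))"
    by (intro prod.cong refl) (simp only: assms(1))
  ultimately show ?thesis by (simp only: L_def)
qed

definition \<kappa>0 :: real where "\<kappa>0 = - (Q / 2) * ln (Im \<tau>)"

text \<open>The integrand for the background metric, where the curvature and the mean correction are absent. The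
  two arguments of \<open>L\<close> come from the same field \<open>c + T - (Q/2) ln Im \<tau>\<close>.\<close>
definition \<Psi> :: "real \<Rightarrow> functional \<Rightarrow> real" where
  "\<Psi> c T = L (\<lambda>f. T f + functional_of (\<lambda>_. c + \<kappa>0) f) (\<lambda>x. c + \<kappa>0 + circle_avg \<tau> \<epsilon> T x)"

lemma add_const_measurable:
  assumes T: "T \<in> measurable N Hm1_borel" and k: "k \<in> borel_measurable N"
  shows "(\<lambda>p. (\<lambda>f. T p f + functional_of (\<lambda>_. k p) f)) \<in> measurable N Hm1_borel"
proof (rule Hm1_borel_measurableI)
  show "(\<lambda>f. T p f + functional_of (\<lambda>_. k p) f) \<in> Hm1" if "p \<in> space N" for p
    using measurable_space[OF T that] by (intro Hm1_add functional_of_Hm1) (auto simp: space_Hm1_borel)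
  have "(\<lambda>p. T p (mode i)) \<in> borel_measurable N" for i
    by (rule measurable_compose[OF T Hm1_evaluation_measurable[OF H1_mode]])
  then show "(\<lambda>p. T p (mode i) + functional_of (\<lambda>_. k p) (mode i)) \<in> borel_measurable N" for i
    unfolding functional_of_mode ip_const_mode using k by (intro borel_measurable_add borel_measurable_times borel_measurable_const)
qed

lemma \<Psi>_measurable:
  assumes c: "c \<in> borel_measurable N" and T: "T \<in> measurable N Hm1_borel"
  shows "(\<lambda>p. \<Psi> (c p) (T p)) \<in> borel_measurable N"
  unfolding \<Psi>_def
proof (rule L_measurable)
  show "(\<lambda>p. (\<lambda>f. T p f + functional_of (\<lambda>_. c p + \<kappa>0) f)) \<in> measurable N Hm1_borel"
    using c by (intro add_const_measurable T borel_measurable_add) simp_all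
  show "(\<lambda>p. c (fst p) + \<kappa>0 + circle_avg \<tau> \<epsilon> (T (fst p)) (snd p)) \<in> borel_measurable (N \<Otimes>\<^sub>M borel)"
    by (intro borel_measurable_add borel_measurable_const circle_avg_measurable
        measurable_compose[OF measurable_fst c] measurable_compose[OF measurable_fst T] measurable_snd)
qed

text \<open>The fields at which all circle averages entering the integrand exist. Points are needed at the
  insertions, almost every point suffices in the volume integral.\<close>
definition good :: "functional \<Rightarrow> bool" where
  "good T \<longleftrightarrow> T \<in> Hm1 \<and> (\<forall>i\<in>{1..n}. circle_conv \<tau> \<epsilon> T (z i)) \<and> (AE x in torus. circle_conv \<tau> \<epsilon> T x)"

lemma circle_avg_fixed: "T \<in> Hm1 \<Longrightarrow> (\<lambda>x. circle_avg \<tau> \<epsilon> T x) \<in> borel_measurable borel"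
  by (rule circle_avg_measurable) (auto simp: space_Hm1_borel)

lemma \<Psi>_const:
  assumes "good T"
  shows "\<Psi> c (\<lambda>f. T f + functional_of (\<lambda>_. k) f) = \<Psi> (c + k) T"
proof -
  have W: "(\<lambda>f. T f + functional_of (\<lambda>_. k) f + functional_of (\<lambda>_. c + \<kappa>0) f) = (\<lambda>f. T f + functional_of (\<lambda>_. c + k + \<kappa>0) f)"
    by (rule ext) (simp add: functional_of_const[of k] functional_of_const[of "c + _"] functional_of_const[of "_ + \<kappa>0"] algebra_simps)
  have V: "circle_avg \<tau> \<epsilon> (\<lambda>f. T f + functional_of (\<lambda>_. k) f) x = circle_avg \<tau> \<epsilon> T x + k" if "circle_conv \<tau> \<epsilon> T x" for x
    using circle_lin(2)[OF that circle_const(1)[of \<tau> \<epsilon> k x], of 1] by (simp add: circle_const)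
  have T: "T \<in> Hm1" "(\<lambda>f. T f + functional_of (\<lambda>_. k) f) \<in> Hm1"
    using assms by (auto simp: good_def intro!: Hm1_add functional_of_Hm1)
  show ?thesis unfolding \<Psi>_def W
  proof (rule L_cong)
    show "c + \<kappa>0 + circle_avg \<tau> \<epsilon> (\<lambda>f. T f + functional_of (\<lambda>_. k) f) (z i) = c + k + \<kappa>0 + circle_avg \<tau> \<epsilon> T (z i)" if "i \<in> {1..n}" for i
      using assms that by (simp add: good_def V)
    have "AE x in torus. circle_conv \<tau> \<epsilon> T x" using assms by (simp add: good_def)
    then show "AE x in torus. c + \<kappa>0 + circle_avg \<tau> \<epsilon> (\<lambda>f. T f + functional_of (\<lambda>_. k) f) x = c + k + \<kappa>0 + circle_avg \<tau> \<epsilon> T x"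
      by eventually_elim (simp add: V)
  qed (intro borel_measurable_add borel_measurable_const circle_avg_fixed T)+
qed

text \<open>For every fixed point the circle average converges almost surely; by Fubini, almost surely it then
  converges at almost every point.\<close>
lemma X_good: "AE \<omega> in M. good (X \<omega>)"
proof -
  have C: "AE \<omega> in M. circle_conv \<tau> \<epsilon> (X \<omega>) x" for x
    unfolding circle_conv_def by (rule circle_average_convergent[OF eps])
  have 1: "AE \<omega> in M. \<forall>i\<in>{1..n}. circle_conv \<tau> \<epsilon> (X \<omega>) (z i)"
    by (rule AE_finite_allI) (auto intro: C)
  interpret pair: pair_sigma_finite torus M by unfold_locales
  have "{p \<in> space (torus \<Otimes>\<^sub>M M). circle_conv \<tau> \<epsilon> (X (snd p)) (fst p)} \<in> sets (torus \<Otimes>\<^sub>M M)"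
    unfolding circle_conv_def Cauchy_convergent_iff[symmetric]
    by (intro sets_Collect_Cauchy borel_measurable_sum borel_measurable_times measurable_compose[OF measurable_snd X_eval[OF H1_mode]]
        measurable_compose[OF measurable_fst borel_measurable_torus[OF circ_mean_measurable]])
  then have "AE \<omega> in M. AE x in torus. circle_conv \<tau> \<epsilon> (X \<omega>) x"
    using pair.AE_commute[of "\<lambda>x \<omega>. circle_conv \<tau> \<epsilon> (X \<omega>) x"] C by simp
  with 1 AE_space show ?thesis by eventually_elim (simp add: good_def X_Hm1)
qed

section \<open>Two changes of variables\<close>

text \<open>Both clauses are needed: the value of the integral alone says nothing when it is \<open>0\<close> by convention.\<close>
definition same_integral :: "real \<Rightarrow> (real \<Rightarrow> 'w \<Rightarrow> real) \<Rightarrow> (real \<Rightarrow> 'w \<Rightarrow> real) \<Rightarrow> bool" where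
  "same_integral K f g \<longleftrightarrow>
     (integrable (lborel \<Otimes>\<^sub>M M) (\<lambda>(c, \<omega>). f c \<omega>) \<longleftrightarrow> integrable (lborel \<Otimes>\<^sub>M M) (\<lambda>(c, \<omega>). g c \<omega>)) \<and>
     integral\<^sup>L (lborel \<Otimes>\<^sub>M M) (\<lambda>(c, \<omega>). f c \<omega>) = K * integral\<^sup>L (lborel \<Otimes>\<^sub>M M) (\<lambda>(c, \<omega>). g c \<omega>)"

lemma same_integral_trans: "same_integral K f g \<Longrightarrow> same_integral K' g h \<Longrightarrow> same_integral (K * K') f h"
  by (simp add: same_integral_def)

sublocale lM: pair_sigma_finite lborel M by unfold_locales

lemma same_integral_cong_AE:
  assumes f: "(\<lambda>(c, \<omega>). f c \<omega>) \<in> borel_measurable (lborel \<Otimes>\<^sub>M M)" and g: "(\<lambda>(c, \<omega>). g c \<omega>) \<in> borel_measurable (lborel \<Otimes>\<^sub>M M)"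
    and AE: "AE \<omega> in M. \<forall>c. f c \<omega> = g c \<omega>"
  shows "same_integral 1 f g"
proof -
  have m: "{p \<in> space (lborel \<Otimes>\<^sub>M M). (\<lambda>(c, \<omega>). f c \<omega>) p = (\<lambda>(c, \<omega>). g c \<omega>) p} \<in> sets (lborel \<Otimes>\<^sub>M M)"
    using f g by measurable
  have "AE c in lborel. AE \<omega> in M. f c \<omega> = g c \<omega>"
    by (rule AE_I2) (use AE in \<open>auto elim: eventually_mono\<close>)
  then have "AE p in lborel \<Otimes>\<^sub>M M. (\<lambda>(c, \<omega>). f c \<omega>) p = (\<lambda>(c, \<omega>). g c \<omega>) p"
    using lM.AE_pair_measure[OF m] by simp
  then show ?thesis
    unfolding same_integral_def mult_1 by (intro conjI integrable_cong_AE integral_cong_AE f g)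
qed

text \<open>Translation invariance of the measure \<open>dc\<close>, for translations that may depend on the field.\<close>
lemma same_integral_shift:
  assumes f: "(\<lambda>(c, \<omega>). f c \<omega>) \<in> borel_measurable (lborel \<Otimes>\<^sub>M M)" and m [measurable]: "m \<in> borel_measurable M"
  shows "same_integral 1 (\<lambda>c \<omega>. f (c - m \<omega>) \<omega>) f"
proof -
  let ?P = "lborel \<Otimes>\<^sub>M M"
  define h where "h p = (fst p - m (snd p), snd p)" for p :: "real \<times> 'w"
  have h [measurable]: "h \<in> measurable ?P ?P" unfolding h_def[abs_def] by measurable
  have "distr ?P ?P h = ?P"
  proof (rule measure_eqI)
    fix A assume "A \<in> sets (distr ?P ?P h)"
    then have A: "A \<in> sets ?P" by simp
    have i: "indicator A \<in> borel_measurable ?P" using A by simp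
    have "emeasure (distr ?P ?P h) A = (\<integral>\<^sup>+p. indicator A p \<partial>distr ?P ?P h)" using A by simp
    also have "\<dots> = (\<integral>\<^sup>+p. indicator A (h p) \<partial>?P)" using i by (intro nn_integral_distr h) simp
    also have "\<dots> = (\<integral>\<^sup>+\<omega>. \<integral>\<^sup>+c. indicator A (h (c, \<omega>)) \<partial>lborel \<partial>M)"
      using measurable_compose[OF h i] by (intro lM.nn_integral_snd[symmetric]) simp
    also have "\<dots> = (\<integral>\<^sup>+\<omega>. \<integral>\<^sup>+c. indicator A (c, \<omega>) \<partial>lborel \<partial>M)"
    proof (rule nn_integral_cong)
      fix \<omega> assume \<omega>: "\<omega> \<in> space M"
      have "(\<lambda>c. indicator A (c, \<omega>) :: ennreal) \<in> borel_measurable borel"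
        using measurable_compose[OF measurable_Pair2'[OF \<omega>] i] by simp
      from nn_integral_real_affine[OF this, of 1 "- m \<omega>"]
      show "(\<integral>\<^sup>+c. indicator A (h (c, \<omega>)) \<partial>lborel) = (\<integral>\<^sup>+c. indicator A (c, \<omega>) \<partial>lborel)"
        by (simp add: h_def)
    qed
    also have "\<dots> = (\<integral>\<^sup>+p. indicator A p \<partial>?P)" using i by (intro lM.nn_integral_snd) simp
    also have "\<dots> = emeasure ?P A" using A by simp
    finally show "emeasure (distr ?P ?P h) A = emeasure ?P A" .
  qed simp
  then have "integrable ?P (\<lambda>(c, \<omega>). f c \<omega>) \<longleftrightarrow> integrable ?P (\<lambda>p. (\<lambda>(c, \<omega>). f c \<omega>) (h p))"
    "(LINT p|?P. (\<lambda>(c, \<omega>). f c \<omega>) p) = (LINT p|?P. (\<lambda>(c, \<omega>). f c \<omega>) (h p))"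
    using integrable_distr_eq[OF h f] integral_distr[OF h f] by simp_all
  then show ?thesis unfolding same_integral_def by (simp add: h_def case_prod_beta')
qed

text \<open>The Cameron--Martin formula for nonnegative functionals says that two measures on \<open>\<real> \<times> Hm1\<close>
  coincide; it therefore also holds for integrable functionals of either sign, with equivalence of
  integrability.\<close>
lemma same_integral_cameron_martin:
  assumes \<phi>: "\<phi> \<in> H1" and g: "(\<lambda>p. g (fst p) (snd p)) \<in> borel_measurable (lborel \<Otimes>\<^sub>M Hm1_borel)"
  shows "same_integral (exp (a\<^sup>2 * (2 * pi * dirichlet_energy \<tau> \<phi>) / 2))
     (\<lambda>c \<omega>. exp (a * curvature_pairing \<tau> \<phi> (X \<omega>)) * g c (X \<omega>))
     (\<lambda>c \<omega>. g c (\<lambda>f. X \<omega> f + 2 * pi * a * functional_of (centre \<phi>) f))"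
proof -
  let ?P = "lborel \<Otimes>\<^sub>M M" and ?H = "lborel \<Otimes>\<^sub>M Hm1_borel"
  define K where "K = exp (a\<^sup>2 * (2 * pi * dirichlet_energy \<tau> \<phi>) / 2)"
  define X' where "X' \<omega> = (\<lambda>f. X \<omega> f + 2 * pi * a * functional_of (centre \<phi>) f)" for \<omega>
  define e where "e p = exp (a * curvature_pairing \<tau> \<phi> (X (snd p)))" for p :: "real \<times> 'w"
  have Ym: "(\<lambda>\<omega>. curvature_pairing \<tau> \<phi> (X \<omega>)) \<in> borel_measurable M"
    using Y_measurable[OF \<phi>] by (simp add: Y_def[OF \<phi>, abs_def])
  have e [measurable]: "e \<in> borel_measurable ?P"
    unfolding e_def[abs_def] using measurable_compose[OF measurable_snd Ym, of lborel] by measurable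
  have X' [measurable]: "X' \<in> measurable M Hm1_borel"
    unfolding X'_def[abs_def]
    by (intro Hm1_borel_measurableI shift_Hm1[OF \<phi>] X_Hm1 borel_measurable_add X_eval H1_mode borel_measurable_const)
  define G where "G p = g (fst p) (snd p)" for p
  have G: "G \<in> borel_measurable ?H" using g by (simp add: G_def[abs_def])
  define h1 where "h1 p = (fst p, X (snd p))" for p :: "real \<times> 'w"
  define h2 where "h2 p = (fst p, X' (snd p))" for p :: "real \<times> 'w"
  have h1 [measurable]: "h1 \<in> measurable ?P ?H" and h2 [measurable]: "h2 \<in> measurable ?P ?H"
    unfolding h1_def[abs_def] h2_def[abs_def]
    by (intro measurable_Pair measurable_fst measurable_compose[OF measurable_snd X_measurable] measurable_compose[OF measurable_snd X'])+
  let ?D1 = "density ?P (\<lambda>p. ennreal (e p))" and ?D2 = "density ?P (\<lambda>_. ennreal K)"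
  have h1': "h1 \<in> measurable ?D1 ?H" and h2': "h2 \<in> measurable ?D2 ?H" using h1 h2 by simp_all
  have "distr ?D1 ?H h1 = distr ?D2 ?H h2"
  proof (rule measure_eqI)
    fix A assume "A \<in> sets (distr ?D1 ?H h1)"
    then have A: "A \<in> sets ?H" by simp
    have i: "(indicator A :: _ \<Rightarrow> ennreal) \<in> borel_measurable ?H" using A by simp
    have m1: "(\<lambda>p. ennreal (e p) * indicator A (h1 p)) \<in> borel_measurable ?P" and m2: "(\<lambda>p. ennreal K * indicator A (h2 p)) \<in> borel_measurable ?P"
      using measurable_compose[OF h1 i] measurable_compose[OF h2 i] e by (auto intro!: borel_measurable_times_ennreal)
    have "emeasure (distr ?D1 ?H h1) A = (\<integral>\<^sup>+p. indicator A (h1 p) \<partial>?D1)"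
      using A nn_integral_distr[OF h1', of "indicator A"] by simp
    also have "\<dots> = (\<integral>\<^sup>+p. ennreal (e p) * indicator A (h1 p) \<partial>?P)"
      using measurable_compose[OF h1 i] e by (intro nn_integral_density) simp_all
    also have "\<dots> = (\<integral>\<^sup>+c. \<integral>\<^sup>+\<omega>. ennreal (e (c, \<omega>)) * indicator A (h1 (c, \<omega>)) \<partial>M \<partial>lborel)"
      by (rule nn_integral_fst[symmetric, OF m1])
    also have "\<dots> = (\<integral>\<^sup>+c. \<integral>\<^sup>+\<omega>. ennreal K * indicator A (h2 (c, \<omega>)) \<partial>M \<partial>lborel)"
    proof (rule nn_integral_cong)
      fix c :: real
      have ic: "(\<lambda>T. indicator A (c, T) :: ennreal) \<in> borel_measurable Hm1_borel"
        using measurable_compose[OF measurable_Pair1'[of c lborel] i] by simp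
      have "(\<integral>\<^sup>+\<omega>. ennreal (exp (a * curvature_pairing \<tau> \<phi> (X \<omega>))) * indicator A (c, X \<omega>) \<partial>M)
          = ennreal K * (\<integral>\<^sup>+\<omega>. indicator A (c, X' \<omega>) \<partial>M)"
        using cameron_martin[OF \<phi> ic, of a] by (simp add: Y_def[OF \<phi>] K_def X'_def)
      also have "\<dots> = (\<integral>\<^sup>+\<omega>. ennreal K * indicator A (c, X' \<omega>) \<partial>M)"
        by (rule nn_integral_cmult[symmetric]) (rule measurable_compose[OF X' ic])
      finally show "(\<integral>\<^sup>+\<omega>. ennreal (e (c, \<omega>)) * indicator A (h1 (c, \<omega>)) \<partial>M) = (\<integral>\<^sup>+\<omega>. ennreal K * indicator A (h2 (c, \<omega>)) \<partial>M)"
        by (simp add: e_def h1_def h2_def)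
    qed
    also have "\<dots> = (\<integral>\<^sup>+p. ennreal K * indicator A (h2 p) \<partial>?P)" by (rule nn_integral_fst[OF m2])
    also have "\<dots> = (\<integral>\<^sup>+p. indicator A (h2 p) \<partial>?D2)"
      using measurable_compose[OF h2 i] by (intro nn_integral_density[symmetric]) simp_all
    also have "\<dots> = emeasure (distr ?D2 ?H h2) A"
      using A nn_integral_distr[OF h2', of "indicator A"] by simp
    finally show "emeasure (distr ?D1 ?H h1) A = emeasure (distr ?D2 ?H h2) A" .
  qed simp
  note eq = this
  have K: "K > 0" by (simp add: K_def)
  have Gh1: "(\<lambda>p. G (h1 p)) \<in> borel_measurable ?P" and Gh2: "(\<lambda>p. G (h2 p)) \<in> borel_measurable ?P"
    by (rule measurable_compose[OF h1 G], rule measurable_compose[OF h2 G])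
  have "integrable ?P (\<lambda>p. e p * G (h1 p)) \<longleftrightarrow> integrable ?D1 (\<lambda>p. G (h1 p))"
    using integrable_real_density[OF e _ Gh1] by (simp add: e_def)
  also have "\<dots> \<longleftrightarrow> integrable ?D2 (\<lambda>p. G (h2 p))"
    using integrable_distr_eq[OF h1' G] integrable_distr_eq[OF h2' G] eq by simp
  also have "\<dots> \<longleftrightarrow> integrable ?P (\<lambda>p. K * G (h2 p))"
    using K by (intro integrable_real_density Gh2) auto
  also have "\<dots> \<longleftrightarrow> integrable ?P (\<lambda>p. G (h2 p))" using K by simp
  finally have I: "integrable ?P (\<lambda>p. e p * G (h1 p)) \<longleftrightarrow> integrable ?P (\<lambda>p. G (h2 p))" .
  have "(LINT p|?P. e p * G (h1 p)) = (LINT p|?D1. G (h1 p))"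
    using integral_real_density[OF e _ Gh1] by (simp add: e_def)
  also have "\<dots> = (LINT p|?D2. G (h2 p))"
    using integral_distr[OF h1' G] integral_distr[OF h2' G] eq by simp
  also have "\<dots> = (LINT p|?P. K * G (h2 p))"
    using K by (intro integral_real_density Gh2) auto
  also have "\<dots> = K * (LINT p|?P. G (h2 p))" by simp
  finally have J: "(LINT p|?P. e p * G (h1 p)) = K * (LINT p|?P. G (h2 p))" .
  show ?thesis using I J
    unfolding same_integral_def K_def[symmetric] by (simp add: e_def G_def h1_def h2_def X'_def case_prod_beta')
qed

end

section \<open>Comparison of the regularized partition functions\<close>

lemma functional_of_lin:
  assumes "L2t g" "L2t h"
  shows "functional_of (\<lambda>x. g x + b * h x) = (\<lambda>f. functional_of g f + b * functional_of h f)"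
proof
  fix f
  show "functional_of (\<lambda>x. g x + b * h x) f = functional_of g f + b * functional_of h f"
  proof (cases "f \<in> H1")
    case True
    then have "L2t f" using H1_D(2) by blast
    then have "ip (\<lambda>x. g x + b * h x) f = ip g f + b * ip h f"
      using assms by (simp add: ip_add_left ip_scale_left L2t_scale)
    with True show ?thesis by (simp add: functional_of_def ip_def)
  qed (simp add: functional_of_def)
qed

lemma functional_of_centre:
  assumes "L2t \<phi>"
  shows "functional_of \<phi> = (\<lambda>f. functional_of (centre \<phi>) f + ip \<phi> (\<lambda>_. 1) * functional_of (\<lambda>_. 1) f)"
proof -
  have "L2t (\<lambda>_. 1)" by auto
  from functional_of_lin[OF centre_L2t[OF assms] this, of "ip \<phi> (\<lambda>_. 1)"]
  show ?thesis by (simp add: centre_def)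
qed

lemma dirichlet_energy_zero: "Im \<tau> > 0 \<Longrightarrow> dirichlet_energy \<tau> (\<lambda>_. 0) = 0"
  using dirichlet_sums[of \<tau> "\<lambda>_. 0", OF _ zero_H1] LIMSEQ_unique[OF _ tendsto_const]
  by (simp add: ip_def)

lemma sigma_finite_vol_g:
  assumes "\<phi> \<in> borel_measurable borel"
  shows "sigma_finite_measure (vol_g \<tau> \<phi>)"
proof -
  interpret finite_measure "torus_vol \<tau>" by (rule finite_torus_vol)
  have "(\<lambda>x. ennreal (exp (\<phi> x))) \<in> borel_measurable (torus_vol \<tau>)"
    by (rule borel_measurable_torus_vol) (use assms in measurable)
  from sigma_finite_iff_density_finite[OF this] show ?thesis by (simp add: vol_g_def)
qed

text \<open>The total mass of \<open>e\<^sup>\<phi> \<lambda>\<^sub>\<tau>\<close> may be infinite, but the measure is \<open>\<sigma>\<close>-finite, and this is enough for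
  measurability of the integrals of the truncated fields.\<close>
lemma mean_g_measurable:
  assumes \<phi>: "\<phi> \<in> borel_measurable borel" and T: "T \<in> measurable N Hm1_borel"
  shows "(\<lambda>p. mean_g \<tau> \<phi> (T p)) \<in> borel_measurable N"
proof -
  interpret sigma_finite_measure "vol_g \<tau> \<phi>" by (rule sigma_finite_vol_g[OF \<phi>])
  have m: "mode i \<in> borel_measurable (vol_g \<tau> \<phi>)" for i
    unfolding vol_g_def using borel_measurable_torus_vol[OF mode_measurable[of i], where \<tau>=\<tau>] by simp
  have "(\<lambda>p. T p (mode i)) \<in> borel_measurable N" for i
    by (rule measurable_compose[OF T Hm1_evaluation_measurable[OF H1_mode]])
  then have "(\<lambda>(p, x). fourier_trunc K (T p) x) \<in> borel_measurable (N \<Otimes>\<^sub>M vol_g \<tau> \<phi>)" for K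
    unfolding fourier_trunc_mode case_prod_beta'
    by (intro borel_measurable_sum borel_measurable_times measurable_compose[OF measurable_snd m])
      (rule measurable_compose[OF measurable_fst])
  then have "(\<lambda>p. LINT x|vol_g \<tau> \<phi>. fourier_trunc K (T p) x) \<in> borel_measurable N" for K
    by (rule borel_measurable_lebesgue_integral)
  then show ?thesis unfolding mean_g_def
    by (intro borel_measurable_divide borel_measurable_lim_metric borel_measurable_const)
qed

text \<open>The Gauss--Bonnet theorem for the torus: the total curvature vanishes, so constants do not
  contribute.\<close>
lemma curvature_pairing_field_g:
  assumes "Im \<tau> > 0" and "L2t \<phi>"
  shows "curvature_pairing \<tau> \<phi> (field_g \<tau> \<phi> c T) = curvature_pairing \<tau> \<phi> T"
proof -
  have "pairing_coeff \<tau> \<phi> i * functional_of (\<lambda>_. k) (mode i) = 0" for k i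
    by (cases "i = (0, 0, True)") (simp_all add: functional_of_mode ip_const_mode pairing_coeff_def eigenvalue_zero level_def)
  then have "pairing_coeff \<tau> \<phi> i * field_g \<tau> \<phi> c T (mode i) = pairing_coeff \<tau> \<phi> i * T (mode i)" for i
    by (simp only: field_g_def distrib_left add_0_right)
  then show ?thesis
    unfolding curvature_pairing_series[OF assms] by (simp only:)
qed

context liouville
begin

text \<open>The parameters that stay fixed in the comparison are suppressed.\<close>
definition J :: "(pt \<Rightarrow> real) \<Rightarrow> real \<Rightarrow> functional \<Rightarrow> real" where
  "J \<phi> c T = liouville_integrand \<tau> \<phi> \<gamma> Q \<mu> n z \<alpha> F \<epsilon> c T"

lemma circle_conv_H1:
  assumes \<phi>: "\<phi> \<in> H1"
  shows "circle_conv \<tau> \<epsilon> (functional_of \<phi>) x"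
proof -
  have "circle_conv \<tau> \<epsilon> (functional_of (centre \<phi>)) x"
    unfolding circle_conv_def by (rule circle_average_shift_convergent[OF \<phi> eps])
  from circle_lin(1)[OF this circle_const(1)[of \<tau> \<epsilon> 1 x], of "ip \<phi> (\<lambda>_. 1)"]
  show ?thesis by (simp add: functional_of_centre[OF H1_D(2)[OF \<phi>], symmetric])
qed

lemma J_L:
  assumes \<phi>: "\<phi> \<in> H1"
  shows "J \<phi> c T = exp (- (Q / (4 * pi)) * curvature_pairing \<tau> \<phi> T)
    * L (\<lambda>h. field_g \<tau> \<phi> c T h + functional_of (\<lambda>x. \<kappa>0 + Q / 2 * \<phi> x) h)
        (\<lambda>x. c + circle_avg \<tau> \<epsilon> (field_g \<tau> \<phi> 0 T) x + \<kappa>0 + Q / 2 * circle_avg \<tau> \<epsilon> (functional_of \<phi>) x)"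
proof -
  have k: "c + A - Q / 2 * ln (Im \<tau>) + B = c + A + \<kappa>0 + B" for A B by (simp add: \<kappa>0_def)
  have e: "exp (A - B) = exp A * exp (- B)" for A B :: real by (simp add: exp_add[symmetric])
  show ?thesis
    unfolding J_def liouville_integrand_def Let_def k curvature_pairing_field_g[OF tau H1_D(2)[OF \<phi>]]
      L_def \<kappa>0_def[symmetric] e by (simp only: mult_ac)
qed

lemma field_g_measurable:
  assumes \<phi>: "\<phi> \<in> H1" and T: "T \<in> measurable N Hm1_borel" and c: "c \<in> borel_measurable N"
  shows "(\<lambda>p. field_g \<tau> \<phi> (c p) (T p)) \<in> measurable N Hm1_borel"
  unfolding field_g_def using c
  by (intro add_const_measurable T borel_measurable_diff mean_g_measurable L2t_measurable(1)[OF H1_D(2)[OF \<phi>]])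

lemma add_function_measurable:
  assumes g: "L2t g" and T: "T \<in> measurable N Hm1_borel"
  shows "(\<lambda>p. (\<lambda>f. T p f + b * functional_of g f)) \<in> measurable N Hm1_borel"
proof (rule Hm1_borel_measurableI)
  show "(\<lambda>f. T p f + b * functional_of g f) \<in> Hm1" if "p \<in> space N" for p
    using measurable_space[OF T that] Hm1_lincomb[of "T p" "functional_of g" 1 b] functional_of_Hm1[OF g]
    by (simp add: space_Hm1_borel)
  show "(\<lambda>p. T p (mode i) + b * functional_of g (mode i)) \<in> borel_measurable N" for i
    using measurable_compose[OF T Hm1_evaluation_measurable[OF H1_mode]]
    by (intro borel_measurable_add borel_measurable_const)
qed

lemma J_measurable:
  assumes \<phi>: "\<phi> \<in> H1"
  shows "(\<lambda>(c, \<omega>). J \<phi> c (X \<omega>)) \<in> borel_measurable (lborel \<Otimes>\<^sub>M M)"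
proof -
  let ?P = "lborel \<Otimes>\<^sub>M M :: (real \<times> 'w) measure"
  have X: "(\<lambda>p. X (snd p)) \<in> measurable ?P Hm1_borel"
    by (rule measurable_compose[OF measurable_snd X_measurable])
  have c: "fst \<in> borel_measurable ?P" using measurable_fst[of lborel M] by simp
  have \<phi>2: "L2t \<phi>" by (rule H1_D(2)[OF \<phi>])
  have g: "L2t (\<lambda>x. \<kappa>0 + Q / 2 * \<phi> x)" by (intro L2t_add L2t_scale \<phi>2) auto
  have 1: "(\<lambda>p. curvature_pairing \<tau> \<phi> (X (snd p))) \<in> borel_measurable ?P"
    using measurable_compose[OF measurable_snd Y_measurable[OF \<phi>], of lborel] by (simp add: Y_def[OF \<phi>])
  have W: "(\<lambda>p. \<lambda>h. field_g \<tau> \<phi> (fst p) (X (snd p)) h + functional_of (\<lambda>x. \<kappa>0 + Q / 2 * \<phi> x) h) \<in> measurable ?P Hm1_borel"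
    using add_function_measurable[OF g field_g_measurable[OF \<phi> X c], of 1] by simp
  have "(\<lambda>p. functional_of \<phi>) \<in> measurable (?P \<Otimes>\<^sub>M borel) Hm1_borel"
    using functional_of_Hm1[OF \<phi>2] by (intro measurable_const) (simp add: space_Hm1_borel)
  moreover have "(\<lambda>p. field_g \<tau> \<phi> 0 (X (snd (fst p)))) \<in> measurable (?P \<Otimes>\<^sub>M (borel :: pt measure)) Hm1_borel"
    by (intro field_g_measurable \<phi> measurable_compose[OF measurable_fst X] borel_measurable_const)
  ultimately have V: "(\<lambda>p. fst (fst p) + circle_avg \<tau> \<epsilon> (field_g \<tau> \<phi> 0 (X (snd (fst p)))) (snd p) + \<kappa>0
      + Q / 2 * circle_avg \<tau> \<epsilon> (functional_of \<phi>) (snd p)) \<in> borel_measurable (?P \<Otimes>\<^sub>M borel)"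
    by (intro borel_measurable_add borel_measurable_times borel_measurable_const circle_avg_measurable measurable_snd
        measurable_compose[OF measurable_fst c])
  from L_measurable[OF W, of "\<lambda>p x. fst p + circle_avg \<tau> \<epsilon> (field_g \<tau> \<phi> 0 (X (snd p))) x + \<kappa>0 + Q / 2 * circle_avg \<tau> \<epsilon> (functional_of \<phi>) x", OF V] 1
  show ?thesis
    unfolding J_L[OF \<phi>] case_prod_beta'
    by (intro borel_measurable_times measurable_compose[OF _ borel_measurable_exp] borel_measurable_const)
qed

text \<open>The metric \<open>g\<close> enters in three ways only: through the weight \<open>exp(-(Q/4\<pi>) \<integral>R\<^sub>g X d\<lambda>\<^sub>g)\<close>, through
  the recentring, which amounts to a translation of \<open>c\<close>, and through the shift of the field by
  \<open>(Q/2) \<phi>\<close>.\<close>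
lemma J_\<Psi>:
  assumes \<phi>: "\<phi> \<in> H1" and T: "good T"
  shows "J \<phi> c T = exp (- (Q / (4 * pi)) * curvature_pairing \<tau> \<phi> T)
     * \<Psi> (c - mean_g \<tau> \<phi> T) (\<lambda>f. T f + Q / 2 * functional_of \<phi> f)"
proof -
  define m where "m = mean_g \<tau> \<phi> T"
  have \<phi>2: "L2t \<phi>" by (rule H1_D(2)[OF \<phi>])
  have TH: "T \<in> Hm1" using T by (simp add: good_def)
  have W: "(\<lambda>h. field_g \<tau> \<phi> c T h + functional_of (\<lambda>x. \<kappa>0 + Q / 2 * \<phi> x) h)
      = (\<lambda>f. T f + Q / 2 * functional_of \<phi> f + functional_of (\<lambda>_. c - m + \<kappa>0) f)"
  proof
    fix f
    have "functional_of (\<lambda>x. \<kappa>0 + Q / 2 * \<phi> x) = (\<lambda>f. functional_of (\<lambda>_. \<kappa>0) f + Q / 2 * functional_of \<phi> f)"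
      by (rule functional_of_lin) (auto simp: \<phi>2)
    moreover have "functional_of (\<lambda>_. c - m + \<kappa>0) f = functional_of (\<lambda>_. c - m) f + functional_of (\<lambda>_. \<kappa>0) f"
      unfolding functional_of_const[of "c - m + \<kappa>0"] functional_of_const[of "c - m"] functional_of_const[of \<kappa>0]
      by (simp add: distrib_right)
    ultimately show "field_g \<tau> \<phi> c T f + functional_of (\<lambda>x. \<kappa>0 + Q / 2 * \<phi> x) f
      = T f + Q / 2 * functional_of \<phi> f + functional_of (\<lambda>_. c - m + \<kappa>0) f"
      by (simp add: field_g_def m_def)
  qed
  have V: "c + circle_avg \<tau> \<epsilon> (field_g \<tau> \<phi> 0 T) x + \<kappa>0 + Q / 2 * circle_avg \<tau> \<epsilon> (functional_of \<phi>) x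
      = c - m + \<kappa>0 + circle_avg \<tau> \<epsilon> (\<lambda>f. T f + Q / 2 * functional_of \<phi> f) x" if x: "circle_conv \<tau> \<epsilon> T x" for x
  proof -
    have "circle_avg \<tau> \<epsilon> (field_g \<tau> \<phi> 0 T) x = circle_avg \<tau> \<epsilon> T x - m"
      using circle_lin(2)[OF x circle_const(1)[of \<tau> \<epsilon> "- m" x], of 1] by (simp add: field_g_def m_def circle_const)
    then show ?thesis using circle_lin(2)[OF x circle_conv_H1[OF \<phi>], of "Q / 2"] by simp
  qed
  have fT: "field_g \<tau> \<phi> 0 T \<in> Hm1" unfolding field_g_def by (intro Hm1_add functional_of_Hm1 TH) auto
  have sT: "(\<lambda>f. T f + Q / 2 * functional_of \<phi> f) \<in> Hm1"
    using Hm1_lincomb[OF TH functional_of_Hm1[OF \<phi>2], of 1 "Q / 2"] by simp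
  show ?thesis
    unfolding J_L[OF \<phi>] \<Psi>_def W m_def[symmetric]
  proof (intro arg_cong2[where f="(*)"] refl L_cong)
    show "c + circle_avg \<tau> \<epsilon> (field_g \<tau> \<phi> 0 T) (z i) + \<kappa>0 + Q / 2 * circle_avg \<tau> \<epsilon> (functional_of \<phi>) (z i)
        = c - m + \<kappa>0 + circle_avg \<tau> \<epsilon> (\<lambda>f. T f + Q / 2 * functional_of \<phi> f) (z i)" if "i \<in> {1..n}" for i
      using T that by (intro V) (simp add: good_def)
    have "AE x in torus. circle_conv \<tau> \<epsilon> T x" using T by (simp add: good_def)
    then show "AE x in torus. c + circle_avg \<tau> \<epsilon> (field_g \<tau> \<phi> 0 T) x + \<kappa>0 + Q / 2 * circle_avg \<tau> \<epsilon> (functional_of \<phi>) x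
        = c - m + \<kappa>0 + circle_avg \<tau> \<epsilon> (\<lambda>f. T f + Q / 2 * functional_of \<phi> f) x"
      by eventually_elim (rule V)
  qed (intro borel_measurable_add borel_measurable_times borel_measurable_const circle_avg_fixed fT sT functional_of_Hm1 \<phi>2)+
qed

text \<open>The Cameron--Martin shift by \<open>2\<pi>a = -Q/2\<close> times \<open>\<phi> - mean\<close> cancels the shift by \<open>(Q/2) \<phi>\<close> up to a
  constant. The coefficient \<open>-Q/(4\<pi>)\<close> of the curvature is the one for which this happens.\<close>
lemma shift_back:
  assumes \<phi>: "L2t \<phi>"
  shows "(\<lambda>f. T f + 2 * pi * - (Q / (4 * pi)) * functional_of (centre \<phi>) f + Q / 2 * functional_of \<phi> f)
    = (\<lambda>f. T f + functional_of (\<lambda>_. Q / 2 * ip \<phi> (\<lambda>_. 1)) f)"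
  unfolding functional_of_centre[OF \<phi>] functional_of_const[of "Q / 2 * ip \<phi> (\<lambda>_. 1)"]
  by (rule ext) (simp add: algebra_simps)

text \<open>First \<open>c\<close> is translated by the mean, then the weight is removed by the Cameron--Martin formula, and
  finally \<open>c\<close> is translated by the constant left over by \<open>shift_back\<close>. The constant comes from
  \<open>a\<^sup>2 (2\<pi> D) / 2 = Q\<^sup>2 D / (16\<pi>) = 6 Q\<^sup>2 D / (96\<pi>)\<close> for \<open>a = -Q/(4\<pi>)\<close> and Dirichlet energy \<open>D\<close>.\<close>
lemma J_to_background:
  assumes \<phi>: "\<phi> \<in> H1"
  shows "same_integral (exp (6 * Q\<^sup>2 / (96 * pi) * dirichlet_energy \<tau> \<phi>)) (\<lambda>c \<omega>. J \<phi> c (X \<omega>)) (\<lambda>c \<omega>. \<Psi> c (X \<omega>))"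
proof -
  define a where "a = - (Q / (4 * pi))"
  define g where "g c T = \<Psi> c (\<lambda>f. T f + Q / 2 * functional_of \<phi> f)" for c T
  define m0 where "m0 = Q / 2 * ip \<phi> (\<lambda>_. 1)"
  define K where "K = exp (a\<^sup>2 * (2 * pi * dirichlet_energy \<tau> \<phi>) / 2)"
  let ?P = "lborel \<Otimes>\<^sub>M M :: (real \<times> 'w) measure"
  have \<phi>2: "L2t \<phi>" by (rule H1_D(2)[OF \<phi>])
  have X: "(\<lambda>p. X (snd p)) \<in> measurable ?P Hm1_borel"
    by (rule measurable_compose[OF measurable_snd X_measurable])
  have c: "fst \<in> borel_measurable ?P" using measurable_fst[of lborel M] by simp
  have e: "(\<lambda>p. exp (a * curvature_pairing \<tau> \<phi> (X (snd p)))) \<in> borel_measurable ?P"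
    using measurable_compose[OF measurable_snd Y_measurable[OF \<phi>], of lborel]
    by (intro measurable_compose[OF _ borel_measurable_exp] borel_measurable_times borel_measurable_const) (simp add: Y_def[OF \<phi>])
  have m: "(\<lambda>\<omega>. mean_g \<tau> \<phi> (X \<omega>)) \<in> borel_measurable M"
    by (rule mean_g_measurable[OF L2t_measurable(1)[OF \<phi>2] X_measurable])
  have gm: "(\<lambda>p. g (k p) (X (snd p))) \<in> borel_measurable ?P" if "k \<in> borel_measurable ?P" for k
    unfolding g_def by (rule \<Psi>_measurable[OF that add_function_measurable[OF \<phi>2 X]])
  have cm: "(\<lambda>p. fst p - mean_g \<tau> \<phi> (X (snd p))) \<in> borel_measurable ?P"
    by (intro borel_measurable_diff c measurable_compose[OF measurable_snd m])
  have \<Psi>m: "(\<lambda>(c, \<omega>). \<Psi> (c + k) (X \<omega>)) \<in> borel_measurable ?P" for k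
    unfolding case_prod_beta' by (intro \<Psi>_measurable X borel_measurable_add c borel_measurable_const)
  have 1: "same_integral 1 (\<lambda>c \<omega>. J \<phi> c (X \<omega>)) (\<lambda>c \<omega>. exp (a * curvature_pairing \<tau> \<phi> (X \<omega>)) * g (c - mean_g \<tau> \<phi> (X \<omega>)) (X \<omega>))"
  proof (rule same_integral_cong_AE[OF J_measurable[OF \<phi>]])
    show "(\<lambda>(c, \<omega>). exp (a * curvature_pairing \<tau> \<phi> (X \<omega>)) * g (c - mean_g \<tau> \<phi> (X \<omega>)) (X \<omega>)) \<in> borel_measurable ?P"
      unfolding case_prod_beta' by (intro borel_measurable_times e gm cm)
    show "AE \<omega> in M. \<forall>c. J \<phi> c (X \<omega>) = exp (a * curvature_pairing \<tau> \<phi> (X \<omega>)) * g (c - mean_g \<tau> \<phi> (X \<omega>)) (X \<omega>)"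
      using X_good by eventually_elim (simp add: J_\<Psi>[OF \<phi>] g_def a_def)
  qed
  have "(\<lambda>(c, \<omega>). exp (a * curvature_pairing \<tau> \<phi> (X \<omega>)) * g c (X \<omega>)) \<in> borel_measurable ?P"
    unfolding case_prod_beta' by (intro borel_measurable_times e gm c)
  note 2 = same_integral_shift[OF this m]
  have "(\<lambda>p. g (fst p) (snd p)) \<in> borel_measurable (lborel \<Otimes>\<^sub>M Hm1_borel)"
    unfolding g_def
  proof (rule \<Psi>_measurable[OF _ add_function_measurable[OF \<phi>2 measurable_snd]])
    show "fst \<in> borel_measurable (lborel \<Otimes>\<^sub>M Hm1_borel)"
      using measurable_fst[of "lborel :: real measure" Hm1_borel] by simp
  qed
  note 3 = same_integral_cameron_martin[OF \<phi> this, of a]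
  have unshift: "g c (\<lambda>f. T f + 2 * pi * a * functional_of (centre \<phi>) f) = \<Psi> c (\<lambda>f. T f + functional_of (\<lambda>_. m0) f)" for c T
    using shift_back[OF \<phi>2, of T] by (simp only: g_def a_def m0_def)
  have 4: "same_integral 1 (\<lambda>c \<omega>. g c (\<lambda>f. X \<omega> f + 2 * pi * a * functional_of (centre \<phi>) f)) (\<lambda>c \<omega>. \<Psi> (c + m0) (X \<omega>))"
    unfolding unshift
  proof (rule same_integral_cong_AE[OF _ \<Psi>m])
    show "(\<lambda>(c, \<omega>). \<Psi> c (\<lambda>f. X \<omega> f + functional_of (\<lambda>_. m0) f)) \<in> borel_measurable ?P"
      unfolding case_prod_beta' by (intro \<Psi>_measurable c add_const_measurable X borel_measurable_const)
    show "AE \<omega> in M. \<forall>c. \<Psi> c (\<lambda>f. X \<omega> f + functional_of (\<lambda>_. m0) f) = \<Psi> (c + m0) (X \<omega>)"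
      using X_good by eventually_elim (simp add: \<Psi>_const)
  qed
  have 5: "same_integral 1 (\<lambda>c \<omega>. \<Psi> (c + m0) (X \<omega>)) (\<lambda>c \<omega>. \<Psi> c (X \<omega>))"
    using same_integral_shift[of "\<lambda>c \<omega>. \<Psi> c (X \<omega>)" "\<lambda>_. - m0"] \<Psi>m[of 0] by simp
  have "a\<^sup>2 * (2 * pi * d) / 2 = 6 * Q\<^sup>2 / (96 * pi) * d" for d
    by (simp add: a_def power2_eq_square field_simps)
  with same_integral_trans[OF 1 same_integral_trans[OF 2 same_integral_trans[OF 3 same_integral_trans[OF 4 5]]]]
  show ?thesis by simp
qed

theorem J_comparison:
  assumes \<phi>: "\<phi> \<in> H1"
  shows "same_integral (exp (6 * Q\<^sup>2 / (96 * pi) * dirichlet_energy \<tau> \<phi>)) (\<lambda>c \<omega>. J \<phi> c (X \<omega>)) (\<lambda>c \<omega>. J (\<lambda>_. 0) c (X \<omega>))"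
  using J_to_background[OF \<phi>] J_to_background[OF zero_H1]
  by (simp add: same_integral_def dirichlet_energy_zero[OF tau])

text \<open>The anomaly is exact at every \<open>\<epsilon>\<close>: the free field partition function contributes \<open>1\<close> and the
  change of measure \<open>6 Q\<^sup>2\<close> to the central charge.\<close>
corollary Pi_reg_comparison:
  assumes \<phi>: "\<phi> \<in> H1"
  shows "integrable (lborel \<Otimes>\<^sub>M M) (\<lambda>(c, \<omega>). liouville_integrand \<tau> \<phi> \<gamma> Q \<mu> n z \<alpha> F \<epsilon> c (X \<omega>)) \<longleftrightarrow>
         integrable (lborel \<Otimes>\<^sub>M M) (\<lambda>(c, \<omega>). liouville_integrand \<tau> (\<lambda>_. 0) \<gamma> Q \<mu> n z \<alpha> F \<epsilon> c (X \<omega>))"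
    and "integrable (lborel \<Otimes>\<^sub>M M) (\<lambda>(c, \<omega>). liouville_integrand \<tau> \<phi> \<gamma> Q \<mu> n z \<alpha> F \<epsilon> c (X \<omega>)) \<Longrightarrow>
         Pi_reg M X \<tau> \<phi> \<gamma> Q \<mu> n z \<alpha> F \<epsilon>
         = exp ((1 + 6 * Q\<^sup>2) / (96 * pi) * dirichlet_energy \<tau> \<phi>) * Pi_reg M X \<tau> (\<lambda>_. 0) \<gamma> Q \<mu> n z \<alpha> F \<epsilon>"
proof -
  let ?P = "lborel \<Otimes>\<^sub>M M :: (real \<times> 'w) measure"
  let ?D = "dirichlet_energy \<tau> \<phi>"
  note comp = J_comparison[OF \<phi>, unfolded same_integral_def J_def]
  show iff: "integrable ?P (\<lambda>(c, \<omega>). liouville_integrand \<tau> \<phi> \<gamma> Q \<mu> n z \<alpha> F \<epsilon> c (X \<omega>)) \<longleftrightarrow>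
         integrable ?P (\<lambda>(c, \<omega>). liouville_integrand \<tau> (\<lambda>_. 0) \<gamma> Q \<mu> n z \<alpha> F \<epsilon> c (X \<omega>))"
    using comp by (rule conjunct1)
  have fubini: "Pi_reg M X \<tau> \<psi> \<gamma> Q \<mu> n z \<alpha> F \<epsilon> = Z_FF \<tau> \<psi> * integral\<^sup>L ?P (\<lambda>(c, \<omega>). liouville_integrand \<tau> \<psi> \<gamma> Q \<mu> n z \<alpha> F \<epsilon> c (X \<omega>))"
    if "integrable ?P (\<lambda>(c, \<omega>). liouville_integrand \<tau> \<psi> \<gamma> Q \<mu> n z \<alpha> F \<epsilon> c (X \<omega>))" for \<psi>
    using lM.integral_fst'[OF that] by (simp add: Pi_reg_def)
  assume int: "integrable ?P (\<lambda>(c, \<omega>). liouville_integrand \<tau> \<phi> \<gamma> Q \<mu> n z \<alpha> F \<epsilon> c (X \<omega>))"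
  have "exp ((1 + 6 * Q\<^sup>2) / (96 * pi) * ?D) = exp (1 / (96 * pi) * ?D) * exp (6 * Q\<^sup>2 / (96 * pi) * ?D)"
    by (simp add: exp_add[symmetric] add_divide_distrib distrib_right)
  moreover have "Z_FF \<tau> \<phi> = exp (1 / (96 * pi) * ?D) * Z_FF \<tau> (\<lambda>_. 0)"
    by (simp add: Z_FF_def dirichlet_energy_zero[OF tau])
  ultimately show "Pi_reg M X \<tau> \<phi> \<gamma> Q \<mu> n z \<alpha> F \<epsilon>
         = exp ((1 + 6 * Q\<^sup>2) / (96 * pi) * ?D) * Pi_reg M X \<tau> (\<lambda>_. 0) \<gamma> Q \<mu> n z \<alpha> F \<epsilon>"
    using fubini[OF int] fubini[OF int[unfolded iff]] conjunct2[OF comp] by simp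
qed

end

lemma modular_log_conformal_factor_H1:
  assumes "modular_log_conformal_factor \<phi>" and "\<tau> \<in> upper_half"
  shows "\<phi> \<tau> \<in> H1"
proof -
  have "\<phi> \<tau> \<in> space H1_borel"
    using assms by (intro measurable_space[of \<phi> "restrict_space borel upper_half"])
      (auto simp: modular_log_conformal_factor_def space_restrict_space)
  then show ?thesis by (simp add: H1_borel_def borel_of_metric_def space_measure_of_conv)
qed

text \<open>The factor relating the two regularized partition functions is positive and does not depend on
  \<open>\<epsilon>\<close>, so that it passes to the limit in both directions.\<close>
theorem theorem4p1:
  fixes \<tau> :: complex and \<gamma> Q \<mu> :: real and n :: nat
    and z :: "nat \<Rightarrow> pt" and \<alpha> :: "nat \<Rightarrow> real"
    and \<phi> :: "complex \<Rightarrow> pt \<Rightarrow> real" and F :: "functional \<Rightarrow> real"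
    and M :: "'w measure" and X :: "'w \<Rightarrow> functional"
  assumes "\<tau> \<in> upper_half"
    and "0 < \<gamma>" and "\<gamma> < 2" and "Q = 2 / \<gamma> + \<gamma> / 2" and "0 < \<mu>"
    and "\<And>i j. i \<in> {1..n} \<Longrightarrow> j \<in> {1..n} \<Longrightarrow> i \<noteq> j \<Longrightarrow> \<not> torus_eq (z i) (z j)"
    and "modular_log_conformal_factor \<phi>"
    and "F \<in> borel_measurable Hm1_borel" and "\<exists>B. \<forall>Y\<in>Hm1. \<bar>F Y\<bar> \<le> B"
    and "gaussian_free_field M \<tau> X"
  shows "(Pi_nontrivial M X \<tau> (\<phi> \<tau>) \<gamma> Q \<mu> n z \<alpha> F \<longleftrightarrow>
            Pi_nontrivial M X \<tau> (\<lambda>_. 0) \<gamma> Q \<mu> n z \<alpha> F) \<and>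
         (Pi_nontrivial M X \<tau> (\<phi> \<tau>) \<gamma> Q \<mu> n z \<alpha> F \<and>
            Pi_nontrivial M X \<tau> (\<lambda>_. 0) \<gamma> Q \<mu> n z \<alpha> F \<longrightarrow>
          ln (Pi_lim M X \<tau> (\<phi> \<tau>) \<gamma> Q \<mu> n z \<alpha> F / Pi_lim M X \<tau> (\<lambda>_. 0) \<gamma> Q \<mu> n z \<alpha> F)
            = (1 + 6 * Q\<^sup>2) / (96 * pi) * dirichlet_energy \<tau> (\<phi> \<tau>))"
proof -
  define R where "R \<psi> = Pi_reg M X \<tau> \<psi> \<gamma> Q \<mu> n z \<alpha> F" for \<psi>
  define I where "I \<psi> \<epsilon> \<longleftrightarrow> integrable (lborel \<Otimes>\<^sub>M M)
      (\<lambda>(c, \<omega>). liouville_integrand \<tau> \<psi> \<gamma> Q \<mu> n z \<alpha> F \<epsilon> c (X \<omega>))" for \<psi> \<epsilon>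
  define E where "E = (1 + 6 * Q\<^sup>2) / (96 * pi) * dirichlet_energy \<tau> (\<phi> \<tau>)"
  have nontrivial: "Pi_nontrivial M X \<tau> \<psi> \<gamma> Q \<mu> n z \<alpha> F \<longleftrightarrow>
      (\<forall>\<^sub>F \<epsilon> in at_right 0. I \<psi> \<epsilon>) \<and> (\<exists>l>0. (R \<psi> \<longlongrightarrow> l) (at_right 0))" for \<psi>
    by (simp add: Pi_nontrivial_def R_def I_def)
  have \<phi>: "\<phi> \<tau> \<in> H1" by (rule modular_log_conformal_factor_H1) fact+
  have fixed_\<epsilon>: "(I (\<phi> \<tau>) \<epsilon> \<longleftrightarrow> I (\<lambda>_. 0) \<epsilon>) \<and> (I (\<lambda>_. 0) \<epsilon> \<longrightarrow> R (\<phi> \<tau>) \<epsilon> = exp E * R (\<lambda>_. 0) \<epsilon>)" if "\<epsilon> > 0" for \<epsilon>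
  proof -
    interpret liouville M \<tau> X \<gamma> Q \<mu> n z \<alpha> F \<epsilon>
      using assms that by unfold_locales (auto simp: upper_half_def)
    show ?thesis using Pi_reg_comparison[OF \<phi>] by (simp add: I_def R_def E_def)
  qed
  have pos: "\<forall>\<^sub>F \<epsilon> in at_right 0. \<epsilon> > (0::real)" by (rule eventually_at_right_less)
  have I_iff: "(\<forall>\<^sub>F \<epsilon> in at_right 0. I (\<phi> \<tau>) \<epsilon>) \<longleftrightarrow> (\<forall>\<^sub>F \<epsilon> in at_right 0. I (\<lambda>_. 0) \<epsilon>)"
    by (rule eventually_cong[OF pos]) (use fixed_\<epsilon> in blast)
  have lim: "(R (\<phi> \<tau>) \<longlongrightarrow> exp E * l) (at_right 0) \<longleftrightarrow> (R (\<lambda>_. 0) \<longlongrightarrow> l) (at_right 0)"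
    if "\<forall>\<^sub>F \<epsilon> in at_right 0. I (\<lambda>_. 0) \<epsilon>" for l
  proof -
    have "\<forall>\<^sub>F \<epsilon> in at_right 0. R (\<phi> \<tau>) \<epsilon> = exp E * R (\<lambda>_. 0) \<epsilon>"
      using that pos by eventually_elim (use fixed_\<epsilon> in blast)
    then have "(R (\<phi> \<tau>) \<longlongrightarrow> exp E * l) (at_right 0) \<longleftrightarrow> ((\<lambda>\<epsilon>. exp E * R (\<lambda>_. 0) \<epsilon>) \<longlongrightarrow> exp E * l) (at_right 0)"
      by (rule tendsto_cong)
    also have "\<dots> \<longleftrightarrow> (R (\<lambda>_. 0) \<longlongrightarrow> l) (at_right 0)"
      by (rule tendsto_mult_left_iff) simp
    finally show ?thesis .
  qed
  have "(\<exists>l>0. (R (\<phi> \<tau>) \<longlongrightarrow> l) (at_right 0)) \<longleftrightarrow> (\<exists>l>0. (R (\<lambda>_. 0) \<longlongrightarrow> l) (at_right 0))"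
    if "\<forall>\<^sub>F \<epsilon> in at_right 0. I (\<lambda>_. 0) \<epsilon>"
  proof
    assume "\<exists>l>0. (R (\<phi> \<tau>) \<longlongrightarrow> l) (at_right 0)"
    then obtain l where "l > 0" "(R (\<phi> \<tau>) \<longlongrightarrow> l) (at_right 0)" by blast
    then show "\<exists>l>0. (R (\<lambda>_. 0) \<longlongrightarrow> l) (at_right 0)"
      using lim[OF that, of "l / exp E"] by (intro exI[of _ "l / exp E"]) simp
  next
    assume "\<exists>l>0. (R (\<lambda>_. 0) \<longlongrightarrow> l) (at_right 0)"
    then obtain l where "l > 0" "(R (\<lambda>_. 0) \<longlongrightarrow> l) (at_right 0)" by blast
    then show "\<exists>l>0. (R (\<phi> \<tau>) \<longlongrightarrow> l) (at_right 0)"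
      using lim[OF that, of l] by (intro exI[of _ "exp E * l"]) simp
  qed
  then have iff: "Pi_nontrivial M X \<tau> (\<phi> \<tau>) \<gamma> Q \<mu> n z \<alpha> F \<longleftrightarrow> Pi_nontrivial M X \<tau> (\<lambda>_. 0) \<gamma> Q \<mu> n z \<alpha> F"
    unfolding nontrivial I_iff by blast
  have "ln (Pi_lim M X \<tau> (\<phi> \<tau>) \<gamma> Q \<mu> n z \<alpha> F / Pi_lim M X \<tau> (\<lambda>_. 0) \<gamma> Q \<mu> n z \<alpha> F) = E"
    if nt: "Pi_nontrivial M X \<tau> (\<lambda>_. 0) \<gamma> Q \<mu> n z \<alpha> F"
  proof -
    obtain l where l: "l > 0" "(R (\<lambda>_. 0) \<longlongrightarrow> l) (at_right 0)" and int: "\<forall>\<^sub>F \<epsilon> in at_right 0. I (\<lambda>_. 0) \<epsilon>"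
      using nt unfolding nontrivial by blast
    have "(R (\<phi> \<tau>) \<longlongrightarrow> exp E * l) (at_right 0)" using lim[OF int] l(2) by blast
    then have "Pi_lim M X \<tau> (\<phi> \<tau>) \<gamma> Q \<mu> n z \<alpha> F = exp E * l"
      unfolding Pi_lim_def R_def by (intro tendsto_Lim) simp_all
    moreover have "Pi_lim M X \<tau> (\<lambda>_. 0) \<gamma> Q \<mu> n z \<alpha> F = l"
      using l(2) unfolding Pi_lim_def R_def by (intro tendsto_Lim) simp_all
    ultimately show ?thesis using l(1) by simp
  qed
  with iff show ?thesis unfolding E_def by blast
qed

end
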